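(* Let $d\ge5$. Suppose that $V\colon\mathbb{R}^d\to\mathbb{R}$ satisfies $V\in L^1_{\mathrm{loc}}(\mathbb{R}^d)$, $[x\cdot\nabla V]_+\in L^1_{\mathrm{loc}}(\mathbb{R}^d)$ and $V\in W^{1,d/4}_{\mathrm{loc}}(\mathbb{R}^d)$, and assume that there exists $a\in[0,1)$ such that $$\forall\,\psi\in H^2(\mathbb{R}^d),\qquad\frac14\int_{\mathbb{R}^d}[x\cdot\nabla V]_+|\psi|^2\le a\int_{\mathbb{R}^d}|\Delta\psi|^2.$$ Then, given any $z\in\mathbb{R}$ and any measurable $f\colon\mathbb{R}^d\to\mathbb{C}$ with $r^2f\in L^2(\mathbb{R}^d)$, any solution $u\in H^2(\mathbb{R}^d)$ of the equation $(H_V-z)u=f$ satisfies $$\|\Delta u\|_{L^2(\mathbb{R}^d)}\le\tilde c(d)\,\|r^2f\|_{L^2(\mathbb{R}^d)},\qquad\tilde c(d):=\frac1{1-a}\,\frac{2(d-2)}{d(d-4)}.$$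
   Context: Notation: $r(x):=|x|$; $[w]_+:=\max\{w,0\}$ is the positive part; $\nabla V$ is the weak gradient. $H_V:=\Delta^2+V$, where $V$ acts by multiplication. A function $u\in H^2(\mathbb{R}^d)$ is a solution of $(H_V-z)u=f$ if $\int_{\mathbb{R}^d}\Delta u\,\overline{\Delta v}+\int_{\mathbb{R}^d}Vu\,\bar v-z\int_{\mathbb{R}^d}u\,\bar v=\int_{\mathbb{R}^d}f\,\bar v$ for all compactly supported $v\in H^2(\mathbb{R}^d)$. *)

theory Defs
  imports "HOL-Analysis.Analysis"
begin

section \<open>Lebesgue spaces\<close>

definition Lp :: "real \<Rightarrow> ('a::euclidean_space \<Rightarrow> 'b::{banach,second_countable_topology}) \<Rightarrow> bool" where
  "Lp p f \<longleftrightarrow> f \<in> borel_measurable lebesgue \<and> integrable lebesgue (\<lambda>x. norm (f x) powr p)"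

definition Lp_norm :: "real \<Rightarrow> ('a::euclidean_space \<Rightarrow> 'b::{banach,second_countable_topology}) \<Rightarrow> real" where
  "Lp_norm p f = (\<integral>x. norm (f x) powr p \<partial>lebesgue) powr (1 / p)"

definition Lp_loc :: "real \<Rightarrow> ('a::euclidean_space \<Rightarrow> 'b::{banach,second_countable_topology}) \<Rightarrow> bool" where
  "Lp_loc p f \<longleftrightarrow> f \<in> borel_measurable lebesgue \<and>
     (\<forall>K. compact K \<longrightarrow> set_integrable lebesgue K (\<lambda>x. norm (f x) powr p))"


section \<open>Test functions and weak derivatives\<close>

definition partial :: "'a::euclidean_space \<Rightarrow> ('a \<Rightarrow> real) \<Rightarrow> 'a \<Rightarrow> real" where
  "partial i f x = frechet_derivative f (at x) i"

primrec Ck :: "nat \<Rightarrow> ('a::euclidean_space \<Rightarrow> real) \<Rightarrow> bool" where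
  "Ck 0 f \<longleftrightarrow> continuous_on UNIV f"
| "Ck (Suc k) f \<longleftrightarrow> f differentiable_on UNIV \<and> (\<forall>i\<in>Basis. Ck k (partial i f))"

definition test_function :: "('a::euclidean_space \<Rightarrow> real) \<Rightarrow> bool" where
  "test_function \<phi> \<longleftrightarrow> (\<forall>k. Ck k \<phi>) \<and> compact (closure {x. \<phi> x \<noteq> 0})"

text \<open>Real-valued test functions suffice for complex-valued \<open>f\<close>, by linearity.\<close>

definition has_weak_partial ::
  "'a::euclidean_space \<Rightarrow> ('a \<Rightarrow> 'b::{banach,second_countable_topology}) \<Rightarrow> ('a \<Rightarrow> 'b) \<Rightarrow> bool" where
  "has_weak_partial i f g \<longleftrightarrow> Lp_loc 1 f \<and> Lp_loc 1 g \<and>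
     (\<forall>\<phi>. test_function \<phi> \<longrightarrow>
        (\<integral>x. partial i \<phi> x *\<^sub>R f x \<partial>lebesgue) = - (\<integral>x. \<phi> x *\<^sub>R g x \<partial>lebesgue))"

text \<open>A weak derivative is determined only up to a null set; the operators below pick an arbitrary
  representative and are meaningful only for functions which do have the weak derivatives in
  question.\<close>

definition weak_partial ::
  "'a::euclidean_space \<Rightarrow> ('a \<Rightarrow> 'b::{banach,second_countable_topology}) \<Rightarrow> 'a \<Rightarrow> 'b" where
  "weak_partial i f = (SOME g. has_weak_partial i f g)"

definition weak_gradient :: "('a::euclidean_space \<Rightarrow> real) \<Rightarrow> 'a \<Rightarrow> 'a" where
  "weak_gradient V x = (\<Sum>i\<in>Basis. weak_partial i V x *\<^sub>R i)"

definition weak_laplacian ::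
  "('a::euclidean_space \<Rightarrow> 'b::{banach,second_countable_topology}) \<Rightarrow> 'a \<Rightarrow> 'b" where
  "weak_laplacian u x = (\<Sum>i\<in>Basis. weak_partial i (weak_partial i u) x)"


section \<open>Sobolev spaces\<close>

primrec sobolev ::
  "nat \<Rightarrow> real \<Rightarrow> ('a::euclidean_space \<Rightarrow> 'b::{banach,second_countable_topology}) \<Rightarrow> bool" where
  "sobolev 0 p u \<longleftrightarrow> Lp p u"
| "sobolev (Suc k) p u \<longleftrightarrow> Lp p u \<and> (\<forall>i\<in>Basis. \<exists>g. has_weak_partial i u g \<and> sobolev k p g)"

primrec sobolev_loc ::
  "nat \<Rightarrow> real \<Rightarrow> ('a::euclidean_space \<Rightarrow> 'b::{banach,second_countable_topology}) \<Rightarrow> bool" where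
  "sobolev_loc 0 p u \<longleftrightarrow> Lp_loc p u"
| "sobolev_loc (Suc k) p u \<longleftrightarrow>
     Lp_loc p u \<and> (\<forall>i\<in>Basis. \<exists>g. has_weak_partial i u g \<and> sobolev_loc k p g)"

abbreviation H2 :: "('a::euclidean_space \<Rightarrow> complex) \<Rightarrow> bool" where
  "H2 \<equiv> sobolev 2 2"


section \<open>Solutions of the perturbed biharmonic equation\<close>

text \<open>Elements of \<open>H\<^sup>2\<close> are classes modulo null sets, hence the essential notion of support.\<close>

definition compactly_supported :: "('a::euclidean_space \<Rightarrow> complex) \<Rightarrow> bool" where
  "compactly_supported v \<longleftrightarrow> (\<exists>K. compact K \<and> (AE x in lebesgue. x \<notin> K \<longrightarrow> v x = 0))"

text \<open>\<open>H2_solution V z f u\<close>: \<open>u\<close> in \<open>H\<^sup>2\<close> solves \<open>(\<Delta>\<^sup>2 + V - z) u = f\<close>. The Bochner integral of a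
  non-integrable function is \<open>0\<close>, so the identity is meaningful only if \<open>V u v\<close> and \<open>f v\<close> are
  integrable for compactly supported \<open>v\<close> in \<open>H\<^sup>2\<close>. In dimension \<open>d \<ge> 5\<close> this holds if \<open>V\<close> is locally
  in \<open>L\<^sup>d\<^sup>/\<^sup>4\<close> (Sobolev embedding) and \<open>|x|\<^sup>2 f\<close> is in \<open>L\<^sup>2\<close> (Rellich inequality).\<close>

definition H2_solution ::
  "('a::euclidean_space \<Rightarrow> real) \<Rightarrow> real \<Rightarrow> ('a \<Rightarrow> complex) \<Rightarrow> ('a \<Rightarrow> complex) \<Rightarrow> bool" where
  "H2_solution V z f u \<longleftrightarrow> H2 u \<and>
     (\<forall>v. H2 v \<and> compactly_supported v \<longrightarrow>
        (\<integral>x. weak_laplacian u x * cnj (weak_laplacian v x) \<partial>lebesgue)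
        + (\<integral>x. complex_of_real (V x) * u x * cnj (v x) \<partial>lebesgue)
        - complex_of_real z * (\<integral>x. u x * cnj (v x) \<partial>lebesgue)
        = (\<integral>x. f x * cnj (v x) \<partial>lebesgue))"

end

theory Submission
  imports Defs "HOL-Probability.Probability" "HOL-Computational_Algebra.Polynomial"
begin

text \<open>
  The formal argument multiplies the equation by \<open>(2 x \<cdot> \<nabla> + d) u\<close>, whose bilaplacian part gives
  \<open>4 \<parallel>\<Delta>u\<parallel>\<^sup>2\<close> and whose potential part gives \<open>- \<integral> (x \<cdot> \<nabla>V) u\<^sup>2\<close>, while \<open>z\<close> drops out because the
  multiplier is antisymmetric. As \<open>x \<cdot> \<nabla>u\<close> is not in \<open>H\<^sup>2\<close>, the multiplier is replaced by an
  antisymmetrised dilation: for \<open>w = \<kappa> u\<close> with a cutoff \<open>\<kappa>\<close> the test function is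
  \<open>\<kappa> (w(l \<cdot>) - l^(-d) w(\<cdot>/l))\<close>, one divides by \<open>l - 1\<close>, lets \<open>l\<close> tend to 1, and finally removes the
  cutoff. The assumption on \<open>[x \<cdot> \<nabla>V]\<^sub>+\<close>, applied to \<open>w\<close>, absorbs the potential term, leaving
  \<open>4 (1 - a) \<parallel>\<Delta>u\<parallel>\<^sup>2 \<le> \<parallel>r\<^sup>2 f\<parallel> \<cdot> (2 \<parallel>r^(-2) x \<cdot> \<nabla>u\<parallel> + d \<parallel>r^(-2) u\<parallel>)\<close>. The
  Hardy--Rellich inequality \<open>\<parallel>r^(-2) x \<cdot> \<nabla>u\<parallel> \<le> (2/d) \<parallel>\<Delta>u\<parallel>\<close> and the Rellich inequality
  \<open>\<parallel>r^(-2) u\<parallel> \<le> 4/(d (d - 4)) \<parallel>\<Delta>u\<parallel>\<close> bound the bracket by \<open>(4/d + 4/(d - 4)) \<parallel>\<Delta>u\<parallel>\<close>, which is the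
  stated constant. The Sobolev embedding of \<open>H\<^sup>2\<close> into \<open>L^(2d/(d - 4))\<close> gives a meaning to the
  potential terms for \<open>V\<close> locally in \<open>W^(1, d/4)\<close>.
\<close>

text \<open>The L^2 adjoint of the dilation by l is l^(-d) times the dilation by 1/l. Cutting off
  once inside and once outside their difference keeps the antisymmetry exact for every l, so z
  disappears before any limit is taken. The obstacle is that u has only two derivatives, and V only
  one, in L^(d/4): after division by l - 1 each difference quotient has to sit on a factor with a
  derivative to spare. The adjoint relation moves it from \<Delta>w to the commutator of \<Delta>
  and \<kappa>, which lies in H^1, and from w to V; in the term with \<Delta>w twice it leaves the
  scalar (l^2 - l^(-2))/(l - 1), whose limit is 4. The source term is not passed to the limit in the
  weighted norm: Hardy--Rellich, averaged over intermediate dilations, bounds the quotient itself.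
  There 4/d is 2/d from each of the two dilations, and 4/(d - 4) is the derivative d of -l^(-d) at 1
  times 4/(d(d - 4)). The cutoff errors contain derivatives of \<kappa> with at most one factor x;
  these remain bounded when \<kappa> is stretched.\<close>

section \<open>Functions of class C^k, cutoffs and test functions\<close>

definition smooth :: "('a::euclidean_space \<Rightarrow> real) \<Rightarrow> bool" where
  "smooth f \<longleftrightarrow> (\<forall>k. Ck k f)"

lemma partial_eq: "(f has_derivative D) (at x) \<Longrightarrow> partial i f x = D i"
  unfolding partial_def by (metis frechet_derivative_at)

lemma Ck_Suc_imp_Ck: "Ck (Suc k) f \<Longrightarrow> Ck k f"
  by (induction k arbitrary: f) (auto simp: differentiable_imp_continuous_on)

lemma Ck_imp_continuous_on: "Ck k f \<Longrightarrow> continuous_on UNIV f"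
  by (induction k) (auto dest: Ck_Suc_imp_Ck simp del: Ck.simps(2))

lemma Ck_SucI:
  assumes "\<And>x. (f has_derivative f' x) (at x)" "\<And>i. i \<in> Basis \<Longrightarrow> Ck k (\<lambda>x. f' x i)"
  shows "Ck (Suc k) f"
proof -
  have "partial i f = (\<lambda>x. f' x i)" for i
    using assms(1) by (intro ext partial_eq)
  then show ?thesis
    using assms by (auto simp: differentiable_on_def differentiable_def intro: has_derivative_at_withinI)
qed

text \<open>\<open>Ck\<close> asks for total differentiability outright, so the derivative is linear
  and is recovered from its values on the basis. In this form the product and chain rules can be
  read off at the next order.\<close>

lemma Ck_Suc_has_derivative:
  assumes "Ck (Suc k) f"
  shows "(f has_derivative (\<lambda>h. \<Sum>i\<in>Basis. (h \<bullet> i) * partial i f x)) (at x)"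
proof -
  obtain D where D: "(f has_derivative D) (at x)"
    using assms by (auto simp: differentiable_on_def differentiable_def)
  then interpret D: bounded_linear D by (rule has_derivative_bounded_linear)
  have "D = (\<lambda>h. \<Sum>i\<in>Basis. (h \<bullet> i) * partial i f x)"
  proof
    fix h
    have "D h = D (\<Sum>i\<in>Basis. (h \<bullet> i) *\<^sub>R i)" by (simp add: euclidean_representation)
    then show "D h = (\<Sum>i\<in>Basis. (h \<bullet> i) * partial i f x)"
      by (simp add: D.sum D.scaleR partial_eq[OF D])
  qed
  with D show ?thesis by simp
qed

lemma sum_inner_Basis:
  fixes F :: "'a::euclidean_space \<Rightarrow> real"
  assumes "i \<in> Basis"
  shows "(\<Sum>j\<in>Basis. (i \<bullet> j) * F j) = F i"
  using assms by (simp add: inner_Basis if_distrib if_distribR cong: if_cong)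

lemma Ck_const: "Ck k (\<lambda>x. c)"
  by (induction k arbitrary: c) (auto intro!: Ck_SucI[where f'="\<lambda>x h. 0"] simp del: Ck.simps(2))

lemma Ck_inner_left: "Ck k (\<lambda>x. x \<bullet> b)"
proof (cases k)
  case (Suc l)
  show ?thesis unfolding Suc
    by (rule Ck_SucI[where f'="\<lambda>x h. h \<bullet> b"]) (auto intro!: derivative_eq_intros Ck_const)
qed (auto intro!: continuous_intros)

lemma Ck_inner: "Ck k (\<lambda>x. b \<bullet> x)"
  using Ck_inner_left[of k b] by (simp add: inner_commute)

lemma Ck_add: "Ck k f \<Longrightarrow> Ck k g \<Longrightarrow> Ck k (\<lambda>x. f x + g x)"
proof (induction k arbitrary: f g)
  case (Suc k)
  show ?case
    by (rule Ck_SucI[OF has_derivative_add[OF Ck_Suc_has_derivative[OF Suc.prems(1)] Ck_Suc_has_derivative[OF Suc.prems(2)]]])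
      (use Suc in \<open>auto simp: inner_Basis if_distrib if_distribR cong: if_cong\<close>)
qed (auto intro!: continuous_intros)

lemma Ck_mult: "Ck k f \<Longrightarrow> Ck k g \<Longrightarrow> Ck k (\<lambda>x. f x * g x)"
proof (induction k arbitrary: f g)
  case (Suc k)
  show ?case
    by (rule Ck_SucI[OF has_derivative_mult[OF Ck_Suc_has_derivative[OF Suc.prems(1)] Ck_Suc_has_derivative[OF Suc.prems(2)]]])
      (use Suc Ck_Suc_imp_Ck[OF Suc.prems(1)] Ck_Suc_imp_Ck[OF Suc.prems(2)] in
        \<open>auto simp: inner_Basis if_distrib if_distribR cong: if_cong intro!: Ck_add Suc.IH\<close>)
qed (auto intro!: continuous_intros)

lemma Ck_affine: "Ck k f \<Longrightarrow> Ck k (\<lambda>x. f (c *\<^sub>R x + t))"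
proof (induction k arbitrary: f)
  case 0
  then show ?case
    by (auto intro!: continuous_on_compose2[of UNIV f] continuous_intros)
next
  case (Suc k)
  have "((\<lambda>x. f (c *\<^sub>R x + t)) has_derivative
     (\<lambda>h. \<Sum>i\<in>Basis. ((c *\<^sub>R h) \<bullet> i) * partial i f (c *\<^sub>R x + t))) (at x)" for x
    by (rule has_derivative_compose[OF _ Ck_Suc_has_derivative[OF Suc.prems]])
      (auto intro!: derivative_eq_intros)
  then show ?case
    by (rule Ck_SucI)
      (use Suc in \<open>auto simp: inner_Basis if_distrib if_distribR cong: if_cong intro!: Ck_mult Ck_const\<close>)
qed

text \<open>The derivative of 1/f is -(1/f) f' (1/f), so regularity of 1/f at order k feeds the step
  to order k + 1.\<close>

lemma Ck_inverse:
  assumes "Ck k f" and nz: "\<And>x. f x \<noteq> 0"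
  shows "Ck k (\<lambda>x. inverse (f x))"
  using assms(1)
proof (induction k)
  case 0
  then show ?case using nz by (auto intro!: continuous_intros)
next
  case (Suc k)
  have IH: "Ck k (\<lambda>x. inverse (f x))" "\<And>i. i \<in> Basis \<Longrightarrow> Ck k (partial i f)"
    using Suc Ck_Suc_imp_Ck[OF Suc.prems] by auto
  have "((\<lambda>x. inverse (f x)) has_derivative
     (\<lambda>h. (- 1) * (inverse (f x) * (\<Sum>i\<in>Basis. (h \<bullet> i) * partial i f x) * inverse (f x)))) (at x)" for x
    using Deriv.has_derivative_inverse[OF nz Ck_Suc_has_derivative[OF Suc.prems]] by simp
  then show ?case
    by (rule Ck_SucI) (simp only: sum_inner_Basis, intro Ck_mult Ck_const IH)
qed

text \<open>The outer function comes with the whole tower of its derivatives; the induction is over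
  all levels \<open>n\<close> at once because differentiating moves one level up.\<close>

lemma Ck_compose_derivs:
  fixes h :: "nat \<Rightarrow> real \<Rightarrow> real"
  assumes h: "\<And>n t. (h n has_real_derivative h (Suc n) t) (at t)" and "Ck k q"
  shows "Ck k (\<lambda>x. h n (q x))"
  using assms(2)
proof (induction k arbitrary: n)
  case 0
  have "continuous_on UNIV (h n)"
    using h by (meson DERIV_continuous continuous_at_imp_continuous_on)
  with 0 show ?case by (auto intro!: continuous_on_compose2[of UNIV "h n"])
next
  case (Suc k)
  have "((\<lambda>x. h n (q x)) has_derivative
     (\<lambda>y. h (Suc n) (q x) * (\<Sum>i\<in>Basis. (y \<bullet> i) * partial i q x))) (at x)" for x
    by (rule has_derivative_compose[OF Ck_Suc_has_derivative[OF Suc.prems]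
       h[unfolded has_field_derivative_def]])
  then show ?case
    by (rule Ck_SucI)
      (use Suc Ck_Suc_imp_Ck[OF Suc.prems] in \<open>auto simp: inner_Basis if_distrib if_distribR
         cong: if_cong intro!: Ck_mult Ck_const\<close>)
qed

lemma Ck_inner_self: "Ck k (\<lambda>x. x \<bullet> x)"
proof (cases k)
  case (Suc l)
  show ?thesis unfolding Suc
    by (rule Ck_SucI[where f'="\<lambda>x h. 2 * (x \<bullet> h)"])
      (auto intro!: derivative_eq_intros Ck_mult Ck_const Ck_inner_left Ck_inner simp: inner_commute fun_eq_iff)
qed (auto intro!: continuous_intros)

subsection \<open>A smooth function that is flat at the origin\<close>

text \<open>The n-th derivative of exp(-1/t) is p(1/t) exp(-1/t) for a polynomial p. With s = 1/t
  one has ds/dt = -s^2, whence the factor s^2 and the difference p - p' in the recursion.\<close>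

primrec flat_poly :: "nat \<Rightarrow> real poly" where
  "flat_poly 0 = 1"
| "flat_poly (Suc n) = monom 1 2 * (flat_poly n - pderiv (flat_poly n))"

definition flat :: "nat \<Rightarrow> real \<Rightarrow> real" where
  "flat n t = (if t > 0 then poly (flat_poly n) (1 / t) * exp (- (1 / t)) else 0)"

lemma tendsto_poly_exp_0: "((\<lambda>s. poly q s * exp (- s)) \<longlongrightarrow> (0::real)) at_top"
proof -
  have "((\<lambda>s. \<Sum>i\<le>degree q. coeff q i * (s ^ i / exp s)) \<longlongrightarrow> (\<Sum>i\<le>degree q. coeff q i * 0)) at_top"
    by (intro tendsto_intros tendsto_power_div_exp_0)
  then show ?thesis
    by (simp add: poly_altdef sum_distrib_right exp_minus divide_inverse mult.assoc)
qed

text \<open>Away from 0 this is the chain rule. At 0 the difference quotient from the right is a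
  polynomial in 1/t times exp(-1/t), which the exponential forces to 0; from the left it vanishes
  identically.\<close>

lemma flat_derivative: "(flat n has_real_derivative flat (Suc n) t) (at t)"
proof (cases t "0::real" rule: linorder_cases)
  case less
  have "((\<lambda>_. 0) has_real_derivative 0) (at t)" by simp
  then have "(flat n has_real_derivative 0) (at t)"
    by (rule has_field_derivative_transform_within_open[where S="{..<0}"])
      (use less in \<open>auto simp: flat_def\<close>)
  then show ?thesis using less by (simp add: flat_def)
next
  case greater
  have "((\<lambda>t. poly (flat_poly n) (1 / t) * exp (- (1 / t))) has_real_derivative flat (Suc n) t) (at t)"
  proof -
    have d: "((\<lambda>t. 1 / t) has_real_derivative - (1 / t^2)) (at t)"
      using greater by (auto intro!: derivative_eq_intros simp: power2_eq_square)
    have "((\<lambda>t. poly (flat_poly n) (1 / t) * exp (- (1 / t))) has_real_derivative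
       (poly (pderiv (flat_poly n)) (1 / t) * - (1 / t^2)) * exp (- (1 / t))
        + (exp (- (1 / t)) * - (- (1 / t^2))) * poly (flat_poly n) (1 / t)) (at t)"
      by (intro DERIV_mult DERIV_chain2[OF poly_DERIV d] DERIV_fun_exp DERIV_minus d)
    then show ?thesis
      using greater by (simp add: flat_def poly_monom algebra_simps power_one_over)
  qed
  then show ?thesis
    by (rule has_field_derivative_transform_within_open[where S="{0<..}"])
      (use greater in \<open>auto simp: flat_def\<close>)
next
  case equal
  \<comment> \<open>Division by t is multiplication by s = 1/t, hence the extra factor
    \<open>monom 1 1\<close>.\<close>
  have "((\<lambda>s. poly (monom 1 1 * flat_poly n) s * exp (- s)) \<longlongrightarrow> 0) at_top"
    by (rule tendsto_poly_exp_0)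
  then have "((\<lambda>t. poly (monom 1 1 * flat_poly n) (inverse t) * exp (- inverse t)) \<longlongrightarrow> 0) (at_right 0)"
    by (rule filterlim_compose[OF _ filterlim_inverse_at_top_right])
  then have "((\<lambda>t. (flat n t - flat n 0) / (t - 0)) \<longlongrightarrow> 0) (at_right 0)"
    by (rule Lim_transform_eventually)
      (auto simp: flat_def eventually_at_right_field poly_monom field_simps intro!: exI[of _ 1])
  moreover have "((\<lambda>t. (flat n t - flat n 0) / (t - 0)) \<longlongrightarrow> 0) (at_left 0)"
    by (rule Lim_transform_eventually[OF tendsto_const])
      (auto simp: flat_def eventually_at_left_field intro!: exI[of _ "-1"])
  ultimately have "((\<lambda>t. (flat n t - flat n 0) / (t - 0)) \<longlongrightarrow> 0) (at 0)"
    by (simp add: filterlim_split_at)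
  then show ?thesis using equal
    by (simp add: has_field_derivative_iff flat_def)
qed

lemma flat0_pos_iff: "flat 0 t > 0 \<longleftrightarrow> t > 0" and flat0_nonneg: "flat 0 t \<ge> 0"
  by (auto simp: flat_def)

text \<open>The quotient \<alpha>/(\<alpha> + \<beta>) works because \<alpha> is positive exactly
  for |x| < 2 and \<beta> exactly for |x| > 1, so the denominator never vanishes. Composing with x
  \<bullet> x rather than the norm avoids a singularity at the origin.\<close>

lemma smooth_cutoff_exists:
  obtains \<kappa> :: "'a::euclidean_space \<Rightarrow> real" where "smooth \<kappa>" "\<And>x. 0 \<le> \<kappa> x" "\<And>x. \<kappa> x \<le> 1"
    "\<And>x. norm x \<le> 1 \<Longrightarrow> \<kappa> x = 1" "\<And>x. norm x \<ge> 2 \<Longrightarrow> \<kappa> x = 0"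
proof
  define \<alpha> where "\<alpha> = (\<lambda>x::'a. flat 0 (4 + (- 1) * (x \<bullet> x)))"
  define \<beta> where "\<beta> = (\<lambda>x::'a. flat 0 (x \<bullet> x + (- 1)))"
  define \<kappa> where "\<kappa> = (\<lambda>x. \<alpha> x * inverse (\<alpha> x + \<beta> x))"
  have nn: "\<alpha> x \<ge> 0" "\<beta> x \<ge> 0" for x
    by (auto simp: \<alpha>_def \<beta>_def flat0_nonneg)
  have pos: "\<alpha> x + \<beta> x > 0" for x
  proof (cases "x \<bullet> x < 4")
    case True
    then have "\<alpha> x > 0" unfolding \<alpha>_def flat0_pos_iff by simp
    with nn[of x] show ?thesis by linarith
  next
    case False
    then have "\<beta> x > 0" unfolding \<beta>_def flat0_pos_iff by simp
    with nn[of x] show ?thesis by linarith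
  qed
  have "Ck k \<alpha>" "Ck k \<beta>" for k
    unfolding \<alpha>_def \<beta>_def
    by (rule Ck_compose_derivs[where h=flat, OF flat_derivative], intro Ck_add Ck_mult Ck_const Ck_inner_self)+
  then show "smooth \<kappa>"
    unfolding smooth_def \<kappa>_def using pos
    by (intro allI Ck_mult Ck_inverse Ck_add) (auto simp: less_le)
  show "0 \<le> \<kappa> x" for x
    using nn[of x] pos[of x] by (auto simp: \<kappa>_def)
  show "\<kappa> x \<le> 1" for x
    using nn[of x] pos[of x] by (auto simp: \<kappa>_def divide_inverse[symmetric])
  show "\<kappa> x = 1" if "norm x \<le> 1" for x
  proof -
    have "x \<bullet> x \<le> 1" using that by (simp add: power2_norm_eq_inner[symmetric] power_le_one)
    then have "\<beta> x = 0" by (simp add: \<beta>_def flat_def)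
    then show ?thesis using pos[of x] by (simp add: \<kappa>_def)
  qed
  show "\<kappa> x = 0" if "norm x \<ge> 2" for x
  proof -
    have "x \<bullet> x \<ge> 2^2" unfolding power2_norm_eq_inner[symmetric] using that by (intro power_mono) auto
    then have "\<alpha> x = 0" by (simp add: \<alpha>_def flat_def)
    then show ?thesis by (simp add: \<kappa>_def)
  qed
qed

lemma smooth_add: "smooth f \<Longrightarrow> smooth g \<Longrightarrow> smooth (\<lambda>x. f x + g x)"
  and smooth_mult: "smooth f \<Longrightarrow> smooth g \<Longrightarrow> smooth (\<lambda>x. f x * g x)"
  and smooth_const: "smooth (\<lambda>x. c)"
  and smooth_affine: "smooth f \<Longrightarrow> smooth (\<lambda>x. f (a *\<^sub>R x + t))"
  by (simp_all add: smooth_def Ck_add Ck_mult Ck_const Ck_affine del: Ck.simps)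

lemma smooth_partial: "smooth f \<Longrightarrow> i \<in> Basis \<Longrightarrow> smooth (partial i f)"
  unfolding smooth_def by (metis Ck.simps(2))

lemma smooth_has_derivative:
  "smooth f \<Longrightarrow> (f has_derivative (\<lambda>h. \<Sum>i\<in>Basis. (h \<bullet> i) * partial i f x)) (at x)"
  unfolding smooth_def by (rule Ck_Suc_has_derivative[of 0], blast)

lemma smooth_continuous_on: "smooth f \<Longrightarrow> continuous_on A f"
  by (metis smooth_def Ck_imp_continuous_on continuous_on_subset subset_UNIV)

lemma smooth_borel_measurable: "smooth f \<Longrightarrow> f \<in> borel_measurable borel"
  by (simp add: smooth_continuous_on borel_measurable_continuous_onI)

lemma partial_mult:
  assumes "smooth f" "smooth g" "i \<in> Basis"
  shows "partial i (\<lambda>x. f x * g x) x = f x * partial i g x + partial i f x * g x"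
  using partial_eq[OF has_derivative_mult[OF smooth_has_derivative[OF assms(1)] smooth_has_derivative[OF assms(2)]], of i x] assms(3)
  by (simp add: inner_Basis if_distrib if_distribR cong: if_cong)

lemma partial_affine:
  assumes "smooth f" "i \<in> Basis"
  shows "partial i (\<lambda>x. f (c *\<^sub>R x + t)) x = c * partial i f (c *\<^sub>R x + t)"
proof -
  have "((\<lambda>x. f (c *\<^sub>R x + t)) has_derivative
     (\<lambda>h. \<Sum>i\<in>Basis. ((c *\<^sub>R h) \<bullet> i) * partial i f (c *\<^sub>R x + t))) (at x)"
    by (rule has_derivative_compose[OF _ smooth_has_derivative[OF assms(1)]])
      (auto intro!: derivative_eq_intros)
  from partial_eq[OF this, of i] show ?thesis using assms(2)
    by (simp add: inner_Basis if_distrib if_distribR cong: if_cong)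
qed

lemma test_function_iff: "test_function \<phi> \<longleftrightarrow> smooth \<phi> \<and> (\<exists>R. \<forall>x. norm x > R \<longrightarrow> \<phi> x = 0)"
proof -
  have "bounded {x. \<phi> x \<noteq> 0} \<longleftrightarrow> (\<exists>R. \<forall>x. norm x > R \<longrightarrow> \<phi> x = 0)"
    unfolding bounded_iff by (auto simp: not_less[symmetric])
  then show ?thesis
    by (auto simp: test_function_def smooth_def compact_eq_bounded_closed
        dest: bounded_closure intro: bounded_subset[OF _ closure_subset])
qed

lemma partial_eq_0:
  assumes "norm x > R" "\<And>x. norm x > R \<Longrightarrow> \<phi> x = 0"
  shows "partial i \<phi> x = 0"
proof -
  have "((\<lambda>_. 0) has_derivative (\<lambda>_. 0)) (at x)" by simp
  then have "(\<phi> has_derivative (\<lambda>_. 0)) (at x)"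
  proof (rule has_derivative_transform_within_open)
    show "open {x::'a. norm x > R}" by (intro open_Collect_less continuous_intros)
  qed (use assms in auto)
  from partial_eq[OF this] show ?thesis by simp
qed

lemma test_function_partial: "test_function \<phi> \<Longrightarrow> i \<in> Basis \<Longrightarrow> test_function (partial i \<phi>)"
  unfolding test_function_iff by (auto intro: smooth_partial intro!: exI partial_eq_0)

lemma test_function_mult: "smooth f \<Longrightarrow> test_function \<phi> \<Longrightarrow> test_function (\<lambda>x. f x * \<phi> x)"
  unfolding test_function_iff by (auto intro: smooth_mult)

lemma test_function_affine:
  assumes "test_function \<phi>" "c \<noteq> 0"
  shows "test_function (\<lambda>x. \<phi> (c *\<^sub>R x + t))"
proof -
  obtain R where R: "\<And>x. norm x > R \<Longrightarrow> \<phi> x = 0" using assms by (auto simp: test_function_iff)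
  have "\<phi> (c *\<^sub>R x + t) = 0" if "norm x > (R + norm t) / \<bar>c\<bar>" for x
  proof -
    have "R + norm t < norm (c *\<^sub>R x)" using that assms(2) by (simp add: field_simps)
    also have "\<dots> \<le> norm (c *\<^sub>R x + t) + norm t" using norm_triangle_ineq4[of "c *\<^sub>R x + t" t] by simp
    finally show ?thesis by (intro R) simp
  qed
  then show ?thesis using assms by (auto simp: test_function_iff intro: smooth_affine)
qed

section \<open>Integral norms\<close>

text \<open>The p-th power of the L^p norm, kept in the extended nonnegative reals: finiteness
  becomes a statement, and Fatou and Tonelli apply without prior integrability. Omitting the root
  costs the triangle inequality, replaced below by one with a factor 2^p.\<close>

definition NP :: "real \<Rightarrow> ('a::euclidean_space \<Rightarrow> real) \<Rightarrow> ennreal" where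
  "NP p f = (\<integral>\<^sup>+x. ennreal (\<bar>f x\<bar> powr p) \<partial>lborel)"

lemma nn_integral_cindicator:
  assumes "A \<in> sets M" "c \<ge> 0"
  shows "(\<integral>\<^sup>+x. ennreal (c * indicator A x) \<partial>M) = ennreal c * emeasure M A"
proof -
  have "(\<integral>\<^sup>+x. ennreal (c * indicator A x) \<partial>M) = (\<integral>\<^sup>+x. ennreal c * indicator A x \<partial>M)"
    by (intro nn_integral_cong) (auto split: split_indicator)
  then show ?thesis using assms by (simp add: nn_integral_cmult_indicator)
qed

lemma NP_2: "NP 2 f = (\<integral>\<^sup>+x. ennreal ((f x)\<^sup>2) \<partial>lborel)"
  by (simp add: NP_def)

lemma NP_uminus: "NP p (\<lambda>x. - f x) = NP p f"
  by (simp add: NP_def)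

lemma NP_minus_commute: "NP p (\<lambda>x. f x - g x) = NP p (\<lambda>x. g x - f x)"
  by (simp add: NP_def abs_minus_commute)

lemma NP_mono_AE: "p \<ge> 0 \<Longrightarrow> AE x in lborel. \<bar>f x\<bar> \<le> \<bar>g x\<bar> \<Longrightarrow> NP p f \<le> NP p g"
  unfolding NP_def by (rule nn_integral_mono_AE) (auto intro!: ennreal_leI powr_mono2)

lemma NP_mono: "p \<ge> 0 \<Longrightarrow> (\<And>x. \<bar>f x\<bar> \<le> \<bar>g x\<bar>) \<Longrightarrow> NP p f \<le> NP p g"
  by (rule NP_mono_AE) auto

lemma NP_cmult:
  assumes [measurable]: "f \<in> borel_measurable borel"
  shows "NP p (\<lambda>x. c * f x) = ennreal (\<bar>c\<bar> powr p) * NP p f"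
  by (simp add: NP_def abs_mult powr_mult ennreal_mult nn_integral_cmult)

lemma powr_add_le:
  assumes "(a::real) \<ge> 0" "b \<ge> 0" "p \<ge> 0"
  shows "(a + b) powr p \<le> 2 powr p * (a powr p + b powr p)"
proof -
  have "(a + b) powr p \<le> (2 * max a b) powr p"
    using assms by (intro powr_mono2) auto
  also have "\<dots> = 2 powr p * max a b powr p"
    using assms by (simp add: powr_mult)
  also have "\<dots> \<le> 2 powr p * (a powr p + b powr p)"
    by (intro mult_left_mono) (auto simp: max_def)
  finally show ?thesis .
qed

text \<open>A crude constant suffices, since only finiteness and convergence to 0 are drawn from it;
  the sharp triangle inequality in L^2 is treated separately for \<open>nm\<close>.\<close>

lemma NP_add_le:
  assumes [measurable]: "f \<in> borel_measurable borel" "g \<in> borel_measurable borel" and "p \<ge> 0"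
  shows "NP p (\<lambda>x. f x + g x) \<le> ennreal (2 powr p) * (NP p f + NP p g)"
proof -
  have "NP p (\<lambda>x. f x + g x) \<le> (\<integral>\<^sup>+x. ennreal (2 powr p) * (ennreal (\<bar>f x\<bar> powr p) + ennreal (\<bar>g x\<bar> powr p)) \<partial>lborel)"
    unfolding NP_def
  proof (rule nn_integral_mono)
    fix x
    have "\<bar>f x + g x\<bar> powr p \<le> (\<bar>f x\<bar> + \<bar>g x\<bar>) powr p"
      using assms by (intro powr_mono2) auto
    also have "\<dots> \<le> 2 powr p * (\<bar>f x\<bar> powr p + \<bar>g x\<bar> powr p)"
      using assms by (intro powr_add_le) auto
    finally show "ennreal (\<bar>f x + g x\<bar> powr p) \<le> ennreal (2 powr p) * (ennreal (\<bar>f x\<bar> powr p) + ennreal (\<bar>g x\<bar> powr p))"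
      by (simp add: ennreal_mult[symmetric] ennreal_plus[symmetric] del: ennreal_plus)
  qed
  also have "\<dots> = ennreal (2 powr p) * (NP p f + NP p g)"
    by (simp add: nn_integral_cmult nn_integral_add NP_def)
  finally show ?thesis .
qed

lemma NP_triangle:
  assumes [measurable]: "f \<in> borel_measurable borel" "g \<in> borel_measurable borel" "h \<in> borel_measurable borel"
    and "p \<ge> 0"
  shows "NP p (\<lambda>x. f x - h x) \<le> ennreal (2 powr p) * (NP p (\<lambda>x. f x - g x) + NP p (\<lambda>x. g x - h x))"
  using NP_add_le[of "\<lambda>x. f x - g x" "\<lambda>x. g x - h x" p] assms by simp

lemma NP_add_fin:
  assumes [measurable]: "f \<in> borel_measurable borel" "g \<in> borel_measurable borel"
    and "p \<ge> 0" "NP p f < \<infinity>" "NP p g < \<infinity>"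
  shows "NP p (\<lambda>x. f x + g x) < \<infinity>"
  using NP_add_le[of f g p] assms by (auto intro: le_less_trans simp: ennreal_mult_less_top)

lemma NP_cmult_fin:
  assumes [measurable]: "f \<in> borel_measurable borel" and "NP p f < \<infinity>"
  shows "NP p (\<lambda>x. c * f x) < \<infinity>"
  using assms by (auto simp: NP_cmult ennreal_mult_less_top)

lemma NP_bound_mult_fin:
  assumes [measurable]: "f \<in> borel_measurable borel" and "NP p f < \<infinity>" "p \<ge> 0" "\<And>x. \<bar>g x\<bar> \<le> C"
  shows "NP p (\<lambda>x. g x * f x) < \<infinity>"
proof -
  have "NP p (\<lambda>x. g x * f x) \<le> NP p (\<lambda>x. C * f x)"
    using assms(3) order.trans[OF assms(4) abs_ge_self] by (intro NP_mono) (auto simp: abs_mult intro!: mult_right_mono)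
  then show ?thesis using NP_cmult_fin[OF assms(1,2), of C] by auto
qed

lemma NP_sum_fin:
  assumes "finite I" "\<And>i. i \<in> I \<Longrightarrow> f i \<in> borel_measurable borel" "\<And>i. i \<in> I \<Longrightarrow> NP p (f i) < \<infinity>" "p \<ge> 0"
  shows "NP p (\<lambda>x. \<Sum>i\<in>I. f i x) < \<infinity>"
  using assms
proof (induction I)
  case empty
  then show ?case by (simp add: NP_def)
next
  case (insert i I)
  then have "NP p (\<lambda>x. f i x + (\<Sum>i\<in>I. f i x)) < \<infinity>"
    by (intro NP_add_fin borel_measurable_sum) auto
  with insert show ?case by simp
qed

lemma NP_tendsto_0_add:
  assumes [measurable]: "\<And>n. f n \<in> borel_measurable borel" "\<And>n. g n \<in> borel_measurable borel"
    and "p \<ge> 0" "((\<lambda>n. NP p (f n)) \<longlongrightarrow> 0) F" "((\<lambda>n. NP p (g n)) \<longlongrightarrow> 0) F"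
  shows "((\<lambda>n. NP p (\<lambda>x. f n x + g n x)) \<longlongrightarrow> 0) F"
proof (rule tendsto_sandwich[where f="\<lambda>_. 0"])
  show "((\<lambda>n. ennreal (2 powr p) * (NP p (f n) + NP p (g n))) \<longlongrightarrow> 0) F"
    using ennreal_tendsto_cmult[OF _ tendsto_add[OF assms(4,5)], of "ennreal (2 powr p)"] by simp
qed (auto intro!: always_eventually NP_add_le assms)

lemma NP_tendsto_0_cmult:
  assumes [measurable]: "\<And>n. f n \<in> borel_measurable borel"
    and "((\<lambda>n. NP p (f n)) \<longlongrightarrow> 0) F"
  shows "((\<lambda>n. NP p (\<lambda>x. c * f n x)) \<longlongrightarrow> 0) F"
  using ennreal_tendsto_cmult[OF _ assms(2), of "ennreal (\<bar>c\<bar> powr p)"]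
  by (simp add: NP_cmult)

lemma NP_tendsto_0_sum:
  assumes "finite I" "\<And>n i. i \<in> I \<Longrightarrow> f i n \<in> borel_measurable borel"
    and "p \<ge> 0" "\<And>i. i \<in> I \<Longrightarrow> ((\<lambda>n. NP p (f i n)) \<longlongrightarrow> 0) F"
  shows "((\<lambda>n. NP p (\<lambda>x. \<Sum>i\<in>I. f i n x)) \<longlongrightarrow> 0) F"
  using assms
proof (induction I)
  case empty
  then show ?case by (simp add: NP_def)
next
  case (insert i I)
  then have "((\<lambda>n. NP p (\<lambda>x. f i n x + (\<Sum>i\<in>I. f i n x))) \<longlongrightarrow> 0) F"
    by (intro NP_tendsto_0_add borel_measurable_sum) auto
  with insert show ?case by simp
qed

lemma nn_integral_affine:
  fixes F :: "'a::euclidean_space \<Rightarrow> ennreal"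
  assumes [measurable]: "F \<in> borel_measurable borel" and c: "c \<noteq> 0"
  shows "(\<integral>\<^sup>+x. F (c *\<^sub>R x + t) \<partial>lborel) = ennreal (1 / \<bar>c\<bar> ^ DIM('a)) * (\<integral>\<^sup>+x. F x \<partial>lborel)"
proof -
  have "(\<integral>\<^sup>+x. F x \<partial>lborel) = ennreal (\<bar>c\<bar> ^ DIM('a)) * (\<integral>\<^sup>+x. F (c *\<^sub>R x + t) \<partial>lborel)"
    by (subst lborel_affine[OF c, of t])
      (simp add: nn_integral_density nn_integral_distr nn_integral_cmult add.commute)
  then have "ennreal (1 / \<bar>c\<bar> ^ DIM('a)) * (\<integral>\<^sup>+x. F x \<partial>lborel)
      = (ennreal (1 / \<bar>c\<bar> ^ DIM('a)) * ennreal (\<bar>c\<bar> ^ DIM('a))) * (\<integral>\<^sup>+x. F (c *\<^sub>R x + t) \<partial>lborel)"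
    by (simp add: mult.assoc)
  also have "ennreal (1 / \<bar>c\<bar> ^ DIM('a)) * ennreal (\<bar>c\<bar> ^ DIM('a)) = 1"
    using c by (simp add: ennreal_mult[symmetric])
  finally show ?thesis by simp
qed

lemma NP_affine:
  fixes f :: "'a::euclidean_space \<Rightarrow> real"
  assumes [measurable]: "f \<in> borel_measurable borel" and c: "c \<noteq> 0"
  shows "NP p (\<lambda>x. f (c *\<^sub>R x + t)) = ennreal (1 / \<bar>c\<bar> ^ DIM('a)) * NP p f"
  unfolding NP_def using nn_integral_affine[OF _ c, of "\<lambda>x. ennreal (\<bar>f x\<bar> powr p)" t] by simp

lemma integral_affine:
  fixes f :: "'a::euclidean_space \<Rightarrow> real"
  assumes [measurable]: "f \<in> borel_measurable borel" and c: "c \<noteq> 0"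
  shows "(\<integral>x. f (c *\<^sub>R x + t) \<partial>lborel) = 1 / \<bar>c\<bar> ^ DIM('a) * (\<integral>x. f x \<partial>lborel)"
proof -
  have "(\<integral>x. f x \<partial>lborel) = \<bar>c\<bar> ^ DIM('a) * (\<integral>x. f (c *\<^sub>R x + t) \<partial>lborel)"
    by (subst lborel_affine[OF c, of t])
      (simp add: integral_density integral_distr add.commute)
  then show ?thesis using c by simp
qed

lemma integrable_affine:
  fixes f :: "'a::euclidean_space \<Rightarrow> real"
  assumes f: "integrable lborel f" and c: "c \<noteq> 0"
  shows "integrable lborel (\<lambda>x. f (c *\<^sub>R x + t))"
proof -
  have [measurable]: "f \<in> borel_measurable borel" using f by auto
  show ?thesis
    using f nn_integral_affine[OF _ c, of "\<lambda>x. ennreal (norm (f x))" t]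
    unfolding integrable_iff_bounded by (auto simp: ennreal_mult_less_top)
qed

subsection \<open>Density of continuous functions\<close>

text \<open>First \<open>f\<close> is truncated in height and in support, then the truncation is an
  a.e. limit of continuous functions. These are clamped to the same height and multiplied by a tent
  function, which supplies a dominating function.\<close>

lemma Lp_dense_continuous:
  fixes f :: "'a::euclidean_space \<Rightarrow> real"
  assumes [measurable]: "f \<in> borel_measurable borel" and fin: "NP p f < \<infinity>" and p: "p > 0" and e: "e > 0"
  obtains g R where "continuous_on UNIV g" "\<And>x. norm x > R \<Longrightarrow> g x = 0" "NP p (\<lambda>x. f x - g x) < e"
proof -
  \<comment> \<open>Two errors below \<open>e'\<close> are joined by the triangle inequality with
    factor 2^p.\<close>
  define e' where "e' = e / ennreal (2 * 2 powr p) "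
  define t where "t n x = (if \<bar>f x\<bar> \<le> real n \<and> norm x \<le> real n then f x else 0)" for n x
  have [measurable]: "t n \<in> borel_measurable borel" for n unfolding t_def by measurable
  have dct: "(\<lambda>n. (\<integral>\<^sup>+x. ennreal (norm (0 - \<bar>f x - t n x\<bar> powr p)) \<partial>lborel)) \<longlonglongrightarrow> 0"
  proof (rule nn_integral_dominated_convergence_norm[where w="\<lambda>x. \<bar>f x\<bar> powr p"])
    show "AE x in lborel. norm (\<bar>f x - t j x\<bar> powr p) \<le> \<bar>f x\<bar> powr p" for j
      using p by (auto simp: t_def intro!: powr_mono2)
    show "AE x in lborel. (\<lambda>i. \<bar>f x - t i x\<bar> powr p) \<longlonglongrightarrow> 0"
    proof (rule AE_I2)
      fix x
      obtain N where "real N \<ge> max \<bar>f x\<bar> (norm x)" using real_arch_simple by blast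
      then have "\<bar>f x - t n x\<bar> powr p = 0" if "n \<ge> N" for n
        using that by (auto simp: t_def)
      then show "(\<lambda>i. \<bar>f x - t i x\<bar> powr p) \<longlonglongrightarrow> 0"
        by (intro tendsto_eventually) (auto simp: eventually_sequentially)
    qed
  qed (use fin in \<open>auto simp: NP_def\<close>)
  then have "(\<lambda>n. NP p (\<lambda>x. f x - t n x)) \<longlonglongrightarrow> 0" by (simp add: NP_def)
  moreover have e': "e' > 0"
    using e unfolding e'_def by (simp add: ennreal_zero_less_divide)
  ultimately have "eventually (\<lambda>n. NP p (\<lambda>x. f x - t n x) < e') sequentially"
    by (rule order_tendstoD(2))
  then obtain n where n: "NP p (\<lambda>x. f x - t n x) < e'" by (auto simp: eventually_sequentially)
  have "t n \<in> borel_measurable lebesgue"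
    by (rule measurable_completion) simp
  then have "t n measurable_on UNIV" by (rule lebesgue_measurable_imp_measurable_on) auto
  then obtain N g where N: "negligible N" and g: "\<And>k. continuous_on UNIV (g k)"
    and lim: "\<And>x. x \<notin> N \<Longrightarrow> (\<lambda>k. g k x) \<longlonglongrightarrow> t n x"
    unfolding measurable_on_def by auto
  have "AE x in lebesgue. x \<notin> N" using N by (auto simp: negligible_iff_null_sets intro!: AE_not_in)
  then have AEN: "AE x in lborel. x \<notin> N" by (simp add: AE_completion_iff)
  \<comment> \<open>The tent is 1 for |x| \<le> n and 0 beyond n + 1, and clamping to [-n, n] does
    not alter the limit because the truncation already lies in that range.\<close>
  define G where "G k x = max 0 (min 1 (real n + 1 - norm x)) * max (- real n) (min (real n) (g k x))" for k x
  have G: "continuous_on UNIV (G k)" for k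
    unfolding G_def by (intro continuous_intros g)
  then have [measurable]: "G k \<in> borel_measurable borel" for k by (rule borel_measurable_continuous_onI)
  have G0: "norm x > real n + 1 \<Longrightarrow> G k x = 0" for k x by (simp add: G_def)
  have absG: "\<bar>G k x\<bar> \<le> real n" for k x
  proof -
    have "\<bar>G k x\<bar> \<le> 1 * real n" unfolding G_def abs_mult by (intro mult_mono) auto
    then show ?thesis by simp
  qed
  have "(\<lambda>k. (\<integral>\<^sup>+x. ennreal (norm (0 - \<bar>t n x - G k x\<bar> powr p)) \<partial>lborel)) \<longlonglongrightarrow> 0"
  proof (rule nn_integral_dominated_convergence_norm[where w="\<lambda>x. (2 * real n) powr p * indicator (cball 0 (real n + 1)) x"])
    show "AE x in lborel. norm (\<bar>t n x - G j x\<bar> powr p) \<le> (2 * real n) powr p * indicator (cball 0 (real n + 1)) x" for j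
    proof (rule AE_I2)
      fix x :: 'a
      show "norm (\<bar>t n x - G j x\<bar> powr p) \<le> (2 * real n) powr p * indicator (cball 0 (real n + 1)) x"
      proof (cases "norm x \<le> real n + 1")
        case True
        have "\<bar>t n x\<bar> \<le> real n" by (auto simp: t_def)
        with absG[of j x] have "\<bar>t n x - G j x\<bar> \<le> 2 * real n" by linarith
        with True p show ?thesis by (auto intro!: powr_mono2)
      qed (auto simp: G0 t_def)
    qed
    have "(\<integral>\<^sup>+ x. ennreal ((2 * real n) powr p * indicator (cball (0::'a) (real n + 1)) x) \<partial>lborel)
       = ennreal ((2 * real n) powr p) * emeasure lborel (cball (0::'a) (real n + 1))"
      by (rule nn_integral_cindicator) simp_all
    then show "(\<integral>\<^sup>+ x. ennreal ((2 * real n) powr p * indicator (cball (0::'a) (real n + 1)) x) \<partial>lborel) < \<infinity>"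
      using emeasure_lborel_cball_finite[of "0::'a" "real n + 1"] by (simp add: ennreal_mult_less_top)
    show "AE x in lborel. (\<lambda>i. \<bar>t n x - G i x\<bar> powr p) \<longlonglongrightarrow> 0"
      using AEN
    proof eventually_elim
      case (elim x)
      have "(\<lambda>k. G k x) \<longlonglongrightarrow> max 0 (min 1 (real n + 1 - norm x)) * max (- real n) (min (real n) (t n x))"
        unfolding G_def by (intro tendsto_intros lim elim)
      also have "max 0 (min 1 (real n + 1 - norm x)) * max (- real n) (min (real n) (t n x)) = t n x"
        by (auto simp: t_def)
      finally have "(\<lambda>k. \<bar>t n x - G k x\<bar>) \<longlonglongrightarrow> 0"
        by (auto intro!: tendsto_eq_intros)
      then have "(\<lambda>k. \<bar>t n x - G k x\<bar> powr p) \<longlonglongrightarrow> 0 powr p"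
        using p by (intro tendsto_powr') auto
      then show ?case by simp
    qed
  next
    have [measurable]: "cball (0::'a) (real n + 1) \<in> sets borel" by (intro borel_closed) auto
    show "(\<lambda>x. (2 * real n) powr p * indicator (cball (0::'a) (real n + 1)) x) \<in> borel_measurable lborel"
      by (intro borel_measurable_times borel_measurable_indicator borel_measurable_const) simp
    show "(\<lambda>x. \<bar>t n x - G k x\<bar> powr p) \<in> borel_measurable lborel" for k by measurable
  qed simp
  then have "(\<lambda>k. NP p (\<lambda>x. t n x - G k x)) \<longlonglongrightarrow> 0" by (simp add: NP_def)
  then have "eventually (\<lambda>k. NP p (\<lambda>x. t n x - G k x) < e') sequentially"
    using e' by (rule order_tendstoD(2))
  then obtain k where k: "NP p (\<lambda>x. t n x - G k x) < e'" by (auto simp: eventually_sequentially)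
  have "NP p (\<lambda>x. f x - G k x) \<le> ennreal (2 powr p) * (NP p (\<lambda>x. f x - t n x) + NP p (\<lambda>x. t n x - G k x))"
    using p by (intro NP_triangle) auto
  also have "\<dots> < ennreal (2 powr p) * (e' + e')"
    using n k by (intro ennreal_mult_strict_left_mono add_strict_mono) auto
  also have "\<dots> = e"
  proof -
    have "e' + e' = 2 * e'" by (simp add: mult_2)
    then have "ennreal (2 powr p) * (e' + e') = ennreal (2 * 2 powr p) * (e / ennreal (2 * 2 powr p))"
      by (simp add: e'_def ennreal_mult mult_ac)
    also have "\<dots> = e"
      by (simp add: ennreal_times_divide ennreal_mult_divide_eq[of "ennreal (2 * 2 powr p)" e] mult.commute)
    finally show ?thesis .
  qed
  finally show ?thesis using that[of "G k" "real n + 1"] G G0 by blast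
qed

text \<open>Dilations and translations are treated together: the former serve the multiplier, the
  latter mollification. A continuous approximation with bounded support is uniformly continuous;
  requiring \<delta> \<le> 1/2 keeps the Jacobian factor below 2^d.\<close>

lemma NP_affine_continuous_at_id:
  fixes f :: "'a::euclidean_space \<Rightarrow> real"
  assumes [measurable]: "f \<in> borel_measurable borel" and fin: "NP p f < \<infinity>" and p: "p > 0" and e: "(e::real) > 0"
  obtains \<delta> where "\<delta> > 0" "\<delta> \<le> 1/2"
    "\<And>s h. \<bar>s - 1\<bar> < \<delta> \<Longrightarrow> norm h < \<delta> \<Longrightarrow> NP p (\<lambda>x. f (s *\<^sub>R x + h) - f x) < ennreal e"
proof -
  \<comment> \<open>Bookkeeping for two triangle inequalities: 2^d from the change of variables in
    \<open>f - g\<close>, and the two errors that remain inside the second one.\<close>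
  define C :: real where "C = 2 powr p * (2 ^ DIM('a) + 2 powr p * 2)"
  have C: "C > 0" unfolding C_def by (intro mult_pos_pos add_pos_pos) auto
  define e' where "e' = e / (2 * C)"
  have e': "e' > 0" using e C by (simp add: e'_def)
  obtain g R where g: "continuous_on UNIV g" and R: "\<And>x::'a. norm x > R \<Longrightarrow> g x = 0" and fg: "NP p (\<lambda>x. f x - g x) < ennreal e'"
    using Lp_dense_continuous[OF assms(1-3), of "ennreal e'"] e' by auto
  have gm[measurable]: "g \<in> borel_measurable borel" using g by (rule borel_measurable_continuous_onI)
  \<comment> \<open>For |x| > \<open>B\<close> one has |s x + h| \<ge> |x|/2 - 1/2 > R, so both
    points lie outside the support of \<open>g\<close>.\<close>
  define B where "B = max 1 (2 * \<bar>R\<bar> + 2)"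
  have B: "B \<ge> 1" "B \<ge> 2 * \<bar>R\<bar> + 2" by (auto simp: B_def)
  define v where "v = measure lborel (cball (0::'a) B)"
  have v: "emeasure lborel (cball (0::'a) B) = ennreal v"
    unfolding v_def using emeasure_lborel_cball_finite[of "0::'a" B]
    by (intro emeasure_eq_ennreal_measure) (auto simp: less_top)
  have v0: "v \<ge> 0" by (simp add: v_def)
  \<comment> \<open>Chosen so that \<eta>^p times the volume \<open>v\<close> stays below
    \<open>e'\<close>; the 1 in the denominator covers a vanishing volume.\<close>
  define \<eta> where "\<eta> = (e' / (v + 1)) powr (1 / p)"
  have \<eta>: "\<eta> > 0" "\<eta> powr p = e' / (v + 1)" using e' v0 p by (auto simp: \<eta>_def powr_powr)
  have "uniformly_continuous_on (cball 0 (2 * B)) g"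
    by (intro compact_uniformly_continuous continuous_on_subset[OF g]) auto
  then obtain d where d: "d > 0" "\<And>x y. x \<in> cball 0 (2 * B) \<Longrightarrow> y \<in> cball 0 (2 * B) \<Longrightarrow> dist y x < d \<Longrightarrow> dist (g y) (g x) < \<eta>"
    unfolding uniformly_continuous_on_def using \<eta>(1) by metis
  define \<delta> where "\<delta> = min (1/2) (d / (2 * B))"
  have \<delta>: "\<delta> > 0" "\<delta> \<le> 1/2" "\<delta> * (2 * B) \<le> d" using d(1) B by (auto simp: \<delta>_def min_def field_simps)
  have "NP p (\<lambda>x. f (s *\<^sub>R x + h) - f x) < ennreal e" if s: "\<bar>s - 1\<bar> < \<delta>" and h: "norm h < \<delta>" for s and h :: 'a
  proof -
    have s2: "s \<ge> 1/2" "s \<le> 3/2" using s \<delta>(2) by (auto simp: abs_real_def split: if_splits)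
    have bd: "\<bar>g (s *\<^sub>R x + h) - g x\<bar> powr p \<le> \<eta> powr p * indicator (cball 0 B) x" for x
    proof (cases "norm x \<le> B")
      case True
      have "norm (s *\<^sub>R x + h - x) = norm ((s - 1) *\<^sub>R x + h)" by (simp add: algebra_simps)
      also have "\<dots> \<le> \<bar>s - 1\<bar> * norm x + norm h" by (metis norm_triangle_ineq norm_scaleR)
      also have "\<dots> < \<delta> * B + \<delta> * B"
        using True s h B \<delta>(1) by (intro add_le_less_mono mult_mono) (auto intro: order.strict_trans2 simp: less_imp_le)
      finally have n: "norm (s *\<^sub>R x + h - x) < \<delta> * (2 * B)" by (simp add: mult_ac)
      then have "norm (s *\<^sub>R x + h - x) < d" using \<delta>(3) by linarith
      moreover have "norm (s *\<^sub>R x + h) \<le> 2 * B"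
      proof -
        have "norm (s *\<^sub>R x + h) \<le> norm (s *\<^sub>R x + h - x) + norm x" by (metis diff_add_cancel norm_triangle_ineq)
        moreover have "\<delta> * (2 * B) \<le> 1/2 * (2 * B)" using \<delta>(2) B by (intro mult_right_mono) auto
        ultimately show ?thesis using n True by linarith
      qed
      ultimately have "dist (g (s *\<^sub>R x + h)) (g x) < \<eta>"
        using True B by (intro d(2)) (auto simp: dist_norm mem_cball_0 simp del: mem_cball)
      then show ?thesis using True p by (auto simp: dist_real_def intro!: powr_mono2)
    next
      case False
      have "norm (s *\<^sub>R x + h) \<ge> s * norm x - norm h"
        using norm_triangle_ineq4[of "s *\<^sub>R x + h" h] s2 by simp
      moreover have "s * norm x \<ge> 1/2 * norm x" using s2 by (intro mult_right_mono) auto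
      ultimately have "norm (s *\<^sub>R x + h) > R" using False B h \<delta>(2) by linarith
      moreover have "norm x > R" using False B by linarith
      ultimately show ?thesis using False R by auto
    qed
    have "NP p (\<lambda>x. g (s *\<^sub>R x + h) - g x) \<le> (\<integral>\<^sup>+x. ennreal (\<eta> powr p * indicator (cball (0::'a) B) x) \<partial>lborel)"
      unfolding NP_def
    proof (rule nn_integral_mono)
      fix x
      show "ennreal (\<bar>g (s *\<^sub>R x + h) - g x\<bar> powr p) \<le> ennreal (\<eta> powr p * indicator (cball 0 B) x)"
        by (rule ennreal_leI) (rule bd)
    qed
    also have "\<dots> = ennreal (\<eta> powr p) * ennreal v"
      unfolding v[symmetric] by (rule nn_integral_cindicator) simp_all
    also have "\<dots> = ennreal (e' / (v + 1) * v)"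
      unfolding \<eta> using e' v0 by (intro ennreal_mult[symmetric]) auto
    also have "\<dots> \<le> ennreal e'" using e' v0 by (intro ennreal_leI) (simp add: field_simps)
    finally have 2: "NP p (\<lambda>x. g (s *\<^sub>R x + h) - g x) \<le> ennreal e'" .
    have "NP p (\<lambda>x. f (s *\<^sub>R x + h) - g (s *\<^sub>R x + h)) = ennreal (1 / \<bar>s\<bar> ^ DIM('a)) * NP p (\<lambda>x. f x - g x)"
      using NP_affine[of "\<lambda>x. f x - g x" s p h] s2 by simp
    also have "\<dots> \<le> ennreal (2 ^ DIM('a)) * ennreal e'"
    proof (intro mult_mono ennreal_leI)
      have "1 / \<bar>s\<bar> ^ DIM('a) = (1 / s) ^ DIM('a)" using s2 by (simp add: power_one_over)
      also have "\<dots> \<le> 2 ^ DIM('a)" using s2 by (intro power_mono) (auto simp: field_simps)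
      finally show "1 / \<bar>s\<bar> ^ DIM('a) \<le> 2 ^ DIM('a)" .
    qed (use fg in auto)
    finally have 1: "NP p (\<lambda>x. f (s *\<^sub>R x + h) - g (s *\<^sub>R x + h)) \<le> ennreal (2 ^ DIM('a)) * ennreal e'" .
    have 3: "NP p (\<lambda>x. g x - f x) \<le> ennreal e'"
      using fg by (subst NP_minus_commute) simp
    have "NP p (\<lambda>x. f (s *\<^sub>R x + h) - f x) \<le> ennreal (2 powr p) *
       (NP p (\<lambda>x. f (s *\<^sub>R x + h) - g (s *\<^sub>R x + h)) + NP p (\<lambda>x. g (s *\<^sub>R x + h) - f x))"
      using p by (intro NP_triangle) auto
    also have "\<dots> \<le> ennreal (2 powr p) * (ennreal (2 ^ DIM('a)) * ennreal e' +
       ennreal (2 powr p) * (NP p (\<lambda>x. g (s *\<^sub>R x + h) - g x) + NP p (\<lambda>x. g x - f x)))"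
      using p by (intro mult_left_mono add_mono 1 NP_triangle) auto
    also have "\<dots> \<le> ennreal (2 powr p) * (ennreal (2 ^ DIM('a)) * ennreal e' +
       ennreal (2 powr p) * (ennreal e' + ennreal e'))"
      by (intro mult_left_mono add_mono 2 3 order.refl) auto
    also have "\<dots> = ennreal (C * e')"
      using e' by (simp add: C_def ennreal_mult[symmetric] ennreal_plus[symmetric] algebra_simps del: ennreal_plus)
    also have "\<dots> < ennreal e"
      using e C by (intro ennreal_lessI) (auto simp: e'_def)
    finally show ?thesis .
  qed
  with \<delta> show ?thesis using that by blast
qed

lemma NP_dilation_tendsto:
  fixes f :: "'a::euclidean_space \<Rightarrow> real"
  assumes [measurable]: "f \<in> borel_measurable borel" and fin: "NP p f < \<infinity>" and p: "p > 0" and s: "(s \<longlongrightarrow> 1) F"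
  shows "((\<lambda>n. NP p (\<lambda>x. f (s n *\<^sub>R x) - f x)) \<longlongrightarrow> 0) F"
proof (rule order_tendstoI)
  fix e :: ennreal assume e: "0 < e"
  obtain e' where e': "e' > 0" "ennreal e' \<le> e"
  proof (cases e)
    case (real r)
    then show ?thesis using e that[of r] by auto
  next
    case top
    then show ?thesis using that[of 1] by auto
  qed
  obtain \<delta> where \<delta>: "\<delta> > 0"
    "\<And>s h. \<bar>s - 1\<bar> < \<delta> \<Longrightarrow> norm h < \<delta> \<Longrightarrow> NP p (\<lambda>x. f (s *\<^sub>R x + h) - f x) < ennreal e'"
    using NP_affine_continuous_at_id[OF assms(1-3) e'(1)] by metis
  have "eventually (\<lambda>n. dist (s n) 1 < \<delta>) F" using s \<delta>(1) by (rule tendstoD)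
  then show "\<forall>\<^sub>F n in F. NP p (\<lambda>x. f (s n *\<^sub>R x) - f x) < e"
  proof eventually_elim
    case (elim n)
    then show ?case using \<delta>(2)[of "s n" 0] \<delta>(1) e'(2) by (auto simp: dist_real_def)
  qed
qed auto

subsection \<open>Products\<close>

lemma Young_powr:
  assumes "(a::real) \<ge> 0" "b \<ge> 0" "p > 1" "q > 1" "1 / p + 1 / q = 1"
  shows "a * b \<le> a powr p + b powr q"
proof -
  have "a * b \<le> a powr p / p + b powr q / q"
    using Youngs_inequality[of p q a b] assms by simp
  also have "\<dots> \<le> a powr p + b powr q"
    using assms by (intro add_mono) (auto simp: divide_le_eq mult_le_cancel_left1 intro: mult_right_mono[of 1, simplified])
  finally show ?thesis .
qed

text \<open>The free parameter \<open>t\<close>, which scales \<open>a\<close> up and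
  \<open>b\<close> down, lets this inequality stand in for Hoelder's: it can be tuned either to make
  one term small or to balance both.\<close>

lemma nn_integral_Young:
  assumes [measurable]: "a \<in> borel_measurable borel" "b \<in> borel_measurable borel"
    and pq: "p > 1" "q > 1" "1 / p + 1 / q = 1" and t: "t > 0"
  shows "(\<integral>\<^sup>+x. ennreal \<bar>a x * b x\<bar> \<partial>lborel) \<le> ennreal (t powr p) * NP p a + ennreal (t powr (- q)) * NP q b"
proof -
  have "(\<integral>\<^sup>+x. ennreal \<bar>a x * b x\<bar> \<partial>lborel)
     \<le> (\<integral>\<^sup>+x. ennreal (t powr p) * ennreal (\<bar>a x\<bar> powr p) + ennreal (t powr (- q)) * ennreal (\<bar>b x\<bar> powr q) \<partial>lborel)"
  proof (rule nn_integral_mono)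
    fix x
    have "\<bar>a x * b x\<bar> = (t * \<bar>a x\<bar>) * (\<bar>b x\<bar> / t)" using t by (simp add: abs_mult)
    also have "\<dots> \<le> (t * \<bar>a x\<bar>) powr p + (\<bar>b x\<bar> / t) powr q"
      using pq t by (intro Young_powr) auto
    also have "\<dots> = t powr p * \<bar>a x\<bar> powr p + t powr (- q) * \<bar>b x\<bar> powr q"
      using t by (simp add: powr_mult powr_divide powr_minus divide_simps)
    finally show "ennreal \<bar>a x * b x\<bar> \<le> ennreal (t powr p) * ennreal (\<bar>a x\<bar> powr p) + ennreal (t powr (- q)) * ennreal (\<bar>b x\<bar> powr q)"
      by (simp add: ennreal_mult[symmetric] ennreal_plus[symmetric] del: ennreal_plus)
  qed
  also have "\<dots> = ennreal (t powr p) * NP p a + ennreal (t powr (- q)) * NP q b"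
    by (simp add: nn_integral_add nn_integral_cmult NP_def)
  finally show ?thesis .
qed

lemma integrable_mult_NP:
  assumes [measurable]: "a \<in> borel_measurable borel" "b \<in> borel_measurable borel"
    and pq: "p > 1" "q > 1" "1 / p + 1 / q = 1" and fin: "NP p a < \<infinity>" "NP q b < \<infinity>"
  shows "integrable lborel (\<lambda>x. a x * b x)"
  unfolding integrable_iff_bounded
  using nn_integral_Young[OF assms(1-5), of 1] fin by (auto intro: le_less_trans)

text \<open>First \<open>t\<close> is fixed so that the bounded factor contributes at most half of
  the allowed error; then the vanishing factor makes the other half small.\<close>

lemma nn_integral_mult_tendsto_0:
  assumes [measurable]: "\<And>n. a n \<in> borel_measurable borel" "\<And>n. b n \<in> borel_measurable borel"
    and pq: "p > 1" "q > 1" "1 / p + 1 / q = 1"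
    and a: "((\<lambda>n. NP p (a n)) \<longlongrightarrow> 0) F" and b: "eventually (\<lambda>n. NP q (b n) \<le> ennreal B) F"
  shows "((\<lambda>n. \<integral>\<^sup>+x. ennreal \<bar>a n x * b n x\<bar> \<partial>lborel) \<longlongrightarrow> 0) F"
proof (rule order_tendstoI)
  fix e :: ennreal assume e: "0 < e"
  obtain e' where e': "e' > 0" "ennreal e' \<le> e"
  proof (cases e)
    case (real r)
    then show ?thesis using e that[of r] by auto
  next
    case top
    then show ?thesis using that[of 1] by auto
  qed
  \<comment> \<open>A negative \<open>B\<close> means the bound 0, because \<open>ennreal\<close>
    truncates.\<close>
  define B' where "B' = max B 0"
  define t where "t = (e' / (2 * (B' + 1))) powr (- 1 / q)"
  have B': "B' \<ge> 0" "ennreal B = ennreal B'" by (auto simp: B'_def max_def ennreal_neg)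
  have t: "t > 0" "t powr (- q) = e' / (2 * (B' + 1))"
    using e' B' pq by (auto simp: t_def powr_powr)
  have "((\<lambda>n. ennreal (t powr p) * NP p (a n)) \<longlongrightarrow> ennreal (t powr p) * 0) F"
    by (intro ennreal_tendsto_cmult a) auto
  then have "((\<lambda>n. ennreal (t powr p) * NP p (a n)) \<longlongrightarrow> 0) F" by simp
  then have "eventually (\<lambda>n. ennreal (t powr p) * NP p (a n) < ennreal (e' / 2)) F"
    using e' by (intro order_tendstoD(2)) auto
  with b show "\<forall>\<^sub>F n in F. (\<integral>\<^sup>+x. ennreal \<bar>a n x * b n x\<bar> \<partial>lborel) < e"
  proof eventually_elim
    case (elim n)
    have "ennreal (t powr (- q)) * NP q (b n) \<le> ennreal (e' / (2 * (B' + 1))) * ennreal B'"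
      unfolding t using elim B' by (intro mult_mono) auto
    also have "\<dots> = ennreal (e' / (2 * (B' + 1)) * B')" using e' B' by (intro ennreal_mult[symmetric]) auto
    also have "\<dots> \<le> ennreal (e' / 2)" using e' B' by (intro ennreal_leI) (simp add: field_simps)
    finally have 1: "ennreal (t powr (- q)) * NP q (b n) \<le> ennreal (e' / 2)" .
    have "(\<integral>\<^sup>+x. ennreal \<bar>a n x * b n x\<bar> \<partial>lborel) \<le> ennreal (t powr p) * NP p (a n) + ennreal (t powr (- q)) * NP q (b n)"
      by (intro nn_integral_Young pq t) auto
    also have "\<dots> < ennreal (e' / 2) + ennreal (e' / 2)"
    proof -
      obtain r where r: "ennreal (t powr (- q)) * NP q (b n) = ennreal r" "r \<ge> 0"
        using 1 by (cases "ennreal (t powr (- q)) * NP q (b n)") (auto simp: top_unique)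
      show ?thesis
        using elim(2) 1 unfolding r(1) by (cases "ennreal (t powr p) * NP p (a n)")
          (use r(2) e'(1) in \<open>auto simp: ennreal_plus[symmetric] ennreal_less_iff simp del: ennreal_plus\<close>)
    qed
    also have "\<dots> = ennreal e'" using e' by (simp add: ennreal_plus[symmetric] del: ennreal_plus)
    finally show ?case using e' by simp
  qed
qed auto

lemma NP_eventually_bounded:
  assumes [measurable]: "\<And>n. b n \<in> borel_measurable borel" "c \<in> borel_measurable borel"
    and "p \<ge> 0" and b: "((\<lambda>n. NP p (\<lambda>x. b n x - c x)) \<longlongrightarrow> 0) F" and c: "NP p c < \<infinity>"
  obtains B where "eventually (\<lambda>n. NP p (b n) \<le> ennreal B) F"
proof -
  define B where "B = enn2real (ennreal (2 powr p) * (1 + NP p c))"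
  have B: "ennreal (2 powr p) * (1 + NP p c) = ennreal B"
    unfolding B_def using c by (intro ennreal_enn2real[symmetric]) (simp add: ennreal_mult_less_top)
  have "eventually (\<lambda>n. NP p (\<lambda>x. b n x - c x) < 1) F"
    using b by (rule order_tendstoD) simp
  then have "eventually (\<lambda>n. NP p (b n) \<le> ennreal B) F"
  proof eventually_elim
    case (elim n)
    have "NP p (b n) \<le> ennreal (2 powr p) * (NP p (\<lambda>x. b n x - c x) + NP p c)"
      using NP_triangle[of "b n" c "\<lambda>_. 0" p] assms by simp
    also have "\<dots> \<le> ennreal B" unfolding B[symmetric] using elim by (intro mult_left_mono add_mono) auto
    finally show ?case .
  qed
  then show ?thesis using that by blast
qed

text \<open>The difference of the products splits as (a_n - a') b_n + (b_n - b') a': in each term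
  one factor tends to 0 and the other is eventually bounded.\<close>

lemma integral_mult_tendsto:
  assumes [measurable]: "\<And>n. a n \<in> borel_measurable borel" "\<And>n. b n \<in> borel_measurable borel"
      "a' \<in> borel_measurable borel" "b' \<in> borel_measurable borel"
    and pq: "p > 1" "q > 1" "1 / p + 1 / q = 1"
    and a: "((\<lambda>n. NP p (\<lambda>x. a n x - a' x)) \<longlongrightarrow> 0) F" and b: "((\<lambda>n. NP q (\<lambda>x. b n x - b' x)) \<longlongrightarrow> 0) F"
    and fin: "NP p a' < \<infinity>" "NP q b' < \<infinity>"
  shows "((\<lambda>n. \<integral>x. a n x * b n x \<partial>lborel) \<longlongrightarrow> (\<integral>x. a' x * b' x \<partial>lborel)) F"
proof -
  obtain B where B: "eventually (\<lambda>n. NP q (b n) \<le> ennreal B) F"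
    using NP_eventually_bounded[of b b' q F] pq b fin by auto
  obtain A where A: "eventually (\<lambda>n. NP p (a n) \<le> ennreal A) F"
    using NP_eventually_bounded[of a a' p F] pq a fin by auto
  have qp: "1 / q + 1 / p = 1" using pq by simp
  define I where "I n = (\<integral>\<^sup>+x. ennreal \<bar>(a n x - a' x) * b n x\<bar> \<partial>lborel)" for n
  define J where "J n = (\<integral>\<^sup>+x. ennreal \<bar>(b n x - b' x) * a' x\<bar> \<partial>lborel)" for n
  have I: "(I \<longlongrightarrow> 0) F" unfolding I_def
    by (rule nn_integral_mult_tendsto_0[OF _ _ pq a B]) auto
  have J: "(J \<longlongrightarrow> 0) F" unfolding J_def
    by (rule nn_integral_mult_tendsto_0[OF _ _ pq(2,1) qp b, where B="enn2real (NP p a')"]) (use fin in auto)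
  have IJ: "((\<lambda>n. I n + J n) \<longlongrightarrow> 0) F" using tendsto_add[OF I J] by simp
  have "eventually (\<lambda>n. ennreal \<bar>(\<integral>x. a n x * b n x \<partial>lborel) - (\<integral>x. a' x * b' x \<partial>lborel)\<bar> \<le> I n + J n) F"
    using A B
  proof eventually_elim
    case (elim n)
    have fn: "NP p (a n) < \<infinity>" "NP q (b n) < \<infinity>" using elim by (auto intro: le_less_trans)
    have i: "integrable lborel (\<lambda>x. a n x * b n x)" "integrable lborel (\<lambda>x. a' x * b' x)"
      by (intro integrable_mult_NP[OF _ _ pq] fn fin; simp)+
    have "ennreal \<bar>(\<integral>x. a n x * b n x \<partial>lborel) - (\<integral>x. a' x * b' x \<partial>lborel)\<bar>
       = ennreal (norm (\<integral>x. (a n x * b n x - a' x * b' x) \<partial>lborel))" using i by simp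
    also have "\<dots> \<le> (\<integral>\<^sup>+x. ennreal (norm (a n x * b n x - a' x * b' x)) \<partial>lborel)"
      using i by (intro integral_norm_bound_ennreal) auto
    also have "\<dots> \<le> (\<integral>\<^sup>+x. ennreal \<bar>(a n x - a' x) * b n x\<bar> + ennreal \<bar>(b n x - b' x) * a' x\<bar> \<partial>lborel)"
    proof (rule nn_integral_mono)
      fix x
      have "a n x * b n x - a' x * b' x = (a n x - a' x) * b n x + (b n x - b' x) * a' x" by (simp add: algebra_simps)
      then show "ennreal (norm (a n x * b n x - a' x * b' x)) \<le> ennreal \<bar>(a n x - a' x) * b n x\<bar> + ennreal \<bar>(b n x - b' x) * a' x\<bar>"
        by (simp add: ennreal_plus[symmetric] del: ennreal_plus)
    qed
    also have "\<dots> = I n + J n" unfolding I_def J_def by (rule nn_integral_add) auto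
    finally show ?case .
  qed
  then have "((\<lambda>n. ennreal \<bar>(\<integral>x. a n x * b n x \<partial>lborel) - (\<integral>x. a' x * b' x \<partial>lborel)\<bar>) \<longlongrightarrow> 0) F"
    by (intro tendsto_sandwich[OF _ _ tendsto_const IJ]) auto
  then have "((\<lambda>n. ennreal \<bar>(\<integral>x. a n x * b n x \<partial>lborel) - (\<integral>x. a' x * b' x \<partial>lborel)\<bar>) \<longlongrightarrow> ennreal 0) F"
    by simp
  then have "((\<lambda>n. \<bar>(\<integral>x. a n x * b n x \<partial>lborel) - (\<integral>x. a' x * b' x \<partial>lborel)\<bar>) \<longlongrightarrow> 0) F"
    by (subst (asm) tendsto_ennreal_iff) auto
  then show ?thesis by (simp add: tendsto_rabs_zero_iff LIM_zero_iff)
qed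

lemma NP_AE_subseq:
  assumes [measurable]: "\<And>n. f n \<in> borel_measurable borel" "g \<in> borel_measurable borel"
    and p: "p > 0" and lim: "(\<lambda>n. NP p (\<lambda>x. f n x - g x)) \<longlonglongrightarrow> 0" and fin: "\<And>n. NP p (\<lambda>x. f n x - g x) < \<infinity>"
  obtains r :: "nat \<Rightarrow> nat" where "strict_mono r" "AE x in lborel. (\<lambda>n. f (r n) x) \<longlonglongrightarrow> g x"
proof -
  define u where "u n x = \<bar>f n x - g x\<bar> powr p" for n x
  have u: "integrable lborel (u n)" for n
  proof -
    have "u n \<in> borel_measurable lborel" unfolding u_def by measurable
    then show ?thesis using fin[of n] unfolding integrable_iff_bounded by (simp add: NP_def u_def)
  qed
  have "ennreal (\<integral>x. norm (u n x) \<partial>lborel) = NP p (\<lambda>x. f n x - g x)" for n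
    unfolding NP_def using u[of n] by (subst nn_integral_eq_integral[symmetric]) (auto simp: u_def[abs_def])
  then have "(\<lambda>n. ennreal (\<integral>x. norm (u n x) \<partial>lborel)) \<longlonglongrightarrow> ennreal 0" using lim by simp
  then have "(\<lambda>n. (\<integral>x. norm (u n x) \<partial>lborel)) \<longlonglongrightarrow> 0"
    by (subst (asm) tendsto_ennreal_iff) auto
  from tendsto_L1_AE_subseq[OF u this]
  obtain r :: "nat \<Rightarrow> nat" where r: "strict_mono r" "AE x in lborel. (\<lambda>n. u (r n) x) \<longlonglongrightarrow> 0" by auto
  from r(2) have "AE x in lborel. (\<lambda>n. f (r n) x) \<longlonglongrightarrow> g x"
  proof eventually_elim
    case (elim x)
    have "(\<lambda>n. u (r n) x powr (1 / p)) \<longlonglongrightarrow> 0 powr (1 / p)"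
      using p by (intro tendsto_powr' elim) (auto simp: u_def)
    then have "(\<lambda>n. \<bar>f (r n) x - g x\<bar>) \<longlonglongrightarrow> 0" using p by (simp add: u_def powr_powr)
    then show ?case by (simp add: tendsto_rabs_zero_iff LIM_zero_iff)
  qed
  with r(1) show ?thesis using that by blast
qed

text \<open>Convexity of the power function yields the tangent inequality on the open half line; t =
  0 is verified by hand.\<close>

lemma powr_tangent:
  assumes "(t::real) \<ge> 0" "m > 0" "p \<ge> 1"
  shows "t powr p \<ge> m powr p + p * m powr (p - 1) * (t - m)"
proof (cases "t = 0")
  case True
  have "m powr p = m powr (p - 1) * m" using assms powr_add[of m "p - 1" 1] by simp
  then have "m powr p + p * m powr (p - 1) * (t - m) = m powr p * (1 - p)" using True by (simp add: algebra_simps)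
  also have "\<dots> \<le> 0" using assms by (intro mult_nonneg_nonpos) auto
  finally show ?thesis using True by simp
next
  case False
  have "t powr p - m powr p \<ge> (p * m powr (p - 1)) * (t - m)"
  proof (rule convex_on_imp_above_tangent[OF powr_convex[OF assms(3)]])
    show "((\<lambda>x. x powr p) has_real_derivative p * m powr (p - 1)) (at m within {0<..})"
      using assms by (auto intro!: derivative_eq_intros)
  qed (use assms False in \<open>auto simp: interior_open\<close>)
  then show ?thesis by simp
qed

text \<open>The tangent inequality at m, the absolute value of the mean, is integrated: its linear
  term has nonnegative mean since m is at most the mean of |h|. If the right-hand side is infinite
  there is nothing to prove.\<close>

lemma (in prob_space) powr_Jensen:
  assumes h: "integrable M h" and p: "p \<ge> 1"
  shows "ennreal (\<bar>\<integral>x. h x \<partial>M\<bar> powr p) \<le> (\<integral>\<^sup>+x. ennreal (\<bar>h x\<bar> powr p) \<partial>M)"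
proof (cases "(\<integral>\<^sup>+x. ennreal (\<bar>h x\<bar> powr p) \<partial>M) < \<infinity>")
  case True
  have i: "integrable M (\<lambda>x. \<bar>h x\<bar> powr p)"
  proof -
    have [measurable]: "h \<in> borel_measurable M" using h by simp
    show ?thesis using True unfolding integrable_iff_bounded by simp
  qed
  define m where "m = \<bar>\<integral>x. h x \<partial>M\<bar>"
  have "m powr p \<le> (\<integral>x. \<bar>h x\<bar> powr p \<partial>M)"
  proof (cases "m = 0")
    case False
    then have m: "m > 0" by (simp add: m_def)
    have mle: "m \<le> (\<integral>x. \<bar>h x\<bar> \<partial>M)" unfolding m_def by (rule integral_abs_bound)
    have "m powr p = m powr p + p * m powr (p - 1) * (m - m)" by simp
    also have "\<dots> \<le> m powr p + p * m powr (p - 1) * ((\<integral>x. \<bar>h x\<bar> \<partial>M) - m)"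
      using p mle by (intro add_left_mono mult_left_mono diff_right_mono) simp_all
    also have "\<dots> = (\<integral>x. m powr p + p * m powr (p - 1) * (\<bar>h x\<bar> - m) \<partial>M)"
      using h by (simp add: prob_space algebra_simps)
    also have "\<dots> \<le> (\<integral>x. \<bar>h x\<bar> powr p \<partial>M)"
      using m p by (intro integral_mono powr_tangent Bochner_Integration.integrable_add integrable_mult_right
          Bochner_Integration.integrable_diff integrable_abs h i integrable_const) simp_all
    finally show ?thesis .
  qed (auto intro!: integral_nonneg)
  then show ?thesis
    using i by (subst nn_integral_eq_integral) (auto simp: m_def)
qed (auto simp: not_less top_unique)

section \<open>Mollification\<close>

lemma compact_support_bounded:
  fixes f :: "'a::euclidean_space \<Rightarrow> real"
  assumes "continuous_on UNIV f" "\<And>x. norm x > R \<Longrightarrow> f x = 0"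
  obtains C where "C \<ge> 0" "\<And>x. \<bar>f x\<bar> \<le> C"
proof -
  have "bounded (f ` cball 0 R)"
    by (intro compact_imp_bounded compact_continuous_image continuous_on_subset[OF assms(1)]) auto
  then obtain C where "\<forall>y\<in>f ` cball 0 R. norm y \<le> C"
    unfolding bounded_iff by blast
  then have C: "\<And>x. norm x \<le> R \<Longrightarrow> \<bar>f x\<bar> \<le> C" by auto
  have "\<bar>f x\<bar> \<le> max C 0" for x
    using C[of x] assms(2)[of x] by (cases "norm x \<le> R") auto
  then show ?thesis using that[of "max C 0"] by auto
qed

lemma test_function_bounded:
  assumes "test_function \<phi>"
  obtains C where "C \<ge> 0" "\<And>x. \<bar>\<phi> x\<bar> \<le> C"
  using assms compact_support_bounded smooth_continuous_on unfolding test_function_iff by metis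

lemma test_function_borel: "test_function \<phi> \<Longrightarrow> \<phi> \<in> borel_measurable borel"
  by (simp add: test_function_iff smooth_borel_measurable)

text \<open>On a ball |f| \<le> 1 + |f|^p, and the constant 1 has finite integral there.\<close>

lemma integrable_compact_support:
  fixes f :: "'a::euclidean_space \<Rightarrow> real"
  assumes [measurable]: "f \<in> borel_measurable borel" and "\<And>x. norm x > R \<Longrightarrow> f x = 0" "NP p f < \<infinity>" "p \<ge> 1"
  shows "integrable lborel f"
proof -
  have "(\<integral>\<^sup>+x. ennreal (norm (f x)) \<partial>lborel) \<le> (\<integral>\<^sup>+x. indicator (cball (0::'a) R) x + ennreal (\<bar>f x\<bar> powr p) \<partial>lborel)"
  proof (rule nn_integral_mono)
    fix x
    show "ennreal (norm (f x)) \<le> indicator (cball 0 R) x + ennreal (\<bar>f x\<bar> powr p)"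
    proof (cases "norm x \<le> R")
      case True
      have "\<bar>f x\<bar> \<le> 1 + \<bar>f x\<bar> powr p"
      proof (cases "\<bar>f x\<bar> \<le> 1")
        case False
        then have "\<bar>f x\<bar> powr 1 \<le> \<bar>f x\<bar> powr p" using assms(4) by (intro powr_mono) auto
        then show ?thesis by simp
      qed (auto intro: order.trans[of _ 1])
      then have "ennreal \<bar>f x\<bar> \<le> ennreal (1 + \<bar>f x\<bar> powr p)" by (rule ennreal_leI)
      then show ?thesis using True by simp
    qed (use assms(2) in auto)
  qed
  also have "\<dots> = emeasure lborel (cball (0::'a) R) + NP p f"
    by (subst nn_integral_add) (auto simp: NP_def intro!: borel_measurable_indicator)
  also have "\<dots> < \<infinity>" using emeasure_lborel_cball_finite[of "0::'a" R] assms(3) by auto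
  finally show ?thesis by (simp add: integrable_iff_bounded)
qed

lemma NP_compact_support_fin:
  fixes f :: "'a::euclidean_space \<Rightarrow> real"
  assumes f: "continuous_on UNIV f" "\<And>x. norm x > R \<Longrightarrow> f x = 0" and p: "p > 0"
  shows "NP p f < \<infinity>"
proof -
  obtain C where C: "C \<ge> 0" "\<And>x. \<bar>f x\<bar> \<le> C" using compact_support_bounded[OF f] by blast
  have "NP p f \<le> (\<integral>\<^sup>+x. ennreal (C powr p * indicator (cball (0::'a) R) x) \<partial>lborel)"
    unfolding NP_def
  proof (rule nn_integral_mono)
    fix x
    show "ennreal (\<bar>f x\<bar> powr p) \<le> ennreal (C powr p * indicator (cball 0 R) x)"
      using C(2)[of x] f(2)[of x] p by (cases "norm x \<le> R") (auto intro!: ennreal_leI powr_mono2)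
  qed
  also have "\<dots> = ennreal (C powr p) * emeasure lborel (cball (0::'a) R)"
    by (rule nn_integral_cindicator) simp_all
  also have "\<dots> < \<infinity>" using emeasure_lborel_cball_finite[of "0::'a" R] by (simp add: ennreal_mult_less_top)
  finally show ?thesis .
qed

text \<open>Positivity and unit mass make each kernel a probability density, as Jensen's inequality
  requires; the support radius is at most 1 for every index.\<close>

definition mollifiers :: "(nat \<Rightarrow> 'a::euclidean_space \<Rightarrow> real) \<Rightarrow> bool" where
  "mollifiers K \<longleftrightarrow> (\<forall>n. test_function (K n) \<and> (\<forall>x. K n x \<ge> 0) \<and> integrable lborel (K n) \<and>
     (\<integral>x. K n x \<partial>lborel) = 1 \<and> (\<forall>x. norm x \<ge> 1 / (real n + 1) \<longrightarrow> K n x = 0))"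

lemma mollifiers_exist:
  obtains K :: "nat \<Rightarrow> 'a::euclidean_space \<Rightarrow> real" where "mollifiers K"
proof -
  obtain \<kappa> :: "'a \<Rightarrow> real" where \<kappa>: "smooth \<kappa>" "\<And>x. 0 \<le> \<kappa> x" "\<And>x. \<kappa> x \<le> 1"
    "\<And>x. norm x \<le> 1 \<Longrightarrow> \<kappa> x = 1" "\<And>x. norm x \<ge> 2 \<Longrightarrow> \<kappa> x = 0"
    using smooth_cutoff_exists by blast
  have [measurable]: "\<kappa> \<in> borel_measurable borel" by (rule smooth_borel_measurable[OF \<kappa>(1)])
  have int: "integrable lborel \<kappa>"
    using integrable_compact_support[of \<kappa> 2 1] NP_compact_support_fin[of \<kappa> 2 1] \<kappa>(5)
      smooth_continuous_on[OF \<kappa>(1)] by auto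
  define c where "c = (\<integral>x. \<kappa> x \<partial>lborel)"
  \<comment> \<open>The cutoff equals 1 on the unit ball, which is not negligible.\<close>
  have "c \<noteq> 0"
  proof
    assume "c = 0"
    then have "AE x in lborel. \<kappa> x = 0"
      using integral_nonneg_eq_0_iff_AE[OF int] \<kappa>(2) by (simp add: c_def)
    then have "AE x in lborel. x \<notin> ball (0::'a) 1"
      by eventually_elim (use \<kappa>(4) in fastforce)
    then have "AE x in lebesgue. x \<notin> ball (0::'a) 1" by (simp add: AE_completion_iff)
    then have "negligible (ball (0::'a) 1)"
      unfolding negligible_iff_null_sets by (subst (asm) AE_iff_null_sets[symmetric]) auto
    then show False using open_not_negligible[of "ball (0::'a) 1"] by auto
  qed
  moreover have "c \<ge> 0" unfolding c_def by (rule Bochner_Integration.integral_nonneg) (rule \<kappa>(2))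
  ultimately have c: "c > 0" by simp
  \<comment> \<open>The cutoff lives in the ball of radius 2, so the support radius 1/(n + 1) needs
    the scale 2 (n + 1).\<close>
  define a where "a n = 2 * (real n + 1)" for n
  have a: "a n > 0" for n by (simp add: a_def)
  define K where "K n x = (a n ^ DIM('a) / c) * \<kappa> (a n *\<^sub>R x + 0)" for n x
  have test: "test_function \<kappa>" using \<kappa> by (auto simp: test_function_iff intro!: exI[of _ 2])
  have "mollifiers K"
    unfolding mollifiers_def
  proof (intro allI conjI impI)
    fix n and x :: 'a
    show "test_function (K n)"
      unfolding K_def[abs_def] using a[of n] by (intro test_function_mult smooth_const test_function_affine test) auto
    show "0 \<le> K n x" using \<kappa>(2) c a[of n] by (simp add: K_def)
    show "integrable lborel (K n)"
      unfolding K_def[abs_def] using a[of n] by (intro integrable_mult_right integrable_affine int) auto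
    have "(\<integral>x. K n x \<partial>lborel) = (a n ^ DIM('a) / c) * (1 / \<bar>a n\<bar> ^ DIM('a) * c)"
      unfolding K_def c_def[symmetric] using a[of n] by (subst integral_mult_right_zero, subst integral_affine) (auto simp: c_def)
    then show "(\<integral>x. K n x \<partial>lborel) = 1" using c a[of n] by simp
    assume "1 / (real n + 1) \<le> norm x"
    then have "(real n + 1) * norm x \<ge> 1" by (simp add: field_simps)
    moreover have "norm (a n *\<^sub>R x) = 2 * ((real n + 1) * norm x)"
      unfolding norm_scaleR by (simp add: a_def)
    ultimately have "norm (a n *\<^sub>R x) \<ge> 2" by linarith
    then show "K n x = 0" by (simp add: K_def \<kappa>(5))
  qed
  then show ?thesis using that by blast
qed

definition conv :: "('a::euclidean_space \<Rightarrow> real) \<Rightarrow> ('a \<Rightarrow> real) \<Rightarrow> 'a \<Rightarrow> real" where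
  "conv K f x = (\<integral>y. K (x - y) * f y \<partial>lborel)"

lemma integrable_bounded_mult:
  fixes f g :: "'a \<Rightarrow> real"
  assumes f: "integrable M f" and [measurable]: "g \<in> borel_measurable M" and g: "\<And>x. \<bar>g x\<bar> \<le> C"
  shows "integrable M (\<lambda>x. g x * f x)"
proof (rule Bochner_Integration.integrable_bound)
  show "integrable M (\<lambda>x. C * f x)" using f by simp
  show "AE x in M. norm (g x * f x) \<le> norm (C * f x)"
    using order.trans[OF g abs_ge_self] by (auto simp: abs_mult intro!: mult_right_mono)
qed (use f in measurable)

lemma integrable_conv:
  assumes "test_function K" "integrable lborel f"
  shows "integrable lborel (\<lambda>y. K (x - y) * f y)"
proof -
  obtain C where "\<And>x. \<bar>K x\<bar> \<le> C" using test_function_bounded[OF assms(1)] by blast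
  then show ?thesis using assms test_function_borel[OF assms(1)] by (intro integrable_bounded_mult[where C=C]) auto
qed

lemma conv_support:
  assumes "\<And>x. norm x \<ge> e \<Longrightarrow> K x = 0" "\<And>x. norm x > R \<Longrightarrow> f x = 0" "norm x > R + e"
  shows "conv K f x = 0"
proof -
  have "K (x - y) * f y = 0" for y
  proof (cases "norm y > R")
    case False
    have "norm x \<le> norm (x - y) + norm y" by (metis diff_add_cancel norm_triangle_ineq)
    with False assms(3) have "norm (x - y) \<ge> e" by linarith
    then show ?thesis using assms(1) by simp
  qed (use assms(2) in simp)
  then have "(\<lambda>y. K (x - y) * f y) = (\<lambda>_. 0)" by (intro ext)
  then show ?thesis by (simp add: conv_def)
qed

lemma conv_continuous:
  fixes f :: "'a::euclidean_space \<Rightarrow> real"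
  assumes K: "test_function K" and f: "integrable lborel f"
  shows "continuous_on UNIV (conv K f)"
proof (rule continuous_at_imp_continuous_on, rule ballI)
  fix x :: 'a
  obtain C where C: "\<And>x. \<bar>K x\<bar> \<le> C" using test_function_bounded[OF K] by blast
  have Kc: "continuous_on UNIV K" using K by (simp add: test_function_iff smooth_continuous_on)
  have [measurable]: "K \<in> borel_measurable borel" "f \<in> borel_measurable borel" using f by (auto intro: test_function_borel[OF K])
  show "isCont (conv K f) x"
    unfolding continuous_at_sequentially comp_def
  proof (intro allI impI)
    fix u assume u: "u \<longlonglongrightarrow> x"
    show "(\<lambda>n. conv K f (u n)) \<longlonglongrightarrow> conv K f x"
      unfolding conv_def
    proof (rule integral_dominated_convergence[where w="\<lambda>y. C * \<bar>f y\<bar>"])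
      show "AE y in lborel. (\<lambda>n. K (u n - y) * f y) \<longlonglongrightarrow> K (x - y) * f y"
      proof (rule AE_I2)
        fix y
        have "(\<lambda>n. u n - y) \<longlonglongrightarrow> x - y" by (intro tendsto_intros u)
        moreover have "isCont K (x - y)" using Kc by (simp add: continuous_on_eq_continuous_at)
        ultimately have "(\<lambda>n. K (u n - y)) \<longlonglongrightarrow> K (x - y)" by (metis isCont_tendsto_compose)
        then show "(\<lambda>n. K (u n - y) * f y) \<longlonglongrightarrow> K (x - y) * f y" by (intro tendsto_intros)
      qed
      show "AE y in lborel. norm (K (u n - y) * f y) \<le> C * \<bar>f y\<bar>" for n
        using C by (auto simp: abs_mult intro!: mult_right_mono)
    qed (use f in auto)
  qed
qed

lemma test_function_Lipschitz:
  fixes K :: "'a::euclidean_space \<Rightarrow> real"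
  assumes K: "test_function K"
  obtains L where "L \<ge> 0" "\<And>x h. \<bar>K (x + h) - K x\<bar> \<le> L * norm h"
    "\<And>x h. \<bar>\<Sum>i\<in>Basis. (h \<bullet> i) * partial i K x\<bar> \<le> L * norm h"
proof -
  have "\<exists>C. C \<ge> 0 \<and> (\<forall>x. \<bar>partial i K x\<bar> \<le> C)" if "i \<in> Basis" for i
    using test_function_bounded[OF test_function_partial[OF K that]] by metis
  then obtain C where C: "\<And>i. i \<in> Basis \<Longrightarrow> C i \<ge> 0" "\<And>i x. i \<in> Basis \<Longrightarrow> \<bar>partial i K x\<bar> \<le> C i"
    by metis
  define L where "L = (\<Sum>i\<in>Basis. C i)"
  have L: "L \<ge> 0" unfolding L_def by (intro sum_nonneg C)
  have D: "\<bar>\<Sum>i\<in>Basis. (h \<bullet> i) * partial i K x\<bar> \<le> L * norm h" for x h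
  proof -
    have "\<bar>\<Sum>i\<in>Basis. (h \<bullet> i) * partial i K x\<bar> \<le> (\<Sum>i\<in>Basis. \<bar>(h \<bullet> i) * partial i K x\<bar>)" by (rule sum_abs)
    also have "\<dots> \<le> (\<Sum>i\<in>Basis. norm h * C i)"
      using C by (intro sum_mono) (auto simp: abs_mult intro!: mult_mono Basis_le_norm)
    finally show ?thesis by (simp add: L_def sum_distrib_left mult.commute)
  qed
  have sm: "smooth K" using K by (simp add: test_function_iff)
  have "\<bar>K (x + h) - K x\<bar> \<le> L * norm h" for x h
  proof -
    have "norm (K (x + h) - K x) \<le> L * norm (x + h - x)"
    proof (rule differentiable_bound[of UNIV K])
      show "(K has_derivative (\<lambda>h. \<Sum>i\<in>Basis. (h \<bullet> i) * partial i K x)) (at x within UNIV)" for x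
        using smooth_has_derivative[OF sm] by simp
      show "onorm (\<lambda>h. \<Sum>i\<in>Basis. (h \<bullet> i) * partial i K x) \<le> L" for x
        using D by (intro onorm_le) (auto simp: mult.commute)
    qed auto
    then show ?thesis by simp
  qed
  with L D show ?thesis using that by blast
qed

text \<open>Differentiation under the integral sign: the Lipschitz bound on the kernel controls its
  normalised Taylor remainder by 2 \<open>L\<close>, so dominated convergence applies with majorant
  2 \<open>L\<close> |f|.\<close>

lemma conv_has_derivative:
  fixes f :: "'a::euclidean_space \<Rightarrow> real"
  assumes K: "test_function K" and f: "integrable lborel f"
  shows "(conv K f has_derivative (\<lambda>h. \<Sum>i\<in>Basis. (h \<bullet> i) * conv (partial i K) f x)) (at x)"
proof -
  obtain L where L: "L \<ge> 0" "\<And>x h. \<bar>K (x + h) - K x\<bar> \<le> L * norm h"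
    "\<And>x h. \<bar>\<Sum>i\<in>Basis. (h \<bullet> i) * partial i K x\<bar> \<le> L * norm h"
    using test_function_Lipschitz[OF K] by blast
  have [measurable]: "K \<in> borel_measurable borel" "f \<in> borel_measurable borel" using f by (auto intro: test_function_borel[OF K])
  have [measurable]: "\<And>i. i \<in> Basis \<Longrightarrow> partial i K \<in> borel_measurable borel"
    using test_function_partial[OF K] by (auto intro: test_function_borel)
  have sm: "smooth K" using K by (simp add: test_function_iff)
  have int: "integrable lborel (\<lambda>y. K (x - y) * f y)" for x
    by (rule integrable_conv[OF K f])
  have intD: "integrable lborel (\<lambda>y. (\<Sum>i\<in>Basis. (h \<bullet> i) * partial i K (x - y)) * f y)" for h
    unfolding sum_distrib_right mult.assoc
    by (intro Bochner_Integration.integrable_sum integrable_mult_right integrable_conv test_function_partial K f)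
  define r where "r h y = (K (x - y + h) - K (x - y) - (\<Sum>i\<in>Basis. (h \<bullet> i) * partial i K (x - y))) / norm h" for h y
  have D: "(\<Sum>i\<in>Basis. (h \<bullet> i) * conv (partial i K) f x) = (\<integral>y. (\<Sum>i\<in>Basis. (h \<bullet> i) * partial i K (x - y)) * f y \<partial>lborel)" for h
    unfolding sum_distrib_right mult.assoc conv_def
    by (subst Bochner_Integration.integral_sum) (auto intro!: integrable_mult_right integrable_conv test_function_partial K f)
  have eq: "(conv K f (x + h) - conv K f x - (\<Sum>i\<in>Basis. (h \<bullet> i) * conv (partial i K) f x)) / norm h = (\<integral>y. r h y * f y \<partial>lborel)" for h
  proof -
    have "conv K f (x + h) - conv K f x - (\<Sum>i\<in>Basis. (h \<bullet> i) * conv (partial i K) f x)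
      = (\<integral>y. K (x + h - y) * f y - K (x - y) * f y - (\<Sum>i\<in>Basis. (h \<bullet> i) * partial i K (x - y)) * f y \<partial>lborel)"
      unfolding D unfolding conv_def using int[of x] int[of "x + h"] intD[of h]
      by (simp add: Bochner_Integration.integral_diff)
    also have "\<dots> / norm h = (\<integral>y. r h y * f y \<partial>lborel)"
      unfolding integral_divide_zero[symmetric]
      by (intro Bochner_Integration.integral_cong) (auto simp: r_def algebra_simps diff_divide_distrib)
    finally show ?thesis .
  qed
  have rb: "\<bar>r h y\<bar> \<le> 2 * L" for h y
  proof (cases "h = 0")
    case False
    have "\<bar>K (x - y + h) - K (x - y) - (\<Sum>i\<in>Basis. (h \<bullet> i) * partial i K (x - y))\<bar> \<le> L * norm h + L * norm h"
      using L(2)[of "x - y" h] L(3)[of h "x - y"] by linarith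
    then show ?thesis using False by (simp add: r_def abs_divide pos_divide_le_eq)
  qed (use L in \<open>simp add: r_def\<close>)
  have "((\<lambda>h. (conv K f (x + h) - conv K f x - (\<Sum>i\<in>Basis. (h \<bullet> i) * conv (partial i K) f x)) / norm h) \<longlongrightarrow> 0) (at 0)"
    unfolding tendsto_at_iff_sequentially comp_def
  proof (intro allI impI)
    fix u :: "nat \<Rightarrow> 'a" assume u0: "\<forall>i. u i \<in> UNIV - {0}" and u: "u \<longlonglongrightarrow> 0"
    have "(\<lambda>n. \<integral>y. r (u n) y * f y \<partial>lborel) \<longlonglongrightarrow> (\<integral>y. 0 * f y \<partial>(lborel::'a measure))"
    proof (rule integral_dominated_convergence[where w="\<lambda>y. 2 * L * \<bar>f y\<bar>"])
      show "AE y in lborel. (\<lambda>n. r (u n) y * f y) \<longlonglongrightarrow> 0 * f y"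
      proof (rule AE_I2)
        fix y
        have "((\<lambda>h. r h y) \<longlongrightarrow> 0) (at 0)"
          using smooth_has_derivative[OF sm, of "x - y"] unfolding has_derivative_at r_def
          by (subst (asm) tendsto_rabs_zero_iff[symmetric], subst tendsto_rabs_zero_iff[symmetric]) simp
        then have "(\<lambda>n. r (u n) y) \<longlonglongrightarrow> 0"
          using u u0 unfolding tendsto_at_iff_sequentially comp_def by blast
        then show "(\<lambda>n. r (u n) y * f y) \<longlonglongrightarrow> 0 * f y" by (intro tendsto_intros)
      qed
      show "AE y in lborel. norm (r (u n) y * f y) \<le> 2 * L * \<bar>f y\<bar>" for n
        using rb by (auto simp: abs_mult intro!: mult_right_mono)
      show "(\<lambda>y. r (u n) y * f y) \<in> borel_measurable lborel" for n
        unfolding r_def by measurable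
    qed (use f in auto)
    then show "(\<lambda>n. (conv K f (x + u n) - conv K f x - (\<Sum>i\<in>Basis. (u n \<bullet> i) * conv (partial i K) f x)) / norm (u n)) \<longlonglongrightarrow> 0"
      unfolding eq by simp
  qed
  then have "((\<lambda>h. norm (conv K f (x + h) - conv K f x - (\<Sum>i\<in>Basis. (h \<bullet> i) * conv (partial i K) f x)) / norm h) \<longlongrightarrow> 0) (at 0)"
    by (subst (asm) tendsto_rabs_zero_iff[symmetric]) simp
  moreover have "bounded_linear (\<lambda>h. \<Sum>i\<in>Basis. (h \<bullet> i) * conv (partial i K) f x)"
    by (intro bounded_linear_sum bounded_linear_mult_const bounded_linear_inner_left)
  ultimately show ?thesis unfolding has_derivative_at by simp
qed

section \<open>Weak derivatives and their mollification\<close>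

text \<open>The integration by parts identity of \<open>has_weak_partial\<close> alone, for Borel
  functions; local integrability is carried separately by \<open>locint\<close> or by a finite
  \<open>NP\<close>.\<close>

definition wpd :: "'a::euclidean_space \<Rightarrow> ('a \<Rightarrow> real) \<Rightarrow> ('a \<Rightarrow> real) \<Rightarrow> bool" where
  "wpd i f g \<longleftrightarrow> (\<forall>\<phi>. test_function \<phi> \<longrightarrow>
     (\<integral>x. partial i \<phi> x * f x \<partial>lborel) = - (\<integral>x. \<phi> x * g x \<partial>lborel))"

text \<open>For fixed \<open>x\<close> the reflected kernel K(x - y) is itself a test function in y;
  the sign from the reflection cancels the sign from integration by parts.\<close>

lemma conv_wpd:
  assumes K: "test_function K" and i: "i \<in> Basis" and w: "wpd i f g"
  shows "conv (partial i K) f x = conv K g x"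
proof -
  define \<phi> where "\<phi> y = K ((- 1) *\<^sub>R y + x)" for y
  have t: "test_function \<phi>" unfolding \<phi>_def by (rule test_function_affine[OF K]) simp
  have "partial i \<phi> y = - partial i K (x - y)" for y
    unfolding \<phi>_def using partial_affine[of K i "- 1" x y] K i by (simp add: test_function_iff)
  then have "- (\<integral>y. partial i K (x - y) * f y \<partial>lborel) = - (\<integral>y. \<phi> y * g y \<partial>lborel)"
    using w[unfolded wpd_def, rule_format, OF t] by simp
  then show ?thesis by (simp add: conv_def \<phi>_def)
qed

lemma conv_GDERIV:
  fixes f :: "'a::euclidean_space \<Rightarrow> real"
  assumes K: "test_function K" and f: "integrable lborel f" and w: "\<And>i. i \<in> Basis \<Longrightarrow> wpd i f (g i)"
  shows "GDERIV (conv K f) x :> (\<Sum>i\<in>Basis. conv K (g i) x *\<^sub>R i)"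
proof -
  have "(\<lambda>h. \<Sum>i\<in>Basis. (h \<bullet> i) * conv (partial i K) f x) = (\<lambda>h. h \<bullet> (\<Sum>i\<in>Basis. conv K (g i) x *\<^sub>R i))"
    by (auto simp: inner_sum_right conv_wpd[OF K _ w] mult.commute intro!: sum.cong)
  then show ?thesis using conv_has_derivative[OF K f, of x] by (simp add: gderiv_def)
qed

text \<open>The error of mollification is the mean of f(x - z) - f(x) with respect to the density
  \<open>K\<close>. Jensen's inequality brings the power inside the mean, and Tonelli's theorem
  leaves an average of translation errors with |z| < e.\<close>

lemma NP_conv_le:
  fixes f :: "'a::euclidean_space \<Rightarrow> real"
  assumes K: "test_function K" "\<And>x. K x \<ge> 0" "integrable lborel K" "(\<integral>x. K x \<partial>lborel) = 1" "\<And>x. norm x \<ge> e \<Longrightarrow> K x = 0"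
    and f: "integrable lborel f" and p: "p \<ge> 1"
    and B: "\<And>h. norm h < e \<Longrightarrow> NP p (\<lambda>x. f (x + h) - f x) \<le> B"
  shows "NP p (\<lambda>x. conv K f x - f x) \<le> B"
proof -
  have [measurable]: "K \<in> borel_measurable borel" "f \<in> borel_measurable borel" using f by (auto intro: test_function_borel[OF K(1)])
  define \<mu> where "\<mu> = density lborel (\<lambda>z. ennreal (K z))"
  have K1: "(\<integral>\<^sup>+z. ennreal (K z) \<partial>lborel) = 1"
    using K by (subst nn_integral_eq_integral) auto
  interpret \<mu>: prob_space \<mu>
    by standard (simp add: \<mu>_def emeasure_density K1)
  have int: "integrable lborel (\<lambda>z. K z * f (x - z))" for x
    using integrable_affine[OF integrable_conv[OF K(1) f, of x], of "- 1" x] by simp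
  have eq: "conv K f x = (\<integral>z. K z * f (x - z) \<partial>lborel)" for x
    unfolding conv_def using integral_affine[of "\<lambda>y. K (x - y) * f y" "- 1" x] by simp
  have pt: "ennreal (\<bar>conv K f x - f x\<bar> powr p) \<le> (\<integral>\<^sup>+z. ennreal (K z) * ennreal (\<bar>f (x - z) - f x\<bar> powr p) \<partial>lborel)" for x
  proof -
    have i: "integrable \<mu> (\<lambda>z. f (x - z) - f x)"
      unfolding \<mu>_def using int[of x] K by (subst integrable_density) (auto simp: algebra_simps)
    have "conv K f x - f x = (\<integral>z. K z * f (x - z) - K z * f x \<partial>lborel)"
      unfolding eq using int[of x] K by simp
    also have "\<dots> = (\<integral>z. f (x - z) - f x \<partial>\<mu>)"
      unfolding \<mu>_def using K by (subst integral_density) (auto simp: algebra_simps)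
    finally have "ennreal (\<bar>conv K f x - f x\<bar> powr p) \<le> (\<integral>\<^sup>+z. ennreal (\<bar>f (x - z) - f x\<bar> powr p) \<partial>\<mu>)"
      using \<mu>.powr_Jensen[OF i p] by simp
    also have "\<dots> = (\<integral>\<^sup>+z. ennreal (K z) * ennreal (\<bar>f (x - z) - f x\<bar> powr p) \<partial>lborel)"
      unfolding \<mu>_def by (subst nn_integral_density) auto
    finally show ?thesis .
  qed
  have "NP p (\<lambda>x. conv K f x - f x) \<le> (\<integral>\<^sup>+x. (\<integral>\<^sup>+z. ennreal (K z) * ennreal (\<bar>f (x - z) - f x\<bar> powr p) \<partial>lborel) \<partial>lborel)"
    unfolding NP_def by (intro nn_integral_mono pt)
  also have "\<dots> = (\<integral>\<^sup>+z. (\<integral>\<^sup>+x. ennreal (K z) * ennreal (\<bar>f (x - z) - f x\<bar> powr p) \<partial>lborel) \<partial>lborel)"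
    by (rule lborel_pair.Fubini') measurable
  also have "\<dots> = (\<integral>\<^sup>+z. ennreal (K z) * NP p (\<lambda>x. f (x + - z) - f x) \<partial>lborel)"
    unfolding NP_def by (intro nn_integral_cong, subst nn_integral_cmult) auto
  also have "\<dots> \<le> (\<integral>\<^sup>+z. ennreal (K z) * B \<partial>lborel)"
  proof (rule nn_integral_mono)
    fix z
    show "ennreal (K z) * NP p (\<lambda>x. f (x + - z) - f x) \<le> ennreal (K z) * B"
    proof (cases "norm z < e")
      case True
      then show ?thesis using B[of "- z"] by (intro mult_left_mono) auto
    qed (use K(5) in auto)
  qed
  also have "\<dots> = B" by (subst nn_integral_multc) (auto simp: K1)
  finally show ?thesis .
qed

lemma mollifiers_NP_tendsto:
  fixes f :: "'a::euclidean_space \<Rightarrow> real"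
  assumes K: "mollifiers K" and f: "integrable lborel f" "NP p f < \<infinity>" and p: "p \<ge> 1"
  shows "(\<lambda>n. NP p (\<lambda>x. conv (K n) f x - f x)) \<longlonglongrightarrow> 0"
proof (rule order_tendstoI)
  have fm[measurable]: "f \<in> borel_measurable borel" using f by auto
  have p0: "p > 0" using p by simp
  fix e :: ennreal assume e: "0 < e"
  obtain e' where e': "e' > 0" "ennreal e' < e"
  proof (cases e)
    case (real r)
    then show ?thesis using e that[of "r / 2"] by (auto simp: ennreal_less_iff)
  next
    case top
    then show ?thesis using that[of 1] by auto
  qed
  obtain \<delta> where \<delta>: "\<delta> > 0"
    "\<And>s h. \<bar>s - 1\<bar> < \<delta> \<Longrightarrow> norm h < \<delta> \<Longrightarrow> NP p (\<lambda>x. f (s *\<^sub>R x + h) - f x) < ennreal e'"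
    by (rule NP_affine_continuous_at_id[OF fm f(2) p0 e'(1)]) blast
  have "eventually (\<lambda>n. 1 / (real n + 1) < \<delta>) sequentially"
    using LIMSEQ_inverse_real_of_nat \<delta>(1) by (auto dest!: order_tendstoD(2)[of _ 0] simp: inverse_eq_divide add.commute)
  then show "\<forall>\<^sub>F n in sequentially. NP p (\<lambda>x. conv (K n) f x - f x) < e"
  proof eventually_elim
    case (elim n)
    have "NP p (\<lambda>x. conv (K n) f x - f x) \<le> ennreal e'"
    proof (rule NP_conv_le[where e="1 / (real n + 1)", OF _ _ _ _ _ f(1) p])
      fix h :: 'a assume "norm h < 1 / (real n + 1)"
      then show "NP p (\<lambda>x. f (x + h) - f x) \<le> ennreal e'"
        using \<delta>(2)[of 1 h] \<delta>(1) elim by simp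
    qed (use K in \<open>auto simp: mollifiers_def\<close>)
    with e'(2) show ?case by simp
  qed
qed auto

section \<open>Locally integrable functions and uniqueness of weak derivatives\<close>

definition locint :: "('a::euclidean_space \<Rightarrow> real) \<Rightarrow> bool" where
  "locint f \<longleftrightarrow> f \<in> borel_measurable borel \<and> (\<forall>R. integrable lborel (\<lambda>x. indicator (cball 0 R) x * f x))"

lemma locint_measurable[measurable_dest]: "locint f \<Longrightarrow> f \<in> borel_measurable borel"
  by (simp add: locint_def)

lemma integrable_locint_bounded_mult:
  assumes f: "locint f" and [measurable]: "g \<in> borel_measurable borel" and g: "\<And>x. \<bar>g x\<bar> \<le> C" "\<And>x. norm x > R \<Longrightarrow> g x = 0"
  shows "integrable lborel (\<lambda>x. g x * f x)"
proof -
  have "integrable lborel (\<lambda>x. g x * (indicator (cball 0 R) x * f x))"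
    by (rule integrable_bounded_mult[OF _ _ g(1)]) (use f in \<open>auto simp: locint_def\<close>)
  also have "(\<lambda>x. g x * (indicator (cball 0 R) x * f x)) = (\<lambda>x. g x * f x)"
    using g(2) by (auto simp: fun_eq_iff indicator_def)
  finally show ?thesis .
qed

lemma integrable_test_mult:
  assumes "locint f" "test_function \<phi>"
  shows "integrable lborel (\<lambda>x. \<phi> x * f x)"
proof -
  obtain C where C: "\<And>x. \<bar>\<phi> x\<bar> \<le> C" using test_function_bounded[OF assms(2)] by blast
  obtain R where R: "\<And>x. norm x > R \<Longrightarrow> \<phi> x = 0" using assms(2) by (auto simp: test_function_iff)
  show ?thesis using integrable_locint_bounded_mult[OF assms(1) test_function_borel[OF assms(2)] C R] by simp
qed

lemma locint_add: "locint f \<Longrightarrow> locint g \<Longrightarrow> locint (\<lambda>x. f x + g x)"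
  and locint_diff: "locint f \<Longrightarrow> locint g \<Longrightarrow> locint (\<lambda>x. f x - g x)"
  by (auto simp: locint_def distrib_left right_diff_distrib)

text \<open>Convolving with mollifiers turns the vanishing of all pairings into pointwise vanishing.\<close>

lemma AE_eq_0_test:
  fixes f :: "'a::euclidean_space \<Rightarrow> real"
  assumes f: "locint f" and z: "\<And>\<phi>. test_function \<phi> \<Longrightarrow> (\<integral>x. \<phi> x * f x \<partial>lborel) = 0"
  shows "AE x in lborel. f x = 0"
proof -
  have [measurable]: "f \<in> borel_measurable borel" using f by (simp add: locint_def)
  obtain \<kappa> :: "'a \<Rightarrow> real" where \<kappa>: "smooth \<kappa>" "\<And>x. 0 \<le> \<kappa> x" "\<And>x. \<kappa> x \<le> 1"
    "\<And>x. norm x \<le> 1 \<Longrightarrow> \<kappa> x = 1" "\<And>x. norm x \<ge> 2 \<Longrightarrow> \<kappa> x = 0"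
    using smooth_cutoff_exists by blast
  have t\<kappa>: "test_function \<kappa>" using \<kappa> by (auto simp: test_function_iff intro!: exI[of _ 2])
  obtain K :: "nat \<Rightarrow> 'a \<Rightarrow> real" where K: "mollifiers K" using mollifiers_exist by blast
  have "AE x in lborel. \<kappa> ((1 / (real m + 1)) *\<^sub>R x + 0) * f x = 0" for m
  proof -
    define \<psi> where "\<psi> x = \<kappa> ((1 / (real m + 1)) *\<^sub>R x + 0)" for x
    have \<psi>: "test_function \<psi>" unfolding \<psi>_def by (rule test_function_affine[OF t\<kappa>]) simp
    define F where "F x = \<psi> x * f x" for x
    have F: "integrable lborel F" unfolding F_def by (rule integrable_test_mult[OF f \<psi>])
    have "conv (K n) F x = 0" for n x
    proof -
      \<comment> \<open>The product of reflected kernel and cutoff is an admissible test function,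
        so every mollification of the truncated function vanishes exactly.\<close>
      have "test_function (\<lambda>y. K n ((- 1) *\<^sub>R y + x) * \<psi> y)"
        using K \<psi> by (intro test_function_mult smooth_affine) (auto simp: mollifiers_def test_function_iff)
      from z[OF this] show ?thesis by (simp add: conv_def F_def mult.assoc)
    qed
    moreover have "NP 1 F < \<infinity>" using F by (simp add: NP_def integrable_iff_bounded)
    ultimately have "(\<lambda>n::nat. NP 1 (\<lambda>x. - F x)) \<longlonglongrightarrow> 0"
      using mollifiers_NP_tendsto[OF K F, of 1] by simp
    then have "NP 1 F = 0" by (simp add: NP_uminus LIMSEQ_const_iff)
    then have "AE x in lborel. F x = 0"
      using F by (simp add: NP_def nn_integral_0_iff_AE)
    then show ?thesis by (simp add: F_def \<psi>_def)
  qed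
  then have "AE x in lborel. \<forall>m. \<kappa> ((1 / (real m + 1)) *\<^sub>R x + 0) * f x = 0"
    by (subst AE_all_countable) blast
  then show ?thesis
  proof eventually_elim
    case (elim x)
    obtain m where "norm x \<le> real m" using real_arch_simple by blast
    then have "\<kappa> ((1 / (real m + 1)) *\<^sub>R x + 0) = 1" by (intro \<kappa>(4)) (simp add: field_simps)
    then show ?case using elim[rule_format, of m] by simp
  qed
qed

lemma wpd_unique:
  assumes "wpd i f g" "wpd i f g'" "locint g" "locint g'"
  shows "AE x in lborel. g x = g' x"
proof -
  have "AE x in lborel. g x - g' x = 0"
  proof (rule AE_eq_0_test[OF locint_diff[OF assms(3,4)]])
    fix \<phi> :: "'a \<Rightarrow> real" assume \<phi>: "test_function \<phi>"
    then have "(\<integral>x. \<phi> x * g x \<partial>lborel) = (\<integral>x. \<phi> x * g' x \<partial>lborel)" using assms(1,2) by (auto simp: wpd_def)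
    then show "(\<integral>x. \<phi> x * (g x - g' x) \<partial>lborel) = 0"
      using integrable_test_mult[OF assms(3) \<phi>] integrable_test_mult[OF assms(4) \<phi>] by (simp add: right_diff_distrib)
  qed
  then show ?thesis by simp
qed

section \<open>The divergence theorem and the Hardy--Rellich inequalities\<close>

lemma integrable_continuous_compact_support:
  fixes f :: "'a::euclidean_space \<Rightarrow> real"
  assumes "continuous_on UNIV f" "\<And>x. norm x > R \<Longrightarrow> f x = 0"
  shows "integrable lborel f"
  using integrable_compact_support[of f R 1] NP_compact_support_fin[of f R 1] assms
    borel_measurable_continuous_onI[OF assms(1)] by auto

lemma derivative_eq_0_outside:
  fixes f :: "'a::euclidean_space \<Rightarrow> 'b::real_normed_vector"
  assumes "(f has_derivative f') (at x)" "norm x > R" "\<And>x. norm x > R \<Longrightarrow> f x = 0"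
  shows "f' h = 0"
proof -
  have "((\<lambda>_. 0) has_derivative (\<lambda>_. 0)) (at x)" by simp
  then have "(f has_derivative (\<lambda>_. 0)) (at x)"
  proof (rule has_derivative_transform_within_open)
    show "open {x::'a. norm x > R}" by (intro open_Collect_less continuous_intros)
  qed (use assms in auto)
  then show ?thesis using assms(1) has_derivative_unique by metis
qed

text \<open>The integral of a difference quotient vanishes by translation invariance.\<close>

lemma integral_directional_derivative:
  fixes f :: "'a::euclidean_space \<Rightarrow> real"
  assumes f: "\<And>x. (f has_derivative f' x) (at x)" and c: "continuous_on UNIV (\<lambda>x. f' x v)"
    and R: "\<And>x. norm x > R \<Longrightarrow> f x = 0"
  shows "(\<integral>x. f' x v \<partial>lborel) = 0"
proof -
  have fc: "continuous_on UNIV f"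
    using f by (meson continuous_at_imp_continuous_on has_derivative_continuous)
  have fm[measurable]: "f \<in> borel_measurable borel" using fc by (rule borel_measurable_continuous_onI)
  have cm[measurable]: "(\<lambda>x. f' x v) \<in> borel_measurable borel" using c by (rule borel_measurable_continuous_onI)
  have fi: "integrable lborel f" by (rule integrable_continuous_compact_support[OF fc R])
  have R': "f' x v = 0" if "norm x > R" for x
    by (rule derivative_eq_0_outside[OF f that R])
  obtain C where C: "C \<ge> 0" "\<And>x. \<bar>f' x v\<bar> \<le> C" using compact_support_bounded[OF c R'] by blast
  \<comment> \<open>The coefficient 1 keeps the shift in the affine form of
    \<open>integral_affine\<close>.\<close>
  define q where "q n x = (f (1 *\<^sub>R x + (1 / (real n + 1)) *\<^sub>R v) - f x) / (1 / (real n + 1))" for n x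
  have line: "((\<lambda>t. f (x + t *\<^sub>R v)) has_real_derivative f' (x + t *\<^sub>R v) v) (at t)" for x t
  proof -
    have "((\<lambda>t. f (x + t *\<^sub>R v)) has_derivative (\<lambda>s. f' (x + t *\<^sub>R v) (s *\<^sub>R v))) (at t)"
      by (rule has_derivative_compose[OF _ f]) (auto intro!: derivative_eq_intros)
    moreover have "f' (x + t *\<^sub>R v) (s *\<^sub>R v) = f' (x + t *\<^sub>R v) v * s" for s
      using linear_cmul[OF has_derivative_linear[OF f]] by (simp add: mult.commute)
    ultimately show ?thesis by (simp add: has_field_derivative_def)
  qed
  have bd: "\<bar>q n x\<bar> \<le> C * indicator (cball 0 (R + norm v)) x" for n x
  proof (cases "norm x \<le> R + norm v")
    case True
    define t where "t = 1 / (real n + 1)"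
    have t: "t > 0" by (simp add: t_def)
    obtain z where "f (x + t *\<^sub>R v) - f (x + 0 *\<^sub>R v) = (t - 0) * f' (x + z *\<^sub>R v) v"
      using MVT2[OF t, of "\<lambda>t. f (x + t *\<^sub>R v)" "\<lambda>t. f' (x + t *\<^sub>R v) v"] line by blast
    then have "q n x = f' (x + z *\<^sub>R v) v"
      unfolding q_def t_def[symmetric] using t by simp
    then show ?thesis using C True by simp
  next
    case False
    have "norm ((1 / (real n + 1)) *\<^sub>R v) \<le> 1 * norm v"
      unfolding norm_scaleR by (intro mult_right_mono) (auto simp: field_simps)
    moreover have "norm x \<le> norm (x + (1 / (real n + 1)) *\<^sub>R v) + norm ((1 / (real n + 1)) *\<^sub>R v)"
      using norm_triangle_ineq4[of "x + (1 / (real n + 1)) *\<^sub>R v" "(1 / (real n + 1)) *\<^sub>R v"] by simp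
    ultimately have "norm (x + (1 / (real n + 1)) *\<^sub>R v) > R" using False by linarith
    moreover have "norm x > R" using False norm_ge_zero[of v] by linarith
    ultimately have "q n x = 0" using R by (simp add: q_def)
    then show ?thesis using C by simp
  qed
  have "(\<lambda>n. \<integral>x. q n x \<partial>lborel) \<longlonglongrightarrow> (\<integral>x. f' x v \<partial>lborel)"
  proof (rule integral_dominated_convergence[where w="\<lambda>x. C * indicator (cball 0 (R + norm v)) x"])
    show "integrable lborel (\<lambda>x. C * indicator (cball (0::'a) (R + norm v)) x)"
      using emeasure_lborel_cball_finite[of "0::'a" "R + norm v"]
      by (intro integrable_mult_right integrable_real_indicator) auto
    show "AE x in lborel. norm (q n x) \<le> C * indicator (cball 0 (R + norm v)) x" for n
      using bd by simp
    show "AE x in lborel. (\<lambda>n. q n x) \<longlonglongrightarrow> f' x v"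
    proof (rule AE_I2)
      fix x
      have "((\<lambda>t. (f (x + t *\<^sub>R v) - f x) / t) \<longlongrightarrow> f' x v) (at 0)"
        using line[of x 0] unfolding has_field_derivative_iff by simp
      moreover have "filterlim (\<lambda>n. 1 / (real n + 1)) (at 0) sequentially"
        using LIMSEQ_inverse_real_of_nat by (simp add: filterlim_at inverse_eq_divide add.commute add_nonneg_eq_0_iff)
      ultimately have "(\<lambda>n. (f (x + (1 / (real n + 1)) *\<^sub>R v) - f x) / (1 / (real n + 1))) \<longlonglongrightarrow> f' x v"
        by (rule filterlim_compose)
      then show "(\<lambda>n. q n x) \<longlonglongrightarrow> f' x v" by (simp add: q_def)
    qed
    show "q n \<in> borel_measurable lborel" for n unfolding q_def by measurable
  qed simp
  moreover have "(\<integral>x. q n x \<partial>lborel) = 0" for n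
  proof -
    have "integrable lborel (\<lambda>x. f (1 *\<^sub>R x + (1 / (real n + 1)) *\<^sub>R v))"
      by (rule integrable_affine[OF fi]) simp
    then show ?thesis
      unfolding q_def using fi integral_affine[OF fm, of 1 "(1 / (real n + 1)) *\<^sub>R v"]
      by (subst integral_divide_zero, subst Bochner_Integration.integral_diff) auto
  qed
  ultimately show ?thesis by (simp add: LIMSEQ_const_iff)
qed

lemma integral_divergence:
  fixes P :: "'a::euclidean_space \<Rightarrow> 'a"
  assumes P: "\<And>x. (P has_derivative P' x) (at x)" and c: "\<And>i. i \<in> Basis \<Longrightarrow> continuous_on UNIV (\<lambda>x. P' x i)"
    and R: "\<And>x. norm x > R \<Longrightarrow> P x = 0"
  shows "(\<integral>x. (\<Sum>i\<in>Basis. P' x i \<bullet> i) \<partial>lborel) = 0"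
proof -
  have "(\<integral>x. P' x i \<bullet> i \<partial>lborel) = 0" if "i \<in> Basis" for i
  proof (rule integral_directional_derivative[where f="\<lambda>x. P x \<bullet> i" and f'="\<lambda>x h. P' x h \<bullet> i" and R=R])
    show "((\<lambda>x. P x \<bullet> i) has_derivative (\<lambda>h. P' x h \<bullet> i)) (at x)" for x
      by (rule has_derivative_inner_left[OF P])
    show "continuous_on UNIV (\<lambda>x. P' x i \<bullet> i)" by (intro continuous_intros c that)
  qed (use R in auto)
  moreover have "integrable lborel (\<lambda>x. P' x i \<bullet> i)" if "i \<in> Basis" for i
    using derivative_eq_0_outside[OF P _ R]
    by (intro integrable_continuous_compact_support[where R=R] continuous_intros c that) auto
  ultimately show ?thesis by (subst Bochner_Integration.integral_sum) auto
qed

text \<open>The mean value theorem is applied in direction \<open>a\<close> to the increment of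
  \<open>u\<close> in direction \<open>b\<close>, then in direction \<open>b\<close> to the
  component of the gradient along \<open>a\<close>.\<close>

lemma second_difference_MVT:
  fixes u :: "'a::euclidean_space \<Rightarrow> real"
  assumes u: "\<And>x. GDERIV u x :> G x" and G: "\<And>x. (G has_derivative M x) (at x)" and t: "t > 0"
  obtains \<xi> \<eta> where "0 < \<xi>" "\<xi> < t" "0 < \<eta>" "\<eta> < t"
    "u (x + t *\<^sub>R a + t *\<^sub>R b) - u (x + t *\<^sub>R a) - u (x + t *\<^sub>R b) + u x = t * (t * (a \<bullet> M (x + \<xi> *\<^sub>R a + \<eta> *\<^sub>R b) b))"
proof -
  have d1: "((\<lambda>s. u (y + s *\<^sub>R a)) has_real_derivative a \<bullet> G (y + s *\<^sub>R a)) (at s)" for y s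
  proof -
    have "((\<lambda>s. u (y + s *\<^sub>R a)) has_derivative (\<lambda>h. (h *\<^sub>R a) \<bullet> G (y + s *\<^sub>R a))) (at s)"
      by (rule has_derivative_compose[OF _ u[unfolded gderiv_def]]) (auto intro!: derivative_eq_intros)
    then show ?thesis by (simp add: has_field_derivative_def mult_commute_abs)
  qed
  have d2: "((\<lambda>s. a \<bullet> G (y + s *\<^sub>R b)) has_real_derivative a \<bullet> M (y + s *\<^sub>R b) b) (at s)" for y s
  proof -
    have "((\<lambda>s. a \<bullet> G (y + s *\<^sub>R b)) has_derivative (\<lambda>h. a \<bullet> M (y + s *\<^sub>R b) (h *\<^sub>R b))) (at s)"
      by (intro has_derivative_inner_right has_derivative_compose[OF _ G]) (auto intro!: derivative_eq_intros)
    moreover have "M (y + s *\<^sub>R b) (h *\<^sub>R b) = h *\<^sub>R M (y + s *\<^sub>R b) b" for h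
      using linear_cmul[OF has_derivative_linear[OF G]] by simp
    ultimately show ?thesis by (simp add: has_field_derivative_def mult_commute_abs)
  qed
  have "((\<lambda>s. u ((x + t *\<^sub>R b) + s *\<^sub>R a) - u (x + s *\<^sub>R a)) has_real_derivative
     a \<bullet> G ((x + t *\<^sub>R b) + s *\<^sub>R a) - a \<bullet> G (x + s *\<^sub>R a)) (at s)" for s
    by (intro DERIV_diff d1)
  from MVT2[OF t this] obtain \<xi> where \<xi>: "0 < \<xi>" "\<xi> < t"
    "(u ((x + t *\<^sub>R b) + t *\<^sub>R a) - u (x + t *\<^sub>R a)) - (u ((x + t *\<^sub>R b) + 0 *\<^sub>R a) - u (x + 0 *\<^sub>R a))
     = (t - 0) * (a \<bullet> G ((x + t *\<^sub>R b) + \<xi> *\<^sub>R a) - a \<bullet> G (x + \<xi> *\<^sub>R a))" by blast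
  obtain \<eta> where \<eta>: "0 < \<eta>" "\<eta> < t"
    "a \<bullet> G ((x + \<xi> *\<^sub>R a) + t *\<^sub>R b) - a \<bullet> G ((x + \<xi> *\<^sub>R a) + 0 *\<^sub>R b) = (t - 0) * (a \<bullet> M ((x + \<xi> *\<^sub>R a) + \<eta> *\<^sub>R b) b)"
    using MVT2[OF t d2[of "x + \<xi> *\<^sub>R a"]] by blast
  have c: "x + t *\<^sub>R a + t *\<^sub>R b = x + t *\<^sub>R b + t *\<^sub>R a" "x + \<xi> *\<^sub>R a + t *\<^sub>R b = x + t *\<^sub>R b + \<xi> *\<^sub>R a"
    by (simp_all add: algebra_simps)
  show ?thesis using that[OF \<xi>(1,2) \<eta>(1,2)] \<xi>(3) \<eta>(3) c by simp
qed

text \<open>The second difference does not change when \<open>a\<close> and \<open>b\<close> are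
  exchanged. Divided by t^2 it converges to either mixed derivative, depending on the order in which
  the mean value theorem was used.\<close>

lemma Hessian_symmetric:
  fixes u :: "'a::euclidean_space \<Rightarrow> real"
  assumes u: "\<And>x. GDERIV u x :> G x" and G: "\<And>x. (G has_derivative M x) (at x)"
    and ca: "continuous_on UNIV (\<lambda>x. M x a)" and cb: "continuous_on UNIV (\<lambda>x. M x b)"
  shows "a \<bullet> M x b = b \<bullet> M x a"
proof -
  define t where "t n = 1 / (real n + 1)" for n
  have t: "t n > 0" for n by (simp add: t_def)
  have t0: "t \<longlonglongrightarrow> 0"
    unfolding t_def using LIMSEQ_inverse_real_of_nat by (simp add: inverse_eq_divide add.commute)
  define \<Delta> where "\<Delta> n = (u (x + t n *\<^sub>R a + t n *\<^sub>R b) - u (x + t n *\<^sub>R a) - u (x + t n *\<^sub>R b) + u x) / (t n * t n)" for n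
  have lim: "(\<lambda>n. a' \<bullet> M (x + \<xi> n *\<^sub>R a' + \<eta> n *\<^sub>R b') b') \<longlonglongrightarrow> a' \<bullet> M x b'"
    if "\<And>n. 0 < \<xi> n \<and> \<xi> n < t n \<and> 0 < \<eta> n \<and> \<eta> n < t n" "continuous_on UNIV (\<lambda>x. M x b')" for \<xi> \<eta> a' b'
  proof -
    have "\<xi> \<longlonglongrightarrow> 0" "\<eta> \<longlonglongrightarrow> 0"
      using that(1) by (auto intro!: tendsto_sandwich[OF _ _ tendsto_const t0] always_eventually simp: less_imp_le)
    then have "(\<lambda>n. x + \<xi> n *\<^sub>R a' + \<eta> n *\<^sub>R b') \<longlonglongrightarrow> x + 0 *\<^sub>R a' + 0 *\<^sub>R b'" by (intro tendsto_intros)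
    moreover have "isCont (\<lambda>x. a' \<bullet> M x b') x"
      using that(2) by (intro isCont_inner) (auto simp: continuous_on_eq_continuous_at)
    ultimately show ?thesis by (simp add: isCont_tendsto_compose[where g="\<lambda>x. a' \<bullet> M x b'"])
  qed
  have "\<exists>\<xi> \<eta>. 0 < \<xi> \<and> \<xi> < t n \<and> 0 < \<eta> \<and> \<eta> < t n \<and> \<Delta> n = a \<bullet> M (x + \<xi> *\<^sub>R a + \<eta> *\<^sub>R b) b" for n
    by (rule second_difference_MVT[OF u G t[of n], of x a b]) (use t[of n] in \<open>auto simp: \<Delta>_def\<close>)
  then obtain \<xi> \<eta> where 1: "\<And>n. 0 < \<xi> n \<and> \<xi> n < t n \<and> 0 < \<eta> n \<and> \<eta> n < t n"
    "\<And>n. \<Delta> n = a \<bullet> M (x + \<xi> n *\<^sub>R a + \<eta> n *\<^sub>R b) b" by metis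
  have "\<exists>\<xi> \<eta>. 0 < \<xi> \<and> \<xi> < t n \<and> 0 < \<eta> \<and> \<eta> < t n \<and> \<Delta> n = b \<bullet> M (x + \<xi> *\<^sub>R b + \<eta> *\<^sub>R a) a" for n
    by (rule second_difference_MVT[OF u G t[of n], of x b a])
      (use t[of n] in \<open>auto simp: \<Delta>_def add.commute add.left_commute diff_diff_eq\<close>)
  then obtain \<xi>' \<eta>' where 2: "\<And>n. 0 < \<xi>' n \<and> \<xi>' n < t n \<and> 0 < \<eta>' n \<and> \<eta>' n < t n"
    "\<And>n. \<Delta> n = b \<bullet> M (x + \<xi>' n *\<^sub>R b + \<eta>' n *\<^sub>R a) a" by metis
  have "\<Delta> \<longlonglongrightarrow> a \<bullet> M x b" using lim[OF 1(1) cb, of a] unfolding 1(2)[symmetric] .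
  moreover have "\<Delta> \<longlonglongrightarrow> b \<bullet> M x a" using lim[OF 2(1) ca, of b] unfolding 2(2)[symmetric] .
  ultimately show ?thesis by (rule LIMSEQ_unique)
qed

text \<open>Converts the traces that arise from a divergence into values of the Hessian as a
  bilinear form.\<close>

lemma trace_inner_Basis:
  fixes M :: "'a::euclidean_space \<Rightarrow> 'a"
  assumes "linear M"
  shows "(\<Sum>i\<in>Basis. (x \<bullet> M i) * (y \<bullet> i)) = x \<bullet> M y"
proof -
  have "M y = M (\<Sum>i\<in>Basis. (y \<bullet> i) *\<^sub>R i)" by (simp add: euclidean_representation)
  also have "\<dots> = (\<Sum>i\<in>Basis. (y \<bullet> i) *\<^sub>R M i)" using assms by (simp add: linear_sum linear_cmul)
  finally show ?thesis by (simp add: inner_sum_right mult.commute)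
qed

section \<open>Hardy--Rellich and Rellich inequalities for classical functions\<close>

text \<open>\<open>G\<close> is the gradient and \<open>M x\<close> the Hessian as a linear map.
  Mollified Sobolev functions are instances, so the inequalities can first be proved by classical
  calculus.\<close>

locale C2_compact =
  fixes u :: "'a::euclidean_space \<Rightarrow> real" and G M R
  assumes u: "\<And>x. GDERIV u x :> G x" and G: "\<And>x. (G has_derivative M x) (at x)"
    and Mc: "\<And>i. i \<in> Basis \<Longrightarrow> continuous_on UNIV (\<lambda>x. M x i)"
    and supp: "\<And>x. norm x > R \<Longrightarrow> u x = 0"
begin

definition L where "L x = (\<Sum>i\<in>Basis. M x i \<bullet> i)"

lemma uc: "continuous_on UNIV u"
  using u unfolding gderiv_def by (meson continuous_at_imp_continuous_on has_derivative_continuous)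

lemma Gc: "continuous_on UNIV G"
  using G by (meson continuous_at_imp_continuous_on has_derivative_continuous)

lemma Lc: "continuous_on UNIV L"
  unfolding L_def[abs_def] by (intro continuous_intros Mc)

lemma suppG: "norm x > R \<Longrightarrow> G x = 0"
  using derivative_eq_0_outside[OF u[unfolded gderiv_def] _ supp, where x=x and h="G x"] by simp

lemma suppM: "norm x > R \<Longrightarrow> M x h = 0"
  by (rule derivative_eq_0_outside[OF G _ suppG])

lemma suppL: "norm x > R \<Longrightarrow> L x = 0"
  by (simp add: L_def suppM)

lemma linM: "linear (M x)"
  by (rule has_derivative_linear[OF G])

text \<open>Continuity of \<open>M\<close> is available in basis directions, where mixed derivatives
  commute; bilinearity carries the symmetry to all vectors.\<close>

lemma M_sym: "x \<bullet> M z y = y \<bullet> M z x"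
proof -
  have b: "i \<bullet> M z j = j \<bullet> M z i" if "i \<in> Basis" "j \<in> Basis" for i j
    by (rule Hessian_symmetric[OF u G Mc[OF that(1)] Mc[OF that(2)]])
  have e: "x \<bullet> M z y = (\<Sum>i\<in>Basis. \<Sum>j\<in>Basis. (x \<bullet> j) * (y \<bullet> i) * (j \<bullet> M z i))" for x y
  proof -
    have "x \<bullet> M z y = (\<Sum>i\<in>Basis. (x \<bullet> M z i) * (y \<bullet> i))"
      by (rule trace_inner_Basis[OF linM, symmetric])
    also have "\<dots> = (\<Sum>i\<in>Basis. (\<Sum>j\<in>Basis. (x \<bullet> j) * (M z i \<bullet> j)) * (y \<bullet> i))"
      by (intro sum.cong refl arg_cong2[where f=times] euclidean_inner)
    also have "\<dots> = (\<Sum>i\<in>Basis. \<Sum>j\<in>Basis. (x \<bullet> j) * (y \<bullet> i) * (j \<bullet> M z i))"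
      unfolding sum_distrib_right by (intro sum.cong refl) (simp add: inner_commute mult_ac)
    finally show ?thesis .
  qed
  have "x \<bullet> M z y = (\<Sum>i\<in>Basis. \<Sum>j\<in>Basis. (x \<bullet> j) * (y \<bullet> i) * (j \<bullet> M z i))" by (rule e)
  also have "\<dots> = (\<Sum>j\<in>Basis. \<Sum>i\<in>Basis. (x \<bullet> j) * (y \<bullet> i) * (j \<bullet> M z i))" by (rule sum.swap)
  also have "\<dots> = (\<Sum>i\<in>Basis. \<Sum>j\<in>Basis. (y \<bullet> j) * (x \<bullet> i) * (j \<bullet> M z i))"
  proof (intro sum.cong refl)
    fix i j :: 'a assume "i \<in> Basis" "j \<in> Basis"
    from b[OF this] show "(x \<bullet> i) * (y \<bullet> j) * (i \<bullet> M z j) = (y \<bullet> j) * (x \<bullet> i) * (j \<bullet> M z i)" by simp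
  qed
  also have "\<dots> = y \<bullet> M z x" by (rule e[symmetric])
  finally show ?thesis .
qed

lemma LI: "integrable lborel (\<lambda>x. (L x)\<^sup>2)"
  using suppL by (intro integrable_continuous_compact_support[where R=R] continuous_intros Lc) auto

text \<open>Each inequality integrates the divergence of a radial-type vector field. Replacing
  1/|x|^2 by \<phi> = 1/(|x|^2 + \<epsilon>) makes the field regular at the origin, and \<phi> |x|^2
  \<le> 1 has the right sign in both computations, so the constants do not depend on
  \<epsilon>.\<close>

lemma Hardy_Rellich_eps:
  assumes d: "DIM('a) \<ge> 5" and eps: "\<epsilon> > 0"
  shows "(\<integral>x. (inverse (x \<bullet> x + \<epsilon>) * (x \<bullet> G x))\<^sup>2 \<partial>lborel) \<le> 4 / (DIM('a))\<^sup>2 * (\<integral>x. (L x)\<^sup>2 \<partial>lborel)"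
    and "(\<integral>x. (inverse (x \<bullet> x + \<epsilon>) * u x)\<^sup>2 \<partial>lborel)
       \<le> 4 / (DIM('a) - 4)\<^sup>2 * (\<integral>x. (inverse (x \<bullet> x + \<epsilon>) * (x \<bullet> G x))\<^sup>2 \<partial>lborel)"
proof -
  define d where "d = real DIM('a)"
  have d5: "d \<ge> 5" using d by (simp add: d_def)
  define \<phi> where "\<phi> x = inverse (x \<bullet> x + \<epsilon>)" for x :: 'a
  have nz: "x \<bullet> x + \<epsilon> > 0" for x :: 'a using eps by (simp add: add_nonneg_pos)
  then have nz': "x \<bullet> x + \<epsilon> \<noteq> 0" for x :: 'a by (metis less_irrefl)
  have \<phi>0: "\<phi> x > 0" for x using nz by (simp add: \<phi>_def)
  have \<phi>1: "\<phi> x * (x \<bullet> x) \<le> 1" for x using nz[of x] eps by (simp add: \<phi>_def field_simps)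
  have \<phi>c: "continuous_on UNIV \<phi>" unfolding \<phi>_def[abs_def] using nz' by (intro continuous_intros) auto
  have \<phi>': "(\<phi> has_derivative (\<lambda>h. - (2 * (x \<bullet> h)) * (\<phi> x)\<^sup>2)) (at x)" for x
    unfolding \<phi>_def[abs_def] using nz'[of x]
    by (auto intro!: derivative_eq_intros simp: inner_commute power2_eq_square fun_eq_iff)
  define \<rho> where "\<rho> x = x \<bullet> G x" for x
  have \<rho>c: "continuous_on UNIV \<rho>" unfolding \<rho>_def[abs_def] by (intro continuous_intros Gc)
  have \<rho>0: "norm x > R \<Longrightarrow> \<rho> x = 0" for x by (simp add: \<rho>_def suppG)
  have \<rho>': "(\<rho> has_derivative (\<lambda>h. h \<bullet> G x + x \<bullet> M x h)) (at x)" for x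
    unfolding \<rho>_def[abs_def] by (auto intro!: derivative_eq_intros G simp: fun_eq_iff)
  \<comment> \<open>A field of Pohozaev type: in its divergence the two Hessian terms cancel by
    symmetry, leaving \<phi> \<rho> \<Delta>u and terms of first order.\<close>
  define P where "P x = (\<phi> x * \<rho> x) *\<^sub>R G x - (\<phi> x / 2 * (G x \<bullet> G x)) *\<^sub>R x" for x
  define P' where "P' x h = (\<phi> x * \<rho> x) *\<^sub>R M x h + ((- (2 * (x \<bullet> h)) * (\<phi> x)\<^sup>2) * \<rho> x + \<phi> x * (h \<bullet> G x + x \<bullet> M x h)) *\<^sub>R G x
     - ((\<phi> x / 2 * (G x \<bullet> G x)) *\<^sub>R h + ((- (x \<bullet> h) * (\<phi> x)\<^sup>2) * (G x \<bullet> G x) + \<phi> x * (G x \<bullet> M x h)) *\<^sub>R x)" for x h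
  have "(P has_derivative P' x) (at x)" for x
    unfolding P_def[abs_def] P'_def[abs_def]
    by (auto intro!: derivative_eq_intros \<phi>' \<rho>' G simp: fun_eq_iff inner_commute algebra_simps)
      (simp add: scaleR_left_distrib[symmetric] field_simps)
  moreover have "continuous_on UNIV (\<lambda>x. P' x i)" if "i \<in> Basis" for i
    unfolding P'_def by (intro continuous_intros \<phi>c \<rho>c Gc Mc that) auto
  ultimately have I0: "(\<integral>x. (\<Sum>i\<in>Basis. P' x i \<bullet> i) \<partial>lborel) = 0"
    by (rule integral_divergence[where R=R]) (auto simp: P_def suppG)
  have tr: "(\<Sum>i\<in>Basis. P' x i \<bullet> i) = \<phi> x * \<rho> x * L x - 2 * (\<phi> x * \<rho> x)\<^sup>2 + (1 - d / 2) * (\<phi> x * (G x \<bullet> G x))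
      + (\<phi> x)\<^sup>2 * (x \<bullet> x) * (G x \<bullet> G x)" for x
  proof -
    have "(\<Sum>i\<in>Basis. P' x i \<bullet> i) = \<phi> x * \<rho> x * (\<Sum>i\<in>Basis. M x i \<bullet> i)
       - 2 * (\<phi> x)\<^sup>2 * \<rho> x * (\<Sum>i\<in>Basis. (x \<bullet> i) * (G x \<bullet> i)) + \<phi> x * (\<Sum>i\<in>Basis. (G x \<bullet> i) * (G x \<bullet> i))
       + \<phi> x * (\<Sum>i\<in>Basis. (x \<bullet> M x i) * (G x \<bullet> i)) - \<phi> x / 2 * (G x \<bullet> G x) * (\<Sum>i\<in>(Basis::'a set). i \<bullet> i)
       + (\<phi> x)\<^sup>2 * (G x \<bullet> G x) * (\<Sum>i\<in>Basis. (x \<bullet> i) * (x \<bullet> i)) - \<phi> x * (\<Sum>i\<in>Basis. (G x \<bullet> M x i) * (x \<bullet> i))"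
      unfolding P'_def sum_distrib_left sum.distrib[symmetric] sum_subtractf[symmetric]
      by (intro sum.cong refl) (simp add: algebra_simps inner_commute)
    also have "(\<Sum>i\<in>(Basis::'a set). i \<bullet> i) = d" by (simp add: d_def)
    also have "(\<Sum>i\<in>Basis. (x \<bullet> M x i) * (G x \<bullet> i)) = (\<Sum>i\<in>Basis. (G x \<bullet> M x i) * (x \<bullet> i))"
      unfolding trace_inner_Basis[OF linM] by (rule M_sym)
    finally show ?thesis
      by (simp add: euclidean_inner[symmetric] L_def[symmetric] \<rho>_def power2_eq_square algebra_simps)
  qed
  \<comment> \<open>By Cauchy--Schwarz (\<phi> \<rho>)^2 \<le> \<phi> |G|^2, and |G|^2 enters with a
    coefficient at most 2 - d/2, which is negative. Together with -2 this gives -(d/2) (\<phi>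
    \<rho>)^2; Young's inequality for \<phi> \<rho> \<Delta>u uses up half of it.\<close>
  have pw: "(d / 4) * (\<phi> x * \<rho> x)\<^sup>2 \<le> 1 / d * (L x)\<^sup>2 - (\<Sum>i\<in>Basis. P' x i \<bullet> i)" for x
  proof -
    define g where "g = \<phi> x * (G x \<bullet> G x)"
    have g0: "g \<ge> 0" using \<phi>0[of x] by (simp add: g_def less_imp_le)
    have 1: "(\<phi> x)\<^sup>2 * (x \<bullet> x) * (G x \<bullet> G x) \<le> g"
    proof -
      have "(\<phi> x)\<^sup>2 * (x \<bullet> x) * (G x \<bullet> G x) = (\<phi> x * (x \<bullet> x)) * g" by (simp add: g_def power2_eq_square)
      also have "\<dots> \<le> 1 * g" using \<phi>1[of x] g0 by (intro mult_right_mono) auto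
      finally show ?thesis by simp
    qed
    have 2: "(\<phi> x * \<rho> x)\<^sup>2 \<le> g"
    proof -
      have "(\<rho> x)\<^sup>2 \<le> (x \<bullet> x) * (G x \<bullet> G x)" unfolding \<rho>_def by (rule Cauchy_Schwarz_ineq)
      then have "(\<phi> x)\<^sup>2 * (\<rho> x)\<^sup>2 \<le> (\<phi> x)\<^sup>2 * ((x \<bullet> x) * (G x \<bullet> G x))" by (intro mult_left_mono) auto
      with 1 show ?thesis by (simp add: power_mult_distrib mult.assoc)
    qed
    have 3: "\<phi> x * \<rho> x * L x \<le> d / 4 * (\<phi> x * \<rho> x)\<^sup>2 + 1 / d * (L x)\<^sup>2"
    proof -
      have "0 \<le> 1 / d * (d / 2 * (\<phi> x * \<rho> x) - L x)\<^sup>2" using d5 by simp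
      also have "\<dots> = d / 4 * (\<phi> x * \<rho> x)\<^sup>2 + 1 / d * (L x)\<^sup>2 - \<phi> x * \<rho> x * L x"
        using d5 by (simp add: power2_eq_square field_simps)
      finally show ?thesis by simp
    qed
    have "(d / 2 - 2) * (\<phi> x * \<rho> x)\<^sup>2 \<le> (d / 2 - 2) * g" using 2 d5 by (intro mult_left_mono) auto
    then show ?thesis
      unfolding tr g_def[symmetric] using 1 3 by (simp add: algebra_simps)
  qed
  have int\<rho>: "integrable lborel (\<lambda>x. (\<phi> x * \<rho> x)\<^sup>2)"
    using \<rho>0 by (intro integrable_continuous_compact_support[where R=R] continuous_intros \<phi>c \<rho>c) auto
  have intP: "integrable lborel (\<lambda>x. \<Sum>i\<in>Basis. P' x i \<bullet> i)"
    unfolding tr using \<rho>0 suppG by (intro integrable_continuous_compact_support[where R=R] continuous_intros \<phi>c \<rho>c Lc Gc) auto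
  have "(d / 4) * (\<integral>x. (\<phi> x * \<rho> x)\<^sup>2 \<partial>lborel) \<le> (\<integral>x. 1 / d * (L x)\<^sup>2 - (\<Sum>i\<in>Basis. P' x i \<bullet> i) \<partial>lborel)"
    unfolding integral_mult_right_zero[symmetric]
    by (intro integral_mono integrable_mult_right int\<rho> Bochner_Integration.integrable_diff LI intP pw)
  also have "\<dots> = 1 / d * (\<integral>x. (L x)\<^sup>2 \<partial>lborel)"
    using intP LI I0 by simp
  finally have "(\<integral>x. (\<phi> x * \<rho> x)\<^sup>2 \<partial>lborel) \<le> 4 / d\<^sup>2 * (\<integral>x. (L x)\<^sup>2 \<partial>lborel)"
    using d5 by (simp add: field_simps power2_eq_square)
  then show "(\<integral>x. (inverse (x \<bullet> x + \<epsilon>) * (x \<bullet> G x))\<^sup>2 \<partial>lborel) \<le> 4 / (DIM('a))\<^sup>2 * (\<integral>x. (L x)\<^sup>2 \<partial>lborel)"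
    by (simp add: \<phi>_def \<rho>_def d_def)
  \<comment> \<open>Its divergence compares u with x \<bullet> \<nabla>u: the dimension gives d, the
    derivative of \<phi>^2 takes away at most 4.\<close>
  define Q where "Q x = ((\<phi> x * u x)\<^sup>2) *\<^sub>R x" for x
  define Q' where "Q' x h = ((\<phi> x * u x)\<^sup>2) *\<^sub>R h + (2 * (\<phi> x * u x) * (\<phi> x * (h \<bullet> G x) + (- (2 * (x \<bullet> h)) * (\<phi> x)\<^sup>2) * u x)) *\<^sub>R x" for x h
  have "(Q has_derivative Q' x) (at x)" for x
    unfolding Q_def[abs_def] Q'_def[abs_def]
    by (auto intro!: derivative_eq_intros \<phi>' u[unfolded gderiv_def] simp: fun_eq_iff algebra_simps power2_eq_square)
  moreover have "continuous_on UNIV (\<lambda>x. Q' x i)" if "i \<in> Basis" for i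
    unfolding Q'_def by (intro continuous_intros \<phi>c uc Gc)
  ultimately have J0: "(\<integral>x. (\<Sum>i\<in>Basis. Q' x i \<bullet> i) \<partial>lborel) = 0"
    by (rule integral_divergence[where R=R]) (auto simp: Q_def supp)
  have tr2: "(\<Sum>i\<in>Basis. Q' x i \<bullet> i) = d * (\<phi> x * u x)\<^sup>2 + 2 * (\<phi> x * u x) * (\<phi> x * \<rho> x) - 4 * (\<phi> x * (x \<bullet> x)) * (\<phi> x * u x)\<^sup>2" for x
  proof -
    have "(\<Sum>i\<in>Basis. Q' x i \<bullet> i) = (\<phi> x * u x)\<^sup>2 * (\<Sum>i\<in>(Basis::'a set). i \<bullet> i)
       + 2 * (\<phi> x * u x) * \<phi> x * (\<Sum>i\<in>Basis. (x \<bullet> i) * (G x \<bullet> i)) - 4 * (\<phi> x * u x) * (\<phi> x)\<^sup>2 * u x * (\<Sum>i\<in>Basis. (x \<bullet> i) * (x \<bullet> i))"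
      unfolding Q'_def sum_distrib_left sum.distrib[symmetric] sum_subtractf[symmetric]
      by (intro sum.cong refl) (simp add: algebra_simps inner_commute)
    also have "(\<Sum>i\<in>(Basis::'a set). i \<bullet> i) = d" by (simp add: d_def)
    finally show ?thesis
      by (simp add: euclidean_inner[symmetric] \<rho>_def power2_eq_square algebra_simps)
  qed
  \<comment> \<open>Young's inequality spends half of the coefficient d - 4 on the cross term 2
    (\<phi> u) (\<phi> \<rho>).\<close>
  have pw2: "(d - 4) / 2 * (\<phi> x * u x)\<^sup>2 \<le> 2 / (d - 4) * (\<phi> x * \<rho> x)\<^sup>2 + (\<Sum>i\<in>Basis. Q' x i \<bullet> i)" for x
  proof -
    have "\<phi> x * (x \<bullet> x) * (\<phi> x * u x)\<^sup>2 \<le> 1 * (\<phi> x * u x)\<^sup>2" using \<phi>1[of x] by (intro mult_right_mono) auto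
    moreover have "- 2 * (\<phi> x * u x) * (\<phi> x * \<rho> x) \<le> (d - 4) / 2 * (\<phi> x * u x)\<^sup>2 + 2 / (d - 4) * (\<phi> x * \<rho> x)\<^sup>2"
    proof -
      have "0 \<le> 2 / (d - 4) * ((d - 4) / 2 * (\<phi> x * u x) + \<phi> x * \<rho> x)\<^sup>2" using d5 by simp
      also have "\<dots> = (d - 4) / 2 * (\<phi> x * u x)\<^sup>2 + 2 / (d - 4) * (\<phi> x * \<rho> x)\<^sup>2 + 2 * (\<phi> x * u x) * (\<phi> x * \<rho> x)"
      proof -
        have "2 / (d - 4) * ((d - 4) / 2 * a + b)\<^sup>2 = (d - 4) / 2 * a\<^sup>2 + 2 / (d - 4) * b\<^sup>2 + 2 * a * b" for a b
        proof -
          define k where "k = d - 4"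
          have "k > 0" using d5 by (simp add: k_def)
          then show ?thesis unfolding k_def[symmetric] by (simp add: power2_eq_square field_simps)
        qed
        then show ?thesis .
      qed
      finally show ?thesis by simp
    qed
    ultimately show ?thesis unfolding tr2 by (simp add: field_simps)
  qed
  have intu: "integrable lborel (\<lambda>x. (\<phi> x * u x)\<^sup>2)"
    using supp by (intro integrable_continuous_compact_support[where R=R] continuous_intros \<phi>c uc) auto
  have intQ: "integrable lborel (\<lambda>x. \<Sum>i\<in>Basis. Q' x i \<bullet> i)"
    unfolding tr2 using supp by (intro integrable_continuous_compact_support[where R=R] continuous_intros \<phi>c \<rho>c uc) auto
  have "(d - 4) / 2 * (\<integral>x. (\<phi> x * u x)\<^sup>2 \<partial>lborel) \<le> (\<integral>x. 2 / (d - 4) * (\<phi> x * \<rho> x)\<^sup>2 + (\<Sum>i\<in>Basis. Q' x i \<bullet> i) \<partial>lborel)"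
    unfolding integral_mult_right_zero[symmetric]
    by (intro integral_mono integrable_mult_right int\<rho> Bochner_Integration.integrable_add intu intQ pw2)
  also have "\<dots> = 2 / (d - 4) * (\<integral>x. (\<phi> x * \<rho> x)\<^sup>2 \<partial>lborel)"
    using intQ int\<rho> J0 by simp
  finally have *: "(d - 4) / 2 * (\<integral>x. (\<phi> x * u x)\<^sup>2 \<partial>lborel) \<le> 2 / (d - 4) * (\<integral>x. (\<phi> x * \<rho> x)\<^sup>2 \<partial>lborel)" .
  have "(\<integral>x. (\<phi> x * u x)\<^sup>2 \<partial>lborel) \<le> 4 / (d - 4)\<^sup>2 * (\<integral>x. (\<phi> x * \<rho> x)\<^sup>2 \<partial>lborel)"
  proof -
    define k where "k = d - 4"
    have "k > 0" using d5 by (simp add: k_def)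
    then show ?thesis using * unfolding k_def[symmetric] by (simp add: power2_eq_square field_simps)
  qed
  then show "(\<integral>x. (inverse (x \<bullet> x + \<epsilon>) * u x)\<^sup>2 \<partial>lborel)
       \<le> 4 / (DIM('a) - 4)\<^sup>2 * (\<integral>x. (inverse (x \<bullet> x + \<epsilon>) * (x \<bullet> G x))\<^sup>2 \<partial>lborel)"
    using d by (simp add: \<phi>_def \<rho>_def d_def of_nat_diff)
qed

end

section \<open>The Sobolev inequality\<close>

text \<open>Meant for \<open>p > 0\<close>: infinity is a fixed point whatever the exponent.\<close>

definition epow :: "ennreal \<Rightarrow> real \<Rightarrow> ennreal" where
  "epow x p = (if x = top then top else ennreal (enn2real x powr p))"

lemma epow_ennreal: "r \<ge> 0 \<Longrightarrow> epow (ennreal r) p = ennreal (r powr p)"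
  by (simp add: epow_def)

lemma epow_measurable[measurable]: "(\<lambda>x. epow x p) \<in> borel_measurable borel"
  unfolding epow_def by measurable

lemma epow_mono: "p \<ge> 0 \<Longrightarrow> x \<le> y \<Longrightarrow> epow x p \<le> epow y p"
  by (auto simp: epow_def top_unique less_top intro!: ennreal_leI powr_mono2 enn2real_mono)

lemma epow_eq_0_iff: "epow x p = 0 \<longleftrightarrow> x = 0"
  by (cases x) (auto simp: epow_def)

lemma prod_mono_ennreal:
  fixes f g :: "'a \<Rightarrow> ennreal"
  assumes "\<And>i. i \<in> I \<Longrightarrow> f i \<le> g i"
  shows "prod f I \<le> prod g I"
  using assms by (induction I rule: infinite_finite_induct) (auto intro!: mult_mono)

text \<open>Hoelder's inequality with all exponents equal. After normalising each integral to 1 the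
  integrand is bounded by an arithmetic mean, and the integral of that mean is 1.\<close>

lemma nn_integral_prod_Holder:
  assumes I: "finite I" "I \<noteq> {}" and h[measurable]: "\<And>i. i \<in> I \<Longrightarrow> h i \<in> borel_measurable M"
  shows "(\<integral>\<^sup>+x. (\<Prod>i\<in>I. epow (h i x) (1 / card I)) \<partial>M) \<le> (\<Prod>i\<in>I. epow (\<integral>\<^sup>+x. h i x \<partial>M) (1 / card I))"
proof -
  define p where "p = 1 / real (card I)"
  have p: "p > 0" using I by (simp add: p_def card_gt_0_iff)
  \<comment> \<open>Normalisation needs integrals in the open interval from 0 to infinity. The zero
    case comes first because 0 times infinity is 0; once no factor vanishes, one infinite factor
    makes the right-hand side infinite.\<close>
  consider (zero) i where "i \<in> I" "(\<integral>\<^sup>+x. h i x \<partial>M) = 0"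
    | (top) i where "i \<in> I" "(\<integral>\<^sup>+x. h i x \<partial>M) = top" "\<And>i. i \<in> I \<Longrightarrow> (\<integral>\<^sup>+x. h i x \<partial>M) \<noteq> 0"
    | (fin) "\<And>i. i \<in> I \<Longrightarrow> (\<integral>\<^sup>+x. h i x \<partial>M) \<noteq> top" "\<And>i. i \<in> I \<Longrightarrow> (\<integral>\<^sup>+x. h i x \<partial>M) \<noteq> 0"
    by blast
  then have "(\<integral>\<^sup>+x. (\<Prod>i\<in>I. epow (h i x) p) \<partial>M) \<le> (\<Prod>i\<in>I. epow (\<integral>\<^sup>+x. h i x \<partial>M) p)"
  proof cases
    case zero
    then have "AE x in M. h i x = 0" using h by (subst (asm) nn_integral_0_iff_AE) auto
    then have "AE x in M. (\<Prod>i\<in>I. epow (h i x) p) = 0"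
    proof eventually_elim
      case (elim x)
      then have "epow (h i x) p = 0" by (simp add: epow_eq_0_iff)
      then show ?case using I(1) zero(1) by (intro prod_zero) auto
    qed
    then have "(\<integral>\<^sup>+x. (\<Prod>i\<in>I. epow (h i x) p) \<partial>M) = (\<integral>\<^sup>+x. 0 \<partial>M)" by (rule nn_integral_cong_AE)
    then show ?thesis by simp
  next
    case top
    have "(\<Prod>k\<in>I. epow (\<integral>\<^sup>+x. h k x \<partial>M) p) = epow (\<integral>\<^sup>+x. h i x \<partial>M) p * (\<Prod>k\<in>I - {i}. epow (\<integral>\<^sup>+x. h k x \<partial>M) p)"
      using I(1) top(1) by (rule prod.remove)
    moreover have "(\<Prod>k\<in>I - {i}. epow (\<integral>\<^sup>+x. h k x \<partial>M) p) \<noteq> 0"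
      using I(1) top(3) by (simp add: prod_zero_iff epow_eq_0_iff)
    ultimately have "(\<Prod>k\<in>I. epow (\<integral>\<^sup>+x. h k x \<partial>M) p) = top"
      using top(2) by (simp add: epow_def ennreal_top_mult)
    then show ?thesis by simp
  next
    case fin
    define A where "A i = enn2real (\<integral>\<^sup>+x. h i x \<partial>M)" for i
    have A: "(\<integral>\<^sup>+x. h i x \<partial>M) = ennreal (A i)" "A i > 0" if "i \<in> I" for i
      using fin(1,2)[OF that] by (auto simp: A_def ennreal_enn2real_if enn2real_positive_iff less_top[symmetric] zero_less_iff_neq_zero)
    define C where "C = (\<Prod>i\<in>I. A i powr p)"
    have C0: "C \<ge> 0" unfolding C_def by (intro prod_nonneg) auto
    have "AE x in M. \<forall>i\<in>I. h i x \<noteq> top"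
      using fin(1) I(1) nn_integral_noteq_infinite[OF h] by (intro AE_finite_allI) (auto simp: infinity_ennreal_def)
    then have "(\<integral>\<^sup>+x. (\<Prod>i\<in>I. epow (h i x) p) \<partial>M) \<le> (\<integral>\<^sup>+x. (\<Sum>i\<in>I. ennreal (C * p / A i) * h i x) \<partial>M)"
    proof (intro nn_integral_mono_AE, eventually_elim)
      case (elim x)
      define y where "y i = enn2real (h i x)" for i
      have y: "h i x = ennreal (y i)" "y i \<ge> 0" if "i \<in> I" for i
        using elim that by (auto simp: y_def ennreal_enn2real_if)
      have "(\<Prod>i\<in>I. epow (h i x) p) = (\<Prod>i\<in>I. ennreal (y i powr p))"
        using y by (intro prod.cong) (auto simp: epow_ennreal)
      also have "\<dots> = ennreal (\<Prod>i\<in>I. y i powr p)" by (rule prod_ennreal) auto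
      also have "(\<Prod>i\<in>I. y i powr p) = (\<Prod>i\<in>I. A i powr p * (y i / A i) powr p)"
      proof (intro prod.cong refl)
        fix i assume "i \<in> I"
        then show "y i powr p = A i powr p * (y i / A i) powr p"
          using A(2)[of i] y(2)[of i] by (subst powr_mult[symmetric]) auto
      qed
      also have "\<dots> = C * (\<Prod>i\<in>I. y i / A i) powr p"
        unfolding prod.distrib C_def using A y by (subst prod_powr_distrib) (auto simp: less_imp_le)
      also have "\<dots> \<le> C * (\<Sum>i\<in>I. (y i / A i) / card I)"
        unfolding p_def using A y C0 I by (intro mult_left_mono arith_geom_mean) (auto simp: less_imp_le)
      also have "\<dots> = (\<Sum>i\<in>I. C * p / A i * y i)"
        by (simp add: sum_distrib_left p_def field_simps)
      also have "ennreal \<dots> = (\<Sum>i\<in>I. ennreal (C * p / A i * y i))"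
        using A y C0 p by (intro sum_ennreal[symmetric]) (auto simp: less_imp_le)
      also have "\<dots> = (\<Sum>i\<in>I. ennreal (C * p / A i) * h i x)"
      proof (intro sum.cong refl)
        fix i assume "i \<in> I"
        then show "ennreal (C * p / A i * y i) = ennreal (C * p / A i) * h i x"
          using A(2)[of i] y[of i] C0 p ennreal_mult[of "C * p / A i" "y i"] by (auto simp: less_imp_le)
      qed
      finally show ?case by (simp add: ennreal_leI)
    qed
    also have "\<dots> = (\<Sum>i\<in>I. ennreal (C * p / A i) * ennreal (A i))"
      by (subst nn_integral_sum) (auto simp: nn_integral_cmult A intro!: sum.cong)
    also have "\<dots> = (\<Sum>i\<in>I. ennreal (C * p))"
    proof (intro sum.cong refl)
      fix i assume "i \<in> I"
      then show "ennreal (C * p / A i) * ennreal (A i) = ennreal (C * p)"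
        using A(2)[of i] C0 p by (subst ennreal_mult[symmetric]) (auto simp: less_imp_le)
    qed
    also have "\<dots> = ennreal (\<Sum>i\<in>I. C * p)" using C0 p by (intro sum_ennreal) auto
    also have "(\<Sum>i\<in>I. C * p) = C" using I by (simp add: p_def)
    also have "ennreal C = (\<Prod>i\<in>I. epow (\<integral>\<^sup>+x. h i x \<partial>M) p)"
      unfolding C_def using A by (subst prod_ennreal[symmetric]) (auto simp: epow_ennreal less_imp_le intro!: prod.cong)
    finally show ?thesis .
  qed
  then show ?thesis by (simp add: p_def)
qed

text \<open>The choice of \<open>t\<close> makes both terms of Young's inequality equal to A^(1/p)
  B^(1/q), whence the factor 2.\<close>

lemma Holder_powr:
  assumes [measurable]: "a \<in> borel_measurable borel" "b \<in> borel_measurable borel"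
    and pq: "p > 1" "q > 1" "1 / p + 1 / q = 1" and A: "A > 0" "NP p a \<le> ennreal A" and B: "B > 0" "NP q b \<le> ennreal B"
  shows "(\<integral>\<^sup>+x. ennreal \<bar>a x * b x\<bar> \<partial>lborel) \<le> ennreal (2 * A powr (1 / p) * B powr (1 / q))"
proof -
  define t where "t = (B / A) powr (1 / (p * q))"
  have t: "t > 0" using A B by (simp add: t_def)
  have pq': "1 / p = 1 - 1 / q" "1 / q = 1 - 1 / p" using pq by auto
  have "t powr p = (B / A) powr (1 / q)" using pq by (simp add: t_def powr_powr)
  also have "\<dots> = B powr (1 / q) / A powr (1 / q)" using A B by (simp add: powr_divide)
  also have "\<dots> * A = B powr (1 / q) * A powr (1 / p)"
    unfolding pq'(1) powr_diff using A by simp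
  finally have 1: "t powr p * A = A powr (1 / p) * B powr (1 / q)" by simp
  have "t powr (- q) = (B / A) powr (- (1 / p))" using pq by (simp add: t_def powr_powr)
  also have "\<dots> = A powr (1 / p) / B powr (1 / p)" using A B by (simp add: powr_minus_divide powr_divide)
  also have "\<dots> * B = A powr (1 / p) * B powr (1 / q)"
    unfolding pq'(2) powr_diff using B by simp
  finally have 2: "t powr (- q) * B = A powr (1 / p) * B powr (1 / q)" by simp
  have "(\<integral>\<^sup>+x. ennreal \<bar>a x * b x\<bar> \<partial>lborel) \<le> ennreal (t powr p) * NP p a + ennreal (t powr (- q)) * NP q b"
    by (intro nn_integral_Young pq t) auto
  also have "\<dots> \<le> ennreal (t powr p) * ennreal A + ennreal (t powr (- q)) * ennreal B"
    using A B by (intro add_mono mult_left_mono) auto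
  also have "\<dots> = ennreal (t powr p * A + t powr (- q) * B)"
    using A B by (simp add: ennreal_mult[symmetric] ennreal_plus[symmetric] del: ennreal_plus)
  also have "\<dots> = ennreal (2 * A powr (1 / p) * B powr (1 / q))" by (simp only: 1 2) simp
  finally show ?thesis .
qed

subsection \<open>Partial integration over coordinate subspaces\<close>

text \<open>Integration over the coordinates in \<open>J\<close> only, with a result that still
  lives on the whole space though it is constant along \<open>J\<close>. This permits induction on
  \<open>J\<close> without splitting the space into products.\<close>

definition MI :: "'a::euclidean_space set \<Rightarrow> ('a \<Rightarrow> ennreal) \<Rightarrow> 'a \<Rightarrow> ennreal" where
  "MI J F x = (\<integral>\<^sup>+f. F (x + (\<Sum>b\<in>J. f b *\<^sub>R b)) \<partial>(Pi\<^sub>M J (\<lambda>_. lborel :: real measure)))"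

lemma product_sigma_finite_lborel: "product_sigma_finite (\<lambda>_. lborel :: real measure)"
  by (simp add: product_sigma_finite_def sigma_finite_lborel)

lemma MI_integrand_measurable:
  fixes F :: "'a::euclidean_space \<Rightarrow> ennreal"
  assumes [measurable]: "F \<in> borel_measurable borel"
  shows "(\<lambda>(x, f). F (x + (\<Sum>b\<in>J. f b *\<^sub>R b))) \<in> borel_measurable (borel \<Otimes>\<^sub>M Pi\<^sub>M J (\<lambda>_. lborel :: real measure))"
proof -
  have [measurable]: "(\<lambda>z. snd z b) \<in> borel_measurable (borel \<Otimes>\<^sub>M Pi\<^sub>M J (\<lambda>_. lborel :: real measure))" if "b \<in> J" for b
    using measurable_compose[OF measurable_snd measurable_component_singleton[OF that, of "\<lambda>_. lborel :: real measure"]] by simp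
  show ?thesis
    unfolding split_beta' by measurable
qed

lemma MI_measurable[measurable]:
  assumes F[measurable]: "F \<in> borel_measurable borel" and J: "finite J"
  shows "MI J F \<in> borel_measurable borel"
proof -
  interpret product_sigma_finite "\<lambda>_. lborel :: real measure" by (rule product_sigma_finite_lborel)
  interpret sigma_finite_measure "Pi\<^sub>M J (\<lambda>_. lborel :: real measure)" by (rule sigma_finite[OF J])
  show ?thesis
    unfolding MI_def[abs_def] by (rule borel_measurable_nn_integral) (rule MI_integrand_measurable[OF F])
qed

lemma MI_empty: "MI {} F x = F x"
proof -
  interpret product_sigma_finite "\<lambda>_. lborel :: real measure" by (rule product_sigma_finite_lborel)
  show ?thesis by (simp add: MI_def PiM_empty nn_integral_count_space_finite)
qed

lemma MI_insert:
  fixes F :: "'a::euclidean_space \<Rightarrow> ennreal"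
  assumes F[measurable]: "F \<in> borel_measurable borel" and J: "finite J" "j \<notin> J"
  shows "MI (insert j J) F x = (\<integral>\<^sup>+t. MI J F (x + t *\<^sub>R j) \<partial>lborel)"
proof -
  interpret product_sigma_finite "\<lambda>_. lborel :: real measure" by (rule product_sigma_finite_lborel)
  have m: "(\<lambda>f. F (x + (\<Sum>b\<in>insert j J. f b *\<^sub>R b))) \<in> borel_measurable (Pi\<^sub>M (insert j J) (\<lambda>_. lborel :: real measure))"
    using measurable_compose[OF measurable_Pair1' MI_integrand_measurable[OF F], of x] by simp
  have "(\<Sum>b\<in>insert j J. (f(j := y)) b *\<^sub>R b) = y *\<^sub>R j + (\<Sum>b\<in>J. f b *\<^sub>R b)" for f y
  proof -
    have "(\<Sum>b\<in>J. (f(j := y)) b *\<^sub>R b) = (\<Sum>b\<in>J. f b *\<^sub>R b)"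
      using J by (intro sum.cong) auto
    then show ?thesis using J by simp
  qed
  then show ?thesis
    unfolding MI_def product_nn_integral_insert_rev[OF J m] by (simp add: add.assoc del: fun_upd_apply)
qed

lemma MI_singleton:
  assumes F: "F \<in> borel_measurable borel"
  shows "MI {j} F x = (\<integral>\<^sup>+t. F (x + t *\<^sub>R j) \<partial>lborel)"
  using MI_insert[OF F, of "{}" j x] by (simp add: MI_empty)

lemma MI_invariant:
  assumes F: "F \<in> borel_measurable borel" and J: "finite J" "j \<in> J"
  shows "MI J F (x + s *\<^sub>R j) = MI J F x"
proof -
  define J' where "J' = J - {j}"
  have J': "finite J'" "j \<notin> J'" "J = insert j J'" using J by (auto simp: J'_def)
  have [measurable]: "MI J' F \<in> borel_measurable borel" by (rule MI_measurable[OF F J'(1)])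
  have "MI J F x = (\<integral>\<^sup>+t. MI J' F (x + t *\<^sub>R j) \<partial>lborel)" unfolding J'(3) by (rule MI_insert[OF F J'(1,2)])
  also have "\<dots> = ennreal \<bar>1\<bar> * (\<integral>\<^sup>+t. MI J' F (x + (s + 1 * t) *\<^sub>R j) \<partial>lborel)"
    by (rule nn_integral_real_affine[where f="\<lambda>t. MI J' F (x + t *\<^sub>R j)"]) auto
  also have "\<dots> = MI J F (x + s *\<^sub>R j)"
    unfolding J'(3) MI_insert[OF F J'(1,2)] by (simp add: scaleR_add_left add.assoc)
  finally show ?thesis ..
qed

lemma MI_Basis:
  fixes F :: "'a::euclidean_space \<Rightarrow> ennreal"
  assumes F[measurable]: "F \<in> borel_measurable borel"
  shows "MI Basis F x = (\<integral>\<^sup>+y. F y \<partial>lborel)"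
proof -
  have "(\<integral>\<^sup>+y. F y \<partial>lborel) = (\<integral>\<^sup>+y. F (1 *\<^sub>R y + x) \<partial>lborel)"
    by (subst nn_integral_affine) auto
  also have "\<dots> = (\<integral>\<^sup>+y. F (x + y) \<partial>lborel)" by (simp add: add.commute)
  also have "\<dots> = MI Basis F x"
    unfolding MI_def
  proof (subst lborel_eq, subst nn_integral_distr)
    have [measurable]: "(\<lambda>f. f b) \<in> borel_measurable (Pi\<^sub>M Basis (\<lambda>_. lborel :: real measure))" if "b \<in> Basis" for b :: 'a
      using measurable_component_singleton[OF that, of "\<lambda>_. lborel :: real measure"] by simp
    show "(\<lambda>f. \<Sum>b\<in>Basis. f b *\<^sub>R b) \<in> Pi\<^sub>M Basis (\<lambda>_. lborel :: real measure) \<rightarrow>\<^sub>M (borel :: 'a measure)"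
      by measurable
  qed auto
  finally show ?thesis ..
qed

text \<open>One coordinate \<open>j\<close> is integrated at a time. The factor with index
  \<open>j\<close> is already constant along \<open>j\<close> and leaves the integral; the other d -
  1 factors carry exponents 1/(d - 1) that add up to 1, so Hoelder's inequality applies. For
  \<open>J = Basis\<close> only full integrals remain.\<close>

lemma Loomis_Whitney:
  fixes F :: "'a::euclidean_space \<Rightarrow> 'a \<Rightarrow> ennreal"
  assumes F[measurable]: "\<And>i. i \<in> Basis \<Longrightarrow> F i \<in> borel_measurable borel" and n: "DIM('a) \<ge> 2"
  defines "p \<equiv> 1 / real (DIM('a) - 1)"
  assumes J: "J \<subseteq> Basis"
  shows "MI J (\<lambda>x. \<Prod>i\<in>Basis. epow (MI {i} (F i) x) p) x \<le> (\<Prod>i\<in>Basis. epow (MI (insert i J) (F i) x) p)"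
proof -
  have "finite J" using J finite_Basis finite_subset by blast
  then show ?thesis using J
  proof (induction J arbitrary: x rule: finite_induct)
    case empty
    then show ?case by (simp add: MI_empty)
  next
    case (insert j J)
    have j: "j \<in> Basis" "finite J" "j \<notin> J" using insert by auto
    have [measurable]: "MI K (F i) \<in> borel_measurable borel" if "i \<in> Basis" "finite K" for i K
      by (rule MI_measurable[OF F[OF that(1)] that(2)])
    define Q where "Q x = (\<Prod>i\<in>Basis. epow (MI {i} (F i) x) p)" for x
    have Qm: "Q \<in> borel_measurable borel" unfolding Q_def by measurable
    have card: "card (Basis - {j}) = DIM('a) - 1" using j by (simp add: card_Diff_singleton)
    then have ne: "Basis - {j} \<noteq> {}" using n by (metis card.empty diff_is_0_eq not_numeral_le_zero one_le_numeral order.trans le_numeral_extra(4) numeral_le_one_iff semiring_norm(69))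
    have "MI (insert j J) Q x = (\<integral>\<^sup>+t. MI J Q (x + t *\<^sub>R j) \<partial>lborel)"
      by (rule MI_insert[OF Qm j(2,3)])
    also have "\<dots> \<le> (\<integral>\<^sup>+t. (\<Prod>i\<in>Basis. epow (MI (insert i J) (F i) (x + t *\<^sub>R j)) p) \<partial>lborel)"
      using insert unfolding Q_def by (intro nn_integral_mono insert.IH) auto
    also have "\<dots> = (\<integral>\<^sup>+t. epow (MI (insert j J) (F j) x) p * (\<Prod>i\<in>Basis - {j}. epow (MI (insert i J) (F i) (x + t *\<^sub>R j)) p) \<partial>lborel)"
      using j MI_invariant[OF F[OF j(1)], of "insert j J" j x]
      by (intro nn_integral_cong) (simp add: prod.remove[of Basis j])
    also have "\<dots> = epow (MI (insert j J) (F j) x) p * (\<integral>\<^sup>+t. (\<Prod>i\<in>Basis - {j}. epow (MI (insert i J) (F i) (x + t *\<^sub>R j)) p) \<partial>lborel)"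
      using j by (intro nn_integral_cmult) measurable
    also have "\<dots> \<le> epow (MI (insert j J) (F j) x) p * (\<Prod>i\<in>Basis - {j}. epow (\<integral>\<^sup>+t. MI (insert i J) (F i) (x + t *\<^sub>R j) \<partial>lborel) p)"
      unfolding p_def card[symmetric]
      using j by (intro mult_left_mono nn_integral_prod_Holder ne) auto
    also have "(\<Prod>i\<in>Basis - {j}. epow (\<integral>\<^sup>+t. MI (insert i J) (F i) (x + t *\<^sub>R j) \<partial>lborel) p)
       = (\<Prod>i\<in>Basis - {j}. epow (MI (insert i (insert j J)) (F i) x) p)"
    proof (intro prod.cong refl)
      fix i assume i: "i \<in> Basis - {j}"
      \<comment> \<open>Here \<open>i\<close> may already belong to \<open>J\<close>, in which case
        its insertion changes nothing; what matters is that \<open>j\<close> is new.\<close>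
      have "MI (insert j (insert i J)) (F i) x = (\<integral>\<^sup>+t. MI (insert i J) (F i) (x + t *\<^sub>R j) \<partial>lborel)"
        using i j by (intro MI_insert F) auto
      then show "epow (\<integral>\<^sup>+t. MI (insert i J) (F i) (x + t *\<^sub>R j) \<partial>lborel) p = epow (MI (insert i (insert j J)) (F i) x) p"
        by (simp add: insert_commute)
    qed
    also have "epow (MI (insert j J) (F j) x) p * \<dots> = (\<Prod>i\<in>Basis. epow (MI (insert i (insert j J)) (F i) x) p)"
      using j by (simp add: prod.remove[of Basis j])
    finally show ?case by (simp add: Q_def)
  qed
qed

subsection \<open>The Gagliardo--Nirenberg--Sobolev inequality\<close>

text \<open>The fundamental theorem of calculus along the line in direction \<open>i\<close>,
  started at a point outside the support.\<close>

lemma abs_le_line_integral: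
  fixes u :: "'a::euclidean_space \<Rightarrow> real"
  assumes u: "\<And>x. GDERIV u x :> G x" and Gc: "continuous_on UNIV G" and R: "\<And>x. norm x > R \<Longrightarrow> u x = 0"
    and i: "i \<in> Basis"
  shows "ennreal \<bar>u x\<bar> \<le> (\<integral>\<^sup>+t. ennreal \<bar>G (x + t *\<^sub>R i) \<bullet> i\<bar> \<partial>lborel)"
proof -
  \<comment> \<open>Large enough that the point x - T i lies outside the ball of radius
    \<open>R\<close>.\<close>
  define T where "T = \<bar>R\<bar> + norm x + 1"
  have T: "T > 0" by (simp add: T_def add_nonneg_pos)
  have line: "((\<lambda>t. u (x + t *\<^sub>R i)) has_real_derivative G (x + t *\<^sub>R i) \<bullet> i) (at t)" for t
  proof -
    have "((\<lambda>t. u (x + t *\<^sub>R i)) has_derivative (\<lambda>h. (h *\<^sub>R i) \<bullet> G (x + t *\<^sub>R i))) (at t)"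
      by (rule has_derivative_compose[OF _ u[unfolded gderiv_def]]) (auto intro!: derivative_eq_intros)
    then show ?thesis by (simp add: has_field_derivative_def mult_commute_abs inner_commute)
  qed
  have cont: "continuous_on UNIV (\<lambda>t. G (x + t *\<^sub>R i) \<bullet> i)"
    by (intro continuous_intros continuous_on_compose2[OF Gc]) auto
  have "u (x + (- T) *\<^sub>R i) = 0"
  proof (rule R)
    have "norm ((- T) *\<^sub>R i) \<le> norm (x + (- T) *\<^sub>R i) + norm x"
      using norm_triangle_ineq4[of "x + (- T) *\<^sub>R i" x] by simp
    moreover have "norm ((- T) *\<^sub>R i) = T" using i T by simp
    ultimately show "R < norm (x + (- T) *\<^sub>R i)" by (simp add: T_def)
  qed
  moreover have "has_bochner_integral lborel (\<lambda>t. G (x + t *\<^sub>R i) \<bullet> i * indicator {- T..0} t) (u (x + 0 *\<^sub>R i) - u (x + (- T) *\<^sub>R i))"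
    by (rule has_bochner_integral_FTC_Icc_real)
      (use T line cont in \<open>auto intro: less_imp_le simp: continuous_on_eq_continuous_at\<close>)
  ultimately have b: "has_bochner_integral lborel (\<lambda>t. G (x + t *\<^sub>R i) \<bullet> i * indicator {- T..0} t) (u x)" by simp
  have "ennreal (norm (u x)) = ennreal (norm (\<integral>t. G (x + t *\<^sub>R i) \<bullet> i * indicator {- T..0} t \<partial>lborel))"
    using b by (simp add: has_bochner_integral_iff)
  also have "\<dots> \<le> (\<integral>\<^sup>+t. ennreal (norm (G (x + t *\<^sub>R i) \<bullet> i * indicator {- T..0} t)) \<partial>lborel)"
    using b by (intro integral_norm_bound_ennreal) (simp add: has_bochner_integral_iff)
  also have "\<dots> \<le> (\<integral>\<^sup>+t. ennreal \<bar>G (x + t *\<^sub>R i) \<bullet> i\<bar> \<partial>lborel)"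
    by (intro nn_integral_mono) (auto split: split_indicator)
  finally show ?thesis by simp
qed

text \<open>Each of the d line integrals bounds |u|. The product of their powers 1/(d - 1) therefore
  bounds |u|^(d/(d - 1)), and it has exactly the shape of the Loomis--Whitney inequality.\<close>

lemma Gagliardo_Nirenberg_Sobolev_1:
  fixes u :: "'a::euclidean_space \<Rightarrow> real"
  assumes u: "\<And>x. GDERIV u x :> G x" and Gc: "continuous_on UNIV G" and R: "\<And>x. norm x > R \<Longrightarrow> u x = 0"
    and n: "DIM('a) \<ge> 2" and N: "N \<ge> 0" "(\<integral>\<^sup>+x. ennreal (norm (G x)) \<partial>lborel) \<le> ennreal N"
  shows "NP (DIM('a) / (DIM('a) - 1)) u \<le> ennreal (N powr (DIM('a) / (DIM('a) - 1)))"
proof -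
  define p where "p = 1 / real (DIM('a) - 1)"
  have p: "p > 0" "real DIM('a) * p = DIM('a) / (DIM('a) - 1)" using n by (auto simp: p_def of_nat_diff)
  define F where "F i x = ennreal \<bar>G x \<bullet> i\<bar>" for i x
  have Gm[measurable]: "G \<in> borel_measurable borel" using Gc by (rule borel_measurable_continuous_onI)
  have Fm[measurable]: "F i \<in> borel_measurable borel" for i unfolding F_def by measurable
  have pw: "(y powr p) ^ DIM('a) = y powr (DIM('a) / (DIM('a) - 1))" if "y \<ge> 0" for y :: real
    unfolding p(2)[symmetric] using that n powr_realpow[of "y powr p" "DIM('a)"]
    by (cases "y = 0") (auto simp: powr_powr mult.commute)
  have "NP (DIM('a) / (DIM('a) - 1)) u \<le> (\<integral>\<^sup>+x. (\<Prod>i\<in>Basis. epow (MI {i} (F i) x) p) \<partial>lborel)"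
    unfolding NP_def
  proof (rule nn_integral_mono)
    fix x
    have "ennreal (\<bar>u x\<bar> powr (DIM('a) / (DIM('a) - 1))) = (\<Prod>i\<in>(Basis::'a set). ennreal (\<bar>u x\<bar> powr p))"
      by (subst prod_ennreal) (auto simp: pw)
    also have "\<dots> \<le> (\<Prod>i\<in>Basis. epow (MI {i} (F i) x) p)"
    proof (rule prod_mono_ennreal)
      fix i :: 'a assume i: "i \<in> Basis"
      have "epow (ennreal \<bar>u x\<bar>) p \<le> epow (MI {i} (F i) x) p"
        unfolding MI_singleton[OF Fm] unfolding F_def
        using p by (intro epow_mono abs_le_line_integral[OF u Gc R i]) auto
      then show "ennreal (\<bar>u x\<bar> powr p) \<le> epow (MI {i} (F i) x) p" by (simp add: epow_ennreal)
    qed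
    finally show "ennreal (\<bar>u x\<bar> powr (DIM('a) / (DIM('a) - 1))) \<le> (\<Prod>i\<in>Basis. epow (MI {i} (F i) x) p)" .
  qed
  also have "\<dots> = MI Basis (\<lambda>x. \<Prod>i\<in>Basis. epow (MI {i} (F i) x) p) 0"
  proof (rule MI_Basis[symmetric])
    have [measurable]: "MI {i} (F i) \<in> borel_measurable borel" for i by (rule MI_measurable[OF Fm]) simp
    show "(\<lambda>x. \<Prod>i\<in>Basis. epow (MI {i} (F i) x) p) \<in> borel_measurable borel" by measurable
  qed
  also have "\<dots> \<le> (\<Prod>i\<in>Basis. epow (MI (insert i Basis) (F i) 0) p)"
    unfolding p_def by (rule Loomis_Whitney[OF Fm n]) auto
  also have "\<dots> \<le> (\<Prod>i\<in>(Basis::'a set). ennreal (N powr p))"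
  proof (rule prod_mono_ennreal)
    fix i :: 'a assume i: "i \<in> Basis"
    have "MI Basis (F i) 0 = (\<integral>\<^sup>+x. F i x \<partial>lborel)" by (rule MI_Basis[OF Fm])
    also have "\<dots> \<le> (\<integral>\<^sup>+x. ennreal (norm (G x)) \<partial>lborel)"
      unfolding F_def using i by (intro nn_integral_mono ennreal_leI) (metis Basis_le_norm)
    also have "\<dots> \<le> ennreal N" by (rule N)
    finally have "epow (MI Basis (F i) 0) p \<le> epow (ennreal N) p" using p by (intro epow_mono) auto
    then show "epow (MI (insert i Basis) (F i) 0) p \<le> ennreal (N powr p)"
      using i N by (simp add: epow_ennreal insert_absorb)
  qed
  also have "\<dots> = ennreal (N powr (DIM('a) / (DIM('a) - 1)))"
    using N by (subst prod_ennreal) (auto simp: pw)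
  finally show ?thesis .
qed

text \<open>Writing the derivative as t |t|^(\<gamma> - 2) avoids sign functions, and \<gamma> > 2
  makes this expression continuous at 0, where it also equals the difference quotient divided by
  \<gamma>-free factors: |h|^\<gamma>/h = h |h|^(\<gamma> - 2).\<close>

lemma DERIV_abs_powr:
  assumes "\<gamma> > (2::real)"
  shows "((\<lambda>t. \<bar>t\<bar> powr \<gamma>) has_real_derivative \<gamma> * (t * \<bar>t\<bar> powr (\<gamma> - 2))) (at t)"
proof (cases t "0::real" rule: linorder_cases)
  case greater
  have "((\<lambda>t. t powr \<gamma>) has_real_derivative \<gamma> * t powr (\<gamma> - 1)) (at t)"
    using greater by (auto intro!: derivative_eq_intros)
  moreover have "t powr (\<gamma> - 1) = t * \<bar>t\<bar> powr (\<gamma> - 2)"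
    using greater powr_add[of t 1 "\<gamma> - 2"] by simp
  ultimately have "((\<lambda>t. t powr \<gamma>) has_real_derivative \<gamma> * (t * \<bar>t\<bar> powr (\<gamma> - 2))) (at t)" by simp
  then show ?thesis
    by (rule has_field_derivative_transform_within_open[where S="{0<..}"]) (use greater in auto)
next
  case less
  have "((\<lambda>t. (- t) powr \<gamma>) has_real_derivative - (\<gamma> * (- t) powr (\<gamma> - 1))) (at t)"
    using less by (auto intro!: derivative_eq_intros)
  moreover have "- ((- t) powr (\<gamma> - 1)) = t * \<bar>t\<bar> powr (\<gamma> - 2)"
    using less powr_add[of "- t" 1 "\<gamma> - 2"] by simp
  ultimately have "((\<lambda>t. (- t) powr \<gamma>) has_real_derivative \<gamma> * (t * \<bar>t\<bar> powr (\<gamma> - 2))) (at t)"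
    by (metis mult_minus_right)
  then show ?thesis
    by (rule has_field_derivative_transform_within_open[where S="{..<0}"]) (use less in auto)
next
  case equal
  have "continuous_on UNIV (\<lambda>h::real. h * \<bar>h\<bar> powr (\<gamma> - 2))"
    using assms by (intro continuous_intros continuous_on_powr') auto
  then have "((\<lambda>h::real. h * \<bar>h\<bar> powr (\<gamma> - 2)) \<longlongrightarrow> 0) (at 0)"
    by (auto simp: continuous_on_def dest!: spec[of _ 0])
  then have "((\<lambda>h::real. (\<bar>h\<bar> powr \<gamma> - \<bar>0\<bar> powr \<gamma>) / (h - 0)) \<longlongrightarrow> 0) (at 0)"
  proof (rule Lim_transform_eventually)
    have "h * \<bar>h\<bar> powr (\<gamma> - 2) = (\<bar>h\<bar> powr \<gamma> - \<bar>0\<bar> powr \<gamma>) / (h - 0)" if "h \<noteq> 0" for h :: real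
      using that powr_add[of "\<bar>h\<bar>" "\<gamma> - 2" 2] by (simp add: field_simps power2_eq_square)
    then show "\<forall>\<^sub>F h in at 0. h * \<bar>h\<bar> powr (\<gamma> - 2) = (\<bar>h\<bar> powr \<gamma> - \<bar>0\<bar> powr \<gamma>) / (h - 0)"
      by (auto simp: eventually_at_filter)
  qed
  then show ?thesis using equal by (simp add: has_field_derivative_iff)
qed

text \<open>The case of exponent 1 is applied to |u|^\<gamma>, whose gradient Hoelder's inequality
  splits into |u|^(\<gamma> - 1) and the gradient of u. With this \<gamma> both powers of u become
  |u|^q, so the integral X of |u|^q stands on both sides, with exponents that differ by 1/q.\<close>

lemma Sobolev_C1:
  fixes u :: "'a::euclidean_space \<Rightarrow> real" and r Y :: real
  assumes u: "\<And>x. GDERIV u x :> G x" and Gc: "continuous_on UNIV G" and R: "\<And>x. norm x > R \<Longrightarrow> u x = 0"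
    and r: "r \<ge> 2" "r < DIM('a)" and Y: "Y > 0" "NP r (\<lambda>x. norm (G x)) \<le> ennreal Y"
  defines "q \<equiv> r * DIM('a) / (DIM('a) - r)" and "\<gamma> \<equiv> r * (DIM('a) - 1) / (DIM('a) - r)"
  shows "NP q u \<le> ennreal ((2 * \<gamma> * Y powr (1 / r)) powr q)"
proof -
  define n where "n = real DIM('a)"
  have n: "r < n" "n > 2" using r by (auto simp: n_def)
  have n2: "DIM('a) \<ge> 2" using n by (simp add: n_def)
  have q: "q = r * n / (n - r)" and \<gamma>: "\<gamma> = r * (n - 1) / (n - r)"
    using n2 by (auto simp: q_def \<gamma>_def n_def of_nat_diff)
  have q0: "q > 0" using n r by (simp add: q)
  \<comment> \<open>This is \<gamma> > 2, as differentiability of |t|^\<gamma> above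
    requires.\<close>
  have "2 * (n - r) < r * (n - 1)"
  proof -
    have "2 * (n - r) \<le> r * (n - r)" using r n by (intro mult_right_mono) auto
    also have "\<dots> < r * (n - 1)" using r n by (intro mult_strict_left_mono) auto
    finally show ?thesis .
  qed
  then have \<gamma>2: "\<gamma> > 2" using n by (simp add: \<gamma> pos_less_divide_eq)
  define r' where "r' = r / (r - 1)"
  have r': "r' > 1" "1 / r' + 1 / r = 1" using r by (auto simp: r'_def field_simps)
  have e1: "\<gamma> * (n / (n - 1)) = q" using n by (simp add: q \<gamma>)
  have e2: "(\<gamma> - 1) * r' = q"
  proof -
    have "\<gamma> - 1 = n * (r - 1) / (n - r)" using n by (simp add: \<gamma> field_simps)
    then show ?thesis using r by (simp add: r'_def q)
  qed
  have e3: "(1 / r - 1 / n) * q = 1" using n r by (simp add: q field_simps)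
  have uc: "continuous_on UNIV u"
    using u unfolding gderiv_def by (meson continuous_at_imp_continuous_on has_derivative_continuous)
  have um[measurable]: "u \<in> borel_measurable borel" using uc by (rule borel_measurable_continuous_onI)
  have Gm[measurable]: "G \<in> borel_measurable borel" using Gc by (rule borel_measurable_continuous_onI)
  \<comment> \<open>Finite because \<open>u\<close> is continuous with bounded support; without
    finiteness a power of it could not be cancelled below.\<close>
  define X where "X = enn2real (NP q u)"
  have X: "NP q u = ennreal X"
    unfolding X_def using NP_compact_support_fin[where f=u and R=R and p=q] uc R q0 by (simp add: ennreal_enn2real_if)
  have X0: "X \<ge> 0" by (simp add: X_def)
  show ?thesis
  proof (cases "X = 0")
    case False
    then have Xp: "X > 0" using X0 by simp
    define w where "w x = \<bar>u x\<bar> powr \<gamma>" for x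
    define W where "W x = (\<gamma> * (u x * \<bar>u x\<bar> powr (\<gamma> - 2))) *\<^sub>R G x" for x
    have w: "GDERIV w x :> W x" for x
      unfolding w_def[abs_def] W_def by (rule GDERIV_DERIV_compose[OF u DERIV_abs_powr[OF \<gamma>2]])
    have Wc: "continuous_on UNIV W"
      unfolding W_def[abs_def] using \<gamma>2 by (intro continuous_intros continuous_on_powr' uc Gc) auto
    have W0: "w x = 0" if "norm x > R" for x using R[OF that] by (simp add: w_def)
    define b where "b x = \<bar>u x\<bar> powr (\<gamma> - 1)" for x
    have [measurable]: "b \<in> borel_measurable borel" unfolding b_def by measurable
    have "NP r' b = ennreal X"
      unfolding X[symmetric] NP_def b_def using e2 by (simp add: powr_powr)
    then have Hol: "(\<integral>\<^sup>+x. ennreal \<bar>b x * norm (G x)\<bar> \<partial>lborel) \<le> ennreal (2 * X powr (1 / r') * Y powr (1 / r))"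
      using r r' Xp Y by (intro Holder_powr) auto
    define N where "N = \<gamma> * (2 * X powr (1 / r') * Y powr (1 / r))"
    have N0: "N > 0" using \<gamma>2 Xp Y by (simp add: N_def)
    have "(\<integral>\<^sup>+x. ennreal (norm (W x)) \<partial>lborel) = (\<integral>\<^sup>+x. ennreal \<gamma> * ennreal \<bar>b x * norm (G x)\<bar> \<partial>lborel)"
    proof (rule nn_integral_cong)
      fix x
      have "\<bar>u x\<bar> * \<bar>u x\<bar> powr (\<gamma> - 2) = b x"
        using powr_add[of "\<bar>u x\<bar>" 1 "\<gamma> - 2"] by (cases "u x = 0") (auto simp: b_def)
      then have "norm (W x) = \<gamma> * (b x * norm (G x))"
        using \<gamma>2 by (simp add: W_def abs_mult)
      then show "ennreal (norm (W x)) = ennreal \<gamma> * ennreal \<bar>b x * norm (G x)\<bar>"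
        using \<gamma>2 by (subst ennreal_mult[symmetric]) (auto simp: b_def)
    qed
    also have "\<dots> \<le> ennreal \<gamma> * ennreal (2 * X powr (1 / r') * Y powr (1 / r))"
      by (subst nn_integral_cmult) (auto intro!: mult_left_mono Hol)
    also have "\<dots> = ennreal N"
      unfolding N_def using \<gamma>2 by (intro ennreal_mult[symmetric]) auto
    finally have "NP (n / (n - 1)) w \<le> ennreal (N powr (n / (n - 1)))"
      using Gagliardo_Nirenberg_Sobolev_1[where R=R and N=N, OF w Wc W0 n2] N0 n2 by (simp add: n_def of_nat_diff)
    moreover have "NP (n / (n - 1)) w = ennreal X"
      unfolding X[symmetric] NP_def w_def using e1 by (simp add: powr_powr)
    ultimately have "X \<le> N powr (n / (n - 1))" by (simp add: ennreal_le_iff)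
    then have "X powr ((n - 1) / n) \<le> (N powr (n / (n - 1))) powr ((n - 1) / n)"
      using X0 n by (intro powr_mono2) auto
    also have "\<dots> = N" using n N0 by (simp add: powr_powr)
    finally have 1: "X powr ((n - 1) / n) \<le> (2 * \<gamma> * Y powr (1 / r)) * X powr (1 / r')" by (simp add: N_def mult_ac)
    have "(n - 1) / n = 1 - 1 / n" using n by (simp add: field_simps)
    moreover have "1 / r' = 1 - 1 / r" using r'(2) by simp
    ultimately have "(n - 1) / n = (1 / r - 1 / n) + 1 / r'" by simp
    then have "X powr ((n - 1) / n) = X powr (1 / r - 1 / n) * X powr (1 / r')" by (simp add: powr_add)
    with 1 have 2: "X powr (1 / r - 1 / n) \<le> 2 * \<gamma> * Y powr (1 / r)"
      using Xp by simp
    have "X = (X powr (1 / r - 1 / n)) powr q" using Xp e3 by (simp add: powr_powr)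
    also have "\<dots> \<le> (2 * \<gamma> * Y powr (1 / r)) powr q" using 2 q0 by (intro powr_mono2) auto
    finally show ?thesis unfolding X by (rule ennreal_leI)
  qed (simp add: X)
qed

section \<open>Compactly supported Sobolev functions\<close>

text \<open>Fatou's lemma along a subsequence that converges a.e. The exponent \<open>q\<close> and
  the weight are unrelated to the convergence in exponent \<open>p\<close>, so this covers both the
  singular weight 1/|x|^4 and the higher Sobolev exponents.\<close>

lemma NP_weighted_lsc:
  fixes \<omega> :: "'a::euclidean_space \<Rightarrow> real"
  assumes [measurable]: "\<And>n. f n \<in> borel_measurable borel" "g \<in> borel_measurable borel" "\<omega> \<in> borel_measurable borel"
    and \<omega>: "\<And>x. \<omega> x \<ge> 0" and p: "p > 0" and q: "q > 0"
    and lim: "(\<lambda>n. NP p (\<lambda>x. f n x - g x)) \<longlonglongrightarrow> 0" and fin: "\<And>n. NP p (\<lambda>x. f n x - g x) < \<infinity>"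
    and B: "eventually (\<lambda>n. (\<integral>\<^sup>+x. ennreal (\<omega> x * \<bar>f n x\<bar> powr q) \<partial>lborel) \<le> B n) sequentially" "B \<longlonglongrightarrow> B'"
  shows "(\<integral>\<^sup>+x. ennreal (\<omega> x * \<bar>g x\<bar> powr q) \<partial>lborel) \<le> B'"
proof -
  obtain r :: "nat \<Rightarrow> nat" where r: "strict_mono r" "AE x in lborel. (\<lambda>n. f (r n) x) \<longlonglongrightarrow> g x"
    using NP_AE_subseq[OF assms(1,2) p lim fin] by blast
  have "(\<integral>\<^sup>+x. ennreal (\<omega> x * \<bar>g x\<bar> powr q) \<partial>lborel) = (\<integral>\<^sup>+x. liminf (\<lambda>n. ennreal (\<omega> x * \<bar>f (r n) x\<bar> powr q)) \<partial>lborel)"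
  proof (rule nn_integral_cong_AE)
    from r(2) show "AE x in lborel. ennreal (\<omega> x * \<bar>g x\<bar> powr q) = liminf (\<lambda>n. ennreal (\<omega> x * \<bar>f (r n) x\<bar> powr q))"
    proof eventually_elim
      case (elim x)
      have "(\<lambda>n. \<bar>f (r n) x\<bar> powr q) \<longlonglongrightarrow> \<bar>g x\<bar> powr q"
        using q by (intro tendsto_powr' tendsto_rabs elim tendsto_const) auto
      then have "(\<lambda>n. ennreal (\<omega> x * \<bar>f (r n) x\<bar> powr q)) \<longlonglongrightarrow> ennreal (\<omega> x * \<bar>g x\<bar> powr q)"
        by (intro tendsto_ennrealI tendsto_mult tendsto_const)
      then show ?case by (intro lim_imp_Liminf[symmetric]) auto
    qed
  qed
  also have "\<dots> \<le> liminf (\<lambda>n. \<integral>\<^sup>+x. ennreal (\<omega> x * \<bar>f (r n) x\<bar> powr q) \<partial>lborel)"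
    by (rule nn_integral_liminf) auto
  also have "\<dots> \<le> liminf (\<lambda>n. B (r n))"
    using eventually_subseq[OF r(1) B(1)] by (intro Liminf_mono) auto
  also have "\<dots> = B'"
    using LIMSEQ_subseq_LIMSEQ[OF B(2) r(1)] by (intro lim_imp_Liminf) (auto simp: comp_def)
  finally show ?thesis .
qed

context C2_compact
begin

text \<open>The constants of the regularised inequalities are free of \<epsilon>, so Fatou's lemma
  removes it.\<close>

lemma Hardy_Rellich:
  assumes d: "DIM('a) \<ge> 5"
  shows "(\<integral>\<^sup>+x. ennreal (1 / (x \<bullet> x)\<^sup>2 * \<bar>x \<bullet> G x\<bar> powr 2) \<partial>lborel) \<le> ennreal (4 / (DIM('a))\<^sup>2) * NP 2 L"
    and "(\<integral>\<^sup>+x. ennreal (1 / (x \<bullet> x)\<^sup>2 * \<bar>u x\<bar> powr 2) \<partial>lborel) \<le> ennreal ((4 / (DIM('a) * (DIM('a) - 4)))\<^sup>2) * NP 2 L"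
proof -
  define I where "I = (\<integral>x. (L x)\<^sup>2 \<partial>lborel)"
  have I: "NP 2 L = ennreal I" unfolding NP_2 I_def by (rule nn_integral_eq_integral[OF LI]) auto
  have I0: "I \<ge> 0" unfolding I_def by (rule Bochner_Integration.integral_nonneg) auto
  define \<epsilon> where "\<epsilon> n = 1 / (real n + 1)" for n
  have \<epsilon>: "\<epsilon> n > 0" for n by (simp add: \<epsilon>_def)
  have \<epsilon>0: "\<epsilon> \<longlonglongrightarrow> 0"
    unfolding \<epsilon>_def using LIMSEQ_inverse_real_of_nat by (simp add: inverse_eq_divide add.commute)
  have nz: "x \<bullet> x + \<epsilon> n \<noteq> 0" for n and x :: 'a
    using \<epsilon>[of n] inner_ge_zero[of x] by linarith
  have main: "(\<integral>\<^sup>+x. ennreal (1 / (x \<bullet> x)\<^sup>2 * \<bar>F x\<bar> powr 2) \<partial>lborel) \<le> ennreal B"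
    if F: "continuous_on UNIV F" "\<And>x. norm x > R \<Longrightarrow> F x = 0"
      and B: "\<And>n. (\<integral>x. (inverse (x \<bullet> x + \<epsilon> n) * F x)\<^sup>2 \<partial>lborel) \<le> B" for F :: "'a \<Rightarrow> real" and B
  proof -
    have [measurable]: "F \<in> borel_measurable borel" using F(1) by (rule borel_measurable_continuous_onI)
    have "(\<integral>\<^sup>+x. ennreal (1 / (x \<bullet> x)\<^sup>2 * \<bar>F x\<bar> powr 2) \<partial>lborel)
      = (\<integral>\<^sup>+x. liminf (\<lambda>n. ennreal ((inverse (x \<bullet> x + \<epsilon> n) * F x)\<^sup>2)) \<partial>lborel)"
    proof (rule nn_integral_cong_AE)
      \<comment> \<open>The origin has to be left out: there the unregularised weight is 0 by the
        convention on division.\<close>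
      show "AE x in lborel. ennreal (1 / (x \<bullet> x)\<^sup>2 * \<bar>F x\<bar> powr 2) = liminf (\<lambda>n. ennreal ((inverse (x \<bullet> x + \<epsilon> n) * F x)\<^sup>2))"
        using AE_lborel_singleton[of 0]
      proof eventually_elim
        case (elim x)
        have "(\<lambda>n. (inverse (x \<bullet> x + \<epsilon> n) * F x)\<^sup>2) \<longlonglongrightarrow> (inverse (x \<bullet> x + 0) * F x)\<^sup>2"
          using elim by (intro tendsto_intros \<epsilon>0) auto
        also have "(inverse (x \<bullet> x + 0) * F x)\<^sup>2 = 1 / (x \<bullet> x)\<^sup>2 * \<bar>F x\<bar> powr 2"
          by (simp add: power_mult_distrib power_inverse divide_inverse)
        finally show ?case by (intro lim_imp_Liminf[symmetric] tendsto_ennrealI) auto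
      qed
    qed
    also have "\<dots> \<le> liminf (\<lambda>n. \<integral>\<^sup>+x. ennreal ((inverse (x \<bullet> x + \<epsilon> n) * F x)\<^sup>2) \<partial>lborel)"
      by (rule nn_integral_liminf) auto
    also have "\<dots> \<le> liminf (\<lambda>n. ennreal B)"
    proof (intro Liminf_mono always_eventually allI)
      fix n
      have "integrable lborel (\<lambda>x. (inverse (x \<bullet> x + \<epsilon> n) * F x)\<^sup>2)"
      proof (rule integrable_continuous_compact_support[where R=R])
        have "\<forall>x::'a\<in>UNIV. x \<bullet> x + \<epsilon> n \<noteq> 0" using nz by blast
        then show "continuous_on UNIV (\<lambda>x. (inverse (x \<bullet> x + \<epsilon> n) * F x)\<^sup>2)"
          by (intro continuous_intros F(1))
      qed (use F in simp)
      then show "(\<integral>\<^sup>+x. ennreal ((inverse (x \<bullet> x + \<epsilon> n) * F x)\<^sup>2) \<partial>lborel) \<le> ennreal B"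
        using B[of n] by (subst nn_integral_eq_integral) (auto intro: ennreal_leI)
    qed
    finally show ?thesis by (simp add: Liminf_const)
  qed
  have d0: "real (DIM('a) - 4) = real DIM('a) - 4" using d by (simp add: of_nat_diff)
  have b1: "(\<integral>x. (inverse (x \<bullet> x + \<epsilon> n) * (x \<bullet> G x))\<^sup>2 \<partial>lborel) \<le> 4 / (DIM('a))\<^sup>2 * I" for n
    using Hardy_Rellich_eps(1)[OF d \<epsilon>] by (simp add: I_def)
  have "(\<integral>\<^sup>+x. ennreal (1 / (x \<bullet> x)\<^sup>2 * \<bar>x \<bullet> G x\<bar> powr 2) \<partial>lborel) \<le> ennreal (4 / (DIM('a))\<^sup>2 * I)"
    by (intro main b1 continuous_intros Gc) (simp add: suppG)
  then show "(\<integral>\<^sup>+x. ennreal (1 / (x \<bullet> x)\<^sup>2 * \<bar>x \<bullet> G x\<bar> powr 2) \<partial>lborel) \<le> ennreal (4 / (DIM('a))\<^sup>2) * NP 2 L"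
    unfolding I using I0 by (subst ennreal_mult[symmetric]) auto
  have b2: "(\<integral>x. (inverse (x \<bullet> x + \<epsilon> n) * u x)\<^sup>2 \<partial>lborel) \<le> (4 / (DIM('a) * (DIM('a) - 4)))\<^sup>2 * I" for n
  proof -
    have "(\<integral>x. (inverse (x \<bullet> x + \<epsilon> n) * u x)\<^sup>2 \<partial>lborel) \<le> 4 / (DIM('a) - 4)\<^sup>2 * (\<integral>x. (inverse (x \<bullet> x + \<epsilon> n) * (x \<bullet> G x))\<^sup>2 \<partial>lborel)"
      by (rule Hardy_Rellich_eps(2)[OF d \<epsilon>])
    also have "\<dots> \<le> 4 / (DIM('a) - 4)\<^sup>2 * (4 / (DIM('a))\<^sup>2 * I)"
      by (intro mult_left_mono b1) auto
    also have "\<dots> = (4 / (DIM('a) * (DIM('a) - 4)))\<^sup>2 * I"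
      by (simp add: power_mult_distrib power_divide)
    finally show ?thesis .
  qed
  have "(\<integral>\<^sup>+x. ennreal (1 / (x \<bullet> x)\<^sup>2 * \<bar>u x\<bar> powr 2) \<partial>lborel) \<le> ennreal ((4 / (DIM('a) * (DIM('a) - 4)))\<^sup>2 * I)"
    by (intro main b2 uc) (simp add: supp)
  then show "(\<integral>\<^sup>+x. ennreal (1 / (x \<bullet> x)\<^sup>2 * \<bar>u x\<bar> powr 2) \<partial>lborel) \<le> ennreal ((4 / (DIM('a) * (DIM('a) - 4)))\<^sup>2) * NP 2 L"
    unfolding I using I0 by (subst ennreal_mult[symmetric]) auto
qed

end

section \<open>Weakly differentiable functions with support in a ball\<close>

text \<open>The function and its weak derivatives are Borel representatives that vanish outside the
  ball at every point, not just almost everywhere; supports can then be handled pointwise.\<close>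

definition W1c :: "real \<Rightarrow> real \<Rightarrow> ('a::euclidean_space \<Rightarrow> real) \<Rightarrow> ('a \<Rightarrow> 'a \<Rightarrow> real) \<Rightarrow> bool" where
  "W1c p R w g \<longleftrightarrow> w \<in> borel_measurable borel \<and> (\<forall>x. norm x > R \<longrightarrow> w x = 0) \<and> NP p w < \<infinity> \<and>
     (\<forall>i\<in>Basis. g i \<in> borel_measurable borel \<and> (\<forall>x. norm x > R \<longrightarrow> g i x = 0) \<and> NP p (g i) < \<infinity> \<and> wpd i w (g i))"

definition W2c :: "real \<Rightarrow> ('a::euclidean_space \<Rightarrow> real) \<Rightarrow> ('a \<Rightarrow> 'a \<Rightarrow> real) \<Rightarrow> ('a \<Rightarrow> 'a \<Rightarrow> 'a \<Rightarrow> real) \<Rightarrow> bool" where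
  "W2c R w g h \<longleftrightarrow> W1c 2 R w g \<and> (\<forall>i\<in>Basis. W1c 2 R (g i) (h i))"

locale W1_compact =
  fixes p R :: real and w :: "'a::euclidean_space \<Rightarrow> real" and g :: "'a \<Rightarrow> 'a \<Rightarrow> real" and K :: "nat \<Rightarrow> 'a \<Rightarrow> real"
  assumes p: "p \<ge> 1" and W: "W1c p R w g" and K: "mollifiers K"
begin

lemma p0: "p > 0" "p \<ge> 0" using p by auto

lemma wm[measurable]: "w \<in> borel_measurable borel" and w0: "norm x > R \<Longrightarrow> w x = 0" and wf: "NP p w < \<infinity>"
  using W by (auto simp: W1c_def)

lemma gm[measurable]: "i \<in> Basis \<Longrightarrow> g i \<in> borel_measurable borel" and g0: "i \<in> Basis \<Longrightarrow> norm x > R \<Longrightarrow> g i x = 0"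
  and gf: "i \<in> Basis \<Longrightarrow> NP p (g i) < \<infinity>" and wpd: "i \<in> Basis \<Longrightarrow> wpd i w (g i)"
  using W by (auto simp: W1c_def)

lemma wi: "integrable lborel w"
  using integrable_compact_support[where f=w and R=R and p=p] w0 wf p by auto

lemma gi: "i \<in> Basis \<Longrightarrow> integrable lborel (g i)"
  using integrable_compact_support[where f="g i" and R=R and p=p] g0 gf p by auto

lemma Kt: "test_function (K n)" using K by (simp add: mollifiers_def)

definition \<phi> where "\<phi> n = conv (K n) w"
definition \<gamma> where "\<gamma> n i = conv (K n) (g i)"
definition \<Gamma> where "\<Gamma> n x = (\<Sum>i\<in>Basis. \<gamma> n i x *\<^sub>R i)"
text \<open>The Euler derivative x \<bullet> \<nabla>w, the expected limit of the difference
  quotient under dilations.\<close>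

definition E where "E x = (\<Sum>i\<in>Basis. (x \<bullet> i) * g i x)"

lemma \<phi>_GDERIV: "GDERIV (\<phi> n) x :> \<Gamma> n x"
  unfolding \<phi>_def \<Gamma>_def \<gamma>_def by (rule conv_GDERIV[OF Kt wi wpd])

lemma \<phi>_cont: "continuous_on UNIV (\<phi> n)"
  unfolding \<phi>_def by (rule conv_continuous[OF Kt wi])

lemma \<gamma>_cont: "i \<in> Basis \<Longrightarrow> continuous_on UNIV (\<gamma> n i)"
  unfolding \<gamma>_def by (rule conv_continuous[OF Kt gi])

lemma \<Gamma>_cont: "continuous_on UNIV (\<Gamma> n)"
  unfolding \<Gamma>_def[abs_def] by (intro continuous_intros \<gamma>_cont)

lemma \<phi>m[measurable]: "\<phi> n \<in> borel_measurable borel"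
  by (rule borel_measurable_continuous_onI[OF \<phi>_cont])

lemma \<gamma>m[measurable]: "i \<in> Basis \<Longrightarrow> \<gamma> n i \<in> borel_measurable borel"
  by (rule borel_measurable_continuous_onI[OF \<gamma>_cont])

lemma \<Gamma>m[measurable]: "\<Gamma> n \<in> borel_measurable borel"
  by (rule borel_measurable_continuous_onI[OF \<Gamma>_cont])

lemma Em[measurable]: "E \<in> borel_measurable borel"
  unfolding E_def[abs_def] by measurable

lemma conv_K_support:
  assumes "\<And>x. norm x > R \<Longrightarrow> f x = 0" "norm x > R + 1"
  shows "conv (K n) f x = 0"
proof (rule conv_support[where e="1 / (real n + 1)" and R=R])
  have "1 / (real n + 1) \<le> 1" by simp
  then show "norm x > R + 1 / (real n + 1)" using assms(2) by linarith
qed (use K assms in \<open>auto simp: mollifiers_def\<close>)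

lemma \<phi>_supp: "norm x > R + 1 \<Longrightarrow> \<phi> n x = 0"
  unfolding \<phi>_def by (rule conv_K_support[OF w0])

lemma \<gamma>_supp: "i \<in> Basis \<Longrightarrow> norm x > R + 1 \<Longrightarrow> \<gamma> n i x = 0"
  unfolding \<gamma>_def by (rule conv_K_support[OF g0])

lemma \<phi>_lim: "(\<lambda>n. NP p (\<lambda>x. \<phi> n x - w x)) \<longlonglongrightarrow> 0"
  unfolding \<phi>_def by (rule mollifiers_NP_tendsto[OF K wi wf p])

lemma \<gamma>_lim: "i \<in> Basis \<Longrightarrow> (\<lambda>n. NP p (\<lambda>x. \<gamma> n i x - g i x)) \<longlonglongrightarrow> 0"
  unfolding \<gamma>_def by (rule mollifiers_NP_tendsto[OF K gi gf p])

lemma \<phi>_fin: "NP p (\<phi> n) < \<infinity>"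
  using NP_compact_support_fin[where f="\<phi> n" and R="R + 1" and p=p] \<phi>_cont \<phi>_supp p0 by auto

lemma \<phi>_diff_fin: "NP p (\<lambda>x. \<phi> n x - w x) < \<infinity>"
  using NP_add_fin[of "\<phi> n" "\<lambda>x. - w x" p] \<phi>_fin wf p0 by (simp add: NP_uminus)

lemma inner_\<Gamma>: "y \<bullet> \<Gamma> n x = (\<Sum>i\<in>Basis. (y \<bullet> i) * \<gamma> n i x)"
  by (simp add: \<Gamma>_def inner_sum_right mult.commute)

text \<open>The factor x is unbounded, but all functions involved vanish outside the ball of radius
  R + 1, so it costs only a constant.\<close>

lemma E_lim: "(\<lambda>n. NP p (\<lambda>x. x \<bullet> \<Gamma> n x - E x)) \<longlonglongrightarrow> 0"
proof -
  have "(\<lambda>n. NP p (\<lambda>x. \<Sum>i\<in>Basis. (x \<bullet> i) * (\<gamma> n i x - g i x))) \<longlonglongrightarrow> 0"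
  proof (rule NP_tendsto_0_sum)
    fix i :: 'a assume i: "i \<in> Basis"
    show "(\<lambda>n. NP p (\<lambda>x. (x \<bullet> i) * (\<gamma> n i x - g i x))) \<longlonglongrightarrow> 0"
    proof (rule tendsto_sandwich[OF always_eventually always_eventually tendsto_const])
      show "(\<lambda>n. NP p (\<lambda>x. (\<bar>R\<bar> + 1) * (\<gamma> n i x - g i x))) \<longlonglongrightarrow> 0"
        using i by (intro NP_tendsto_0_cmult \<gamma>_lim) auto
      show "\<forall>n. NP p (\<lambda>x. (x \<bullet> i) * (\<gamma> n i x - g i x)) \<le> NP p (\<lambda>x. (\<bar>R\<bar> + 1) * (\<gamma> n i x - g i x))"
      proof (intro allI NP_mono p0)
        fix n x
        show "\<bar>(x \<bullet> i) * (\<gamma> n i x - g i x)\<bar> \<le> \<bar>(\<bar>R\<bar> + 1) * (\<gamma> n i x - g i x)\<bar>"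
        proof (cases "norm x > R + 1")
          case True
          then show ?thesis using i g0[OF i, of x] \<gamma>_supp[OF i, of x] by simp
        next
          case False
          then have "\<bar>x \<bullet> i\<bar> \<le> \<bar>R\<bar> + 1" using Basis_le_norm[OF i, of x] by linarith
          then show ?thesis by (auto simp: abs_mult intro!: mult_right_mono)
        qed
      qed
    qed auto
  qed (use p0 in auto)
  then show ?thesis by (simp add: inner_\<Gamma> E_def right_diff_distrib sum_subtractf)
qed

lemma E_fin: "NP p E < \<infinity>"
  unfolding E_def[abs_def]
proof (rule NP_sum_fin)
  fix i :: 'a assume i: "i \<in> Basis"
  have "NP p (\<lambda>x. (x \<bullet> i) * g i x) \<le> NP p (\<lambda>x. \<bar>R\<bar> * g i x)"
  proof (intro NP_mono p0)
    fix x
    show "\<bar>(x \<bullet> i) * g i x\<bar> \<le> \<bar>\<bar>R\<bar> * g i x\<bar>"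
      using g0[OF i, of x] Basis_le_norm[OF i, of x]
      by (cases "norm x > R") (auto simp: abs_mult intro!: mult_right_mono)
  qed
  also have "\<dots> < \<infinity>" using i gf by (intro NP_cmult_fin) auto
  finally show "NP p (\<lambda>x. (x \<bullet> i) * g i x) < \<infinity>" .
qed (use p0 in auto)

end

section \<open>Difference quotients under dilation\<close>

text \<open>The quotient is the mean over t in [0, 1] of x \<bullet> \<Gamma>((1 + t (l - 1)) x), so
  Jensen and Tonelli reduce the bound to one that is uniform in t. Weight 1 and Z = \<open>E\<close>
  give convergence in L^p; weight 1/|x|^4 and Z = 0 give the Hardy--Rellich bound.\<close>

lemma FTC_average_bound:
  fixes \<phi> :: "'a::euclidean_space \<Rightarrow> real" and \<omega> Z :: "'a \<Rightarrow> real"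
  assumes \<phi>: "\<And>x. GDERIV \<phi> x :> \<Gamma> x" and \<Gamma>c: "continuous_on UNIV \<Gamma>"
    and [measurable]: "Z \<in> borel_measurable borel" "\<omega> \<in> borel_measurable borel" and \<omega>: "\<And>x. \<omega> x \<ge> 0"
    and p: "p \<ge> 1" and lne: "l \<noteq> 1"
    and B: "\<And>t. 0 \<le> t \<Longrightarrow> t \<le> 1 \<Longrightarrow>
      (\<integral>\<^sup>+x. ennreal (\<omega> x * \<bar>x \<bullet> \<Gamma> ((1 + t * (l - 1)) *\<^sub>R x) - Z x\<bar> powr p) \<partial>lborel) \<le> B"
  shows "(\<integral>\<^sup>+x. ennreal (\<omega> x * \<bar>(\<phi> (l *\<^sub>R x) - \<phi> x) / (l - 1) - Z x\<bar> powr p) \<partial>lborel) \<le> B"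
proof -
  define \<mu> where "\<mu> = density lborel (\<lambda>t::real. ennreal (indicator {0..1} t))"
  interpret \<mu>: prob_space \<mu>
    by standard (simp add: \<mu>_def emeasure_density ennreal_indicator)
  have \<phi>c: "continuous_on UNIV \<phi>"
    using \<phi> unfolding gderiv_def by (meson continuous_at_imp_continuous_on has_derivative_continuous)
  have [measurable]: "\<phi> \<in> borel_measurable borel" using \<phi>c by (rule borel_measurable_continuous_onI)
  have [measurable]: "\<Gamma> \<in> borel_measurable borel" using \<Gamma>c by (rule borel_measurable_continuous_onI)
  define k where "k x t = x \<bullet> \<Gamma> ((1 + t * (l - 1)) *\<^sub>R x)" for x t
  have [measurable]: "(\<lambda>(x, t). k x t) \<in> borel_measurable (borel \<Otimes>\<^sub>M borel)" unfolding k_def by measurable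
  have [measurable]: "k x \<in> borel_measurable borel" for x unfolding k_def by measurable
  have pt: "ennreal (\<omega> x * \<bar>(\<phi> (l *\<^sub>R x) - \<phi> x) / (l - 1) - Z x\<bar> powr p)
     \<le> (\<integral>\<^sup>+t. ennreal (\<omega> x * \<bar>k x t - Z x\<bar> powr p) * ennreal (indicator {0..1} t) \<partial>lborel)" for x
  proof -
    have line: "((\<lambda>t. \<phi> ((1 + t * (l - 1)) *\<^sub>R x) / (l - 1)) has_real_derivative k x t) (at t)" for t
    proof -
      have "((\<lambda>t. \<phi> ((1 + t * (l - 1)) *\<^sub>R x)) has_derivative
         (\<lambda>h. ((h * (l - 1)) *\<^sub>R x) \<bullet> \<Gamma> ((1 + t * (l - 1)) *\<^sub>R x))) (at t)"
        by (rule has_derivative_compose[OF _ \<phi>[unfolded gderiv_def]]) (auto intro!: derivative_eq_intros)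
      then have "((\<lambda>t. \<phi> ((1 + t * (l - 1)) *\<^sub>R x)) has_real_derivative (l - 1) * k x t) (at t)"
        unfolding has_field_derivative_def k_def by (rule has_derivative_eq_rhs) (auto simp: fun_eq_iff)
      from DERIV_cdivide[OF this, of "l - 1"] show ?thesis using lne by simp
    qed
    have cont: "continuous_on UNIV (k x)"
      unfolding k_def by (intro continuous_intros continuous_on_compose2[OF \<Gamma>c]) auto
    have b: "has_bochner_integral lborel (\<lambda>t. k x t * indicator {0..1} t)
      (\<phi> ((1 + 1 * (l - 1)) *\<^sub>R x) / (l - 1) - \<phi> ((1 + 0 * (l - 1)) *\<^sub>R x) / (l - 1))"
      by (rule has_bochner_integral_FTC_Icc_real)
        (use line cont in \<open>auto simp: continuous_on_eq_continuous_at\<close>)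
    have i: "integrable \<mu> (k x)"
      unfolding \<mu>_def using b by (subst integrable_density) (auto simp: has_bochner_integral_iff mult.commute)
    have "(\<integral>t. k x t \<partial>\<mu>) = (\<phi> (l *\<^sub>R x) - \<phi> x) / (l - 1)"
      unfolding \<mu>_def using b by (subst integral_density) (auto simp: has_bochner_integral_iff mult.commute diff_divide_distrib)
    then have "(\<integral>t. k x t - Z x \<partial>\<mu>) = (\<phi> (l *\<^sub>R x) - \<phi> x) / (l - 1) - Z x"
      using i by (simp add: \<mu>.prob_space)
    moreover have "integrable \<mu> (\<lambda>t. k x t - Z x)" using i by simp
    ultimately have "ennreal (\<bar>(\<phi> (l *\<^sub>R x) - \<phi> x) / (l - 1) - Z x\<bar> powr p) \<le> (\<integral>\<^sup>+t. ennreal (\<bar>k x t - Z x\<bar> powr p) \<partial>\<mu>)"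
      using \<mu>.powr_Jensen[of "\<lambda>t. k x t - Z x" p] p by simp
    then have "ennreal (\<omega> x) * ennreal (\<bar>(\<phi> (l *\<^sub>R x) - \<phi> x) / (l - 1) - Z x\<bar> powr p) \<le> ennreal (\<omega> x) * (\<integral>\<^sup>+t. ennreal (\<bar>k x t - Z x\<bar> powr p) \<partial>\<mu>)"
      by (rule mult_left_mono) simp
    also have "\<dots> = (\<integral>\<^sup>+t. ennreal (\<omega> x) * ennreal (\<bar>k x t - Z x\<bar> powr p) \<partial>\<mu>)"
      by (rule nn_integral_cmult[symmetric]) (simp add: \<mu>_def)
    also have "\<dots> = (\<integral>\<^sup>+t. ennreal (indicator {0..1} t) * (ennreal (\<omega> x) * ennreal (\<bar>k x t - Z x\<bar> powr p)) \<partial>lborel)"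
      unfolding \<mu>_def by (rule nn_integral_density) auto
    finally show ?thesis using \<omega>[of x] by (simp add: ennreal_mult mult.commute)
  qed
  have "(\<integral>\<^sup>+x. ennreal (\<omega> x * \<bar>(\<phi> (l *\<^sub>R x) - \<phi> x) / (l - 1) - Z x\<bar> powr p) \<partial>lborel)
    \<le> (\<integral>\<^sup>+x. (\<integral>\<^sup>+t. ennreal (\<omega> x * \<bar>k x t - Z x\<bar> powr p) * ennreal (indicator {0..1} t) \<partial>lborel) \<partial>lborel)"
    by (intro nn_integral_mono pt)
  also have "\<dots> = (\<integral>\<^sup>+t. (\<integral>\<^sup>+x. ennreal (\<omega> x * \<bar>k x t - Z x\<bar> powr p) * ennreal (indicator {0..1} t) \<partial>lborel) \<partial>lborel)"
    by (rule lborel_pair.Fubini') measurable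
  also have "\<dots> = (\<integral>\<^sup>+t. (\<integral>\<^sup>+x. ennreal (\<omega> x * \<bar>k x t - Z x\<bar> powr p) \<partial>lborel) * ennreal (indicator {0..1} t) \<partial>lborel)"
    by (intro nn_integral_cong nn_integral_multc) measurable
  also have "\<dots> \<le> (\<integral>\<^sup>+t. B * indicator {0..1::real} t \<partial>lborel)"
    using B by (intro nn_integral_mono) (auto simp: k_def split: split_indicator)
  also have "\<dots> = B" by (simp add: nn_integral_cmult_indicator)
  finally show ?thesis .
qed

lemma NP_1_weight: "(\<integral>\<^sup>+x. ennreal (1 * \<bar>f x\<bar> powr p) \<partial>lborel) = NP p f"
  by (simp add: NP_def)

lemma NP_abs: "NP p (\<lambda>x. \<bar>f x\<bar>) = NP p f"
  by (simp add: NP_def)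

context W1_compact
begin

text \<open>For fixed l the bound is proved for the mollified functions, with a \<delta> that does
  not depend on the mollification, and then n tends to infinity. The nested powers of 2 record the
  successive triangle inequalities.\<close>

lemma difference_quotient_bound:
  assumes e: "e > 0"
  obtains \<delta> where "\<delta> > 0" "\<And>l. l \<noteq> 1 \<Longrightarrow> \<bar>l - 1\<bar> < \<delta> \<Longrightarrow>
    NP p (\<lambda>x. (w (l *\<^sub>R x) - w x) / (l - 1) - E x) \<le> ennreal (2 powr p * (2 powr p * (2 powr p * (2 powr p * e + e))))"
proof -
  obtain \<delta>1 where \<delta>1: "\<delta>1 > 0" "\<delta>1 \<le> 1/2"
    "\<And>s h. \<bar>s - 1\<bar> < \<delta>1 \<Longrightarrow> norm h < \<delta>1 \<Longrightarrow> NP p (\<lambda>x. E (s *\<^sub>R x + h) - E x) < ennreal e"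
    using NP_affine_continuous_at_id[OF Em E_fin p0(1) e] by metis
  define N where "N = enn2real (NP p E)"
  have N: "NP p E = ennreal N" "N \<ge> 0" using E_fin by (auto simp: N_def ennreal_enn2real_if)
  \<comment> \<open>Makes the error (1/s - 1) \<open>E\<close>, caused by the rescaled argument,
    contribute at most \<open>e\<close>.\<close>
  define \<eta> where "\<eta> = (e / (N + 1)) powr (1 / p)"
  have \<eta>: "\<eta> > 0" "\<eta> powr p = e / (N + 1)" using e N p0 by (auto simp: \<eta>_def powr_powr)
  define \<delta> where "\<delta> = min \<delta>1 (\<eta> / 2)"
  have \<delta>: "\<delta> > 0" "\<delta> \<le> \<delta>1" "2 * \<delta> \<le> \<eta>" using \<delta>1(1) \<eta>(1) by (auto simp: \<delta>_def)
  define a where "a n = NP p (\<lambda>x. x \<bullet> \<Gamma> n x - E x)" for n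
  define C where "C n = ennreal (2 powr p) * (ennreal (2 powr p * 2 ^ DIM('a)) * a n + ennreal (2 powr p) * (ennreal (2 powr p) * ennreal e + ennreal e))" for n
  define C' where "C' = ennreal (2 powr p) * (ennreal (2 powr p) * (ennreal (2 powr p) * ennreal e + ennreal e))"
  have a_lim: "a \<longlonglongrightarrow> 0" unfolding a_def[abs_def] by (rule E_lim)
  have "(\<lambda>n. ennreal (2 powr p * 2 ^ DIM('a)) * a n) \<longlonglongrightarrow> ennreal (2 powr p * 2 ^ DIM('a)) * 0"
    by (rule ennreal_tendsto_cmult[OF _ a_lim]) simp
  then have "C \<longlonglongrightarrow> ennreal (2 powr p) * (ennreal (2 powr p * 2 ^ DIM('a)) * 0
      + ennreal (2 powr p) * (ennreal (2 powr p) * ennreal e + ennreal e))"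
    unfolding C_def[abs_def] by (intro ennreal_tendsto_cmult[OF _ tendsto_add[OF _ tendsto_const]]) simp_all
  then have C_lim: "C \<longlonglongrightarrow> C'" by (simp add: C'_def)
  have "NP p (\<lambda>x. (w (l *\<^sub>R x) - w x) / (l - 1) - E x) \<le> ennreal (2 powr p * (2 powr p * (2 powr p * (2 powr p * e + e))))"
    if lne: "l \<noteq> 1" and l: "\<bar>l - 1\<bar> < \<delta>" for l
  proof -
    have l0: "l \<noteq> 0" using l \<delta> \<delta>1 by auto
    have inner_bd: "NP p (\<lambda>x. x \<bullet> \<Gamma> n (s *\<^sub>R x) - E x) \<le> C n" if s: "\<bar>s - 1\<bar> < \<delta>" for s n
    proof -
      have s2: "s \<ge> 1/2" using s \<delta> \<delta>1 by (auto simp: abs_real_def split: if_splits)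
      have s0: "s \<noteq> 0" using s2 by auto
      have s': "\<bar>1 / s\<bar> powr p \<le> 2 powr p" using s2 p0 by (intro powr_mono2) (auto simp: field_simps)
      have "NP p (\<lambda>x. 1 / s * (s *\<^sub>R x \<bullet> \<Gamma> n (s *\<^sub>R x) - E (s *\<^sub>R x)))
         = ennreal (\<bar>1 / s\<bar> powr p) * (ennreal (1 / \<bar>s\<bar> ^ DIM('a)) * a n)"
        using NP_affine[of "\<lambda>x. x \<bullet> \<Gamma> n x - E x" s p 0] s0 by (subst NP_cmult) (auto simp: a_def)
      also have "\<dots> \<le> ennreal (2 powr p) * (ennreal (2 ^ DIM('a)) * a n)"
      proof (intro mult_mono ennreal_leI s')
        have "1 / \<bar>s\<bar> ^ DIM('a) = (1 / s) ^ DIM('a)" using s2 by (simp add: power_one_over)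
        also have "\<dots> \<le> 2 ^ DIM('a)" using s2 by (intro power_mono) (auto simp: field_simps)
        finally show "1 / \<bar>s\<bar> ^ DIM('a) \<le> 2 ^ DIM('a)" .
      qed auto
      finally have 1: "NP p (\<lambda>x. 1 / s * (s *\<^sub>R x \<bullet> \<Gamma> n (s *\<^sub>R x) - E (s *\<^sub>R x))) \<le> ennreal (2 powr p * 2 ^ DIM('a)) * a n"
        by (simp add: ennreal_mult mult.assoc)
      have "NP p (\<lambda>x. 1 / s * (E (s *\<^sub>R x) - E x)) = ennreal (\<bar>1 / s\<bar> powr p) * NP p (\<lambda>x. E (s *\<^sub>R x + 0) - E x)"
        by (subst NP_cmult) auto
      also have "\<dots> \<le> ennreal (2 powr p) * ennreal e"
        using \<delta>1(1) \<delta>1(3)[of s 0] s \<delta>(2) by (intro mult_mono ennreal_leI s') auto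
      finally have 2: "NP p (\<lambda>x. 1 / s * (E (s *\<^sub>R x) - E x)) \<le> ennreal (2 powr p) * ennreal e" .
      have "\<bar>1 / s - 1\<bar> \<le> \<eta>"
      proof -
        have "\<bar>1 / s - 1\<bar> = \<bar>s - 1\<bar> * (1 / s)" using s2 by (simp add: field_simps abs_real_def)
        also have "\<dots> \<le> \<delta> * 2" using s s2 by (intro mult_mono) (auto simp: field_simps)
        finally show ?thesis using \<delta>(3) by simp
      qed
      then have "\<bar>1 / s - 1\<bar> powr p \<le> e / (N + 1)" unfolding \<eta>(2)[symmetric] using p0 by (intro powr_mono2) auto
      then have "ennreal (\<bar>1 / s - 1\<bar> powr p) * NP p E \<le> ennreal (e / (N + 1)) * ennreal N"
        unfolding N by (intro mult_right_mono ennreal_leI) auto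
      also have "\<dots> = ennreal (e / (N + 1) * N)" using e N by (intro ennreal_mult[symmetric]) auto
      also have "\<dots> \<le> ennreal e" using e N by (intro ennreal_leI) (simp add: field_simps)
      finally have 3: "NP p (\<lambda>x. (1 / s - 1) * E x) \<le> ennreal e" by (subst NP_cmult) auto
      \<comment> \<open>The first summand tends to 0 with n because dilations preserve convergence;
        the other two are small for s near 1, by continuity of dilations and by the choice of
        \<eta>.\<close>
      have eq: "x \<bullet> \<Gamma> n (s *\<^sub>R x) - E x = 1 / s * (s *\<^sub>R x \<bullet> \<Gamma> n (s *\<^sub>R x) - E (s *\<^sub>R x)) + (1 / s * (E (s *\<^sub>R x) - E x) + (1 / s - 1) * E x)" for x
        using s0 by (simp add: field_simps)
      have "NP p (\<lambda>x. x \<bullet> \<Gamma> n (s *\<^sub>R x) - E x) \<le> ennreal (2 powr p) * (NP p (\<lambda>x. 1 / s * (s *\<^sub>R x \<bullet> \<Gamma> n (s *\<^sub>R x) - E (s *\<^sub>R x)))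
          + NP p (\<lambda>x. 1 / s * (E (s *\<^sub>R x) - E x) + (1 / s - 1) * E x))"
        unfolding eq by (rule NP_add_le) (use p0 in auto)
      also have "NP p (\<lambda>x. 1 / s * (E (s *\<^sub>R x) - E x) + (1 / s - 1) * E x)
         \<le> ennreal (2 powr p) * (NP p (\<lambda>x. 1 / s * (E (s *\<^sub>R x) - E x)) + NP p (\<lambda>x. (1 / s - 1) * E x))"
        by (rule NP_add_le) (use p0 in auto)
      also have "ennreal (2 powr p) * (NP p (\<lambda>x. 1 / s * (s *\<^sub>R x \<bullet> \<Gamma> n (s *\<^sub>R x) - E (s *\<^sub>R x))) +
          ennreal (2 powr p) * (NP p (\<lambda>x. 1 / s * (E (s *\<^sub>R x) - E x)) + NP p (\<lambda>x. (1 / s - 1) * E x))) \<le> C n"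
        unfolding C_def by (intro mult_left_mono add_mono 1 2 3) auto
      finally show ?thesis by (simp add: add_left_mono mult_left_mono)
    qed
    have DQ: "NP p (\<lambda>x. (\<phi> n (l *\<^sub>R x) - \<phi> n x) / (l - 1) - E x) \<le> C n" for n
      unfolding NP_1_weight[symmetric]
    proof (rule FTC_average_bound[OF \<phi>_GDERIV \<Gamma>_cont _ _ _ p lne])
      fix t :: real assume t: "0 \<le> t" "t \<le> 1"
      have "\<bar>t * (l - 1)\<bar> \<le> 1 * \<bar>l - 1\<bar>" unfolding abs_mult using t by (intro mult_right_mono) auto
      then have "\<bar>(1 + t * (l - 1)) - 1\<bar> < \<delta>" using l by simp
      from inner_bd[OF this] show "(\<integral>\<^sup>+ x. ennreal (1 * \<bar>x \<bullet> \<Gamma> n ((1 + t * (l - 1)) *\<^sub>R x) - E x\<bar> powr p) \<partial>lborel) \<le> C n"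
        unfolding NP_1_weight .
    qed auto
    \<comment> \<open>Since l is fixed while n grows, the divisor l - 1 is only a constant.\<close>
    have lim: "(\<lambda>n. NP p (\<lambda>x. (w (l *\<^sub>R x) - w x) / (l - 1) - (\<phi> n (l *\<^sub>R x) - \<phi> n x) / (l - 1))) \<longlonglongrightarrow> 0"
    proof -
      have "(\<lambda>n. NP p (\<lambda>x. \<phi> n (l *\<^sub>R x) - w (l *\<^sub>R x))) \<longlonglongrightarrow> 0"
        using ennreal_tendsto_cmult[OF _ \<phi>_lim, of "ennreal (1 / \<bar>l\<bar> ^ DIM('a))"] l0
          NP_affine[of "\<lambda>x. \<phi> n x - w x" l p 0 for n] by simp
      then have "(\<lambda>n. NP p (\<lambda>x. (- (1 / (l - 1))) * (\<phi> n (l *\<^sub>R x) - w (l *\<^sub>R x)) + (1 / (l - 1)) * (\<phi> n x - w x))) \<longlonglongrightarrow> 0"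
        by (intro NP_tendsto_0_add NP_tendsto_0_cmult \<phi>_lim) (use p0 in auto)
      moreover have "(- (1 / (l - 1))) * (\<phi> n (l *\<^sub>R x) - w (l *\<^sub>R x)) + (1 / (l - 1)) * (\<phi> n x - w x)
          = (w (l *\<^sub>R x) - w x) / (l - 1) - (\<phi> n (l *\<^sub>R x) - \<phi> n x) / (l - 1)" for n x
        using lne by (simp add: field_simps)
      ultimately show ?thesis by simp
    qed
    have "NP p (\<lambda>x. (w (l *\<^sub>R x) - w x) / (l - 1) - E x)
      \<le> ennreal (2 powr p) * (NP p (\<lambda>x. (w (l *\<^sub>R x) - w x) / (l - 1) - (\<phi> n (l *\<^sub>R x) - \<phi> n x) / (l - 1)) + C n)" for n
    proof -
      have "NP p (\<lambda>x. (w (l *\<^sub>R x) - w x) / (l - 1) - E x) \<le> ennreal (2 powr p) *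
        (NP p (\<lambda>x. (w (l *\<^sub>R x) - w x) / (l - 1) - (\<phi> n (l *\<^sub>R x) - \<phi> n x) / (l - 1))
         + NP p (\<lambda>x. (\<phi> n (l *\<^sub>R x) - \<phi> n x) / (l - 1) - E x))"
        by (rule NP_triangle) (use p0 in auto)
      also have "\<dots> \<le> ennreal (2 powr p) *
        (NP p (\<lambda>x. (w (l *\<^sub>R x) - w x) / (l - 1) - (\<phi> n (l *\<^sub>R x) - \<phi> n x) / (l - 1)) + C n)"
        by (intro mult_left_mono add_left_mono DQ) simp
      finally show ?thesis .
    qed
    moreover have "(\<lambda>n. ennreal (2 powr p) * (NP p (\<lambda>x. (w (l *\<^sub>R x) - w x) / (l - 1) - (\<phi> n (l *\<^sub>R x) - \<phi> n x) / (l - 1)) + C n))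
       \<longlonglongrightarrow> ennreal (2 powr p) * (0 + C')"
      by (rule ennreal_tendsto_cmult[OF _ tendsto_add[OF lim C_lim]]) simp
    ultimately have "NP p (\<lambda>x. (w (l *\<^sub>R x) - w x) / (l - 1) - E x) \<le> ennreal (2 powr p) * (0 + C')"
      by (intro LIMSEQ_le_const) blast+
    also have "\<dots> = ennreal (2 powr p * (2 powr p * (2 powr p * (2 powr p * e + e))))"
      using e by (simp add: C'_def ennreal_mult[symmetric] ennreal_plus[symmetric] del: ennreal_plus)
    finally show ?thesis .
  qed
  with \<delta>(1) show ?thesis using that by blast
qed

lemma difference_quotient_lim:
  assumes s: "s \<longlonglongrightarrow> 1" and s1: "\<And>n. s n \<noteq> 1"
  shows "(\<lambda>n. NP p (\<lambda>x. (w (s n *\<^sub>R x) - w x) / (s n - 1) - E x)) \<longlonglongrightarrow> 0"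
proof (rule order_tendstoI)
  fix e :: ennreal assume e: "0 < e"
  obtain e' where e': "e' > 0" "ennreal e' < e"
  proof (cases e)
    case (real r)
    then show ?thesis using e that[of "r / 2"] by (auto simp: ennreal_less_iff)
  next
    case top
    then show ?thesis using that[of 1] by auto
  qed
  define C where "C = 2 powr p * (2 powr p * (2 powr p * (2 powr p + 1)))"
  have C: "C > 0" unfolding C_def by (intro mult_pos_pos add_pos_pos) auto
  have eC: "e' / C > 0" using e' C by simp
  obtain \<delta> where \<delta>: "\<delta> > 0" "\<And>l. l \<noteq> 1 \<Longrightarrow> \<bar>l - 1\<bar> < \<delta> \<Longrightarrow>
    NP p (\<lambda>x. (w (l *\<^sub>R x) - w x) / (l - 1) - E x) \<le> ennreal (2 powr p * (2 powr p * (2 powr p * (2 powr p * (e' / C) + e' / C))))"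
    by (rule difference_quotient_bound[OF eC]) blast
  have eq: "2 powr p * (2 powr p * (2 powr p * (2 powr p * (e' / C) + e' / C))) = e'"
  proof -
    have "2 powr p * (2 powr p * (2 powr p * (2 powr p * (e' / C) + e' / C))) = C * (e' / C)"
      by (simp only: C_def) (simp only: algebra_simps)
    then show ?thesis using C by simp
  qed
  have "eventually (\<lambda>n. dist (s n) 1 < \<delta>) sequentially" using s \<delta>(1) by (rule tendstoD)
  then show "\<forall>\<^sub>F n in sequentially. NP p (\<lambda>x. (w (s n *\<^sub>R x) - w x) / (s n - 1) - E x) < e"
  proof eventually_elim
    case (elim n)
    then have "NP p (\<lambda>x. (w (s n *\<^sub>R x) - w x) / (s n - 1) - E x) \<le> ennreal e'"
      using \<delta>(2)[OF s1[of n]] unfolding eq by (simp add: dist_real_def)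
    then show ?case using e'(2) by (rule le_less_trans)
  qed
qed auto

text \<open>Mollified gradients are bounded in L^p, so the classical inequality bounds the
  mollifications uniformly, and Fatou's lemma passes the bound to \<open>w\<close>.\<close>

lemma Sobolev_embedding:
  assumes p2: "p \<ge> 2" "p < DIM('a)"
  shows "NP (p * DIM('a) / (DIM('a) - p)) w < \<infinity>"
proof -
  define q where "q = p * DIM('a) / (DIM('a) - p)"
  have q: "q > 0" using p2 by (simp add: q_def)
  define g' where "g' x = (\<Sum>i\<in>Basis. g i x *\<^sub>R i)" for x
  have [measurable]: "g' \<in> borel_measurable borel" unfolding g'_def[abs_def] by measurable
  have g'f: "NP p (\<lambda>x. norm (g' x)) < \<infinity>"
  proof -
    have "NP p (\<lambda>x. norm (g' x)) \<le> NP p (\<lambda>x. \<Sum>i\<in>Basis. \<bar>g i x\<bar>)"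
    proof (intro NP_mono p0)
      fix x
      have "norm (g' x) \<le> (\<Sum>i\<in>Basis. norm (g i x *\<^sub>R i))" unfolding g'_def by (rule norm_sum)
      also have "\<dots> = (\<Sum>i\<in>Basis. \<bar>g i x\<bar>)" by simp
      finally show "\<bar>norm (g' x)\<bar> \<le> \<bar>\<Sum>i\<in>Basis. \<bar>g i x\<bar>\<bar>" by (simp add: sum_nonneg)
    qed
    also have "\<dots> < \<infinity>" using gf p0 by (intro NP_sum_fin) (auto simp: NP_abs)
    finally show ?thesis .
  qed
  have "(\<lambda>n. NP p (\<lambda>x. norm (\<Gamma> n x) - norm (g' x))) \<longlonglongrightarrow> 0"
  proof (rule tendsto_sandwich[OF always_eventually always_eventually tendsto_const])
    show "(\<lambda>n. NP p (\<lambda>x. \<Sum>i\<in>Basis. \<bar>\<gamma> n i x - g i x\<bar>)) \<longlonglongrightarrow> 0"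
      using p0 by (intro NP_tendsto_0_sum) (auto simp: NP_abs \<gamma>_lim)
    show "\<forall>n. NP p (\<lambda>x. norm (\<Gamma> n x) - norm (g' x)) \<le> NP p (\<lambda>x. \<Sum>i\<in>Basis. \<bar>\<gamma> n i x - g i x\<bar>)"
    proof (intro allI NP_mono p0)
      fix n x
      have "\<bar>norm (\<Gamma> n x) - norm (g' x)\<bar> \<le> norm (\<Gamma> n x - g' x)" by (rule norm_triangle_ineq3)
      also have "\<Gamma> n x - g' x = (\<Sum>i\<in>Basis. (\<gamma> n i x - g i x) *\<^sub>R i)"
        by (simp add: \<Gamma>_def g'_def sum_subtractf scaleR_diff_left)
      also have "norm \<dots> \<le> (\<Sum>i\<in>Basis. norm ((\<gamma> n i x - g i x) *\<^sub>R i))" by (rule norm_sum)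
      also have "\<dots> = (\<Sum>i\<in>Basis. \<bar>\<gamma> n i x - g i x\<bar>)" by simp
      finally show "\<bar>norm (\<Gamma> n x) - norm (g' x)\<bar> \<le> \<bar>\<Sum>i\<in>Basis. \<bar>\<gamma> n i x - g i x\<bar>\<bar>" by (simp add: sum_nonneg)
    qed
  qed auto
  from NP_eventually_bounded[OF _ _ p0(2) this g'f]
  obtain Y' where "eventually (\<lambda>n. NP p (\<lambda>x. norm (\<Gamma> n x)) \<le> ennreal Y') sequentially" by auto
  \<comment> \<open>The classical inequality asks for a strictly positive bound.\<close>
  define Y where "Y = max Y' 1"
  define B where "B = ennreal ((2 * (p * (DIM('a) - 1) / (DIM('a) - p)) * Y powr (1 / p)) powr q)"
  have ev: "eventually (\<lambda>n. NP p (\<lambda>x. norm (\<Gamma> n x)) \<le> ennreal Y) sequentially"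
    using \<open>eventually (\<lambda>n. NP p (\<lambda>x. norm (\<Gamma> n x)) \<le> ennreal Y') sequentially\<close>
    by eventually_elim (auto simp: Y_def intro: order.trans ennreal_leI)
  have "(\<integral>\<^sup>+x. ennreal (1 * \<bar>w x\<bar> powr q) \<partial>lborel) \<le> B"
  proof (rule NP_weighted_lsc[where f=\<phi> and p=p and B="\<lambda>_. B"])
    show "\<forall>\<^sub>F n in sequentially. (\<integral>\<^sup>+ x. ennreal (1 * \<bar>\<phi> n x\<bar> powr q) \<partial>lborel) \<le> B"
      using ev
    proof eventually_elim
      case (elim n)
      show ?case unfolding NP_1_weight B_def q_def
        by (rule Sobolev_C1[where R="R + 1", OF \<phi>_GDERIV \<Gamma>_cont \<phi>_supp p2 _ elim]) (auto simp: Y_def)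
    qed
  qed (use p0 q \<phi>_lim \<phi>_diff_fin in auto)
  also have "B < \<infinity>" by (simp add: B_def)
  finally show ?thesis by (simp add: NP_def q_def)
qed

end

lemma NP_2_integral:
  assumes [measurable]: "f \<in> borel_measurable borel" and fin: "NP 2 f < \<infinity>"
  shows "integrable lborel (\<lambda>x. (f x)\<^sup>2)" "NP 2 f = ennreal (\<integral>x. (f x)\<^sup>2 \<partial>lborel)"
proof -
  show i: "integrable lborel (\<lambda>x. (f x)\<^sup>2)"
    using fin unfolding integrable_iff_bounded by (simp add: NP_2)
  show "NP 2 f = ennreal (\<integral>x. (f x)\<^sup>2 \<partial>lborel)"
    unfolding NP_2 by (rule nn_integral_eq_integral[OF i]) auto
qed

lemma integral_mult_tendsto_2:
  assumes [measurable]: "\<And>n. a n \<in> borel_measurable borel" "\<And>n. b n \<in> borel_measurable borel"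
      "a' \<in> borel_measurable borel" "b' \<in> borel_measurable borel"
    and "((\<lambda>n. NP 2 (\<lambda>x. a n x - a' x)) \<longlongrightarrow> 0) F" "((\<lambda>n. NP 2 (\<lambda>x. b n x - b' x)) \<longlongrightarrow> 0) F"
    and "NP 2 a' < \<infinity>" "NP 2 b' < \<infinity>"
  shows "((\<lambda>n. \<integral>x. a n x * b n x \<partial>lborel) \<longlongrightarrow> (\<integral>x. a' x * b' x \<partial>lborel)) F"
  by (rule integral_mult_tendsto[where p=2 and q=2]) (use assms in auto)

lemma NP_2_tendsto:
  assumes [measurable]: "\<And>n. f n \<in> borel_measurable borel" "g \<in> borel_measurable borel"
    and "((\<lambda>n. NP 2 (\<lambda>x. f n x - g x)) \<longlongrightarrow> 0) F" "NP 2 g < \<infinity>" "\<And>n. NP 2 (f n) < \<infinity>"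
  shows "((\<lambda>n. NP 2 (f n)) \<longlongrightarrow> NP 2 g) F"
proof -
  have "((\<lambda>n. \<integral>x. (f n x)\<^sup>2 \<partial>lborel) \<longlongrightarrow> (\<integral>x. (g x)\<^sup>2 \<partial>lborel)) F"
    unfolding power2_eq_square by (rule integral_mult_tendsto_2) (use assms in auto)
  then show ?thesis
    unfolding NP_2_integral(2)[OF assms(1,5)] NP_2_integral(2)[OF assms(2,4)] by (rule tendsto_ennrealI)
qed

section \<open>Inequalities for functions with two weak derivatives\<close>

locale W2_compact =
  fixes R :: real and w :: "'a::euclidean_space \<Rightarrow> real" and g h and K :: "nat \<Rightarrow> 'a \<Rightarrow> real"
  assumes W2: "W2c R w g h" and K: "mollifiers K"
begin

sublocale W1_compact 2 R w g K
  using W2 K by unfold_locales (auto simp: W2c_def)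

lemma W1g: "i \<in> Basis \<Longrightarrow> W1_compact 2 R (g i) (h i) K"
  using W2 K by unfold_locales (auto simp: W2c_def)

definition Lap where "Lap x = (\<Sum>i\<in>Basis. h i i x)"

definition M where "M n x v = (\<Sum>i\<in>Basis. (v \<bullet> (\<Sum>j\<in>Basis. conv (K n) (h i j) x *\<^sub>R j)) *\<^sub>R i)"

lemma hm[measurable]: "i \<in> Basis \<Longrightarrow> j \<in> Basis \<Longrightarrow> h i j \<in> borel_measurable borel"
  using W1_compact.gm[OF W1g] by blast

lemma Lapm[measurable]: "Lap \<in> borel_measurable borel"
  unfolding Lap_def[abs_def] by measurable

lemma Lap_fin: "NP 2 Lap < \<infinity>"
  unfolding Lap_def[abs_def] using W1_compact.gf[OF W1g] by (intro NP_sum_fin) auto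

lemma conv_h_cont: "i \<in> Basis \<Longrightarrow> j \<in> Basis \<Longrightarrow> continuous_on UNIV (conv (K n) (h i j))"
  using W1_compact.\<gamma>_cont[OF W1g, of i j] by (simp add: W1_compact.\<gamma>_def[OF W1g])

lemma C2: "C2_compact (\<phi> n) (\<Gamma> n) (M n) (R + 1)"
proof
  show "(\<Gamma> n has_derivative M n x) (at x)" for x
    unfolding \<Gamma>_def[abs_def] M_def[abs_def]
  proof (intro has_derivative_sum has_derivative_scaleR_left)
    fix i :: 'a assume i: "i \<in> Basis"
    interpret gi: W1_compact 2 R "g i" "h i" K by (rule W1g[OF i])
    show "(\<gamma> n i has_derivative (\<lambda>v. v \<bullet> (\<Sum>j\<in>Basis. conv (K n) (h i j) x *\<^sub>R j))) (at x)"
      using gi.\<phi>_GDERIV[of n x] unfolding gderiv_def gi.\<phi>_def gi.\<Gamma>_def gi.\<gamma>_def \<gamma>_def .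
  qed
  show "continuous_on UNIV (\<lambda>x. M n x v)" for v
    unfolding M_def by (intro continuous_intros conv_h_cont)
qed (auto simp: \<phi>_GDERIV \<phi>_supp)

lemma L_eq: "C2_compact.L (M n) x = (\<Sum>i\<in>Basis. conv (K n) (h i i) x)"
  unfolding C2_compact.L_def[OF C2] M_def
proof (intro sum.cong refl)
  fix i :: 'a assume i: "i \<in> Basis"
  have "(\<Sum>k\<in>Basis. (i \<bullet> (\<Sum>j\<in>Basis. conv (K n) (h k j) x *\<^sub>R j)) *\<^sub>R k) \<bullet> i = i \<bullet> (\<Sum>j\<in>Basis. conv (K n) (h i j) x *\<^sub>R j)"
    using i by (simp add: inner_sum_left inner_Basis if_distrib cong: if_cong)
  also have "\<dots> = conv (K n) (h i i) x"
    using i by (simp add: inner_sum_right inner_Basis if_distrib cong: if_cong)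
  finally show "(\<Sum>k\<in>Basis. (i \<bullet> (\<Sum>j\<in>Basis. conv (K n) (h k j) x *\<^sub>R j)) *\<^sub>R k) \<bullet> i = conv (K n) (h i i) x" .
qed

lemma L_lim: "(\<lambda>n. NP 2 (C2_compact.L (M n))) \<longlonglongrightarrow> NP 2 Lap"
proof (rule NP_2_tendsto)
  show "C2_compact.L (M n) \<in> borel_measurable borel" for n
    by (rule borel_measurable_continuous_onI[OF C2_compact.Lc[OF C2]])
  show "NP 2 (C2_compact.L (M n)) < \<infinity>" for n
    using NP_compact_support_fin[where f="C2_compact.L (M n)" and R="R + 1" and p=2]
      C2_compact.Lc[OF C2] C2_compact.suppL[OF C2] by auto
  have "(\<lambda>n. NP 2 (\<lambda>x. \<Sum>i\<in>Basis. conv (K n) (h i i) x - h i i x)) \<longlonglongrightarrow> 0"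
  proof (rule NP_tendsto_0_sum)
    fix i :: 'a and n assume i: "i \<in> Basis"
    then show "(\<lambda>n. NP 2 (\<lambda>x. conv (K n) (h i i) x - h i i x)) \<longlonglongrightarrow> 0"
      using W1_compact.\<gamma>_lim[OF W1g[OF i] i] unfolding W1_compact.\<gamma>_def[OF W1g[OF i]] by simp
    have [measurable]: "conv (K n) (h i i) \<in> borel_measurable borel"
      by (rule borel_measurable_continuous_onI[OF conv_h_cont[OF i i]])
    show "(\<lambda>x. conv (K n) (h i i) x - h i i x) \<in> borel_measurable borel" using i by measurable
  qed auto
  then show "(\<lambda>n. NP 2 (\<lambda>x. C2_compact.L (M n) x - Lap x)) \<longlonglongrightarrow> 0"
    by (simp add: L_eq Lap_def sum_subtractf)
qed (use Lap_fin in auto)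

text \<open>The weight is unbounded, so the left-hand side is only lower semicontinuous under
  mollification, while the norms of the Laplacians converge.\<close>

lemma Rellich:
  assumes d: "DIM('a) \<ge> 5"
  shows "(\<integral>\<^sup>+x. ennreal (1 / (x \<bullet> x)\<^sup>2 * \<bar>w x\<bar> powr 2) \<partial>lborel) \<le> ennreal ((4 / (DIM('a) * (DIM('a) - 4)))\<^sup>2) * NP 2 Lap"
proof (rule NP_weighted_lsc[where f=\<phi> and p=2])
  show "(\<lambda>n. ennreal ((4 / (DIM('a) * (DIM('a) - 4)))\<^sup>2) * NP 2 (C2_compact.L (M n))) \<longlonglongrightarrow> ennreal ((4 / (DIM('a) * (DIM('a) - 4)))\<^sup>2) * NP 2 Lap"
    by (intro ennreal_tendsto_cmult L_lim) auto
qed (use \<phi>_lim \<phi>_diff_fin C2_compact.Hardy_Rellich(2)[OF C2 d] in auto)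

text \<open>Stating the inequality for the quotient avoids a limit l -> 1 in the weighted norm.
  Substituting y = s x in the integral of |x|^(-4) |x \<bullet> \<Gamma>(s x)|^2 produces s^(2 - d),
  and every intermediate factor s is at least min 1 l.\<close>

lemma Hardy_Rellich_difference_quotient:
  assumes d: "DIM('a) \<ge> 5" and l: "l > 0" "l \<noteq> 1"
  shows "(\<integral>\<^sup>+x. ennreal (1 / (x \<bullet> x)\<^sup>2 * \<bar>(w (l *\<^sub>R x) - w x) / (l - 1)\<bar> powr 2) \<partial>lborel)
     \<le> ennreal ((1 / min 1 l) ^ (DIM('a) - 2) * (4 / (DIM('a))\<^sup>2)) * NP 2 Lap"
proof (rule NP_weighted_lsc[where f="\<lambda>n x. (\<phi> n (l *\<^sub>R x) - \<phi> n x) / (l - 1)" and p=2])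
  define m where "m = min 1 l"
  have m: "m > 0" "m \<le> 1" "m \<le> l" using l by (auto simp: m_def)
  have diff: "(- 1 / (1 - l)) * (\<phi> n (l *\<^sub>R x) - w (l *\<^sub>R x)) + (1 / (1 - l)) * (\<phi> n x - w x)
          = (\<phi> n (l *\<^sub>R x) - \<phi> n x) / (l - 1) - (w (l *\<^sub>R x) - w x) / (l - 1)" for n x
    using l(2) by (simp add: divide_simps) (simp add: algebra_simps)
  have aff: "NP 2 (\<lambda>x. \<phi> n (l *\<^sub>R x) - w (l *\<^sub>R x)) = ennreal (1 / \<bar>l\<bar> ^ DIM('a)) * NP 2 (\<lambda>x. \<phi> n x - w x)" for n
    using NP_affine[of "\<lambda>x. \<phi> n x - w x" l 2 0] l by simp
  have "(\<lambda>n. NP 2 (\<lambda>x. \<phi> n (l *\<^sub>R x) - w (l *\<^sub>R x))) \<longlonglongrightarrow> 0"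
    unfolding aff using ennreal_tendsto_cmult[OF _ \<phi>_lim, of "ennreal (1 / \<bar>l\<bar> ^ DIM('a))"] by simp
  then have "(\<lambda>n. NP 2 (\<lambda>x. (- 1 / (1 - l)) * (\<phi> n (l *\<^sub>R x) - w (l *\<^sub>R x)) + (1 / (1 - l)) * (\<phi> n x - w x))) \<longlonglongrightarrow> 0"
    by (intro NP_tendsto_0_add NP_tendsto_0_cmult \<phi>_lim) auto
  then show "(\<lambda>n. NP 2 (\<lambda>x. (\<phi> n (l *\<^sub>R x) - \<phi> n x) / (l - 1) - (w (l *\<^sub>R x) - w x) / (l - 1))) \<longlonglongrightarrow> 0"
    unfolding diff .
  show "NP 2 (\<lambda>x. (\<phi> n (l *\<^sub>R x) - \<phi> n x) / (l - 1) - (w (l *\<^sub>R x) - w x) / (l - 1)) < \<infinity>" for n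
    unfolding diff[symmetric]
    by (intro NP_add_fin NP_cmult_fin \<phi>_diff_fin) (auto simp: aff ennreal_mult_less_top intro: \<phi>_diff_fin[simplified])
  show "(\<lambda>n. ennreal ((1 / min 1 l) ^ (DIM('a) - 2) * (4 / (DIM('a))\<^sup>2)) * NP 2 (C2_compact.L (M n)))
     \<longlonglongrightarrow> ennreal ((1 / min 1 l) ^ (DIM('a) - 2) * (4 / (DIM('a))\<^sup>2)) * NP 2 Lap"
    by (intro ennreal_tendsto_cmult L_lim) auto
  show "\<forall>\<^sub>F n in sequentially. (\<integral>\<^sup>+ x. ennreal (1 / (x \<bullet> x)\<^sup>2 * \<bar>(\<phi> n (l *\<^sub>R x) - \<phi> n x) / (l - 1)\<bar> powr 2) \<partial>lborel)
     \<le> ennreal ((1 / min 1 l) ^ (DIM('a) - 2) * (4 / (DIM('a))\<^sup>2)) * NP 2 (C2_compact.L (M n))"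
  proof (intro always_eventually allI)
    fix n
    define F where "F y = ennreal (1 / (y \<bullet> y)\<^sup>2 * \<bar>y \<bullet> \<Gamma> n y\<bar> powr 2)" for y
    have [measurable]: "F \<in> borel_measurable borel" unfolding F_def by measurable
    have FI: "(\<integral>\<^sup>+y. F y \<partial>lborel) \<le> ennreal (4 / (DIM('a))\<^sup>2) * NP 2 (C2_compact.L (M n))"
      unfolding F_def by (rule C2_compact.Hardy_Rellich(1)[OF C2 d])
    \<comment> \<open>The subtracted 0 is the comparison function in
      \<open>FTC_average_bound\<close>.\<close>
    have "(\<integral>\<^sup>+ x. ennreal (1 / (x \<bullet> x)\<^sup>2 * \<bar>(\<phi> n (l *\<^sub>R x) - \<phi> n x) / (l - 1) - 0\<bar> powr 2) \<partial>lborel)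
       \<le> ennreal ((1 / m) ^ (DIM('a) - 2) * (4 / (DIM('a))\<^sup>2)) * NP 2 (C2_compact.L (M n))"
    proof (rule FTC_average_bound[OF \<phi>_GDERIV \<Gamma>_cont _ _ _ _ l(2)])
      fix t :: real assume t: "0 \<le> t" "t \<le> 1"
      define s where "s = 1 + t * (l - 1)"
      have s: "s \<ge> m"
      proof -
        have "m = (1 - t) * m + t * m" by (simp add: algebra_simps)
        also have "\<dots> \<le> (1 - t) * 1 + t * l" using t m by (intro add_mono mult_left_mono) auto
        finally show ?thesis by (simp add: s_def algebra_simps)
      qed
      have s0: "s > 0" using s m by simp
      have "ennreal (1 / (x \<bullet> x)\<^sup>2 * \<bar>x \<bullet> \<Gamma> n (s *\<^sub>R x) - 0\<bar> powr 2) = ennreal (s\<^sup>2) * F (s *\<^sub>R x + 0)" for x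
        unfolding F_def using s0 by (subst ennreal_mult[symmetric]) (auto simp: power2_eq_square field_simps)
      then have "(\<integral>\<^sup>+ x. ennreal (1 / (x \<bullet> x)\<^sup>2 * \<bar>x \<bullet> \<Gamma> n (s *\<^sub>R x) - 0\<bar> powr 2) \<partial>lborel)
         = (\<integral>\<^sup>+ x. ennreal (s\<^sup>2) * F (s *\<^sub>R x + 0) \<partial>lborel)" by (intro nn_integral_cong)
      also have "\<dots> = ennreal (s\<^sup>2) * (\<integral>\<^sup>+ x. F (s *\<^sub>R x + 0) \<partial>lborel)"
        by (rule nn_integral_cmult) measurable
      also have "\<dots> = ennreal (s\<^sup>2) * (ennreal (1 / \<bar>s\<bar> ^ DIM('a)) * (\<integral>\<^sup>+y. F y \<partial>lborel))"
        using s0 by (subst nn_integral_affine) auto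
      also have "\<dots> = ennreal ((1 / s) ^ (DIM('a) - 2)) * (\<integral>\<^sup>+y. F y \<partial>lborel)"
      proof -
        have "s ^ (2 + (DIM('a) - 2)) = s\<^sup>2 * s ^ (DIM('a) - 2)" by (rule power_add)
        moreover have "2 + (DIM('a) - 2) = DIM('a)" using d by simp
        ultimately have "s ^ DIM('a) = s\<^sup>2 * s ^ (DIM('a) - 2)" by metis
        then have "s\<^sup>2 * (1 / \<bar>s\<bar> ^ DIM('a)) = (1 / s) ^ (DIM('a) - 2)" using s0 by (simp add: power_one_over)
        then show ?thesis using s0 by (subst mult.assoc[symmetric], subst ennreal_mult[symmetric]) auto
      qed
      also have "\<dots> \<le> ennreal ((1 / m) ^ (DIM('a) - 2)) * (ennreal (4 / (DIM('a))\<^sup>2) * NP 2 (C2_compact.L (M n)))"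
        using s m by (intro mult_mono ennreal_leI power_mono FI) (auto simp: frac_le)
      also have "\<dots> = ennreal ((1 / m) ^ (DIM('a) - 2) * (4 / (DIM('a))\<^sup>2)) * NP 2 (C2_compact.L (M n))"
        using m by (subst ennreal_mult) (auto simp: mult.assoc)
      finally show "(\<integral>\<^sup>+ x. ennreal (1 / (x \<bullet> x)\<^sup>2 * \<bar>x \<bullet> \<Gamma> n ((1 + t * (l - 1)) *\<^sub>R x) - 0\<bar> powr 2) \<partial>lborel)
         \<le> ennreal ((1 / m) ^ (DIM('a) - 2) * (4 / (DIM('a))\<^sup>2)) * NP 2 (C2_compact.L (M n))"
        unfolding s_def .
    qed auto
    then show "(\<integral>\<^sup>+ x. ennreal (1 / (x \<bullet> x)\<^sup>2 * \<bar>(\<phi> n (l *\<^sub>R x) - \<phi> n x) / (l - 1)\<bar> powr 2) \<partial>lborel)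
     \<le> ennreal ((1 / min 1 l) ^ (DIM('a) - 2) * (4 / (DIM('a))\<^sup>2)) * NP 2 (C2_compact.L (M n))"
      by (simp add: m_def)
  qed
qed auto

text \<open>Two embeddings in succession: with r = 2n/(n - 2) the function and its gradient lie in
  L^r, and from there the next exponent is 2n/(n - 4). The second step needs r < n, that is n >
  4.\<close>

lemma Sobolev_embedding_2:
  assumes d: "DIM('a) \<ge> 5"
  shows "NP (2 * DIM('a) / (DIM('a) - 4)) w < \<infinity>"
proof -
  define n where "n = real DIM('a)"
  have n: "n \<ge> 5" using d by (simp add: n_def)
  define r where "r = 2 * n / (n - 2)"
  have r: "r \<ge> 2" "r < n"
    using n by (auto simp: r_def field_simps)
  have 1: "NP r w < \<infinity>" unfolding r_def n_def by (rule Sobolev_embedding) (use d in auto)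
  have 2: "NP r (g i) < \<infinity>" if "i \<in> Basis" for i
  proof -
    interpret gi: W1_compact 2 R "g i" "h i" K by (rule W1g[OF that])
    show ?thesis unfolding r_def n_def by (rule gi.Sobolev_embedding) (use d in auto)
  qed
  interpret r: W1_compact r R w g K
    using r K 1 2 wm w0 gm g0 wpd by unfold_locales (auto simp: W1c_def)
  have "NP (r * n / (n - r)) w < \<infinity>" unfolding n_def by (rule r.Sobolev_embedding) (use r in \<open>auto simp: n_def\<close>)
  moreover have "r * n / (n - r) = 2 * n / (n - 4)"
  proof -
    have "n - r = n * (n - 4) / (n - 2)" using n by (simp add: r_def field_simps)
    then show ?thesis using n by (simp add: r_def)
  qed
  ultimately show ?thesis using d by (simp add: n_def of_nat_diff)
qed

end

section \<open>Calculus of weak derivatives\<close>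

lemma locint_NP:
  fixes f :: "'a::euclidean_space \<Rightarrow> real"
  assumes [measurable]: "f \<in> borel_measurable borel" and f: "NP p f < \<infinity>" "p \<ge> 1"
  shows "locint f"
  unfolding locint_def
proof (intro conjI allI)
  fix R
  have [measurable]: "cball (0::'a) R \<in> sets borel" by (rule borel_closed) simp
  have "NP p (\<lambda>x. indicator (cball 0 R) x * f x) < \<infinity>"
    using f by (intro NP_bound_mult_fin[where C=1]) auto
  then show "integrable lborel (\<lambda>x. indicator (cball 0 R) x * f x)"
    using f by (intro integrable_compact_support[where R=R and p=p]) auto
qed simp

text \<open>The Leibniz rule is transferred to the test function: \<kappa> \<phi> is again a test
  function.\<close>

lemma wpd_mult:
  assumes w: "wpd i f g" and f: "locint f" and g: "locint g" and \<kappa>: "smooth \<kappa>" and i: "i \<in> Basis"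
  shows "wpd i (\<lambda>x. \<kappa> x * f x) (\<lambda>x. \<kappa> x * g x + partial i \<kappa> x * f x)"
  unfolding wpd_def
proof (intro allI impI)
  fix \<phi> :: "'a \<Rightarrow> real" assume \<phi>: "test_function \<phi>"
  then have sm: "smooth \<phi>" by (simp add: test_function_iff)
  have t: "test_function (\<lambda>x. \<kappa> x * \<phi> x)" by (rule test_function_mult[OF \<kappa> \<phi>])
  have t': "test_function (\<lambda>x. partial i \<kappa> x * \<phi> x)" by (rule test_function_mult[OF smooth_partial[OF \<kappa> i] \<phi>])
  have e: "partial i \<phi> x * (\<kappa> x * f x) = partial i (\<lambda>x. \<kappa> x * \<phi> x) x * f x - (partial i \<kappa> x * \<phi> x) * f x" for x
    using partial_mult[OF \<kappa> sm i, of x] by (simp add: algebra_simps)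
  have "(\<integral>x. partial i \<phi> x * (\<kappa> x * f x) \<partial>lborel)
     = (\<integral>x. partial i (\<lambda>x. \<kappa> x * \<phi> x) x * f x \<partial>lborel) - (\<integral>x. (partial i \<kappa> x * \<phi> x) * f x \<partial>lborel)"
    unfolding e by (intro Bochner_Integration.integral_diff integrable_test_mult f test_function_partial t t' i)
  also have "(\<integral>x. partial i (\<lambda>x. \<kappa> x * \<phi> x) x * f x \<partial>lborel) = - (\<integral>x. (\<kappa> x * \<phi> x) * g x \<partial>lborel)"
    using w t unfolding wpd_def by blast
  also have "- (\<integral>x. (\<kappa> x * \<phi> x) * g x \<partial>lborel) - (\<integral>x. (partial i \<kappa> x * \<phi> x) * f x \<partial>lborel)
     = - (\<integral>x. (\<kappa> x * \<phi> x) * g x + (partial i \<kappa> x * \<phi> x) * f x \<partial>lborel)"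
    using integrable_test_mult[OF g t] integrable_test_mult[OF f t'] by simp
  also have "\<dots> = - (\<integral>x. \<phi> x * (\<kappa> x * g x + partial i \<kappa> x * f x) \<partial>lborel)"
    by (simp add: algebra_simps)
  finally show "(\<integral>x. partial i \<phi> x * (\<kappa> x * f x) \<partial>lborel) = - (\<integral>x. \<phi> x * (\<kappa> x * g x + partial i \<kappa> x * f x) \<partial>lborel)" .
qed

lemma wpd_dilation:
  fixes f :: "'a::euclidean_space \<Rightarrow> real"
  assumes w: "wpd i f g" and [measurable]: "f \<in> borel_measurable borel" "g \<in> borel_measurable borel" and c: "c > 0" and i: "i \<in> Basis"
  shows "wpd i (\<lambda>x. f (c *\<^sub>R x)) (\<lambda>x. c * g (c *\<^sub>R x))"
  unfolding wpd_def
proof (intro allI impI)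
  fix \<phi> :: "'a \<Rightarrow> real" assume \<phi>: "test_function \<phi>"
  define \<psi> where "\<psi> y = \<phi> ((1 / c) *\<^sub>R y + 0)" for y
  have \<psi>: "test_function \<psi>" unfolding \<psi>_def using c by (intro test_function_affine[OF \<phi>]) simp
  have p: "partial i \<psi> y = (1 / c) * partial i \<phi> ((1 / c) *\<^sub>R y + 0)" for y
    unfolding \<psi>_def using \<phi> i by (intro partial_affine) (auto simp: test_function_iff)
  have [measurable]: "\<phi> \<in> borel_measurable borel" "partial i \<phi> \<in> borel_measurable borel" "\<psi> \<in> borel_measurable borel" "partial i \<psi> \<in> borel_measurable borel"
    by (intro test_function_borel \<phi> \<psi> test_function_partial i)+
  have "(\<integral>x. partial i \<phi> x * f (c *\<^sub>R x) \<partial>lborel) = c * (\<integral>x. partial i \<psi> (c *\<^sub>R x + 0) * f (c *\<^sub>R x + 0) \<partial>lborel)"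
    unfolding p using c by simp
  also have "\<dots> = c * (1 / \<bar>c\<bar> ^ DIM('a) * (\<integral>x. partial i \<psi> x * f x \<partial>lborel))"
    using c by (subst integral_affine[of "\<lambda>x. partial i \<psi> x * f x"]) auto
  also have "(\<integral>x. partial i \<psi> x * f x \<partial>lborel) = - (\<integral>x. \<psi> x * g x \<partial>lborel)"
    using w \<psi> unfolding wpd_def by blast
  also have "c * (1 / \<bar>c\<bar> ^ DIM('a) * - (\<integral>x. \<psi> x * g x \<partial>lborel)) = - (c * (\<integral>x. \<psi> (c *\<^sub>R x + 0) * g (c *\<^sub>R x + 0) \<partial>lborel))"
    using c by (subst integral_affine[of "\<lambda>x. \<psi> x * g x"]) auto
  also have "\<dots> = - (\<integral>x. \<phi> x * (c * g (c *\<^sub>R x)) \<partial>lborel)"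
    using c by (simp add: \<psi>_def mult.left_commute[of _ c])
  finally show "(\<integral>x. partial i \<phi> x * f (c *\<^sub>R x) \<partial>lborel) = - (\<integral>x. \<phi> x * (c * g (c *\<^sub>R x)) \<partial>lborel)" .
qed

lemma wpd_lincomb:
  assumes "wpd i f g" "wpd i f' g'" "locint f" "locint g" "locint f'" "locint g'" "i \<in> Basis"
  shows "wpd i (\<lambda>x. a * f x + b * f' x) (\<lambda>x. a * g x + b * g' x)"
  unfolding wpd_def
proof (intro allI impI)
  fix \<phi> :: "'a \<Rightarrow> real" assume \<phi>: "test_function \<phi>"
  have t: "test_function (partial i \<phi>)" by (rule test_function_partial[OF \<phi> assms(7)])
  have "(\<integral>x. partial i \<phi> x * (a * f x + b * f' x) \<partial>lborel) = (\<integral>x. a * (partial i \<phi> x * f x) + b * (partial i \<phi> x * f' x) \<partial>lborel)"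
    by (simp add: algebra_simps)
  also have "\<dots> = a * (\<integral>x. partial i \<phi> x * f x \<partial>lborel) + b * (\<integral>x. partial i \<phi> x * f' x \<partial>lborel)"
    using integrable_test_mult[OF assms(3) t] integrable_test_mult[OF assms(5) t] by simp
  also have "\<dots> = a * - (\<integral>x. \<phi> x * g x \<partial>lborel) + b * - (\<integral>x. \<phi> x * g' x \<partial>lborel)"
    using assms(1,2) \<phi> unfolding wpd_def by simp
  also have "\<dots> = - (\<integral>x. a * (\<phi> x * g x) + b * (\<phi> x * g' x) \<partial>lborel)"
    using integrable_test_mult[OF assms(4) \<phi>] integrable_test_mult[OF assms(6) \<phi>] by simp
  also have "\<dots> = - (\<integral>x. \<phi> x * (a * g x + b * g' x) \<partial>lborel)" by (simp add: algebra_simps)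
  finally show "(\<integral>x. partial i \<phi> x * (a * f x + b * f' x) \<partial>lborel) = - (\<integral>x. \<phi> x * (a * g x + b * g' x) \<partial>lborel)" .
qed

lemma wpd_add:
  assumes "wpd i f g" "wpd i f' g'" "locint f" "locint g" "locint f'" "locint g'" "i \<in> Basis"
  shows "wpd i (\<lambda>x. f x + f' x) (\<lambda>x. g x + g' x)"
  using wpd_lincomb[OF assms, of 1 1] by simp

lemma wpd_0: "wpd i (\<lambda>x. 0) (\<lambda>x. 0)"
  by (simp add: wpd_def)

lemma locint_0: "locint (\<lambda>x. 0)"
  by (simp add: locint_def)

lemma locint_sum:
  "(\<And>k. k \<in> I \<Longrightarrow> locint (f k)) \<Longrightarrow> locint (\<lambda>x. \<Sum>k\<in>I. f k x)"
  by (induction I rule: infinite_finite_induct) (auto intro: locint_0 locint_add)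

lemma wpd_sum:
  assumes "i \<in> Basis" "\<And>k. k \<in> I \<Longrightarrow> wpd i (f k) (g k)" "\<And>k. k \<in> I \<Longrightarrow> locint (f k)" "\<And>k. k \<in> I \<Longrightarrow> locint (g k)"
  shows "wpd i (\<lambda>x. \<Sum>k\<in>I. f k x) (\<lambda>x. \<Sum>k\<in>I. g k x)"
  using assms(2-)
proof (induction I rule: infinite_finite_induct)
  case (insert k I)
  then show ?case using assms(1) by (simp, intro wpd_add locint_sum) auto
qed (simp_all add: wpd_0)

text \<open>Real H^2 functions together with chosen Borel representatives of the derivatives, where
  \<open>H i j\<close> is the derivative of \<open>G i\<close> in direction
  \<open>j\<close>.\<close>

definition H2r :: "('a::euclidean_space \<Rightarrow> real) \<Rightarrow> ('a \<Rightarrow> 'a \<Rightarrow> real) \<Rightarrow> ('a \<Rightarrow> 'a \<Rightarrow> 'a \<Rightarrow> real) \<Rightarrow> bool" where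
  "H2r u G H \<longleftrightarrow> u \<in> borel_measurable borel \<and> NP 2 u < \<infinity> \<and>
     (\<forall>i\<in>Basis. G i \<in> borel_measurable borel \<and> NP 2 (G i) < \<infinity> \<and> wpd i u (G i) \<and>
       (\<forall>j\<in>Basis. H i j \<in> borel_measurable borel \<and> NP 2 (H i j) < \<infinity> \<and> wpd j (G i) (H i j)))"

lemma W2c_iff: "W2c R w g h \<longleftrightarrow> H2r w g h \<and> (\<forall>x. norm x > R \<longrightarrow> w x = 0 \<and> (\<forall>i\<in>Basis. g i x = 0 \<and> (\<forall>j\<in>Basis. h i j x = 0)))"
  unfolding W2c_def W1c_def H2r_def using nonempty_Basis by blast

lemma test_function_eq_0:
  assumes "test_function \<kappa>" "\<And>x. norm x > R \<Longrightarrow> \<kappa> x = 0" "norm x > R"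
  shows "partial i \<kappa> x = 0" "partial j (partial i \<kappa>) x = 0"
proof -
  show "partial i \<kappa> x = 0" by (rule partial_eq_0[OF assms(3,2)])
  show "partial j (partial i \<kappa>) x = 0"
    by (rule partial_eq_0[OF assms(3)]) (rule partial_eq_0[OF _ assms(2)])
qed

lemma NP_test_mult_fin:
  assumes "test_function \<kappa>" "f \<in> borel_measurable borel" "NP p f < \<infinity>" "p \<ge> 0"
  shows "NP p (\<lambda>x. \<kappa> x * f x) < \<infinity>"
proof -
  obtain C where "\<And>x. \<bar>\<kappa> x\<bar> \<le> C" using test_function_bounded[OF assms(1)] by blast
  then show ?thesis using assms by (intro NP_bound_mult_fin) auto
qed

text \<open>Integrability is asked for only on the ball that carries the cutoff, since the potential
  is merely locally in L^(d/4).\<close>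

lemma W1c_mult:
  fixes f :: "'a::euclidean_space \<Rightarrow> real"
  assumes \<kappa>: "test_function \<kappa>" "\<And>x. norm x > R \<Longrightarrow> \<kappa> x = 0" and p: "p \<ge> 1"
    and f: "f \<in> borel_measurable borel" "locint f" "NP p (\<lambda>x. indicator (cball 0 R) x * f x) < \<infinity>"
    and g: "\<And>i. i \<in> Basis \<Longrightarrow> g i \<in> borel_measurable borel \<and> locint (g i) \<and> NP p (\<lambda>x. indicator (cball 0 R) x * g i x) < \<infinity> \<and> wpd i f (g i)"
  shows "W1c p R (\<lambda>x. \<kappa> x * f x) (\<lambda>i x. \<kappa> x * g i x + partial i \<kappa> x * f x)"
proof -
  have [measurable]: "f \<in> borel_measurable borel" "\<And>i. i \<in> Basis \<Longrightarrow> g i \<in> borel_measurable borel" "\<kappa> \<in> borel_measurable borel"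
    using f g test_function_borel[OF \<kappa>(1)] by auto
  have [measurable]: "\<And>i. i \<in> Basis \<Longrightarrow> partial i \<kappa> \<in> borel_measurable borel"
    by (intro test_function_borel test_function_partial \<kappa>)
  have cb[measurable]: "cball (0::'a) R \<in> sets borel" by (rule borel_closed) simp
  have fin: "NP p (\<lambda>x. \<psi> x * h x) < \<infinity>"
    if "test_function \<psi>" "\<And>x. norm x > R \<Longrightarrow> \<psi> x = 0" "h \<in> borel_measurable borel" "NP p (\<lambda>x. indicator (cball 0 R) x * h x) < \<infinity>" for \<psi> h :: "'a \<Rightarrow> real"
  proof -
    have [measurable]: "h \<in> borel_measurable borel" by (rule that)
    have "NP p (\<lambda>x. \<psi> x * (indicator (cball 0 R) x * h x)) < \<infinity>"
      using that p by (intro NP_test_mult_fin[where f="\<lambda>x. indicator (cball 0 R) x * h x"]) auto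
    also have "(\<lambda>x. \<psi> x * (indicator (cball 0 R) x * h x)) = (\<lambda>x. \<psi> x * h x)"
      using that(2) by (auto simp: fun_eq_iff indicator_def)
    finally show ?thesis .
  qed
  have sm: "smooth \<kappa>" using \<kappa> by (simp add: test_function_iff)
  have z: "partial i \<kappa> x = 0" if "norm x > R" for i x by (rule test_function_eq_0[OF \<kappa> that])
  show ?thesis
    unfolding W1c_def
  proof (intro conjI ballI allI impI)
    show "NP p (\<lambda>x. \<kappa> x * f x) < \<infinity>" by (rule fin[OF \<kappa> f(1,3)])
    fix i :: 'a assume i: "i \<in> Basis"
    show "NP p (\<lambda>x. \<kappa> x * g i x + partial i \<kappa> x * f x) < \<infinity>"
    proof (rule NP_add_fin)
      show "NP p (\<lambda>x. \<kappa> x * g i x) < \<infinity>" using g[OF i] by (intro fin[OF \<kappa>]) simp_all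
      show "NP p (\<lambda>x. partial i \<kappa> x * f x) < \<infinity>"
        by (rule fin[OF test_function_partial[OF \<kappa>(1) i] z f(1,3)])
    qed (use p i in \<open>auto intro!: borel_measurable_times\<close>)
    show "wpd i (\<lambda>x. \<kappa> x * f x) (\<lambda>x. \<kappa> x * g i x + partial i \<kappa> x * f x)"
      using g[OF i] by (intro wpd_mult f sm i) auto
    show "(\<lambda>x. \<kappa> x * g i x + partial i \<kappa> x * f x) \<in> borel_measurable borel" using i by measurable
  qed (auto simp: z \<kappa>(2))
qed

lemma NP_indicator_fin:
  fixes f :: "'a::euclidean_space \<Rightarrow> real"
  assumes [measurable]: "f \<in> borel_measurable borel" and "NP p f < \<infinity>" "p \<ge> 0"
  shows "NP p (\<lambda>x. indicator (cball 0 R) x * f x) < \<infinity>"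
  using assms by (intro NP_bound_mult_fin[where C=1]) auto

lemma W1c_mult_NP:
  fixes f :: "'a::euclidean_space \<Rightarrow> real"
  assumes \<kappa>: "test_function \<kappa>" "\<And>x. norm x > R \<Longrightarrow> \<kappa> x = 0" and p: "p \<ge> 1"
    and f: "f \<in> borel_measurable borel" "NP p f < \<infinity>"
    and g: "\<And>i. i \<in> Basis \<Longrightarrow> g i \<in> borel_measurable borel \<and> NP p (g i) < \<infinity> \<and> wpd i f (g i)"
  shows "W1c p R (\<lambda>x. \<kappa> x * f x) (\<lambda>i x. \<kappa> x * g i x + partial i \<kappa> x * f x)"
  using f g p by (intro W1c_mult \<kappa> p) (auto intro!: locint_NP[where p=p, simplified] NP_indicator_fin[simplified])

lemma W1c_sum:
  assumes "finite I" "\<And>k. k \<in> I \<Longrightarrow> W1c p R (f k) (g k)" "p \<ge> 1"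
  shows "W1c p R (\<lambda>x. \<Sum>k\<in>I. f k x) (\<lambda>i x. \<Sum>k\<in>I. g k i x)"
proof -
  have *: "f k \<in> borel_measurable borel" "NP p (f k) < \<infinity>" "norm x > R \<Longrightarrow> f k x = 0" if "k \<in> I" for k x
    using assms(2)[OF that] by (auto simp: W1c_def)
  have **: "g k i \<in> borel_measurable borel" "NP p (g k i) < \<infinity>" "norm x > R \<Longrightarrow> g k i x = 0" "wpd i (f k) (g k i)" if "k \<in> I" "i \<in> Basis" for k i x
    using assms(2)[OF that(1)] that(2) by (auto simp: W1c_def)
  show ?thesis
    unfolding W1c_def using assms(1,3) * **
    by (auto intro!: NP_sum_fin[simplified] wpd_sum locint_NP[of _ p] borel_measurable_sum sum.neutral)
qed

lemma W1c_cmult: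
  assumes "W1c p R f g" "p \<ge> 1"
  shows "W1c p R (\<lambda>x. c * f x) (\<lambda>i x. c * g i x)"
proof -
  have *: "f \<in> borel_measurable borel" "NP p f < \<infinity>"
    using assms(1) by (auto simp: W1c_def)
  have **: "g i \<in> borel_measurable borel" "NP p (g i) < \<infinity>" "wpd i f (g i)" if "i \<in> Basis" for i
    using assms(1) that by (auto simp: W1c_def)
  have w: "wpd i (\<lambda>x. c * f x) (\<lambda>x. c * g i x)" if "i \<in> Basis" for i
    using wpd_lincomb[OF **(3)[OF that] wpd_0 _ _ locint_0 locint_0 that, of c 0]
      locint_NP[OF * assms(2)] locint_NP[OF **(1,2)[OF that] assms(2)] by simp
  show ?thesis
    using assms(1) w * ** NP_cmult_fin[of _ p c] unfolding W1c_def by auto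
qed

lemma W1c_add:
  assumes "W1c p R f g" "W1c p R f' g'" "p \<ge> 1"
  shows "W1c p R (\<lambda>x. f x + f' x) (\<lambda>i x. g i x + g' i x)"
  using W1c_sum[of "UNIV :: bool set" p R "\<lambda>b. if b then f else f'" "\<lambda>b. if b then g else g'"] assms
  by (simp add: UNIV_bool add.commute)

lemma W1c_cong:
  assumes "W1c p R f g" "\<And>x. f x = f' x" "\<And>i x. i \<in> Basis \<Longrightarrow> g i x = g' i x"
  shows "W1c p R f' g'"
proof -
  have "f = f'" using assms(2) by auto
  moreover have "g i = g' i" if "i \<in> Basis" for i using assms(3)[OF that] by auto
  ultimately show ?thesis using assms(1) unfolding W1c_def by simp
qed

lemma W1c_dilation:
  assumes W: "W1c p R f g" and c: "c > 0" "p \<ge> 1" "R \<le> c * R'"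
  shows "W1c p R' (\<lambda>x. f (c *\<^sub>R x)) (\<lambda>i x. c * g i (c *\<^sub>R x))"
proof -
  have [measurable]: "f \<in> borel_measurable borel" "\<And>i. i \<in> Basis \<Longrightarrow> g i \<in> borel_measurable borel"
    using W by (auto simp: W1c_def)
  have n: "norm (c *\<^sub>R x) > R" if "norm x > R'" for x :: 'a
  proof -
    have "c * R' < c * norm x" using that c by simp
    then have "R < c * norm x" using c(3) by linarith
    then show ?thesis using c by simp
  qed
  have fin: "NP p (\<lambda>x. h (c *\<^sub>R x)) < \<infinity>" if "h \<in> borel_measurable borel" "NP p h < \<infinity>" for h :: "'a \<Rightarrow> real"
    using NP_affine[OF that(1), of c p 0] that(2) c by (simp add: ennreal_mult_less_top)
  show ?thesis
    unfolding W1c_def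
  proof (intro conjI ballI allI impI)
    show "NP p (\<lambda>x. f (c *\<^sub>R x)) < \<infinity>" using W by (intro fin) (auto simp: W1c_def)
    show "f (c *\<^sub>R x) = 0" if "norm x > R'" for x using W n[OF that] by (auto simp: W1c_def)
    fix i :: 'a assume i: "i \<in> Basis"
    show "NP p (\<lambda>x. c * g i (c *\<^sub>R x)) < \<infinity>" using W i by (intro NP_cmult_fin fin) (auto simp: W1c_def)
    show "c * g i (c *\<^sub>R x) = 0" if "norm x > R'" for x using W n[OF that] i by (auto simp: W1c_def)
    show "wpd i (\<lambda>x. f (c *\<^sub>R x)) (\<lambda>x. c * g i (c *\<^sub>R x))"
      using W i c by (intro wpd_dilation) (auto simp: W1c_def)
    show "(\<lambda>x. c * g i (c *\<^sub>R x)) \<in> borel_measurable borel" using i by measurable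
  qed measurable
qed

lemma W2c_mult:
  assumes \<kappa>: "test_function \<kappa>" "\<And>x. norm x > R \<Longrightarrow> \<kappa> x = 0" and u: "H2r u G H"
  shows "W2c R (\<lambda>x. \<kappa> x * u x) (\<lambda>i x. \<kappa> x * G i x + partial i \<kappa> x * u x)
    (\<lambda>i j x. (\<kappa> x * H i j x + partial j \<kappa> x * G i x) + (partial i \<kappa> x * G j x + partial j (partial i \<kappa>) x * u x))"
  unfolding W2c_def
proof (intro conjI ballI)
  show "W1c 2 R (\<lambda>x. \<kappa> x * u x) (\<lambda>i x. \<kappa> x * G i x + partial i \<kappa> x * u x)"
    using u by (intro W1c_mult_NP \<kappa>) (auto simp: H2r_def)
  fix i :: 'a assume i: "i \<in> Basis"
  show "W1c 2 R (\<lambda>x. \<kappa> x * G i x + partial i \<kappa> x * u x)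
    (\<lambda>j x. (\<kappa> x * H i j x + partial j \<kappa> x * G i x) + (partial i \<kappa> x * G j x + partial j (partial i \<kappa>) x * u x))"
    using u i test_function_eq_0[OF \<kappa>]
    by (intro W1c_add W1c_mult_NP \<kappa> test_function_partial) (auto simp: H2r_def)
qed

lemma W2c_lincomb:
  assumes "W2c R w g h" "W2c R w' g' h'"
  shows "W2c R (\<lambda>x. a * w x + b * w' x) (\<lambda>i x. a * g i x + b * g' i x) (\<lambda>i j x. a * h i j x + b * h' i j x)"
  using assms unfolding W2c_def by (auto intro!: W1c_add W1c_cmult)

lemma W2c_dilation:
  assumes W: "W2c R w g h" and c: "c > 0" "R \<le> c * R'"
  shows "W2c R' (\<lambda>x. w (c *\<^sub>R x)) (\<lambda>i x. c * g i (c *\<^sub>R x)) (\<lambda>i j x. c\<^sup>2 * h i j (c *\<^sub>R x))"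
  unfolding W2c_def
proof (intro conjI ballI)
  show "W1c 2 R' (\<lambda>x. w (c *\<^sub>R x)) (\<lambda>i x. c * g i (c *\<^sub>R x))"
    using W c by (intro W1c_dilation) (auto simp: W2c_def)
  fix i :: 'a assume i: "i \<in> Basis"
  have "W1c 2 R' (\<lambda>x. c * g i (c *\<^sub>R x)) (\<lambda>j x. c * (c * h i j (c *\<^sub>R x)))"
    using W c i by (intro W1c_cmult W1c_dilation) (auto simp: W2c_def)
  then show "W1c 2 R' (\<lambda>x. c * g i (c *\<^sub>R x)) (\<lambda>j x. c\<^sup>2 * h i j (c *\<^sub>R x))"
    by (rule W1c_cong) (auto simp: power2_eq_square)
qed

section \<open>The norm of square integrable functions\<close>

text \<open>The L^2 norm as a real number. It is 0 where the integral is infinite, so it is always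
  accompanied by finiteness of \<open>NP 2\<close>.\<close>

definition nm :: "('a::euclidean_space \<Rightarrow> real) \<Rightarrow> real" where
  "nm f = sqrt (enn2real (NP 2 f))"

lemma nm_nonneg: "nm f \<ge> 0"
  by (simp add: nm_def)

lemma NP_nm: "NP 2 f < \<infinity> \<Longrightarrow> NP 2 f = ennreal ((nm f)\<^sup>2)"
  by (simp add: nm_def ennreal_enn2real_if)

lemma nm_square: "f \<in> borel_measurable borel \<Longrightarrow> NP 2 f < \<infinity> \<Longrightarrow> (nm f)\<^sup>2 = (\<integral>x. (f x)\<^sup>2 \<partial>lborel)"
  using NP_2_integral(2)[of f] by (simp add: nm_def)

lemma nm_le: "NP 2 f \<le> ennreal (c\<^sup>2) \<Longrightarrow> c \<ge> 0 \<Longrightarrow> nm f \<le> c"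
  unfolding nm_def by (metis enn2real_leI real_sqrt_le_mono real_sqrt_unique zero_le_power2)

lemma integrable_mult_2:
  assumes "f \<in> borel_measurable borel" "g \<in> borel_measurable borel" "NP 2 f < \<infinity>" "NP 2 g < \<infinity>"
  shows "integrable lborel (\<lambda>x. f x * g x)"
  using assms by (intro integrable_mult_NP[where p=2 and q=2]) auto

lemma nm_Cauchy_Schwarz:
  assumes [measurable]: "f \<in> borel_measurable borel" "g \<in> borel_measurable borel" and fin: "NP 2 f < \<infinity>" "NP 2 g < \<infinity>"
  shows "\<bar>\<integral>x. f x * g x \<partial>lborel\<bar> \<le> nm f * nm g"
proof -
  have i: "integrable lborel (\<lambda>x. f x * g x)" by (rule integrable_mult_2[OF assms])
  have "ennreal \<bar>\<integral>x. f x * g x \<partial>lborel\<bar> \<le> (\<integral>\<^sup>+x. ennreal \<bar>f x\<bar> * ennreal \<bar>g x\<bar> \<partial>lborel)"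
    using integral_norm_bound_ennreal[OF i] by (simp add: abs_mult ennreal_mult)
  then have "(ennreal \<bar>\<integral>x. f x * g x \<partial>lborel\<bar>)\<^sup>2 \<le> (\<integral>\<^sup>+x. ennreal \<bar>f x\<bar> * ennreal \<bar>g x\<bar> \<partial>lborel)\<^sup>2"
    by (rule power_mono_ennreal)
  also have "\<dots> \<le> (\<integral>\<^sup>+x. (ennreal \<bar>f x\<bar>)\<^sup>2 \<partial>lborel) * (\<integral>\<^sup>+x. (ennreal \<bar>g x\<bar>)\<^sup>2 \<partial>lborel)"
    by (rule Cauchy_Schwarz_nn_integral) auto
  also have "\<dots> = NP 2 f * NP 2 g" by (simp add: NP_2 ennreal_power)
  also have "\<dots> = ennreal ((nm f * nm g)\<^sup>2)"
    unfolding NP_nm[OF fin(1)] NP_nm[OF fin(2)] by (simp add: power_mult_distrib ennreal_mult)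
  finally have "(\<bar>\<integral>x. f x * g x \<partial>lborel\<bar>)\<^sup>2 \<le> (nm f * nm g)\<^sup>2"
    by (simp add: ennreal_power ennreal_le_iff del: power2_abs)
  then show ?thesis by (rule power2_le_imp_le) (simp add: nm_nonneg)
qed

text \<open>Here the constant 1 matters: this inequality assembles the final bracket 4/d + 4/(d -
  4).\<close>

lemma nm_add_le:
  assumes [measurable]: "f \<in> borel_measurable borel" "g \<in> borel_measurable borel" and fin: "NP 2 f < \<infinity>" "NP 2 g < \<infinity>"
  shows "nm (\<lambda>x. f x + g x) \<le> nm f + nm g"
proof (rule power2_le_imp_le)
  have "(nm (\<lambda>x. f x + g x))\<^sup>2 = (\<integral>x. (f x + g x)\<^sup>2 \<partial>lborel)"
    using fin by (intro nm_square NP_add_fin) auto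
  also have "\<dots> = (\<integral>x. (f x)\<^sup>2 + (2 * (f x * g x) + (g x)\<^sup>2) \<partial>lborel)" by (simp add: power2_sum algebra_simps)
  also have "\<dots> = (nm f)\<^sup>2 + (2 * (\<integral>x. f x * g x \<partial>lborel) + (nm g)\<^sup>2)"
    using NP_2_integral(1)[OF assms(1,3)] NP_2_integral(1)[OF assms(2,4)] integrable_mult_2[OF assms] fin
    by (simp add: nm_square)
  also have "\<dots> \<le> (nm f)\<^sup>2 + (2 * (nm f * nm g) + (nm g)\<^sup>2)"
    using nm_Cauchy_Schwarz[OF assms] by simp
  also have "\<dots> = (nm f + nm g)\<^sup>2" by (simp add: power2_sum algebra_simps)
  finally show "(nm (\<lambda>x. f x + g x))\<^sup>2 \<le> (nm f + nm g)\<^sup>2" .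
qed (auto intro!: add_nonneg_nonneg nm_nonneg)

lemma nm_cmult: "f \<in> borel_measurable borel \<Longrightarrow> nm (\<lambda>x. c * f x) = \<bar>c\<bar> * nm f"
  unfolding nm_def by (subst NP_cmult) (auto simp: enn2real_mult real_sqrt_mult)

section \<open>Antisymmetrised dilations\<close>

lemma NP_tendsto_scale:
  assumes [measurable]: "\<And>n. F n \<in> borel_measurable borel" "G \<in> borel_measurable borel" and p: "p > 0"
    and a: "a \<longlonglongrightarrow> a'" and lim: "(\<lambda>n. NP p (\<lambda>x. F n x - G x)) \<longlonglongrightarrow> 0" and fin: "NP p G < \<infinity>"
  shows "(\<lambda>n. NP p (\<lambda>x. a n * F n x - a' * G x)) \<longlonglongrightarrow> 0"
proof -
  have "(\<lambda>n. \<bar>a n\<bar> powr p) \<longlonglongrightarrow> \<bar>a'\<bar> powr p" using p by (intro tendsto_powr' tendsto_rabs a tendsto_const) auto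
  then have "(\<lambda>n. ennreal (\<bar>a n\<bar> powr p) * NP p (\<lambda>x. F n x - G x)) \<longlonglongrightarrow> ennreal (\<bar>a'\<bar> powr p) * 0"
    by (intro tendsto_mult_ennreal tendsto_ennrealI lim) auto
  then have 1: "(\<lambda>n. NP p (\<lambda>x. a n * (F n x - G x))) \<longlonglongrightarrow> 0" by (simp add: NP_cmult)
  have "(\<lambda>n. \<bar>a n - a'\<bar> powr p) \<longlonglongrightarrow> 0 powr p"
    using p a by (intro tendsto_powr' tendsto_const) (auto simp: LIM_zero_iff tendsto_rabs_zero_iff)
  then have "(\<lambda>n. ennreal (\<bar>a n - a'\<bar> powr p) * NP p G) \<longlonglongrightarrow> ennreal 0 * NP p G"
    using p fin by (intro tendsto_mult_ennreal tendsto_ennrealI tendsto_const) auto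
  then have 2: "(\<lambda>n. NP p (\<lambda>x. (a n - a') * G x)) \<longlonglongrightarrow> 0" by (simp add: NP_cmult)
  have "(\<lambda>n. NP p (\<lambda>x. a n * (F n x - G x) + (a n - a') * G x)) \<longlonglongrightarrow> 0"
    using p by (intro NP_tendsto_0_add 1 2) auto
  then show ?thesis by (simp add: algebra_simps)
qed

text \<open>Adding and subtracting \<open>w\<close> leaves a quotient for l, a quotient for 1/l and
  a multiple of \<open>w\<close>. Since (1/l - 1) l = -(l - 1), the second has the same sign as the
  first, so \<open>E\<close> appears twice. With coefficients 1 and l^(-d) the limit is d w + 2 x
  \<bullet> \<nabla>w, the multiplier.\<close>

lemma (in W1_compact) antisymmetric_dilation_lim:
  assumes l: "l \<longlonglongrightarrow> 1" "\<And>n. l n > 1" and a: "\<alpha> \<longlonglongrightarrow> 1" "\<beta> \<longlonglongrightarrow> 1" and c: "(\<lambda>n. (\<alpha> n - \<beta> n) / (l n - 1)) \<longlonglongrightarrow> c"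
  shows "(\<lambda>n. NP p (\<lambda>x. (\<alpha> n * w (l n *\<^sub>R x) - \<beta> n * w ((1 / l n) *\<^sub>R x)) / (l n - 1) - (c * w x + 2 * E x))) \<longlonglongrightarrow> 0"
proof -
  have l1: "l n \<noteq> 1" "1 / l n \<noteq> 1" "l n > 0" for n using l(2)[of n] by auto
  have r: "(\<lambda>n. 1 / l n) \<longlonglongrightarrow> 1" using tendsto_divide[OF tendsto_const[of 1] l(1)] by simp
  have b: "(\<lambda>n. \<beta> n / l n) \<longlonglongrightarrow> 1" using tendsto_divide[OF a(2) l(1)] by simp
  have A: "(\<lambda>n. NP p (\<lambda>x. \<alpha> n * ((w (l n *\<^sub>R x) - w x) / (l n - 1)) - 1 * E x)) \<longlonglongrightarrow> 0"
    using l1 by (intro NP_tendsto_scale a difference_quotient_lim l p0 E_fin) auto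
  have B: "(\<lambda>n. NP p (\<lambda>x. (\<beta> n / l n) * ((w ((1 / l n) *\<^sub>R x) - w x) / (1 / l n - 1)) - 1 * E x)) \<longlonglongrightarrow> 0"
    using l1 by (intro NP_tendsto_scale b difference_quotient_lim r p0 E_fin) auto
  have C: "(\<lambda>n. NP p (\<lambda>x. ((\<alpha> n - \<beta> n) / (l n - 1)) * w x - c * w x)) \<longlonglongrightarrow> 0"
    by (intro NP_tendsto_scale c p0 wf) (auto simp: NP_def)
  have "(\<lambda>n. NP p (\<lambda>x. (\<alpha> n * ((w (l n *\<^sub>R x) - w x) / (l n - 1)) - 1 * E x) +
      (((\<beta> n / l n) * ((w ((1 / l n) *\<^sub>R x) - w x) / (1 / l n - 1)) - 1 * E x) + (((\<alpha> n - \<beta> n) / (l n - 1)) * w x - c * w x)))) \<longlonglongrightarrow> 0"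
    using p0 by (intro NP_tendsto_0_add A B C) auto
  moreover have "(\<alpha> n * ((w (l n *\<^sub>R x) - w x) / (l n - 1)) - 1 * E x) +
      (((\<beta> n / l n) * ((w ((1 / l n) *\<^sub>R x) - w x) / (1 / l n - 1)) - 1 * E x) + (((\<alpha> n - \<beta> n) / (l n - 1)) * w x - c * w x))
     = (\<alpha> n * w (l n *\<^sub>R x) - \<beta> n * w ((1 / l n) *\<^sub>R x)) / (l n - 1) - (c * w x + 2 * E x)" for n x
  proof -
    have e: "\<beta> / l * (b / (1 / l - 1)) = - (\<beta> * b / (l - 1))" if "l > 1" for \<beta> l b :: real
      using that by (simp add: divide_simps) (simp add: algebra_simps)
    show "(\<alpha> n * ((w (l n *\<^sub>R x) - w x) / (l n - 1)) - 1 * E x) +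
      (((\<beta> n / l n) * ((w ((1 / l n) *\<^sub>R x) - w x) / (1 / l n - 1)) - 1 * E x) + (((\<alpha> n - \<beta> n) / (l n - 1)) * w x - c * w x))
     = (\<alpha> n * w (l n *\<^sub>R x) - \<beta> n * w ((1 / l n) *\<^sub>R x)) / (l n - 1) - (c * w x + 2 * E x)"
      unfolding e[OF l(2)] using l1(1)[of n] by (simp add: diff_divide_distrib right_diff_distrib left_diff_distrib)
  qed
  ultimately show ?thesis by (simp only:)
qed

text \<open>The adjoint of a dilation, which is the source of antisymmetry in all four terms of the
  tested equation.\<close>

lemma integral_dilation_adjoint:
  fixes A B :: "'a::euclidean_space \<Rightarrow> real"
  assumes [measurable]: "A \<in> borel_measurable borel" "B \<in> borel_measurable borel" and l: "l > 0"
  shows "(\<integral>x. A (l *\<^sub>R x) * B x \<partial>lborel) = (1 / l) ^ DIM('a) * (\<integral>x. A x * B ((1 / l) *\<^sub>R x) \<partial>lborel)"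
  using integral_affine[of "\<lambda>x. A x * B ((1 / l) *\<^sub>R x)" l 0] l by (simp add: power_one_over)

text \<open>The limit is the derivative of l^m - l^(-k) at l = 1.\<close>

lemma power_difference_quotient_lim:
  assumes l: "l \<longlonglongrightarrow> 1" "\<And>n. l n \<noteq> (1::real)"
  shows "(\<lambda>n. (l n ^ m - (1 / l n) ^ k) / (l n - 1)) \<longlonglongrightarrow> real m + real k"
proof -
  have "((\<lambda>l::real. l ^ m - (1 / l) ^ k) has_real_derivative real m + real k) (at 1)"
    by (auto intro!: derivative_eq_intros)
  then have "((\<lambda>l::real. (l ^ m - (1 / l) ^ k) / (l - 1)) \<longlongrightarrow> real m + real k) (at 1)"
    by (simp add: has_field_derivative_iff)
  moreover have "filterlim l (at 1) sequentially" using l by (simp add: filterlim_at)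
  ultimately show ?thesis by (rule filterlim_compose)
qed

section \<open>The multiplier identity\<close>

lemma smooth_sum: "(\<And>i. i \<in> I \<Longrightarrow> smooth (f i)) \<Longrightarrow> smooth (\<lambda>x. \<Sum>i\<in>I. f i x)"
  by (induction I rule: infinite_finite_induct) (simp_all add: smooth_const smooth_add)

lemma NP_test_mult_tendsto_0:
  assumes \<kappa>: "test_function \<kappa>" and [measurable]: "\<And>n. F n \<in> borel_measurable borel" and p: "p \<ge> 0"
    and lim: "(\<lambda>n. NP p (F n)) \<longlonglongrightarrow> 0"
  shows "(\<lambda>n. NP p (\<lambda>x. \<kappa> x * F n x)) \<longlonglongrightarrow> 0"
proof -
  obtain C where C: "C \<ge> 0" "\<And>x. \<bar>\<kappa> x\<bar> \<le> C" using test_function_bounded[OF \<kappa>] by blast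
  show ?thesis
  proof (rule tendsto_sandwich[OF always_eventually always_eventually tendsto_const])
    show "(\<lambda>n. NP p (\<lambda>x. C * F n x)) \<longlonglongrightarrow> 0" by (intro NP_tendsto_0_cmult lim) auto
    show "\<forall>n. NP p (\<lambda>x. \<kappa> x * F n x) \<le> NP p (\<lambda>x. C * F n x)"
      using C p by (intro allI NP_mono) (auto simp: abs_mult intro!: mult_right_mono)
  qed auto
qed

lemma W2c_cong:
  assumes "W2c R w g h" "\<And>x. w x = w' x" "\<And>i x. i \<in> Basis \<Longrightarrow> g i x = g' i x"
    "\<And>i j x. i \<in> Basis \<Longrightarrow> j \<in> Basis \<Longrightarrow> h i j x = h' i j x"
  shows "W2c R w' g' h'"
  unfolding W2c_def
proof (intro conjI ballI)
  show "W1c 2 R w' g'" using assms(1) by (intro W1c_cong[OF _ assms(2,3)]) (auto simp: W2c_def)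
  fix i :: 'a assume i: "i \<in> Basis"
  show "W1c 2 R (g' i) (h' i)" using assms(1) i by (intro W1c_cong[OF _ assms(3,4)]) (auto simp: W2c_def)
qed

lemma H2r_W2c: "W2c R w g h \<Longrightarrow> H2r w g h"
  by (simp add: W2c_iff)

text \<open>The setting for real-valued functions and Borel representatives. Because V and z are
  real, the real and imaginary parts of a complex solution each fit it.\<close>

locale biharmonic =
  fixes u :: "'a::euclidean_space \<Rightarrow> real" and G H and V GV f and a z :: real
  assumes d: "DIM('a) \<ge> 5" and u: "H2r u G H"
    and V: "V \<in> borel_measurable borel" "\<And>R. NP (DIM('a) / 4) (\<lambda>x. indicator (cball 0 R) x * V x) < \<infinity>"
    and GV: "\<And>i. i \<in> Basis \<Longrightarrow> GV i \<in> borel_measurable borel"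
      "\<And>i R. i \<in> Basis \<Longrightarrow> NP (DIM('a) / 4) (\<lambda>x. indicator (cball 0 R) x * GV i x) < \<infinity>"
      "\<And>i. i \<in> Basis \<Longrightarrow> wpd i V (GV i)"
    and a: "0 \<le> a" "a < 1"
    and f: "f \<in> borel_measurable borel" "NP 2 (\<lambda>x. (x \<bullet> x) * f x) < \<infinity>"
    and eq: "\<And>R v gv hv. W2c R v gv hv \<Longrightarrow>
      (\<integral>x. (\<Sum>i\<in>Basis. H i i x) * (\<Sum>i\<in>Basis. hv i i x) \<partial>lborel) + (\<integral>x. V x * u x * v x \<partial>lborel)
        - z * (\<integral>x. u x * v x \<partial>lborel) = (\<integral>x. f x * v x \<partial>lborel)"
    and small: "\<And>R \<psi> g\<psi> h\<psi>. W2c R \<psi> g\<psi> h\<psi> \<Longrightarrow>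
      (\<integral>\<^sup>+x. ennreal (max (\<Sum>i\<in>Basis. (x \<bullet> i) * GV i x) 0 * (\<psi> x)\<^sup>2) \<partial>lborel)
        \<le> ennreal (4 * a) * NP 2 (\<lambda>x. \<Sum>i\<in>Basis. h\<psi> i i x)"

locale biharmonic_cutoff = biharmonic u G H V GV f a z
  for u :: "'a::euclidean_space \<Rightarrow> real" and G H V GV f a z +
  fixes \<kappa> :: "'a \<Rightarrow> real" and R :: real and n :: nat
  assumes n: "n = DIM('a)" and \<kappa>: "test_function \<kappa>" and \<kappa>1: "\<And>x. \<bar>\<kappa> x\<bar> \<le> 1" and \<kappa>0: "\<And>x. norm x > R \<Longrightarrow> \<kappa> x = 0" and R: "R > 0"
begin

text \<open>With \<open>w = \<kappa> u\<close>, the families \<open>W1\<close> and \<open>W2\<close> are its first and second derivatives, \<open>g = [\<Delta>, \<kappa>] u\<close> has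
  gradient \<open>g1\<close>, a prefix \<open>E\<close> stands for \<open>x \<cdot> \<nabla>\<close>, and \<open>Z\<close> is the limit of \<open>[\<Delta>, \<kappa>] y\<close> (the function
  \<open>Zk\<close> below) divided by \<open>l - 1\<close>, where \<open>\<kappa> y\<close> is the test function.\<close>

definition X where "X i = partial i \<kappa>"
definition X2 where "X2 i j = partial j (partial i \<kappa>)"
definition S where "S x = (\<Sum>i\<in>Basis. X2 i i x)"
definition w where "w x = \<kappa> x * u x"
definition W1 where "W1 i x = \<kappa> x * G i x + X i x * u x"
definition W2 where "W2 i j x = (\<kappa> x * H i j x + X j x * G i x) + (X i x * G j x + X2 i j x * u x)"
definition Dw where "Dw x = (\<Sum>i\<in>Basis. W2 i i x)"
definition Du where "Du x = (\<Sum>i\<in>Basis. H i i x)"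
definition g where "g x = (\<Sum>i\<in>Basis. 2 * (X i x * G i x)) + S x * u x"
definition g1 where "g1 j x = (\<Sum>i\<in>Basis. 2 * (X i x * H i j x + X2 i j x * G i x)) + (S x * G j x + partial j S x * u x)"
definition EV where "EV x = (\<Sum>i\<in>Basis. (x \<bullet> i) * GV i x)"
definition Ew where "Ew x = (\<Sum>i\<in>Basis. (x \<bullet> i) * W1 i x)"
definition EW where "EW k x = (\<Sum>i\<in>Basis. (x \<bullet> i) * W2 k i x)"
definition Eg where "Eg x = (\<Sum>i\<in>Basis. (x \<bullet> i) * g1 i x)"
definition Z where "Z x = (\<Sum>i\<in>Basis. 2 * (X i x * (real (n + 2) * W1 i x + 2 * EW i x))) + S x * (real n * w x + 2 * Ew x)"

lemma tX: "i \<in> Basis \<Longrightarrow> test_function (X i)"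
  unfolding X_def by (rule test_function_partial[OF \<kappa>])

lemma tX2: "i \<in> Basis \<Longrightarrow> j \<in> Basis \<Longrightarrow> test_function (X2 i j)"
  unfolding X2_def by (intro test_function_partial \<kappa>)

lemma X0: "norm x > R \<Longrightarrow> X i x = 0" and X20: "norm x > R \<Longrightarrow> X2 i j x = 0"
  unfolding X_def X2_def by (auto intro: test_function_eq_0[OF \<kappa> \<kappa>0])

lemma S0: "norm x > R \<Longrightarrow> S x = 0"
  by (simp add: S_def X20)

lemma tS: "test_function S"
  unfolding test_function_iff
proof
  show "smooth S" unfolding S_def[abs_def] using tX2 by (intro smooth_sum) (auto simp: test_function_iff)
qed (use S0 in blast)

lemma meas[measurable]: "u \<in> borel_measurable borel" "V \<in> borel_measurable borel" "f \<in> borel_measurable borel"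
  "i \<in> Basis \<Longrightarrow> G i \<in> borel_measurable borel" "i \<in> Basis \<Longrightarrow> j \<in> Basis \<Longrightarrow> H i j \<in> borel_measurable borel"
  "i \<in> Basis \<Longrightarrow> GV i \<in> borel_measurable borel" "\<kappa> \<in> borel_measurable borel" "S \<in> borel_measurable borel"
  "i \<in> Basis \<Longrightarrow> X i \<in> borel_measurable borel" "i \<in> Basis \<Longrightarrow> j \<in> Basis \<Longrightarrow> X2 i j \<in> borel_measurable borel"
  using u V f GV by (auto simp: H2r_def intro!: test_function_borel \<kappa> tS tX tX2)

lemma W2c_w: "W2c R w W1 W2"
  using W2c_mult[OF \<kappa> \<kappa>0 u] unfolding w_def[abs_def] W1_def[abs_def] W2_def[abs_def] X_def X2_def by simp

lemma wmeas[measurable]: "w \<in> borel_measurable borel" "i \<in> Basis \<Longrightarrow> W1 i \<in> borel_measurable borel"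
    "i \<in> Basis \<Longrightarrow> j \<in> Basis \<Longrightarrow> W2 i j \<in> borel_measurable borel" "Dw \<in> borel_measurable borel" "Du \<in> borel_measurable borel"
    "g \<in> borel_measurable borel" "EV \<in> borel_measurable borel" "Ew \<in> borel_measurable borel"
    "i \<in> Basis \<Longrightarrow> EW i \<in> borel_measurable borel"
  unfolding w_def[abs_def] W1_def[abs_def] W2_def[abs_def] Dw_def[abs_def] Du_def[abs_def] g_def[abs_def] EV_def[abs_def] Ew_def[abs_def] EW_def[abs_def]
  by measurable

lemma w0: "norm x > R \<Longrightarrow> w x = 0"
  by (simp add: w_def \<kappa>0)

lemma w_fin: "NP 2 w < \<infinity>" "i \<in> Basis \<Longrightarrow> NP 2 (W1 i) < \<infinity>" "i \<in> Basis \<Longrightarrow> j \<in> Basis \<Longrightarrow> NP 2 (W2 i j) < \<infinity>"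
  using W2c_w by (auto simp: W2c_iff H2r_def)

lemma Dw_fin: "NP 2 Dw < \<infinity>"
  unfolding Dw_def[abs_def] using w_fin by (intro NP_sum_fin) auto

lemma Du_fin: "NP 2 Du < \<infinity>"
  unfolding Du_def[abs_def] using u by (intro NP_sum_fin) (auto simp: H2r_def)

lemma W1c_g: "W1c 2 R g g1"
proof -
  have "W1c 2 R (\<lambda>x. (\<Sum>i\<in>Basis. 2 * (X i x * G i x)) + S x * u x)
     (\<lambda>j x. (\<Sum>i\<in>Basis. 2 * (X i x * H i j x + partial j (X i) x * G i x)) + (S x * G j x + partial j S x * u x))"
    using u X0 S0 by (intro W1c_add W1c_sum W1c_cmult W1c_mult_NP tX tS) (auto simp: H2r_def)
  then show ?thesis
    unfolding g_def[abs_def] g1_def[abs_def] X2_def X_def .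
qed

lemma g_fin: "NP 2 g < \<infinity>"
  using W1c_g by (simp add: W1c_def)

lemma g1_meas[measurable]: "i \<in> Basis \<Longrightarrow> g1 i \<in> borel_measurable borel"
  using W1c_g by (simp add: W1c_def)

lemma Eg_meas[measurable]: "Eg \<in> borel_measurable borel"
  unfolding Eg_def[abs_def] by measurable

lemma Z_meas[measurable]: "Z \<in> borel_measurable borel"
  unfolding Z_def[abs_def] by measurable

text \<open>The commutator identity for \<Delta> and multiplication by \<kappa>; it exchanges
  \<kappa> \<Delta>u for \<Delta>w at the price of \<open>g\<close>.\<close>

lemma Dw_eq: "Dw x = \<kappa> x * Du x + g x"
  unfolding Dw_def W2_def Du_def g_def S_def
  by (simp add: sum.distrib sum_distrib_left sum_distrib_right algebra_simps)

text \<open>Dilation factors in the interval (1, 2] that tend to 1, their inverses \<open>r\<close>,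
  and the step \<open>q\<close> by which the equation is divided.\<close>

definition l :: "nat \<Rightarrow> real" where "l k = 1 + 1 / (real k + 1)"
definition r :: "nat \<Rightarrow> real" where "r k = 1 / l k"
definition q :: "nat \<Rightarrow> real" where "q k = l k - 1"

lemma l: "l k > 1" "l k \<le> 2" "l k > 0" "l k \<noteq> 1" "l k \<noteq> 0"
  by (auto simp: l_def add_pos_pos field_simps)

lemma r: "r k > 0" "r k < 1" "r k \<ge> 1/2" "r k \<noteq> 1" "l k * r k = 1"
  using l[of k] by (auto simp: r_def field_simps)

lemma q: "q k > 0" "q k \<noteq> 0"
  using l[of k] by (auto simp: q_def)

lemma l_lim: "l \<longlonglongrightarrow> 1"
  unfolding l_def[abs_def] using tendsto_add[OF tendsto_const[of 1] LIMSEQ_inverse_real_of_nat]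
  by (simp add: inverse_eq_divide add.commute)

lemma r_lim: "r \<longlonglongrightarrow> 1"
  unfolding r_def[abs_def] using tendsto_divide[OF tendsto_const[of 1] l_lim] by simp

lemma powers_lim: "(\<lambda>k. (l k ^ i - r k ^ j) / q k) \<longlonglongrightarrow> real i + real j"
  unfolding r_def q_def by (rule power_difference_quotient_lim[OF l_lim l(4)])

lemma l_pow_lim: "(\<lambda>k. l k ^ i) \<longlonglongrightarrow> 1" and r_pow_lim: "(\<lambda>k. r k ^ i) \<longlonglongrightarrow> 1"
  using tendsto_power[OF l_lim, of i] tendsto_power[OF r_lim, of i] by simp_all

text \<open>This is T w minus the adjoint of T applied to w, where T is the dilation by
  \<open>l k\<close>.\<close>

definition y where "y k x = w (l k *\<^sub>R x) - r k ^ n * w (r k *\<^sub>R x)"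
definition Y1 where "Y1 k i x = l k * W1 i (l k *\<^sub>R x) - r k ^ (n + 1) * W1 i (r k *\<^sub>R x)"
definition Y2 where "Y2 k i j x = (l k)\<^sup>2 * W2 i j (l k *\<^sub>R x) - r k ^ (n + 2) * W2 i j (r k *\<^sub>R x)"
definition DY where "DY k x = (l k)\<^sup>2 * Dw (l k *\<^sub>R x) - r k ^ (n + 2) * Dw (r k *\<^sub>R x)"
definition Zk where "Zk k x = (\<Sum>i\<in>Basis. 2 * (X i x * Y1 k i x)) + S x * y k x"

text \<open>Dilation by \<open>r k\<close>, which is at least 1/2, at most doubles the radius of the
  support.\<close>

lemma W2c_y: "W2c (2 * R) (y k) (Y1 k) (Y2 k)"
proof -
  have "R \<le> l k * (2 * R)"
    using mult_mono[of 1 "l k" R "2 * R"] l[of k] R by simp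
  then have A: "W2c (2 * R) (\<lambda>x. w (l k *\<^sub>R x)) (\<lambda>i x. l k * W1 i (l k *\<^sub>R x)) (\<lambda>i j x. (l k)\<^sup>2 * W2 i j (l k *\<^sub>R x))"
    using l[of k] by (intro W2c_dilation[OF W2c_w]) auto
  have "R \<le> r k * (2 * R)" using mult_right_mono[OF r(3)[of k], of "2 * R"] R by simp
  then have B: "W2c (2 * R) (\<lambda>x. w (r k *\<^sub>R x)) (\<lambda>i x. r k * W1 i (r k *\<^sub>R x)) (\<lambda>i j x. (r k)\<^sup>2 * W2 i j (r k *\<^sub>R x))"
    using r[of k] by (intro W2c_dilation[OF W2c_w]) auto
  show ?thesis
    by (rule W2c_cong[OF W2c_lincomb[OF A B, of 1 "- (r k ^ n)"]])
      (auto simp: y_def Y1_def Y2_def power_add power2_eq_square)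
qed

lemma ymeas[measurable]: "y k \<in> borel_measurable borel" "i \<in> Basis \<Longrightarrow> Y1 k i \<in> borel_measurable borel" "DY k \<in> borel_measurable borel"
   "Zk k \<in> borel_measurable borel"
proof -
  show 1[measurable]: "y k \<in> borel_measurable borel" "i \<in> Basis \<Longrightarrow> Y1 k i \<in> borel_measurable borel" for i
    using W2c_y[of k] by (auto simp: W2c_iff H2r_def)
  show "DY k \<in> borel_measurable borel" unfolding DY_def[abs_def] by measurable
  show "Zk k \<in> borel_measurable borel" unfolding Zk_def[abs_def] by measurable
qed

lemma NP_dil_fin:
  assumes "h \<in> borel_measurable borel" "NP p h < \<infinity>" "c > 0"
  shows "NP p (\<lambda>x::'a. h (c *\<^sub>R x)) < \<infinity>"
  using NP_affine[OF assms(1), of c p 0] assms by (simp add: ennreal_mult_less_top)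

lemma y_fin: "NP 2 (y k) < \<infinity>" "i \<in> Basis \<Longrightarrow> NP 2 (Y1 k i) < \<infinity>"
  using W2c_y[of k] by (auto simp: W2c_iff H2r_def)

lemma DY_eq: "DY k x = (\<Sum>i\<in>Basis. Y2 k i i x)"
  unfolding DY_def Dw_def Y2_def by (simp add: sum_subtractf sum_distrib_left)

lemma DY_fin: "NP 2 (DY k) < \<infinity>"
  unfolding DY_eq[abs_def] using W2c_y[of k] by (intro NP_sum_fin) (auto simp: W2c_iff H2r_def)

lemma Zk_fin: "NP 2 (Zk k) < \<infinity>"
  unfolding Zk_def[abs_def] using y_fin
  by (intro NP_add_fin NP_sum_fin NP_cmult_fin NP_test_mult_fin tX tS) auto

text \<open>An operator minus its adjoint has vanishing quadratic form; this is where the spectral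
  parameter z drops out.\<close>

lemma wy_0: "(\<integral>x. w x * y k x \<partial>lborel) = 0"
proof -
  have i: "integrable lborel (\<lambda>x. w x * w (l k *\<^sub>R x))" "integrable lborel (\<lambda>x. w x * w (r k *\<^sub>R x))"
    using l r w_fin by (auto intro!: integrable_mult_2 NP_dil_fin[simplified])
  have "(\<integral>x. w x * y k x \<partial>lborel) = (\<integral>x. w x * w (l k *\<^sub>R x) - r k ^ n * (w x * w (r k *\<^sub>R x)) \<partial>lborel)"
    by (simp add: y_def algebra_simps)
  also have "\<dots> = (\<integral>x. w (l k *\<^sub>R x) * w x \<partial>lborel) - r k ^ n * (\<integral>x. w x * w (r k *\<^sub>R x) \<partial>lborel)"
    using i by (simp add: mult.commute)
  also have "\<dots> = 0" using integral_dilation_adjoint[of w w "l k"] l by (simp add: r_def n)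
  finally show ?thesis .
qed

text \<open>The test function is \<kappa> y. In the terms without derivatives its cutoff turns u
  into w; in the leading term \<kappa> \<Delta>u becomes \<Delta>w - g, and \<open>Zk\<close>
  collects the derivatives that fall on the outer cutoff.\<close>

lemma tested_equation:
  "(\<integral>x. Dw x * DY k x \<partial>lborel) - (\<integral>x. g x * DY k x \<partial>lborel) + (\<integral>x. Du x * Zk k x \<partial>lborel)
    + (\<integral>x. V x * w x * y k x \<partial>lborel) = (\<integral>x. f x * (\<kappa> x * y k x) \<partial>lborel)"
proof -
  have W: "W2c R (\<lambda>x. \<kappa> x * y k x) (\<lambda>i x. \<kappa> x * Y1 k i x + partial i \<kappa> x * y k x)
    (\<lambda>i j x. (\<kappa> x * Y2 k i j x + partial j \<kappa> x * Y1 k i x) + (partial i \<kappa> x * Y1 k j x + partial j (partial i \<kappa>) x * y k x))"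
    by (rule W2c_mult[OF \<kappa> \<kappa>0 H2r_W2c[OF W2c_y]])
  have L: "(\<Sum>i\<in>Basis. (\<kappa> x * Y2 k i i x + partial i \<kappa> x * Y1 k i x) + (partial i \<kappa> x * Y1 k i x + partial i (partial i \<kappa>) x * y k x))
    = \<kappa> x * DY k x + Zk k x" for x
    unfolding DY_eq Zk_def S_def X2_def X_def
    by (simp add: sum.distrib sum_distrib_left sum_distrib_right algebra_simps)
  have "(\<integral>x. Du x * (\<kappa> x * DY k x + Zk k x) \<partial>lborel) + (\<integral>x. V x * u x * (\<kappa> x * y k x) \<partial>lborel)
        - z * (\<integral>x. u x * (\<kappa> x * y k x) \<partial>lborel) = (\<integral>x. f x * (\<kappa> x * y k x) \<partial>lborel)"
    using eq[OF W] unfolding L Du_def[symmetric] .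
  moreover have "(\<integral>x. u x * (\<kappa> x * y k x) \<partial>lborel) = 0"
    using wy_0[of k] by (simp add: w_def mult_ac)
  moreover have "(\<integral>x. V x * u x * (\<kappa> x * y k x) \<partial>lborel) = (\<integral>x. V x * w x * y k x \<partial>lborel)"
    by (simp add: w_def mult_ac)
  moreover have "(\<integral>x. Du x * (\<kappa> x * DY k x + Zk k x) \<partial>lborel)
    = (\<integral>x. Dw x * DY k x \<partial>lborel) - (\<integral>x. g x * DY k x \<partial>lborel) + (\<integral>x. Du x * Zk k x \<partial>lborel)"
  proof -
    have i: "integrable lborel (\<lambda>x. Dw x * DY k x)" "integrable lborel (\<lambda>x. g x * DY k x)" "integrable lborel (\<lambda>x. Du x * Zk k x)"
      by (intro integrable_mult_2 Dw_fin DY_fin g_fin Du_fin Zk_fin; simp)+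
    have "(\<integral>x. Du x * (\<kappa> x * DY k x + Zk k x) \<partial>lborel) = (\<integral>x. Dw x * DY k x - g x * DY k x + Du x * Zk k x \<partial>lborel)"
      by (simp add: Dw_eq algebra_simps)
    then show ?thesis using i by simp
  qed
  ultimately show ?thesis by simp
qed

text \<open>\<Delta>w has no derivative to spare, yet none is needed: two derivatives give the
  factors l^2 and r^2, the adjoint relation identifies the two pairings, and only (l^2 - r^2)/q with
  limit 4 remains.\<close>

lemma laplacian_term_lim: "(\<lambda>k. (\<integral>x. Dw x * DY k x \<partial>lborel) / q k) \<longlonglongrightarrow> 4 * (nm Dw)\<^sup>2"
proof -
  have eq: "(\<integral>x. Dw x * DY k x \<partial>lborel) / q k = ((l k ^ 2 - r k ^ 2) / q k) * (\<integral>x. Dw (l k *\<^sub>R x) * Dw x \<partial>lborel)" for k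
  proof -
    have i: "integrable lborel (\<lambda>x. Dw x * Dw (l k *\<^sub>R x))" "integrable lborel (\<lambda>x. Dw x * Dw (r k *\<^sub>R x))"
      using l r Dw_fin by (auto intro!: integrable_mult_2 NP_dil_fin[simplified])
    have "(\<integral>x. Dw x * DY k x \<partial>lborel) = (\<integral>x. (l k)\<^sup>2 * (Dw x * Dw (l k *\<^sub>R x)) - r k ^ (n + 2) * (Dw x * Dw (r k *\<^sub>R x)) \<partial>lborel)"
      by (simp add: DY_def algebra_simps)
    also have "\<dots> = (l k)\<^sup>2 * (\<integral>x. Dw (l k *\<^sub>R x) * Dw x \<partial>lborel) - (r k)\<^sup>2 * (r k ^ n * (\<integral>x. Dw x * Dw (r k *\<^sub>R x) \<partial>lborel))"
      using i by (simp add: mult.commute power_add power2_eq_square)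
    also have "r k ^ n * (\<integral>x. Dw x * Dw (r k *\<^sub>R x) \<partial>lborel) = (\<integral>x. Dw (l k *\<^sub>R x) * Dw x \<partial>lborel)"
      using integral_dilation_adjoint[of Dw Dw "l k"] l by (simp add: r_def n)
    finally show ?thesis by (simp add: left_diff_distrib)
  qed
  have "(\<lambda>k. ((l k ^ 2 - r k ^ 2) / q k) * (\<integral>x. Dw (l k *\<^sub>R x) * Dw x \<partial>lborel)) \<longlonglongrightarrow> (real 2 + real 2) * (\<integral>x. Dw x * Dw x \<partial>lborel)"
    by (intro tendsto_mult powers_lim integral_mult_tendsto_2 NP_dilation_tendsto l_lim Dw_fin) (auto simp: NP_def)
  moreover have "(real 2 + real 2) * (\<integral>x. Dw x * Dw x \<partial>lborel) = 4 * (nm Dw)\<^sup>2"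
    using Dw_fin by (simp add: nm_square flip: power2_eq_square)
  ultimately show ?thesis unfolding eq by (simp only:)
qed

text \<open>A quotient of \<Delta>w need not converge, so the adjoint relation moves both dilations
  to \<open>g\<close>, which has one weak derivative.\<close>

lemma commutator_term_lim: "(\<lambda>k. - (\<integral>x. g x * DY k x \<partial>lborel) / q k) \<longlonglongrightarrow> (\<integral>x. ((real n - 4) * g x + 2 * Eg x) * Dw x \<partial>lborel)"
proof -
  obtain K :: "nat \<Rightarrow> 'a \<Rightarrow> real" where K: "mollifiers K" using mollifiers_exist by blast
  interpret G: W1_compact 2 R g g1 K using W1c_g K by unfold_locales auto
  have E: "G.E = Eg" by (simp add: fun_eq_iff G.E_def Eg_def)
  have n2: "2 + (n - 2) = n" using d n by simp
  \<comment> \<open>The moved coefficients are r^2 and r^(n - 2). Comparing both with l^0 = 1 gives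
    the limit (n - 2) - 2.\<close>
  have c: "(\<lambda>k. (r k ^ 2 - r k ^ (n - 2)) / (l k - 1)) \<longlonglongrightarrow> real n - 4"
  proof -
    have "(\<lambda>k. (l k ^ 0 - r k ^ (n - 2)) / q k - (l k ^ 0 - r k ^ 2) / q k) \<longlonglongrightarrow> (real 0 + real (n - 2)) - (real 0 + real 2)"
      by (intro tendsto_diff powers_lim)
    moreover have "(l k ^ 0 - r k ^ (n - 2)) / q k - (l k ^ 0 - r k ^ 2) / q k = (r k ^ 2 - r k ^ (n - 2)) / (l k - 1)" for k
      by (simp add: q_def diff_divide_distrib)
    moreover have "(real 0 + real (n - 2)) - (real 0 + real 2) = real n - 4" using d n by (simp add: of_nat_diff)
    ultimately show ?thesis by simp
  qed
  have eq: "- (\<integral>x. g x * DY k x \<partial>lborel) / q k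
      = (\<integral>x. ((r k ^ 2 * g (l k *\<^sub>R x) - r k ^ (n - 2) * g ((1 / l k) *\<^sub>R x)) / (l k - 1)) * Dw x \<partial>lborel)" for k
  proof -
    have i: "integrable lborel (\<lambda>x. g x * Dw (l k *\<^sub>R x))" "integrable lborel (\<lambda>x. g x * Dw (r k *\<^sub>R x))"
        "integrable lborel (\<lambda>x. g (l k *\<^sub>R x) * Dw x)" "integrable lborel (\<lambda>x. g (r k *\<^sub>R x) * Dw x)"
      using l r Dw_fin g_fin by (auto intro!: integrable_mult_2 NP_dil_fin[simplified])
    have "(\<integral>x. g x * DY k x \<partial>lborel) = (\<integral>x. (l k)\<^sup>2 * (g x * Dw (l k *\<^sub>R x)) - r k ^ (n + 2) * (g x * Dw (r k *\<^sub>R x)) \<partial>lborel)"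
      by (simp add: DY_def algebra_simps)
    also have "\<dots> = (l k)\<^sup>2 * (\<integral>x. Dw (l k *\<^sub>R x) * g x \<partial>lborel) - (r k)\<^sup>2 * (r k ^ n * (\<integral>x. g x * Dw (r k *\<^sub>R x) \<partial>lborel))"
      using i by (simp add: mult.commute power_add power2_eq_square)
    also have "r k ^ n * (\<integral>x. g x * Dw (r k *\<^sub>R x) \<partial>lborel) = (\<integral>x. g (l k *\<^sub>R x) * Dw x \<partial>lborel)"
      using integral_dilation_adjoint[of g Dw "l k"] l by (simp add: r_def n)
    also have "(\<integral>x. Dw (l k *\<^sub>R x) * g x \<partial>lborel) = r k ^ n * (\<integral>x. Dw x * g (r k *\<^sub>R x) \<partial>lborel)"
      using integral_dilation_adjoint[of Dw g "l k"] l by (simp add: r_def n)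
    \<comment> \<open>The factor l^2 from two derivatives cancels two of the powers of r from the
      Jacobian.\<close>
    also have "(l k)\<^sup>2 * (r k ^ n * (\<integral>x. Dw x * g (r k *\<^sub>R x) \<partial>lborel)) = r k ^ (n - 2) * (\<integral>x. Dw x * g (r k *\<^sub>R x) \<partial>lborel)"
    proof -
      have "r k ^ n = r k ^ 2 * r k ^ (n - 2)" using power_add[of "r k" 2 "n - 2"] n2 by metis
      then have "(l k)\<^sup>2 * r k ^ n = (l k * r k)\<^sup>2 * r k ^ (n - 2)" by (simp add: power_mult_distrib)
      then show ?thesis using r(5)[of k] by simp
    qed
    finally have "- (\<integral>x. g x * DY k x \<partial>lborel) = (r k)\<^sup>2 * (\<integral>x. g (l k *\<^sub>R x) * Dw x \<partial>lborel) - r k ^ (n - 2) * (\<integral>x. g (r k *\<^sub>R x) * Dw x \<partial>lborel)"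
      by (simp add: mult.commute)
    also have "\<dots> = (\<integral>x. (r k)\<^sup>2 * (g (l k *\<^sub>R x) * Dw x) - r k ^ (n - 2) * (g (r k *\<^sub>R x) * Dw x) \<partial>lborel)"
      using i by simp
    finally show ?thesis
      unfolding q_def by (simp add: r_def algebra_simps flip: integral_divide_zero)
  qed
  have lim: "(\<lambda>k. NP 2 (\<lambda>x. (r k ^ 2 * g (l k *\<^sub>R x) - r k ^ (n - 2) * g ((1 / l k) *\<^sub>R x)) / (l k - 1) - ((real n - 4) * g x + 2 * Eg x))) \<longlonglongrightarrow> 0"
    using G.antisymmetric_dilation_lim[OF l_lim l(1) r_pow_lim r_pow_lim c] unfolding E .
  have fin: "NP 2 (\<lambda>x. (real n - 4) * g x + 2 * Eg x) < \<infinity>"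
    using G.E_fin g_fin unfolding E by (intro NP_add_fin NP_cmult_fin) auto
  show ?thesis
    unfolding eq by (rule integral_mult_tendsto_2[OF _ _ _ _ lim _ fin Dw_fin]) (auto simp: NP_def)
qed

text \<open>Only \<open>w\<close> and its first derivatives are dilated here, so their quotients
  converge in L^2 directly. The derivative of the dilated function carries the coefficients l and
  r^(n + 1), which explains n + 2 in \<open>Z\<close>.\<close>

lemma cutoff_term_lim: "(\<lambda>k. (\<integral>x. Du x * Zk k x \<partial>lborel) / q k) \<longlonglongrightarrow> (\<integral>x. Du x * Z x \<partial>lborel)"
proof -
  obtain K :: "nat \<Rightarrow> 'a \<Rightarrow> real" where K: "mollifiers K" using mollifiers_exist by blast
  interpret w: W2_compact R w W1 W2 K using W2c_w K by unfold_locales auto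
  have Ew: "w.E = Ew" by (simp add: fun_eq_iff w.E_def Ew_def)
  have A: "(\<lambda>k. NP 2 (\<lambda>x. (l k ^ 0 * w (l k *\<^sub>R x) - r k ^ n * w ((1 / l k) *\<^sub>R x)) / (l k - 1) - (real n * w x + 2 * Ew x))) \<longlonglongrightarrow> 0"
    using w.antisymmetric_dilation_lim[OF l_lim l(1) l_pow_lim r_pow_lim powers_lim[of 0 n, unfolded q_def]] unfolding Ew by simp
  have A': "(\<lambda>k. NP 2 (\<lambda>x. y k x / q k - (real n * w x + 2 * Ew x))) \<longlonglongrightarrow> 0"
    using A by (simp add: y_def q_def r_def)
  have EWe: "W1_compact.E (W2 i) = EW i" if "i \<in> Basis" for i
    using W1_compact.E_def[OF w.W1g[OF that]] by (simp add: fun_eq_iff EW_def)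
  have B: "(\<lambda>k. NP 2 (\<lambda>x. Y1 k i x / q k - (real (n + 2) * W1 i x + 2 * EW i x))) \<longlonglongrightarrow> 0" if "i \<in> Basis" for i
  proof -
    interpret i: W1_compact 2 R "W1 i" "W2 i" K by (rule w.W1g[OF that])
    have pl: "(\<lambda>k. (l k ^ 1 - r k ^ (n + 1)) / (l k - 1)) \<longlonglongrightarrow> real (n + 2)"
      using powers_lim[of 1 "n + 1"] by (simp add: q_def add.commute)
    show ?thesis
      using i.antisymmetric_dilation_lim[OF l_lim l(1) l_pow_lim r_pow_lim pl] unfolding EWe[OF that]
      by (simp add: Y1_def q_def r_def)
  qed
  have fE: "NP 2 Ew < \<infinity>" using w.E_fin Ew by simp
  have fEW: "NP 2 (EW i) < \<infinity>" if "i \<in> Basis" for i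
    using W1_compact.E_fin[OF w.W1g[OF that]] EWe[OF that] by simp
  have "(\<lambda>k. NP 2 (\<lambda>x. (\<Sum>i\<in>Basis. 2 * (X i x * (Y1 k i x / q k - (real (n + 2) * W1 i x + 2 * EW i x)))) + S x * (y k x / q k - (real n * w x + 2 * Ew x)))) \<longlonglongrightarrow> 0"
    by (intro NP_tendsto_0_add NP_tendsto_0_sum NP_tendsto_0_cmult NP_test_mult_tendsto_0 tX tS A' B) auto
  moreover have "(\<Sum>i\<in>Basis. 2 * (X i x * (Y1 k i x / q k - (real (n + 2) * W1 i x + 2 * EW i x)))) + S x * (y k x / q k - (real n * w x + 2 * Ew x))
     = Zk k x / q k - Z x" for k x
    unfolding Zk_def Z_def by (simp add: add_divide_distrib sum_divide_distrib right_diff_distrib sum_subtractf algebra_simps)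
  ultimately have lim: "(\<lambda>k. NP 2 (\<lambda>x. Zk k x / q k - Z x)) \<longlonglongrightarrow> 0" by (simp only:)
  have "NP 2 Z < \<infinity>"
    unfolding Z_def[abs_def] using fE fEW w_fin
    by (intro NP_add_fin NP_sum_fin NP_cmult_fin NP_test_mult_fin tX tS) auto
  then have "(\<lambda>k. \<integral>x. Du x * (Zk k x / q k) \<partial>lborel) \<longlonglongrightarrow> (\<integral>x. Du x * Z x \<partial>lborel)"
    by (intro integral_mult_tendsto_2[OF _ _ _ _ _ lim Du_fin]) (auto simp: NP_def)
  then show ?thesis by simp
qed

end

section \<open>The potential term, the source term and the localised inequality\<close>

lemma partial_eq_0_inside:
  assumes "norm x < R" "\<And>x. norm x < R \<Longrightarrow> \<phi> x = c"
  shows "partial i \<phi> x = 0"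
proof -
  have "((\<lambda>_. c) has_derivative (\<lambda>_. 0)) (at x)" by simp
  then have "(\<phi> has_derivative (\<lambda>_. 0)) (at x)"
  proof (rule has_derivative_transform_within_open)
    show "open {x::'a. norm x < R}" by (intro open_Collect_less continuous_intros)
  qed (use assms in auto)
  from partial_eq[OF this] show ?thesis by simp
qed

text \<open>The two integrands agree also at the origin, since division by 0 gives 0 on both
  sides.\<close>

lemma NP_2_div_square:
  fixes h :: "'a::euclidean_space \<Rightarrow> real"
  shows "NP 2 (\<lambda>x. h x / (x \<bullet> x)) = (\<integral>\<^sup>+x. ennreal (1 / (x \<bullet> x)\<^sup>2 * \<bar>h x\<bar> powr 2) \<partial>lborel)"
  unfolding NP_2 by (intro nn_integral_cong) (simp add: power_divide)

context biharmonic_cutoff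
begin

lemma d5: "real n \<ge> 5" "n \<ge> 5"
  using d n by simp_all

text \<open>Continuity of dilations in L^(2p) is turned into convergence of products in L^p by
  applying Cauchy--Schwarz to the p-th powers of the factors.\<close>

lemma powr_dilation_product_lim:
  assumes p: "p > 1" and fin: "NP (2 * p) w < \<infinity>"
  shows "(\<lambda>k. NP p (\<lambda>x. w (l k *\<^sub>R x) * w x - w x * w x)) \<longlonglongrightarrow> 0" "NP p (\<lambda>x. w x * w x) < \<infinity>"
proof -
  have e: "\<bar>w x * w x\<bar> powr p = \<bar>w x\<bar> powr (2 * p)" for x
  proof -
    have "\<bar>w x * w x\<bar> powr p = \<bar>w x\<bar> powr p * \<bar>w x\<bar> powr p"
      unfolding abs_mult by (rule powr_mult)
    then show ?thesis by (simp add: powr_add[symmetric])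
  qed
  show "NP p (\<lambda>x. w x * w x) < \<infinity>" unfolding NP_def e using fin by (simp add: NP_def)
  have "(\<lambda>k. \<integral>\<^sup>+x. ennreal \<bar>\<bar>w (l k *\<^sub>R x) - w x\<bar> powr p * \<bar>w x\<bar> powr p\<bar> \<partial>lborel) \<longlonglongrightarrow> 0"
  proof (rule nn_integral_mult_tendsto_0[where p=2 and q=2 and B="enn2real (NP (2 * p) w)"])
    have "(\<lambda>k. NP (2 * p) (\<lambda>x. w (l k *\<^sub>R x) - w x)) \<longlonglongrightarrow> 0"
      using p by (intro NP_dilation_tendsto fin l_lim) auto
    then show "(\<lambda>k. NP 2 (\<lambda>x. \<bar>w (l k *\<^sub>R x) - w x\<bar> powr p)) \<longlonglongrightarrow> 0"
      by (simp add: NP_def powr_powr powr_realpow[symmetric] mult.commute flip: powr_numeral)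
    have "NP 2 (\<lambda>x. \<bar>w x\<bar> powr p) = NP (2 * p) w"
      by (simp add: NP_def powr_powr mult.commute flip: powr_numeral)
    then show "\<forall>\<^sub>F k in sequentially. NP 2 (\<lambda>x. \<bar>w x\<bar> powr p) \<le> ennreal (enn2real (NP (2 * p) w))"
      using fin by simp
  qed auto
  then show "(\<lambda>k. NP p (\<lambda>x. w (l k *\<^sub>R x) * w x - w x * w x)) \<longlonglongrightarrow> 0"
    by (simp add: NP_def abs_mult powr_mult flip: left_diff_distrib)
qed

text \<open>The adjoint relation moves the quotient from \<open>y\<close> to V, where it converges
  in L^(d/4). The remaining product of two copies of w converges in the dual space L^(d/(d - 4)),
  because w lies in L^(2d/(d - 4)).\<close>

lemma
  shows EV_integrable: "integrable lborel (\<lambda>x. EV x * (w x * w x))"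
    and potential_term_lim: "(\<lambda>k. (\<integral>x. V x * w x * y k x \<partial>lborel) / q k) \<longlonglongrightarrow> - (\<integral>x. EV x * (w x * w x) \<partial>lborel)"
proof -
  define p where "p = real n / 4"
  define p' where "p' = real n / (real n - 4)"
  have p: "p > 1" "p' > 1" "1 / p + 1 / p' = 1" using d5 by (auto simp: p_def p'_def field_simps)
  obtain K :: "nat \<Rightarrow> 'a \<Rightarrow> real" where K: "mollifiers K" using mollifiers_exist by blast
  interpret w: W2_compact R w W1 W2 K using W2c_w K by unfold_locales auto
  have wq: "NP (2 * p') w < \<infinity>"
    using w.Sobolev_embedding_2[OF d] d by (simp add: p'_def n of_nat_diff)
  note wp = powr_dilation_product_lim[OF p(2) wq]
  obtain \<kappa>' :: "'a \<Rightarrow> real" where \<kappa>': "smooth \<kappa>'" "\<And>x. 0 \<le> \<kappa>' x" "\<And>x. \<kappa>' x \<le> 1"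
    "\<And>x. norm x \<le> 1 \<Longrightarrow> \<kappa>' x = 1" "\<And>x. norm x \<ge> 2 \<Longrightarrow> \<kappa>' x = 0"
    using smooth_cutoff_exists by blast
  \<comment> \<open>The second cutoff is 1 on a ball that contains the support of \<open>w\<close>
    in its interior, so V and its gradient are unchanged there, while the product with V becomes
    globally integrable to the power d/4.\<close>
  define R' where "R' = 2 * R + 1"
  have R': "R' > 0" using R by (simp add: R'_def)
  define \<kappa>2 where "\<kappa>2 x = \<kappa>' ((1 / R') *\<^sub>R x + 0)" for x
  have "test_function \<kappa>'" using \<kappa>' by (auto simp: test_function_iff intro!: exI[of _ 2])
  then have t2: "test_function \<kappa>2" unfolding \<kappa>2_def using R' by (intro test_function_affine) auto
  have k2: "\<kappa>2 x = 1" if "norm x \<le> R'" for x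
    unfolding \<kappa>2_def using that R' by (intro \<kappa>'(4)) (simp add: field_simps)
  have k20: "\<kappa>2 x = 0" if "norm x > 2 * R'" for x
    unfolding \<kappa>2_def using that R' by (intro \<kappa>'(5)) (simp add: field_simps)
  define V0 where "V0 x = \<kappa>2 x * V x" for x
  define V1 where "V1 i x = \<kappa>2 x * GV i x + partial i \<kappa>2 x * V x" for i x
  have loc: "locint h" if [measurable]: "h \<in> borel_measurable borel" and "\<And>R. NP (DIM('a) / 4) (\<lambda>x. indicator (cball 0 R) x * h x) < \<infinity>" for h :: "'a \<Rightarrow> real"
    unfolding locint_def
  proof (intro conjI allI)
    fix \<rho>
    have [measurable]: "cball (0::'a) \<rho> \<in> sets borel" by (rule borel_closed) simp
    show "integrable lborel (\<lambda>x. indicator (cball 0 \<rho>) x * h x)"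
      using that(2)[of \<rho>] d5 n by (intro integrable_compact_support[where R=\<rho> and p=p]) (auto simp: p_def)
  qed (rule that)
  have "W1c (DIM('a) / 4) (2 * R') V0 V1"
    unfolding V0_def[abs_def] V1_def[abs_def]
    using d V GV by (intro W1c_mult t2 k20) (auto intro!: loc)
  then interpret V: W1_compact p "2 * R'" V0 V1 K
    using p K by unfold_locales (auto simp: p_def n)
  have VE: "V.E x * (w x * w x) = EV x * (w x * w x)" for x
  proof (cases "norm x \<le> R")
    case True
    then have "norm x < R'" using R by (simp add: R'_def)
    then have "V1 i x = GV i x" for i
      using k2[of x] partial_eq_0_inside[of x R' \<kappa>2 1 i] k2 by (simp add: V1_def)
    then show ?thesis by (simp add: V.E_def EV_def)
  qed (simp add: w0)
  have VE_fin: "NP p V.E < \<infinity>" by (rule V.E_fin)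
  have "integrable lborel (\<lambda>x. V.E x * (w x * w x))"
    by (rule integrable_mult_NP[OF _ _ p VE_fin wp(2)]) auto
  then show "integrable lborel (\<lambda>x. EV x * (w x * w x))" unfolding VE .
  have VV: "V0 x * h = V x * h" if "norm x \<le> R'" for x h using k2[OF that] by (simp add: V0_def)
  \<comment> \<open>The second dilation is moved from \<open>w\<close> to the product of V and w;
    the sign of the antisymmetry ends up as the minus sign before the quotient of V.\<close>
  have eq: "(\<integral>x. V x * w x * y k x \<partial>lborel) / q k = - (\<integral>x. ((V0 (l k *\<^sub>R x) - V0 x) / (l k - 1)) * (w (l k *\<^sub>R x) * w x) \<partial>lborel)" for k
  proof -
    have fin: "NP p' (\<lambda>x. w (c *\<^sub>R x) * w x) < \<infinity>" if "c > 0" for c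
    proof -
      have "NP p' (\<lambda>x. w (c *\<^sub>R x) * w x) \<le> NP p' (\<lambda>x. w (c *\<^sub>R x) * w (c *\<^sub>R x) + w x * w x)"
      proof (intro NP_mono)
        fix x
        show "\<bar>w (c *\<^sub>R x) * w x\<bar> \<le> \<bar>w (c *\<^sub>R x) * w (c *\<^sub>R x) + w x * w x\<bar>"
        proof -
          have "\<bar>a\<bar> * \<bar>b\<bar> \<le> a * a + b * b" for a b :: real
          proof -
            have "2 * (\<bar>a\<bar> * \<bar>b\<bar>) \<le> a * a + b * b"
              using zero_le_power2[of "\<bar>a\<bar> - \<bar>b\<bar>"] by (simp add: power2_eq_square algebra_simps)
            moreover have "0 \<le> \<bar>a\<bar> * \<bar>b\<bar>" by simp
            ultimately show ?thesis by linarith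
          qed
          from this[of "w (c *\<^sub>R x)" "w x"] show ?thesis
            by (simp add: abs_mult)
        qed
      qed (use p in auto)
      also have "\<dots> < \<infinity>"
        using wp(2) p that NP_dil_fin[of "\<lambda>x. w x * w x" p' c] by (intro NP_add_fin) auto
      finally show ?thesis .
    qed
    have V0f: "NP p V0 < \<infinity>" by (rule V.wf)
    have i: "integrable lborel (\<lambda>x. V0 x * (w (l k *\<^sub>R x) * w x))" "integrable lborel (\<lambda>x. V0 x * (w (r k *\<^sub>R x) * w x))"
      by (rule integrable_mult_NP[OF _ _ p V0f fin]; use l r in simp)+
    have i': "integrable lborel (\<lambda>x. V0 (l k *\<^sub>R x) * (w (l k *\<^sub>R x) * w x))"
      using l by (intro integrable_mult_NP[OF _ _ p _ fin] NP_dil_fin V0f) auto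
    have ww: "V x * w x = V0 x * w x" for x
      using VV[of x "w x"] w0[of x] R by (cases "norm x \<le> R") (auto simp: R'_def)
    have "(\<integral>x. V x * w x * y k x \<partial>lborel) = (\<integral>x. V0 x * (w (l k *\<^sub>R x) * w x) - r k ^ n * (V0 x * (w (r k *\<^sub>R x) * w x)) \<partial>lborel)"
      unfolding ww by (simp add: y_def algebra_simps)
    also have "\<dots> = (\<integral>x. V0 x * (w (l k *\<^sub>R x) * w x) \<partial>lborel) - r k ^ n * (\<integral>x. V0 x * (w (r k *\<^sub>R x) * w x) \<partial>lborel)"
      using i by simp
    also have "(\<integral>x. V0 x * (w (r k *\<^sub>R x) * w x) \<partial>lborel) = (\<integral>x. (V0 x * w x) * w (r k *\<^sub>R x) \<partial>lborel)"
      by (simp add: mult_ac)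
    also have "r k ^ n * (\<integral>x. (V0 x * w x) * w (r k *\<^sub>R x) \<partial>lborel) = (\<integral>x. (V0 (l k *\<^sub>R x) * w (l k *\<^sub>R x)) * w x \<partial>lborel)"
      using integral_dilation_adjoint[of "\<lambda>x. V0 x * w x" w "l k"] l by (simp add: r_def n)
    also have "(\<integral>x. V0 x * (w (l k *\<^sub>R x) * w x) \<partial>lborel) - (\<integral>x. (V0 (l k *\<^sub>R x) * w (l k *\<^sub>R x)) * w x \<partial>lborel)
       = - (\<integral>x. V0 (l k *\<^sub>R x) * (w (l k *\<^sub>R x) * w x) - V0 x * (w (l k *\<^sub>R x) * w x) \<partial>lborel)"
      using i i' by (simp add: mult.assoc)
    finally have "(\<integral>x. V x * w x * y k x \<partial>lborel) / q k = - ((\<integral>x. V0 (l k *\<^sub>R x) * (w (l k *\<^sub>R x) * w x) - V0 x * (w (l k *\<^sub>R x) * w x) \<partial>lborel) / q k)"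
      by simp
    then show ?thesis
      unfolding integral_divide_zero[symmetric] by (simp add: q_def left_diff_distrib)
  qed
  have lim: "(\<lambda>k. NP p (\<lambda>x. (V0 (l k *\<^sub>R x) - V0 x) / (l k - 1) - V.E x)) \<longlonglongrightarrow> 0"
    by (rule V.difference_quotient_lim[OF l_lim l(4)])
  have "(\<lambda>k. \<integral>x. ((V0 (l k *\<^sub>R x) - V0 x) / (l k - 1)) * (w (l k *\<^sub>R x) * w x) \<partial>lborel) \<longlonglongrightarrow> (\<integral>x. V.E x * (w x * w x) \<partial>lborel)"
    by (rule integral_mult_tendsto[OF _ _ _ _ p lim wp(1) VE_fin wp(2)]) auto
  then show "(\<lambda>k. (\<integral>x. V x * w x * y k x \<partial>lborel) / q k) \<longlonglongrightarrow> - (\<integral>x. EV x * (w x * w x) \<partial>lborel)"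
    unfolding eq VE by (rule tendsto_minus)
qed

text \<open>Only the positive part is controlled by the hypothesis; the negative part helps and is
  discarded.\<close>

lemma EV_le: "(\<integral>x. EV x * (w x * w x) \<partial>lborel) \<le> 4 * a * (nm Dw)\<^sup>2"
proof -
  have i: "integrable lborel (\<lambda>x. max (EV x * (w x * w x)) 0)"
    using EV_integrable by auto
  have m: "max (EV x * (w x * w x)) 0 = max (EV x) 0 * (w x)\<^sup>2" for x
    using max_mult_distrib_right[of "EV x" 0 "w x * w x"] by (simp add: power2_eq_square)
  have "(\<integral>x. EV x * (w x * w x) \<partial>lborel) \<le> (\<integral>x. max (EV x * (w x * w x)) 0 \<partial>lborel)"
    using EV_integrable i by (intro integral_mono) auto
  moreover have "ennreal (\<integral>x. max (EV x * (w x * w x)) 0 \<partial>lborel) = (\<integral>\<^sup>+x. ennreal (max (EV x) 0 * (w x)\<^sup>2) \<partial>lborel)"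
    using i by (subst nn_integral_eq_integral[symmetric]) (auto simp: m)
  moreover have "\<dots> \<le> ennreal (4 * a) * NP 2 Dw"
    using small[OF W2c_w] unfolding EV_def Dw_def[abs_def] .
  moreover have "\<dots> = ennreal (4 * a * (nm Dw)\<^sup>2)"
    using a by (simp add: NP_nm[OF Dw_fin] ennreal_mult)
  ultimately have "ennreal (\<integral>x. max (EV x * (w x * w x)) 0 \<partial>lborel) \<le> ennreal (4 * a * (nm Dw)\<^sup>2)" by simp
  then have "(\<integral>x. max (EV x * (w x * w x)) 0 \<partial>lborel) \<le> 4 * a * (nm Dw)\<^sup>2"
    using a by (subst (asm) ennreal_le_iff) auto
  with \<open>(\<integral>x. EV x * (w x * w x) \<partial>lborel) \<le> (\<integral>x. max (EV x * (w x * w x)) 0 \<partial>lborel)\<close>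
  show ?thesis by simp
qed

text \<open>The weight is split as |x|^2 f against y/|x|^2. The latter is decomposed into a quotient
  for l, a quotient for r and a multiple of w, bounded by Hardy--Rellich, Hardy--Rellich and Rellich
  respectively.\<close>

lemma source_bound:
  "\<bar>\<integral>x. f x * (\<kappa> x * y k x) \<partial>lborel\<bar> / q k \<le> nm (\<lambda>x. (x \<bullet> x) * f x) *
    ((2 / n + r k ^ n * ((1 - r k) / q k) * (sqrt (l k ^ (n - 2)) * (2 / n)) + (1 - r k ^ n) / q k * (4 / (n * (n - 4)))) * nm Dw)"
proof -
  obtain K :: "nat \<Rightarrow> 'a \<Rightarrow> real" where K: "mollifiers K" using mollifiers_exist by blast
  interpret w: W2_compact R w W1 W2 K using W2c_w K by unfold_locales auto
  have L: "w.Lap = Dw" by (simp add: fun_eq_iff w.Lap_def Dw_def)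
  define A where "A x = ((w (l k *\<^sub>R x) - w x) / (l k - 1)) / (x \<bullet> x)" for x
  define B where "B x = ((w (r k *\<^sub>R x) - w x) / (r k - 1)) / (x \<bullet> x)" for x
  define C where "C x = w x / (x \<bullet> x)" for x
  have [measurable]: "A \<in> borel_measurable borel" "B \<in> borel_measurable borel" "C \<in> borel_measurable borel"
    unfolding A_def[abs_def] B_def[abs_def] C_def[abs_def] by measurable
  have A: "NP 2 A \<le> ennreal ((2 / n * nm Dw)\<^sup>2)"
  proof -
    have "NP 2 A \<le> ennreal ((1 / min 1 (l k)) ^ (DIM('a) - 2) * (4 / (DIM('a))\<^sup>2)) * NP 2 Dw"
      unfolding A_def[abs_def] NP_2_div_square
      using w.Hardy_Rellich_difference_quotient[OF d l(3,4)] unfolding L .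
    also have "\<dots> = ennreal ((2 / n * nm Dw)\<^sup>2)"
      using l[of k] by (simp add: NP_nm[OF Dw_fin] n ennreal_mult[symmetric] power_mult_distrib power_divide)
    finally show ?thesis .
  qed
  have B: "NP 2 B \<le> ennreal ((sqrt (l k ^ (n - 2)) * (2 / n) * nm Dw)\<^sup>2)"
  proof -
    have "NP 2 B \<le> ennreal ((1 / min 1 (r k)) ^ (DIM('a) - 2) * (4 / (DIM('a))\<^sup>2)) * NP 2 Dw"
      unfolding B_def[abs_def] NP_2_div_square
      using w.Hardy_Rellich_difference_quotient[OF d r(1,4)] unfolding L .
    also have "1 / min 1 (r k) = l k" using r[of k] l[of k] by (simp add: r_def)
    also have "ennreal (l k ^ (DIM('a) - 2) * (4 / (DIM('a))\<^sup>2)) * NP 2 Dw = ennreal ((sqrt (l k ^ (n - 2)) * (2 / n) * nm Dw)\<^sup>2)"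
      using l[of k] by (simp add: NP_nm[OF Dw_fin] n ennreal_mult[symmetric] power_mult_distrib power_divide)
    finally show ?thesis .
  qed
  have C: "NP 2 C \<le> ennreal ((4 / (n * (n - 4)) * nm Dw)\<^sup>2)"
  proof -
    have "NP 2 C \<le> ennreal ((4 / (DIM('a) * (DIM('a) - 4)))\<^sup>2) * NP 2 Dw"
      unfolding C_def[abs_def] NP_2_div_square using w.Rellich[OF d] unfolding L .
    also have "\<dots> = ennreal ((4 / (n * (n - 4)) * nm Dw)\<^sup>2)"
      by (simp add: NP_nm[OF Dw_fin] n ennreal_mult[symmetric] power_mult_distrib power_divide)
    finally show ?thesis .
  qed
  have nA: "nm A \<le> 2 / n * nm Dw" by (rule nm_le[OF A]) (simp add: nm_nonneg)
  have nB: "nm B \<le> sqrt (l k ^ (n - 2)) * (2 / n) * nm Dw"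
    using l[of k] by (intro nm_le[OF B] mult_nonneg_nonneg nm_nonneg) auto
  have nC: "nm C \<le> 4 / (n * (n - 4)) * nm Dw" by (rule nm_le[OF C]) (simp add: nm_nonneg)
  have fin: "NP 2 A < \<infinity>" "NP 2 B < \<infinity>" "NP 2 C < \<infinity>"
    using le_less_trans[OF A] le_less_trans[OF B] le_less_trans[OF C] by auto
  define D where "D x = y k x / (x \<bullet> x)" for x
  have [measurable]: "D \<in> borel_measurable borel" unfolding D_def[abs_def] by measurable
  \<comment> \<open>Adding and subtracting w in both parts of \<open>y\<close> leaves (1 - r^n) w,
    the term that will supply the factor n in the limit.\<close>
  have Deq: "D x = q k * A x + (r k ^ n * (1 - r k) * B x + (1 - r k ^ n) * C x)" for x
  proof -
    have 1: "q k * A x = (w (l k *\<^sub>R x) - w x) / (x \<bullet> x)" using q[of k] by (simp add: A_def q_def)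
    have 2: "(1 - r k) * B x = - (w (r k *\<^sub>R x) - w x) / (x \<bullet> x)"
    proof -
      have "(1 - r k) * B x = ((1 - r k) / (r k - 1)) * ((w (r k *\<^sub>R x) - w x) / (x \<bullet> x))" by (simp add: B_def)
      also have "(1 - r k) / (r k - 1) = -1" using r(4)[of k] by (simp add: field_simps)
      finally show ?thesis by simp
    qed
    show ?thesis
      unfolding 1 mult.assoc 2 by (simp add: D_def C_def y_def diff_divide_distrib algebra_simps)
  qed
  have Dfin: "NP 2 D < \<infinity>"
    unfolding Deq[abs_def] by (intro NP_add_fin NP_cmult_fin fin) auto
  have r1: "r k ^ n \<le> 1" using r[of k] by (intro power_le_one) auto
  have "nm D \<le> nm (\<lambda>x. q k * A x) + nm (\<lambda>x. r k ^ n * (1 - r k) * B x + (1 - r k ^ n) * C x)"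
    unfolding Deq[abs_def] by (intro nm_add_le NP_add_fin NP_cmult_fin fin) auto
  also have "\<dots> \<le> nm (\<lambda>x. q k * A x) + (nm (\<lambda>x. r k ^ n * (1 - r k) * B x) + nm (\<lambda>x. (1 - r k ^ n) * C x))"
    by (intro add_left_mono nm_add_le NP_cmult_fin fin) auto
  also have "\<dots> = q k * nm A + (r k ^ n * (1 - r k) * nm B + (1 - r k ^ n) * nm C)"
    using q[of k] r[of k] r1 by (simp add: nm_cmult abs_mult)
  also have "\<dots> \<le> q k * (2 / n * nm Dw) + (r k ^ n * (1 - r k) * (sqrt (l k ^ (n - 2)) * (2 / n) * nm Dw) + (1 - r k ^ n) * (4 / (n * (n - 4)) * nm Dw))"
    using q[of k] r[of k] r1 by (intro add_mono mult_left_mono nA nB nC) auto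
  finally have nD: "nm D \<le> \<dots>" .
  define T where "T = (2 / n + r k ^ n * ((1 - r k) / q k) * (sqrt (l k ^ (n - 2)) * (2 / n)) + (1 - r k ^ n) / q k * (4 / (n * (n - 4)))) * nm Dw"
  have "q k * (2 / n * nm Dw) + (r k ^ n * (1 - r k) * (sqrt (l k ^ (n - 2)) * (2 / n) * nm Dw) + (1 - r k ^ n) * (4 / (n * (n - 4)) * nm Dw)) = q k * T"
  proof -
    \<comment> \<open>Isolated from the concrete expressions so that field arithmetic sees only
      variables.\<close>
    have gen: "Q * (a * m) + (e * x * (b * m) + y * (c * m)) = Q * ((a + e * (x / Q) * b + y / Q * c) * m)"
      if "Q \<noteq> 0" for Q a m e x b y c :: real
      using that by (simp add: field_simps)
    show ?thesis unfolding T_def by (rule gen[OF q(2)])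
  qed
  with nD have nD: "nm D \<le> q k * T" by simp
  have "(\<integral>x. f x * (\<kappa> x * y k x) \<partial>lborel) = (\<integral>x. ((x \<bullet> x) * f x) * (\<kappa> x * D x) \<partial>lborel)"
  proof (rule integral_cong_AE)
    show "AE x in lborel. f x * (\<kappa> x * y k x) = ((x \<bullet> x) * f x) * (\<kappa> x * D x)"
      using AE_lborel_singleton[of 0] by eventually_elim (simp add: D_def)
  qed auto
  also have "\<bar>\<dots>\<bar> \<le> nm (\<lambda>x. (x \<bullet> x) * f x) * nm (\<lambda>x. \<kappa> x * D x)"
  proof (rule nm_Cauchy_Schwarz[OF _ _ f(2)])
    show "NP 2 (\<lambda>x. \<kappa> x * D x) < \<infinity>"
      by (rule NP_bound_mult_fin[OF _ Dfin _ \<kappa>1]) auto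
  qed auto
  also have "\<dots> \<le> nm (\<lambda>x. (x \<bullet> x) * f x) * nm D"
  proof (intro mult_left_mono nm_nonneg)
    have "NP 2 (\<lambda>x. \<kappa> x * D x) \<le> NP 2 D"
      using \<kappa>1 by (intro NP_mono) (auto simp: abs_mult intro!: mult_left_le_one_le)
    also have "\<dots> = ennreal ((nm D)\<^sup>2)" by (rule NP_nm[OF Dfin])
    finally show "nm (\<lambda>x. \<kappa> x * D x) \<le> nm D" by (rule nm_le) (rule nm_nonneg)
  qed
  also have "\<dots> \<le> nm (\<lambda>x. (x \<bullet> x) * f x) * (q k * T)" by (intro mult_left_mono nD nm_nonneg)
  finally have "\<bar>\<integral>x. f x * (\<kappa> x * y k x) \<partial>lborel\<bar> / q k \<le> nm (\<lambda>x. (x \<bullet> x) * f x) * T"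
    by (subst pos_divide_le_eq[OF q(1)]) (simp only: mult_ac)
  then show ?thesis by (simp only: T_def)
qed

text \<open>The limit of the tested equation. The bracket is 2/n + 2/n from the two quotients and n
  times 4/(n (n - 4)) from the multiple of w; the two extra integrals are errors that live where
  \<kappa> varies.\<close>

lemma cutoff_inequality:
  "4 * (1 - a) * (nm Dw)\<^sup>2 + (\<integral>x. ((real n - 4) * g x + 2 * Eg x) * Dw x \<partial>lborel) + (\<integral>x. Du x * Z x \<partial>lborel)
    \<le> nm (\<lambda>x. (x \<bullet> x) * f x) * ((4 / n + 4 / (n - 4)) * nm Dw)"
proof -
  define L where "L k = (\<integral>x. Dw x * DY k x \<partial>lborel) / q k + - (\<integral>x. g x * DY k x \<partial>lborel) / q k + (\<integral>x. Du x * Zk k x \<partial>lborel) / q k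
    + (\<integral>x. V x * w x * y k x \<partial>lborel) / q k" for k
  have "L \<longlonglongrightarrow> 4 * (nm Dw)\<^sup>2 + (\<integral>x. ((real n - 4) * g x + 2 * Eg x) * Dw x \<partial>lborel) + (\<integral>x. Du x * Z x \<partial>lborel)
     + - (\<integral>x. EV x * (w x * w x) \<partial>lborel)"
    unfolding L_def[abs_def] by (intro tendsto_add laplacian_term_lim commutator_term_lim cutoff_term_lim potential_term_lim)
  moreover have "(\<lambda>k. nm (\<lambda>x. (x \<bullet> x) * f x) *
    ((2 / n + r k ^ n * ((1 - r k) / q k) * (sqrt (l k ^ (n - 2)) * (2 / n)) + (1 - r k ^ n) / q k * (4 / (n * (n - 4)))) * nm Dw))
    \<longlonglongrightarrow> nm (\<lambda>x. (x \<bullet> x) * f x) * ((2 / n + 1 * (real 0 + real 1) * (sqrt 1 * (2 / n)) + (real 0 + real n) * (4 / (n * (n - 4)))) * nm Dw)"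
    using powers_lim[of 0 1] powers_lim[of 0 n]
    by (intro tendsto_mult tendsto_add tendsto_const tendsto_real_sqrt r_pow_lim l_pow_lim) simp_all
  moreover have "L k \<le> nm (\<lambda>x. (x \<bullet> x) * f x) *
    ((2 / n + r k ^ n * ((1 - r k) / q k) * (sqrt (l k ^ (n - 2)) * (2 / n)) + (1 - r k ^ n) / q k * (4 / (n * (n - 4)))) * nm Dw)" for k
  proof -
    have "L k = ((\<integral>x. Dw x * DY k x \<partial>lborel) - (\<integral>x. g x * DY k x \<partial>lborel) + (\<integral>x. Du x * Zk k x \<partial>lborel)
      + (\<integral>x. V x * w x * y k x \<partial>lborel)) / q k" by (simp add: L_def add_divide_distrib diff_divide_distrib)
    also have "\<dots> = (\<integral>x. f x * (\<kappa> x * y k x) \<partial>lborel) / q k" by (simp add: tested_equation)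
    also have "\<dots> \<le> \<bar>\<integral>x. f x * (\<kappa> x * y k x) \<partial>lborel\<bar> / q k" using q[of k] by (intro divide_right_mono) auto
    finally show ?thesis using source_bound[of k] by linarith
  qed
  ultimately have "4 * (nm Dw)\<^sup>2 + (\<integral>x. ((real n - 4) * g x + 2 * Eg x) * Dw x \<partial>lborel) + (\<integral>x. Du x * Z x \<partial>lborel)
     + - (\<integral>x. EV x * (w x * w x) \<partial>lborel)
     \<le> nm (\<lambda>x. (x \<bullet> x) * f x) * ((2 / n + 1 * (real 0 + real 1) * (sqrt 1 * (2 / n)) + (real 0 + real n) * (4 / (n * (n - 4)))) * nm Dw)"
    by (intro LIMSEQ_le[of L]) auto
  moreover have "2 / n + 1 * (real 0 + real 1) * (sqrt 1 * (2 / n)) + (real 0 + real n) * (4 / (n * (n - 4))) = 4 / n + 4 / (n - 4)"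
    using d5 by simp
  ultimately have "4 * (nm Dw)\<^sup>2 + (\<integral>x. ((real n - 4) * g x + 2 * Eg x) * Dw x \<partial>lborel) + (\<integral>x. Du x * Z x \<partial>lborel)
     + - (\<integral>x. EV x * (w x * w x) \<partial>lborel) \<le> nm (\<lambda>x. (x \<bullet> x) * f x) * ((4 / n + 4 / (n - 4)) * nm Dw)"
    by (simp only:)
  moreover have "4 * (1 - a) * (nm Dw)\<^sup>2 = 4 * (nm Dw)\<^sup>2 - 4 * a * (nm Dw)\<^sup>2" by (simp add: algebra_simps)
  ultimately show ?thesis using EV_le by linarith
qed

end

section \<open>Removing the cutoff\<close>

lemma abs_sum_Basis_le:
  fixes F :: "'a::euclidean_space \<Rightarrow> real"
  assumes "\<And>i. i \<in> Basis \<Longrightarrow> \<bar>F i\<bar> \<le> c"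
  shows "\<bar>\<Sum>i\<in>Basis. F i\<bar> \<le> real DIM('a) * c"
  using order.trans[OF sum_abs sum_bounded_above[of Basis "\<lambda>i. \<bar>F i\<bar>" c]] assms by simp

lemma abs_mult_le: "\<bar>a\<bar> \<le> A \<Longrightarrow> \<bar>b\<bar> \<le> B \<Longrightarrow> \<bar>a * b\<bar> \<le> A * (B::real)"
  unfolding abs_mult by (intro mult_mono) auto

lemma abs_twice_add_le: "\<bar>a\<bar> \<le> A \<Longrightarrow> \<bar>b\<bar> \<le> A \<Longrightarrow> \<bar>2 * (a + b)\<bar> \<le> 4 * (A::real)"
  using abs_triangle_ineq[of a b] by (simp add: abs_mult)

lemma abs_twice_add_twice_le: "\<bar>a\<bar> \<le> A \<Longrightarrow> \<bar>b\<bar> \<le> B \<Longrightarrow> \<bar>2 * (a + 2 * b)\<bar> \<le> 2 * (A + 2 * (B::real))"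
  using abs_triangle_ineq[of a "2 * b"] by (simp add: abs_mult)

context biharmonic
begin

text \<open>A square integrable majorant of u and all its derivatives up to order two; it does not
  involve the cutoff and so can dominate all error terms at once.\<close>

definition T where "T x = \<bar>u x\<bar> + (\<Sum>i\<in>Basis. \<bar>G i x\<bar>) + (\<Sum>i\<in>Basis. \<Sum>j\<in>Basis. \<bar>H i j x\<bar>)"

lemma T_bounds: "\<bar>u x\<bar> \<le> T x" "i \<in> Basis \<Longrightarrow> \<bar>G i x\<bar> \<le> T x" "i \<in> Basis \<Longrightarrow> j \<in> Basis \<Longrightarrow> \<bar>H i j x\<bar> \<le> T x" "T x \<ge> 0"
proof -
  have nn: "(\<Sum>i\<in>Basis. \<bar>G i x\<bar>) \<ge> 0" "(\<Sum>i\<in>Basis. \<Sum>j\<in>Basis. \<bar>H i j x\<bar>) \<ge> 0"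
    by (auto intro!: sum_nonneg)
  show "\<bar>u x\<bar> \<le> T x" "T x \<ge> 0" using nn by (auto simp: T_def)
  show "\<bar>G i x\<bar> \<le> T x" if "i \<in> Basis"
    using nn member_le_sum[of i Basis "\<lambda>i. \<bar>G i x\<bar>"] that by (auto simp: T_def)
  show "\<bar>H i j x\<bar> \<le> T x" if "i \<in> Basis" "j \<in> Basis"
  proof -
    have "\<bar>H i j x\<bar> \<le> (\<Sum>j\<in>Basis. \<bar>H i j x\<bar>)"
      using member_le_sum[of j Basis "\<lambda>j. \<bar>H i j x\<bar>"] that by auto
    also have "\<dots> \<le> (\<Sum>i\<in>Basis. \<Sum>j\<in>Basis. \<bar>H i j x\<bar>)"
      using member_le_sum[of i Basis "\<lambda>i. \<Sum>j\<in>Basis. \<bar>H i j x\<bar>"] that by (auto intro: sum_nonneg)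
    finally show ?thesis using nn(1) abs_ge_zero[of "u x"] unfolding T_def by linarith
  qed
qed

lemma T_L2: "T \<in> borel_measurable borel" "NP 2 T < \<infinity>" "integrable lborel (\<lambda>x. (T x)\<^sup>2)"
proof -
  have [measurable]: "u \<in> borel_measurable borel" "\<And>i. i \<in> Basis \<Longrightarrow> G i \<in> borel_measurable borel"
    "\<And>i j. i \<in> Basis \<Longrightarrow> j \<in> Basis \<Longrightarrow> H i j \<in> borel_measurable borel"
    using u by (auto simp: H2r_def)
  show 1: "T \<in> borel_measurable borel" unfolding T_def[abs_def] by measurable
  show 2: "NP 2 T < \<infinity>" unfolding T_def[abs_def] using u
    by (intro NP_add_fin NP_sum_fin) (auto simp: H2r_def NP_abs)
  show "integrable lborel (\<lambda>x. (T x)\<^sup>2)" by (rule NP_2_integral(1)[OF 1 2])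
qed

end

context biharmonic_cutoff
begin

text \<open>All errors are quadratic in \<open>T\<close> with coefficients that depend only on the
  dimension and on a bound \<open>B\<close> for the derivatives of \<kappa>, bare or multiplied by
  one coordinate. The numerical constants are not optimised.\<close>

lemma error_bounds:
  assumes B: "B \<ge> 1"
    and X: "\<And>i. i \<in> Basis \<Longrightarrow> \<bar>X i x\<bar> \<le> B" "\<And>i k. i \<in> Basis \<Longrightarrow> k \<in> Basis \<Longrightarrow> \<bar>(x \<bullet> k) * X i x\<bar> \<le> B"
    and X2: "\<And>i j. i \<in> Basis \<Longrightarrow> j \<in> Basis \<Longrightarrow> \<bar>X2 i j x\<bar> \<le> B" "\<And>i j k. i \<in> Basis \<Longrightarrow> j \<in> Basis \<Longrightarrow> k \<in> Basis \<Longrightarrow> \<bar>(x \<bullet> k) * X2 i j x\<bar> \<le> B"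
    and S1: "\<And>j k. j \<in> Basis \<Longrightarrow> k \<in> Basis \<Longrightarrow> \<bar>(x \<bullet> k) * partial j S x\<bar> \<le> B"
  defines "N \<equiv> real n"
  shows "\<bar>Dw x\<bar> \<le> N * (4 * B * T x)"
    and "\<bar>((N - 4) * g x + 2 * Eg x) * Dw x\<bar> \<le> (N * (3 * N * B) + 2 * (N * (6 * N * B))) * (N * (4 * B)) * (T x)\<^sup>2"
    and "\<bar>Du x * Z x\<bar> \<le> N * (N * (2 * (B * ((N + 2) * (2 * B)) + 2 * (N * (B * (4 * B))))) + (N * B * N + 2 * (N * (N * B * (2 * B))))) * (T x)\<^sup>2"
proof -
  have N: "N \<ge> 5" using d5 by (simp add: N_def)
  note N' = n[symmetric]
  define t where "t = T x"
  have t: "\<bar>u x\<bar> \<le> t" "\<And>i. i \<in> Basis \<Longrightarrow> \<bar>G i x\<bar> \<le> t" "\<And>i j. i \<in> Basis \<Longrightarrow> j \<in> Basis \<Longrightarrow> \<bar>H i j x\<bar> \<le> t" "t \<ge> 0"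
    using T_bounds by (auto simp: t_def)
  have tB: "t \<le> B * t" using mult_right_mono[OF B t(4)] by simp
  have k1: "\<bar>\<kappa> x * h\<bar> \<le> B * t" if "\<bar>h\<bar> \<le> t" for h
    using abs_mult_le[OF \<kappa>1[of x] that] tB by simp
  have S: "\<bar>S x\<bar> \<le> N * B" unfolding S_def N_def n by (intro abs_sum_Basis_le X2)
  have xS: "\<bar>(x \<bullet> k) * S x\<bar> \<le> N * B" if "k \<in> Basis" for k
    unfolding S_def N_def n sum_distrib_left by (intro abs_sum_Basis_le X2 that)
  have w: "\<bar>w x\<bar> \<le> t" unfolding w_def using abs_mult_le[OF \<kappa>1[of x] t(1)] by simp
  have W1: "\<bar>W1 i x\<bar> \<le> 2 * B * t" if "i \<in> Basis" for i
    unfolding W1_def using k1[OF t(2)[OF that]] abs_mult_le[OF X(1)[OF that] t(1)] by linarith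
  have W2: "\<bar>W2 i j x\<bar> \<le> 4 * B * t" if "i \<in> Basis" "j \<in> Basis" for i j
    unfolding W2_def using k1[OF t(3)[OF that]] abs_mult_le[OF X(1)[OF that(2)] t(2)[OF that(1)]]
      abs_mult_le[OF X(1)[OF that(1)] t(2)[OF that(2)]] abs_mult_le[OF X2(1)[OF that] t(1)] by linarith
  show Dw: "\<bar>Dw x\<bar> \<le> N * (4 * B * T x)"
    unfolding Dw_def N_def n t_def[symmetric] by (intro abs_sum_Basis_le W2)
  have Du: "\<bar>Du x\<bar> \<le> N * t"
    unfolding Du_def N_def n by (intro abs_sum_Basis_le t)
  have g: "\<bar>g x\<bar> \<le> 3 * N * B * t"
  proof -
    have "\<bar>\<Sum>i\<in>Basis. 2 * (X i x * G i x)\<bar> \<le> N * (2 * (B * t))"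
      unfolding N_def n
    proof (rule abs_sum_Basis_le)
      fix i :: 'a assume i: "i \<in> Basis"
      show "\<bar>2 * (X i x * G i x)\<bar> \<le> 2 * (B * t)" using abs_mult_le[OF X(1)[OF i] t(2)[OF i]] by simp
    qed
    moreover have "\<bar>S x * u x\<bar> \<le> N * B * t" by (rule abs_mult_le[OF S t(1)])
    ultimately show ?thesis unfolding g_def by (simp add: algebra_simps)
  qed
  have Eg: "\<bar>Eg x\<bar> \<le> N * (6 * N * B * t)"
    unfolding Eg_def
  \<comment> \<open>Only the outermost \<open>N\<close> is opened into the dimension, to match the
    number of summands.\<close>
  proof (subst (1) N_def, subst n, rule abs_sum_Basis_le)
    fix j :: 'a assume j: "j \<in> Basis"
    have "\<bar>\<Sum>i\<in>Basis. 2 * (((x \<bullet> j) * X i x) * H i j x + ((x \<bullet> j) * X2 i j x) * G i x)\<bar> \<le> N * (4 * (B * t))"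
      unfolding N_def n
    proof (rule abs_sum_Basis_le)
      fix i :: 'a assume i: "i \<in> Basis"
      show "\<bar>2 * (((x \<bullet> j) * X i x) * H i j x + ((x \<bullet> j) * X2 i j x) * G i x)\<bar> \<le> 4 * (B * t)"
        using abs_mult_le[OF X(2)[OF i j] t(3)[OF i j]] abs_mult_le[OF X2(2)[OF i j j] t(2)[OF i]] by (rule abs_twice_add_le)
    qed
    moreover have "\<bar>((x \<bullet> j) * S x) * G j x\<bar> \<le> N * B * t" by (rule abs_mult_le[OF xS[OF j] t(2)[OF j]])
    moreover have "\<bar>((x \<bullet> j) * partial j S x) * u x\<bar> \<le> B * t" by (rule abs_mult_le[OF S1[OF j j] t(1)])
    \<comment> \<open>Absorbs the last summand into a multiple of N B t, giving 4 + 1 + 1 =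
      6.\<close>
    moreover have "B * t \<le> N * (B * t)" using N B t(4) by (intro mult_le_cancel_right1[THEN iffD2]) (auto simp: mult_less_0_iff)
    moreover have "(x \<bullet> j) * g1 j x = (\<Sum>i\<in>Basis. 2 * (((x \<bullet> j) * X i x) * H i j x + ((x \<bullet> j) * X2 i j x) * G i x))
      + (((x \<bullet> j) * S x) * G j x + ((x \<bullet> j) * partial j S x) * u x)"
      unfolding g1_def by (simp add: algebra_simps sum_distrib_left sum.distrib)
    ultimately show "\<bar>(x \<bullet> j) * g1 j x\<bar> \<le> 6 * N * B * t" by (simp add: mult.assoc)
  qed
  have e1: "\<bar>(N - 4) * g x + 2 * Eg x\<bar> \<le> (N * (3 * N * B) + 2 * (N * (6 * N * B))) * t"
  proof -
    have "\<bar>(N - 4) * g x\<bar> \<le> N * (3 * N * B * t)" using N by (intro abs_mult_le g) auto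
    with Eg show ?thesis by (simp add: algebra_simps)
  qed
  show "\<bar>((N - 4) * g x + 2 * Eg x) * Dw x\<bar> \<le> (N * (3 * N * B) + 2 * (N * (6 * N * B))) * (N * (4 * B)) * (T x)\<^sup>2"
    using abs_mult_le[OF e1 Dw] unfolding t_def by (simp add: power2_eq_square mult_ac)
  have "\<bar>Z x\<bar> \<le> (N * (2 * (B * ((N + 2) * (2 * B)) + 2 * (N * (B * (4 * B))))) + (N * B * N + 2 * (N * (N * B * (2 * B))))) * t"
  proof -
    have 1: "\<bar>\<Sum>i\<in>Basis. 2 * (X i x * (real (n + 2) * W1 i x + 2 * EW i x))\<bar> \<le> N * (2 * (B * ((N + 2) * (2 * B * t)) + 2 * (N * (B * (4 * B * t)))))"
    proof (subst (1) N_def, subst n, rule abs_sum_Basis_le)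
      fix i :: 'a assume i: "i \<in> Basis"
      have "\<bar>X i x * ((N + 2) * W1 i x)\<bar> \<le> B * ((N + 2) * (2 * B * t))"
        using N by (intro abs_mult_le X W1 i) auto
      moreover have "\<bar>\<Sum>k\<in>Basis. ((x \<bullet> k) * X i x) * W2 i k x\<bar> \<le> N * (B * (4 * B * t))"
        unfolding N_def n by (intro abs_sum_Basis_le abs_mult_le X W2 i)
      ultimately have "\<bar>2 * (X i x * ((N + 2) * W1 i x) + 2 * (\<Sum>k\<in>Basis. ((x \<bullet> k) * X i x) * W2 i k x))\<bar>
          \<le> 2 * (B * ((N + 2) * (2 * B * t)) + 2 * (N * (B * (4 * B * t))))"
        by (intro abs_twice_add_twice_le)
      moreover have "2 * (X i x * (real (n + 2) * W1 i x + 2 * EW i x))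
        = 2 * (X i x * ((N + 2) * W1 i x) + 2 * (\<Sum>k\<in>Basis. ((x \<bullet> k) * X i x) * W2 i k x))"
        unfolding EW_def N_def by (simp add: algebra_simps sum_distrib_left)
      ultimately show "\<bar>2 * (X i x * (real (n + 2) * W1 i x + 2 * EW i x))\<bar> \<le> 2 * (B * ((N + 2) * (2 * B * t)) + 2 * (N * (B * (4 * B * t))))"
        by (simp only:)
    qed
    have 2: "\<bar>S x * (real n * w x + 2 * Ew x)\<bar> \<le> N * B * (N * t) + 2 * (N * (N * B * (2 * B * t)))"
    proof -
      have "\<bar>S x * (N * w x)\<bar> \<le> N * B * (N * t)"
        using N by (intro abs_mult_le S w) auto
      moreover have "\<bar>\<Sum>k\<in>Basis. ((x \<bullet> k) * S x) * W1 k x\<bar> \<le> N * (N * B * (2 * B * t))"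
        by (subst (1) N_def, subst n, intro abs_sum_Basis_le abs_mult_le xS W1)
      moreover have "S x * (real n * w x + 2 * Ew x) = S x * (N * w x) + 2 * (\<Sum>k\<in>Basis. ((x \<bullet> k) * S x) * W1 k x)"
        unfolding Ew_def N_def by (simp add: algebra_simps sum_distrib_left)
      ultimately show ?thesis by linarith
    qed
    show ?thesis
      unfolding Z_def using 1 2 by (simp add: algebra_simps)
  qed
  from abs_mult_le[OF Du this]
  show "\<bar>Du x * Z x\<bar> \<le> N * (N * (2 * (B * ((N + 2) * (2 * B)) + 2 * (N * (B * (4 * B))))) + (N * B * N + 2 * (N * (N * B * (2 * B))))) * (T x)\<^sup>2"
    unfolding t_def by (simp add: power2_eq_square mult_ac)
qed

lemma error_inside:
  assumes x: "norm x < \<rho>" and \<rho>: "\<And>x. norm x < \<rho> \<Longrightarrow> \<kappa> x = 1"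
  shows "Dw x = Du x" "g x = 0" "Eg x = 0" "Z x = 0"
proof -
  have X: "X i x = 0" if "norm x < \<rho>" for i x unfolding X_def by (rule partial_eq_0_inside[OF that \<rho>])
  have X2: "X2 i j x = 0" if "norm x < \<rho>" for i j x
    unfolding X2_def X_def[symmetric] by (rule partial_eq_0_inside[OF that X])
  have S: "S x = 0" if "norm x < \<rho>" for x using X2[OF that] by (simp add: S_def)
  have S1: "partial j S x = 0" for j by (rule partial_eq_0_inside[OF x S])
  show g0: "g x = 0" using X[OF x] S[OF x] by (simp add: g_def)
  show "Dw x = Du x" using Dw_eq[of x] \<rho>[OF x] g0 by simp
  show "Eg x = 0" using X[OF x] X2[OF x] S[OF x] S1 by (simp add: Eg_def g1_def)
  show "Z x = 0" using X[OF x] S[OF x] by (simp add: Z_def)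
qed

end

lemma partial_cmult:
  assumes "smooth f" "i \<in> Basis"
  shows "partial i (\<lambda>x. c * f x) x = c * partial i f x"
proof -
  have "((\<lambda>x. c * f x) has_derivative (\<lambda>h. c * (\<Sum>i\<in>Basis. (h \<bullet> i) * partial i f x))) (at x)"
    by (intro has_derivative_mult_right smooth_has_derivative assms)
  from partial_eq[OF this, of i] show ?thesis using assms(2) by (simp only: sum_inner_Basis)
qed

lemma partial_scaled:
  assumes "smooth f" "i \<in> Basis"
  shows "partial i (\<lambda>x. c * f (s *\<^sub>R x + 0)) = (\<lambda>x. c * s * partial i f (s *\<^sub>R x + 0))"
proof
  fix x
  have "partial i (\<lambda>x. c * f (s *\<^sub>R x + 0)) x = c * partial i (\<lambda>x. f (s *\<^sub>R x + 0)) x"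
    by (rule partial_cmult[OF smooth_affine[OF assms(1)] assms(2)])
  also have "partial i (\<lambda>x. f (s *\<^sub>R x + 0)) x = s * partial i f (s *\<^sub>R x + 0)"
    by (rule partial_affine[OF assms])
  finally show "partial i (\<lambda>x. c * f (s *\<^sub>R x + 0)) x = c * s * partial i f (s *\<^sub>R x + 0)" by simp
qed

text \<open>A derivative of order m of \<kappa>(x/\<rho>) carries \<rho>^(-m). One factor x costs
  only \<rho>, because x/\<rho> is bounded on the support of \<psi>; so m \<ge> 1 gives bounds
  uniform in \<rho> \<ge> 1.\<close>

lemma scaled_test_function_bound:
  assumes "test_function (\<psi> :: 'a::euclidean_space \<Rightarrow> real)"
  shows "\<exists>B\<ge>0. \<forall>\<rho>\<ge>1. \<forall>m\<ge>1. \<forall>x. \<forall>k\<in>Basis. \<bar>(1 / \<rho>) ^ m * \<psi> ((1 / \<rho>) *\<^sub>R x + 0)\<bar> \<le> B \<and>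
     \<bar>(x \<bullet> k) * ((1 / \<rho>) ^ m * \<psi> ((1 / \<rho>) *\<^sub>R x + 0))\<bar> \<le> B"
proof -
  obtain C where C: "C \<ge> 0" "\<And>x. \<bar>\<psi> x\<bar> \<le> C" using test_function_bounded[OF assms] by blast
  obtain R where R: "\<And>x. norm x > R \<Longrightarrow> \<psi> x = 0" using assms by (auto simp: test_function_iff)
  define B where "B = C + \<bar>R\<bar> * C"
  have B: "C \<le> B" "\<bar>R\<bar> * C \<le> B" "B \<ge> 0" using C by (auto simp: B_def)
  have "\<bar>(1 / \<rho>) ^ m * \<psi> ((1 / \<rho>) *\<^sub>R x + 0)\<bar> \<le> B \<and> \<bar>(x \<bullet> k) * ((1 / \<rho>) ^ m * \<psi> ((1 / \<rho>) *\<^sub>R x + 0))\<bar> \<le> B"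
    if \<rho>: "\<rho> \<ge> 1" and m: "m \<ge> 1" and k: "k \<in> Basis" for \<rho> :: real and m x and k :: 'a
  proof
    have p1: "\<bar>(1 / \<rho>) ^ i\<bar> \<le> 1" for i using \<rho> by (simp add: power_abs power_le_one)
    have "\<bar>(1 / \<rho>) ^ m * \<psi> ((1 / \<rho>) *\<^sub>R x + 0)\<bar> \<le> 1 * C" by (intro abs_mult_le p1 C)
    then show "\<bar>(1 / \<rho>) ^ m * \<psi> ((1 / \<rho>) *\<^sub>R x + 0)\<bar> \<le> B" using B by simp
    define v where "v = (1 / \<rho>) *\<^sub>R x + 0"
    have v: "\<bar>(v \<bullet> k) * \<psi> v\<bar> \<le> \<bar>R\<bar> * C"
    proof (cases "norm v > R")
      case True
      then show ?thesis using R C by simp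
    next
      case False
      then have "\<bar>v \<bullet> k\<bar> \<le> \<bar>R\<bar>" using Basis_le_norm[OF k, of v] by linarith
      then show ?thesis by (intro abs_mult_le C)
    qed
    obtain m' where m': "m = Suc m'" using m by (cases m) auto
    have "(x \<bullet> k) * ((1 / \<rho>) ^ m * \<psi> ((1 / \<rho>) *\<^sub>R x + 0)) = (1 / \<rho>) ^ m' * ((v \<bullet> k) * \<psi> v)"
      by (simp add: v_def m')
    also have "\<bar>\<dots>\<bar> \<le> 1 * (\<bar>R\<bar> * C)" by (intro abs_mult_le p1 v)
    finally show "\<bar>(x \<bullet> k) * ((1 / \<rho>) ^ m * \<psi> ((1 / \<rho>) *\<^sub>R x + 0))\<bar> \<le> B" using B by simp
  qed
  then show ?thesis using B(3) by blast
qed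

context biharmonic
begin

text \<open>The constant is fixed before \<rho>, and the objects built from the cutoff are hidden
  behind existential quantifiers: what remains are a localised Laplacian and two errors, each
  dominated uniformly and correct on the ball of radius \<rho>.\<close>

lemma cutoff_approximation:
  obtains C where "\<And>\<rho>. \<rho> \<ge> 1 \<Longrightarrow> \<exists>D e1 e2. D \<in> borel_measurable borel \<and> e1 \<in> borel_measurable borel \<and> e2 \<in> borel_measurable borel \<and>
    (\<forall>x. \<bar>D x\<bar> \<le> C * T x \<and> \<bar>e1 x\<bar> \<le> C * (T x)\<^sup>2 \<and> \<bar>e2 x\<bar> \<le> C * (T x)\<^sup>2) \<and>
    (\<forall>x. norm x < \<rho> \<longrightarrow> D x = (\<Sum>i\<in>Basis. H i i x) \<and> e1 x = 0 \<and> e2 x = 0) \<and>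
    4 * (1 - a) * (nm D)\<^sup>2 + (\<integral>x. e1 x \<partial>lborel) + (\<integral>x. e2 x \<partial>lborel)
    \<le> nm (\<lambda>x. (x \<bullet> x) * f x) * ((4 / DIM('a) + 4 / (DIM('a) - 4)) * nm D)"
proof -
  obtain \<kappa>0 :: "'a \<Rightarrow> real" where \<kappa>0: "smooth \<kappa>0" "\<And>x. 0 \<le> \<kappa>0 x" "\<And>x. \<kappa>0 x \<le> 1"
    "\<And>x. norm x \<le> 1 \<Longrightarrow> \<kappa>0 x = 1" "\<And>x. norm x \<ge> 2 \<Longrightarrow> \<kappa>0 x = 0"
    using smooth_cutoff_exists by blast
  have t0: "test_function \<kappa>0" using \<kappa>0 by (auto simp: test_function_iff intro!: exI[of _ 2])
  define s0 where "s0 x = (\<Sum>i\<in>Basis. partial i (partial i \<kappa>0) x)" for x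
  have ts0: "test_function s0"
    unfolding test_function_iff
  proof
    show "smooth s0" unfolding s0_def[abs_def] by (intro smooth_sum smooth_partial \<kappa>0) auto
    have "s0 x = 0" if "norm x > 2" for x
      using test_function_eq_0(2)[OF t0 _ that] \<kappa>0(5) by (simp add: s0_def)
    then show "\<exists>R. \<forall>x. norm x > R \<longrightarrow> s0 x = 0" by blast
  qed
  define bnd where "bnd \<psi> B \<longleftrightarrow> B \<ge> 0 \<and> (\<forall>\<rho>\<ge>1. \<forall>m\<ge>1. \<forall>x. \<forall>k\<in>Basis. \<bar>(1 / \<rho>) ^ m * \<psi> ((1 / \<rho>) *\<^sub>R x + 0)\<bar> \<le> B \<and>
     \<bar>(x \<bullet> k) * ((1 / \<rho>) ^ m * \<psi> ((1 / \<rho>) *\<^sub>R x + 0))\<bar> \<le> B)" for \<psi> :: "'a \<Rightarrow> real" and B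
  \<comment> \<open>A choice function for the bounds, so that they can be added over all basis
    directions.\<close>
  define b where "b \<psi> = (SOME B. bnd \<psi> B)" for \<psi>
  have bb: "bnd \<psi> (b \<psi>)" if "test_function \<psi>" for \<psi>
  proof -
    have "\<exists>B. bnd \<psi> B" using scaled_test_function_bound[OF that] unfolding bnd_def by blast
    then show ?thesis unfolding b_def by (rule someI_ex)
  qed
  have b: "b \<psi> \<ge> 0" if "test_function \<psi>" for \<psi>
    using bb[OF that] by (simp add: bnd_def)
  have b': "\<bar>(1 / \<rho>) ^ m * \<psi> ((1 / \<rho>) *\<^sub>R x + 0)\<bar> \<le> b \<psi> \<and>
      \<bar>(x \<bullet> k) * ((1 / \<rho>) ^ m * \<psi> ((1 / \<rho>) *\<^sub>R x + 0))\<bar> \<le> b \<psi>"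
    if "test_function \<psi>" "\<rho> \<ge> 1" "m \<ge> 1" "k \<in> Basis" for \<psi> \<rho> m x k
    using conjunct2[OF bb[OF that(1), unfolded bnd_def], rule_format, OF that(2-4)] .
  note b2' = conjunct1[OF b'] and b3' = conjunct2[OF b']
  define B1 where "B1 = (\<Sum>i\<in>Basis. b (partial i \<kappa>0))"
  define B2 where "B2 = (\<Sum>i\<in>Basis. \<Sum>j\<in>Basis. b (partial j (partial i \<kappa>0)))"
  define B3 where "B3 = (\<Sum>j\<in>Basis. b (partial j s0))"
  have t1: "test_function (partial i \<kappa>0)" "test_function (partial i s0)" if "i \<in> Basis" for i
    by (intro test_function_partial t0 ts0 that)+
  have t2: "test_function (partial j (partial i \<kappa>0))" if "i \<in> Basis" "j \<in> Basis" for i j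
    by (intro test_function_partial t0 that)
  have nn: "B1 \<ge> 0" "B2 \<ge> 0" "B3 \<ge> 0"
    unfolding B1_def B2_def B3_def by (intro sum_nonneg b t1 t2; assumption)+
  have b1: "b (partial i \<kappa>0) \<le> B1" if "i \<in> Basis" for i
    unfolding B1_def using that b t1 by (intro member_le_sum) auto
  have b3: "b (partial i s0) \<le> B3" if "i \<in> Basis" for i
    unfolding B3_def using that b t1 by (intro member_le_sum) auto
  have b2: "b (partial j (partial i \<kappa>0)) \<le> B2" if "i \<in> Basis" "j \<in> Basis" for i j
  proof -
    have "b (partial j (partial i \<kappa>0)) \<le> (\<Sum>j\<in>Basis. b (partial j (partial i \<kappa>0)))"
      using that b t2 by (intro member_le_sum[of j Basis "\<lambda>j. b (partial j (partial i \<kappa>0))"]) auto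
    also have "\<dots> \<le> B2"
      unfolding B2_def using that b t2 by (intro member_le_sum[of i Basis "\<lambda>i. \<Sum>j\<in>Basis. b (partial j (partial i \<kappa>0))"]) (auto intro: sum_nonneg)
    finally show ?thesis .
  qed
  define B where "B = 1 + B1 + B2 + B3"
  have B: "B \<ge> 1" "B1 \<le> B" "B2 \<le> B" "B3 \<le> B" using nn by (auto simp: B_def)
  define N where "N = real DIM('a)"
  define C1 where "C1 = N * (4 * B)"
  define C2 where "C2 = (N * (3 * N * B) + 2 * (N * (6 * N * B))) * (N * (4 * B))"
  define C3 where "C3 = N * (N * (2 * (B * ((N + 2) * (2 * B)) + 2 * (N * (B * (4 * B))))) + (N * B * N + 2 * (N * (N * B * (2 * B)))))"
  define C where "C = max C1 (max C2 C3)"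
  have C: "C1 \<le> C" "C2 \<le> C" "C3 \<le> C" by (auto simp: C_def)
  have "\<exists>D e1 e2. D \<in> borel_measurable borel \<and> e1 \<in> borel_measurable borel \<and> e2 \<in> borel_measurable borel \<and>
    (\<forall>x. \<bar>D x\<bar> \<le> C * T x \<and> \<bar>e1 x\<bar> \<le> C * (T x)\<^sup>2 \<and> \<bar>e2 x\<bar> \<le> C * (T x)\<^sup>2) \<and>
    (\<forall>x. norm x < \<rho> \<longrightarrow> D x = (\<Sum>i\<in>Basis. H i i x) \<and> e1 x = 0 \<and> e2 x = 0) \<and>
    4 * (1 - a) * (nm D)\<^sup>2 + (\<integral>x. e1 x \<partial>lborel) + (\<integral>x. e2 x \<partial>lborel)
    \<le> nm (\<lambda>x. (x \<bullet> x) * f x) * ((4 / DIM('a) + 4 / (DIM('a) - 4)) * nm D)"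
    if \<rho>: "\<rho> \<ge> 1" for \<rho>
  proof -
    \<comment> \<open>The factor 1 brings the stretched cutoff into the shape of
      \<open>partial_scaled\<close>, where each derivative multiplies the leading coefficient by
      1/\<rho>.\<close>
    define \<kappa> where "\<kappa> x = 1 * \<kappa>0 ((1 / \<rho>) *\<^sub>R x + 0)" for x
    have k1: "\<kappa> x = 1" if "norm x < \<rho>" for x
      unfolding \<kappa>_def using that \<rho> by (simp add: \<kappa>0(4) field_simps)
    have k0: "\<kappa> x = 0" if "norm x > 2 * \<rho>" for x
      unfolding \<kappa>_def using that \<rho> by (simp add: \<kappa>0(5) field_simps)
    have "test_function \<kappa>"
      unfolding \<kappa>_def using \<rho> by (intro test_function_mult smooth_const test_function_affine t0) auto
    then interpret C: biharmonic_cutoff u G H V GV f a z \<kappa> "2 * \<rho>" "DIM('a)"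
      using \<kappa>0(2,3) \<rho> k0 by unfold_locales (auto simp: \<kappa>_def)
    have X: "C.X i = (\<lambda>x. (1 / \<rho>) ^ 1 * partial i \<kappa>0 ((1 / \<rho>) *\<^sub>R x + 0))" if "i \<in> Basis" for i
      unfolding C.X_def unfolding \<kappa>_def[abs_def] using partial_scaled[OF \<kappa>0(1) that, of 1 "1 / \<rho>"] by simp
    have X2: "C.X2 i j = (\<lambda>x. (1 / \<rho>) ^ 2 * partial j (partial i \<kappa>0) ((1 / \<rho>) *\<^sub>R x + 0))" if "i \<in> Basis" "j \<in> Basis" for i j
      unfolding C.X2_def C.X_def[symmetric] X[OF that(1)]
      using partial_scaled[OF smooth_partial[OF \<kappa>0(1) that(1)] that(2), of "(1 / \<rho>) ^ 1" "1 / \<rho>"] by (simp add: power2_eq_square)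
    have S: "C.S = (\<lambda>x. (1 / \<rho>) ^ 2 * s0 ((1 / \<rho>) *\<^sub>R x + 0))"
      unfolding C.S_def[abs_def] s0_def by (auto simp: X2 sum_distrib_left simp del: power_divide power_one_over intro!: sum.cong ext)
    have "smooth s0" using ts0 by (simp add: test_function_iff)
    then have S1: "partial j C.S = (\<lambda>x. (1 / \<rho>) ^ 3 * partial j s0 ((1 / \<rho>) *\<^sub>R x + 0))" if "j \<in> Basis" for j
      unfolding S using partial_scaled[OF _ that, of s0 "(1 / \<rho>) ^ 2" "1 / \<rho>"] by (simp add: power2_eq_square power3_eq_cube)
    obtain k0 :: 'a where k0: "k0 \<in> Basis" using nonempty_Basis by blast
    have bds: "\<bar>C.X i x\<bar> \<le> B" "\<bar>(x \<bullet> k) * C.X i x\<bar> \<le> B" "\<bar>C.X2 i j x\<bar> \<le> B" "\<bar>(x \<bullet> k) * C.X2 i j x\<bar> \<le> B"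
      "\<bar>(x \<bullet> k) * partial j C.S x\<bar> \<le> B"
      if ij: "i \<in> Basis" "j \<in> Basis" "k \<in> Basis" for i j k x
    proof -
      show "\<bar>C.X i x\<bar> \<le> B" unfolding X[OF ij(1)]
        using order.trans[OF b2'[OF t1(1)[OF ij(1)] \<rho> order.refl k0] b1[OF ij(1)]] B(2) by (rule order.trans)
      show "\<bar>(x \<bullet> k) * C.X i x\<bar> \<le> B" unfolding X[OF ij(1)]
        using order.trans[OF b3'[OF t1(1)[OF ij(1)] \<rho> order.refl ij(3)] b1[OF ij(1)]] B(2) by (rule order.trans)
      show "\<bar>C.X2 i j x\<bar> \<le> B" unfolding X2[OF ij(1,2)]
        using order.trans[OF b2'[OF t2[OF ij(1,2)] \<rho> one_le_numeral k0] b2[OF ij(1,2)]] B(3) by (rule order.trans)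
      show "\<bar>(x \<bullet> k) * C.X2 i j x\<bar> \<le> B" unfolding X2[OF ij(1,2)]
        using order.trans[OF b3'[OF t2[OF ij(1,2)] \<rho> one_le_numeral ij(3)] b2[OF ij(1,2)]] B(3) by (rule order.trans)
      show "\<bar>(x \<bullet> k) * partial j C.S x\<bar> \<le> B" unfolding S1[OF ij(2)]
        using order.trans[OF b3'[OF t1(2)[OF ij(2)] \<rho> one_le_numeral ij(3)] b3[OF ij(2)]] B(4) by (rule order.trans)
    qed
    have eb: "\<bar>C.Dw x\<bar> \<le> C1 * T x"
      "\<bar>((real DIM('a) - 4) * C.g x + 2 * C.Eg x) * C.Dw x\<bar> \<le> C2 * (T x)\<^sup>2"
      "\<bar>C.Du x * C.Z x\<bar> \<le> C3 * (T x)\<^sup>2" for x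
      using C.error_bounds[OF B(1), of x] bds k0
      unfolding C1_def C2_def C3_def N_def by (simp_all add: mult.assoc)
    show ?thesis
    proof (intro exI conjI)
      show "\<forall>x. \<bar>C.Dw x\<bar> \<le> C * T x \<and> \<bar>((real DIM('a) - 4) * C.g x + 2 * C.Eg x) * C.Dw x\<bar> \<le> C * (T x)\<^sup>2
          \<and> \<bar>C.Du x * C.Z x\<bar> \<le> C * (T x)\<^sup>2"
      proof (intro allI conjI)
        fix x
        show "\<bar>C.Dw x\<bar> \<le> C * T x" using eb(1)[of x] mult_right_mono[OF C(1) T_bounds(4)[of x]] by linarith
        show "\<bar>((real DIM('a) - 4) * C.g x + 2 * C.Eg x) * C.Dw x\<bar> \<le> C * (T x)\<^sup>2"
          using eb(2)[of x] mult_right_mono[OF C(2) zero_le_power2[of "T x"]] by linarith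
        show "\<bar>C.Du x * C.Z x\<bar> \<le> C * (T x)\<^sup>2"
          using eb(3)[of x] mult_right_mono[OF C(3) zero_le_power2[of "T x"]] by linarith
      qed
      show "\<forall>x. norm x < \<rho> \<longrightarrow> C.Dw x = (\<Sum>i\<in>Basis. H i i x) \<and>
          ((real DIM('a) - 4) * C.g x + 2 * C.Eg x) * C.Dw x = 0 \<and> C.Du x * C.Z x = 0"
        using C.error_inside[OF _ k1] by (simp add: C.Du_def)
      show "4 * (1 - a) * (nm C.Dw)\<^sup>2 + (\<integral>x. ((real DIM('a) - 4) * C.g x + 2 * C.Eg x) * C.Dw x \<partial>lborel) + (\<integral>x. C.Du x * C.Z x \<partial>lborel)
        \<le> nm (\<lambda>x. (x \<bullet> x) * f x) * ((4 / DIM('a) + 4 / (DIM('a) - 4)) * nm C.Dw)"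
        by (rule C.cutoff_inequality)
    qed measurable
  qed
  then show ?thesis by (rule that)
qed

text \<open>As the radius grows the errors vanish pointwise and are dominated by multiples of T^2,
  so their integrals tend to 0 and the localised Laplacian converges in norm. One factor of the norm
  is then cancelled.\<close>

theorem final_bound:
  "nm (\<lambda>x. \<Sum>i\<in>Basis. H i i x) \<le> 1 / (1 - a) * (2 * (real DIM('a) - 2) / (real DIM('a) * (real DIM('a) - 4))) * nm (\<lambda>x. (x \<bullet> x) * f x)"
proof -
  define Du where "Du x = (\<Sum>i\<in>Basis. H i i x)" for x
  define F where "F = nm (\<lambda>x. (x \<bullet> x) * f x)"
  define c where "c = 4 / real DIM('a) + 4 / real (DIM('a) - 4)"
  have [measurable]: "\<And>i j. i \<in> Basis \<Longrightarrow> j \<in> Basis \<Longrightarrow> H i j \<in> borel_measurable borel"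
    using u by (auto simp: H2r_def)
  have [measurable]: "Du \<in> borel_measurable borel" unfolding Du_def[abs_def] by measurable
  have Tm[measurable]: "T \<in> borel_measurable borel" by (rule T_L2)
  have Duf: "NP 2 Du < \<infinity>" unfolding Du_def[abs_def] using u by (intro NP_sum_fin) (auto simp: H2r_def)
  obtain C where C: "\<And>\<rho>. \<rho> \<ge> 1 \<Longrightarrow> \<exists>D e1 e2. D \<in> borel_measurable borel \<and> e1 \<in> borel_measurable borel \<and> e2 \<in> borel_measurable borel \<and>
    (\<forall>x. \<bar>D x\<bar> \<le> C * T x \<and> \<bar>e1 x\<bar> \<le> C * (T x)\<^sup>2 \<and> \<bar>e2 x\<bar> \<le> C * (T x)\<^sup>2) \<and>
    (\<forall>x. norm x < \<rho> \<longrightarrow> D x = (\<Sum>i\<in>Basis. H i i x) \<and> e1 x = 0 \<and> e2 x = 0) \<and>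
    4 * (1 - a) * (nm D)\<^sup>2 + (\<integral>x. e1 x \<partial>lborel) + (\<integral>x. e2 x \<partial>lborel)
    \<le> nm (\<lambda>x. (x \<bullet> x) * f x) * ((4 / DIM('a) + 4 / (DIM('a) - 4)) * nm D)"
    by (rule cutoff_approximation) blast
  have "\<exists>D e1 e2. D \<in> borel_measurable borel \<and> e1 \<in> borel_measurable borel \<and> e2 \<in> borel_measurable borel \<and>
    (\<forall>x. \<bar>D x\<bar> \<le> C * T x \<and> \<bar>e1 x\<bar> \<le> C * (T x)\<^sup>2 \<and> \<bar>e2 x\<bar> \<le> C * (T x)\<^sup>2) \<and>
    (\<forall>x. norm x < real k + 1 \<longrightarrow> D x = Du x \<and> e1 x = 0 \<and> e2 x = 0) \<and>
    4 * (1 - a) * (nm D)\<^sup>2 + (\<integral>x. e1 x \<partial>lborel) + (\<integral>x. e2 x \<partial>lborel) \<le> F * (c * nm D)" for k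
    unfolding Du_def F_def c_def by (rule C) simp
  then obtain D e1 e2 where m[measurable]: "\<And>k. D k \<in> borel_measurable borel" "\<And>k. e1 k \<in> borel_measurable borel" "\<And>k. e2 k \<in> borel_measurable borel"
    and bd: "\<And>k x. \<bar>D k x\<bar> \<le> C * T x" "\<And>k x. \<bar>e1 k x\<bar> \<le> C * (T x)\<^sup>2" "\<And>k x. \<bar>e2 k x\<bar> \<le> C * (T x)\<^sup>2"
    and inside: "\<And>k x. norm x < real k + 1 \<Longrightarrow> D k x = Du x" "\<And>k x. norm x < real k + 1 \<Longrightarrow> e1 k x = 0" "\<And>k x. norm x < real k + 1 \<Longrightarrow> e2 k x = 0"
    and ineq: "\<And>k. 4 * (1 - a) * (nm (D k))\<^sup>2 + (\<integral>x. e1 k x \<partial>lborel) + (\<integral>x. e2 k x \<partial>lborel) \<le> F * (c * nm (D k))"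
    by metis
  have ev: "eventually (\<lambda>k. norm x < real k + 1) sequentially" for x :: 'a
  proof -
    obtain N where "norm x < real N" using reals_Archimedean2 by blast
    then show ?thesis by (intro eventually_sequentiallyI[of N]) auto
  qed
  have e: "(\<lambda>k. \<integral>x. E k x \<partial>lborel) \<longlonglongrightarrow> 0"
    if "\<And>k. E k \<in> borel_measurable borel" "\<And>k x. \<bar>E k x\<bar> \<le> C * (T x)\<^sup>2" "\<And>k x. norm x < real k + 1 \<Longrightarrow> E k x = 0" for E :: "nat \<Rightarrow> 'a \<Rightarrow> real"
  proof -
    have "(\<lambda>k. \<integral>x. E k x \<partial>lborel) \<longlonglongrightarrow> (\<integral>x. 0 \<partial>(lborel :: 'a measure))"
    proof (rule integral_dominated_convergence[where w="\<lambda>x. C * (T x)\<^sup>2"])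
      show "AE x in lborel. (\<lambda>k. E k x) \<longlonglongrightarrow> 0"
      proof (intro AE_I2 tendsto_eventually)
        fix x
        show "\<forall>\<^sub>F k in sequentially. E k x = 0" using ev[of x] by eventually_elim (rule that(3))
      qed
    qed (use that T_L2 in auto)
    then show ?thesis by simp
  qed
  have Dfin: "NP 2 (D k) < \<infinity>" for k
  proof -
    have "NP 2 (D k) \<le> NP 2 (\<lambda>x. C * T x)"
      using bd(1) by (intro NP_mono) (auto intro: order.trans[OF _ abs_ge_self])
    also have "\<dots> < \<infinity>" by (intro NP_cmult_fin T_L2)
    finally show ?thesis .
  qed
  have "(\<lambda>k. \<integral>x. (D k x)\<^sup>2 \<partial>lborel) \<longlonglongrightarrow> (\<integral>x. (Du x)\<^sup>2 \<partial>lborel)"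
  proof (rule integral_dominated_convergence[where w="\<lambda>x. C\<^sup>2 * (T x)\<^sup>2"])
    show "AE x in lborel. (\<lambda>k. (D k x)\<^sup>2) \<longlonglongrightarrow> (Du x)\<^sup>2"
    proof (intro AE_I2 tendsto_eventually)
      fix x
      show "\<forall>\<^sub>F k in sequentially. (D k x)\<^sup>2 = (Du x)\<^sup>2"
        using ev[of x] by eventually_elim (simp add: inside(1))
    qed
    show "AE x in lborel. norm ((D k x)\<^sup>2) \<le> C\<^sup>2 * (T x)\<^sup>2" for k
    proof (rule AE_I2)
      fix x
      have "\<bar>D k x\<bar> \<le> \<bar>C * T x\<bar>" using bd(1)[of k x] by linarith
      then have "(D k x)\<^sup>2 \<le> (C * T x)\<^sup>2" by (simp add: abs_le_square_iff)
      then show "norm ((D k x)\<^sup>2) \<le> C\<^sup>2 * (T x)\<^sup>2" by (simp add: power_mult_distrib)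
    qed
  qed (use T_L2 in auto)
  then have "(\<lambda>k. (nm (D k))\<^sup>2) \<longlonglongrightarrow> (nm Du)\<^sup>2"
    using Dfin Duf by (simp add: nm_square)
  then have "(\<lambda>k. sqrt ((nm (D k))\<^sup>2)) \<longlonglongrightarrow> sqrt ((nm Du)\<^sup>2)" by (rule tendsto_real_sqrt)
  then have nmD: "(\<lambda>k. nm (D k)) \<longlonglongrightarrow> nm Du" by (simp add: nm_nonneg)
  have "4 * (1 - a) * (nm Du)\<^sup>2 + 0 + 0 \<le> F * (c * nm Du)"
  proof (rule LIMSEQ_le)
    show "(\<lambda>k. 4 * (1 - a) * (nm (D k))\<^sup>2 + (\<integral>x. e1 k x \<partial>lborel) + (\<integral>x. e2 k x \<partial>lborel)) \<longlonglongrightarrow> 4 * (1 - a) * (nm Du)\<^sup>2 + 0 + 0"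
      by (intro tendsto_intros nmD e m bd inside)
    show "(\<lambda>k. F * (c * nm (D k))) \<longlonglongrightarrow> F * (c * nm Du)" by (intro tendsto_intros nmD)
  qed (use ineq in auto)
  then have main: "4 * (1 - a) * (nm Du)\<^sup>2 \<le> F * (c * nm Du)" by simp
  have F0: "F \<ge> 0" by (simp add: F_def nm_nonneg)
  have n5: "real DIM('a) \<ge> 5" using d by simp
  have c: "c = 4 * (2 * (real DIM('a) - 2) / (real DIM('a) * (real DIM('a) - 4)))"
  proof -
    have "c = 4 / real DIM('a) + 4 / (real DIM('a) - 4)" using d by (simp add: c_def of_nat_diff)
    also have "\<dots> = 4 * (2 * (real DIM('a) - 2) / (real DIM('a) * (real DIM('a) - 4)))"
    proof -
      define N where "N = real DIM('a)"
      have "N > 4" using n5 by (simp add: N_def)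
      then show ?thesis unfolding N_def[symmetric] by (simp add: divide_simps)
    qed
    finally show ?thesis .
  qed
  have c0: "c \<ge> 0" by (simp add: c_def)
  \<comment> \<open>The limiting inequality is quadratic in \<open>nm Du\<close>; cancelling one
    factor requires it to be nonzero.\<close>
  have "nm Du \<le> 1 / (1 - a) * (c / 4) * F"
  proof (cases "nm Du = 0")
    case True
    then show ?thesis using F0 c0 a by simp
  next
    case False
    then have p: "nm Du > 0" using nm_nonneg[of Du] by simp
    have "(4 * (1 - a) * nm Du) * nm Du \<le> (F * c) * nm Du" using main by (simp add: power2_eq_square mult.assoc)
    then have "4 * (1 - a) * nm Du \<le> F * c" using p by (simp add: mult_le_cancel_right)
    then show ?thesis using a by (simp add: field_simps)
  qed
  moreover have "c / 4 = 2 * (real DIM('a) - 2) / (real DIM('a) * (real DIM('a) - 4))"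
    unfolding c by (rule nonzero_mult_div_cancel_left) simp
  ultimately show ?thesis unfolding F_def Du_def[abs_def] by (simp only:)
qed

end

section \<open>Transfer to Lebesgue measurable functions\<close>

lemma Borel_representative:
  fixes f :: "'a::euclidean_space \<Rightarrow> real"
  assumes "f \<in> borel_measurable lebesgue"
  obtains g where "g \<in> borel_measurable borel" "AE x in lborel. f x = g x"
  using completion_ex_borel_measurable_real[OF assms] by auto

lemma AE_lebesgue_iff: "(AE x in lebesgue. P x) \<longleftrightarrow> (AE x in lborel. P x)"
  by (rule AE_completion_iff)

lemma integral_lebesgue_cong:
  fixes f g :: "'a::euclidean_space \<Rightarrow> real"
  assumes "f \<in> borel_measurable lebesgue" "g \<in> borel_measurable borel" "AE x in lborel. f x = g x"
  shows "(\<integral>x. f x \<partial>lebesgue) = (\<integral>x. g x \<partial>lborel)"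
proof -
  have g: "g \<in> borel_measurable lborel" using assms(2) by simp
  have "(\<integral>x. f x \<partial>lebesgue) = (\<integral>x. g x \<partial>lebesgue)"
    using assms measurable_completion[OF g] by (intro integral_cong_AE) (auto simp: AE_lebesgue_iff)
  also have "\<dots> = (\<integral>x. g x \<partial>lborel)" by (rule integral_completion[OF g])
  finally show ?thesis .
qed

lemma nn_integral_lebesgue_cong:
  fixes f g :: "'a::euclidean_space \<Rightarrow> real"
  assumes "g \<in> borel_measurable borel" "AE x in lborel. f x = g x"
  shows "(\<integral>\<^sup>+x. ennreal (f x) \<partial>lebesgue) = (\<integral>\<^sup>+x. ennreal (g x) \<partial>lborel)"
proof -
  have "(\<integral>\<^sup>+x. ennreal (f x) \<partial>lebesgue) = (\<integral>\<^sup>+x. ennreal (g x) \<partial>lebesgue)"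
    using assms(2) by (intro nn_integral_cong_AE) (auto simp: AE_lebesgue_iff)
  also have "\<dots> = (\<integral>\<^sup>+x. ennreal (g x) \<partial>lborel)"
    by (rule nn_integral_completion)
  finally show ?thesis .
qed

lemma borel_imp_lebesgue: "g \<in> borel_measurable borel \<Longrightarrow> g \<in> borel_measurable lebesgue"
  by (rule measurable_completion) simp

text \<open>The a.e. bound by the norm, rather than equality, covers both Borel representatives and
  real or imaginary parts.\<close>

lemma NP_indicator_Lp_loc:
  fixes f :: "'a::euclidean_space \<Rightarrow> 'b::{banach,second_countable_topology}"
  assumes f: "Lp_loc p f" and [measurable]: "g \<in> borel_measurable borel" and "AE x in lborel. \<bar>g x\<bar> \<le> norm (f x)" and p: "p \<ge> 0"
  shows "NP p (\<lambda>x. indicator (cball 0 R) x * g x) < \<infinity>"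
proof -
  have [measurable]: "cball (0::'a) R \<in> sets borel" by (rule borel_closed) simp
  have "(\<integral>\<^sup>+x. ennreal (norm (indicator (cball 0 R) x *\<^sub>R (norm (f x) powr p))) \<partial>lebesgue) < \<infinity>"
    using f compact_cball[of "0::'a" R] unfolding Lp_loc_def set_integrable_def integrable_iff_bounded by blast
  moreover have "NP p (\<lambda>x. indicator (cball 0 R) x * g x)
      \<le> (\<integral>\<^sup>+x. ennreal (norm (indicator (cball 0 R) x *\<^sub>R (norm (f x) powr p))) \<partial>lebesgue)"
  proof -
    have "NP p (\<lambda>x. indicator (cball 0 R) x * g x) = (\<integral>\<^sup>+x. ennreal (\<bar>indicator (cball 0 R) x * g x\<bar> powr p) \<partial>lebesgue)"
      unfolding NP_def by (rule nn_integral_completion[symmetric]) measurable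
    also have "\<dots> \<le> (\<integral>\<^sup>+x. ennreal (norm (indicator (cball 0 R) x *\<^sub>R (norm (f x) powr p))) \<partial>lebesgue)"
    proof (rule nn_integral_mono_AE)
      have "AE x in lebesgue. \<bar>g x\<bar> \<le> norm (f x)" using assms(3) by (simp add: AE_lebesgue_iff)
      then show "AE x in lebesgue. ennreal (\<bar>indicator (cball 0 R) x * g x\<bar> powr p) \<le> ennreal (norm (indicator (cball 0 R) x *\<^sub>R (norm (f x) powr p)))"
        by eventually_elim (use p in \<open>auto intro!: ennreal_leI powr_mono2 split: split_indicator\<close>)
    qed
    finally show ?thesis .
  qed
  ultimately show ?thesis by (rule le_less_trans[rotated])
qed

lemma locint_Lp_loc:
  fixes f :: "'a::euclidean_space \<Rightarrow> 'b::{banach,second_countable_topology}"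
  assumes f: "Lp_loc p f" and g[measurable]: "g \<in> borel_measurable borel" and "AE x in lborel. \<bar>g x\<bar> \<le> norm (f x)" and p: "p \<ge> 1"
  shows "locint g"
  unfolding locint_def
proof (intro conjI allI g)
  fix R
  have [measurable]: "cball (0::'a) R \<in> sets borel" by (rule borel_closed) simp
  show "integrable lborel (\<lambda>x. indicator (cball 0 R) x * g x)"
    using NP_indicator_Lp_loc[OF assms(1-3)] p
    by (intro integrable_compact_support[where R=R and p=p]) auto
qed

lemma NP_Lp:
  fixes f :: "'a::euclidean_space \<Rightarrow> 'b::{banach,second_countable_topology}"
  assumes f: "Lp p f" and [measurable]: "g \<in> borel_measurable borel" and "AE x in lborel. \<bar>g x\<bar> \<le> norm (f x)" and p: "p \<ge> 0"
  shows "NP p g < \<infinity>"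
proof -
  have "NP p g = (\<integral>\<^sup>+x. ennreal (\<bar>g x\<bar> powr p) \<partial>lebesgue)"
    unfolding NP_def by (rule nn_integral_completion[symmetric]) measurable
  also have "\<dots> \<le> (\<integral>\<^sup>+x. ennreal (norm (norm (f x) powr p)) \<partial>lebesgue)"
  proof (rule nn_integral_mono_AE)
    have "AE x in lebesgue. \<bar>g x\<bar> \<le> norm (f x)" using assms(3) by (simp add: AE_lebesgue_iff)
    then show "AE x in lebesgue. ennreal (\<bar>g x\<bar> powr p) \<le> ennreal (norm (norm (f x) powr p))"
      by eventually_elim (use p in \<open>auto intro!: ennreal_leI powr_mono2\<close>)
  qed
  also have "\<dots> < \<infinity>" using f unfolding Lp_def integrable_iff_bounded by blast
  finally show ?thesis .
qed

lemma has_weak_partial_wpd: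
  fixes f g :: "'a::euclidean_space \<Rightarrow> real"
  assumes w: "has_weak_partial i f g" and i: "i \<in> Basis"
    and [measurable]: "f' \<in> borel_measurable borel" "g' \<in> borel_measurable borel"
    and ae: "AE x in lborel. f x = f' x" "AE x in lborel. g x = g' x"
  shows "wpd i f' g'"
  unfolding wpd_def
proof (intro allI impI)
  fix \<phi> :: "'a \<Rightarrow> real" assume \<phi>: "test_function \<phi>"
  have [measurable]: "\<phi> \<in> borel_measurable borel" "partial i \<phi> \<in> borel_measurable borel"
    by (intro test_function_borel \<phi> test_function_partial i)+
  have [measurable]: "\<phi> \<in> borel_measurable lebesgue" "partial i \<phi> \<in> borel_measurable lebesgue"
    by (intro borel_imp_lebesgue; simp)+
  have [measurable]: "f \<in> borel_measurable lebesgue" "g \<in> borel_measurable lebesgue"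
    using w by (auto simp: has_weak_partial_def Lp_loc_def)
  have 1: "AE x in lborel. partial i \<phi> x *\<^sub>R f x = partial i \<phi> x * f' x" using ae(1) by eventually_elim simp
  have 2: "AE x in lborel. \<phi> x *\<^sub>R g x = \<phi> x * g' x" using ae(2) by eventually_elim simp
  have "(\<integral>x. partial i \<phi> x * f' x \<partial>lborel) = (\<integral>x. partial i \<phi> x *\<^sub>R f x \<partial>lebesgue)"
    by (rule integral_lebesgue_cong[symmetric, OF _ _ 1]) measurable
  also have "\<dots> = - (\<integral>x. \<phi> x *\<^sub>R g x \<partial>lebesgue)" using w \<phi> unfolding has_weak_partial_def by blast
  also have "(\<integral>x. \<phi> x *\<^sub>R g x \<partial>lebesgue) = (\<integral>x. \<phi> x * g' x \<partial>lborel)"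
    by (rule integral_lebesgue_cong[OF _ _ 2]) measurable
  finally show "(\<integral>x. partial i \<phi> x * f' x \<partial>lborel) = - (\<integral>x. \<phi> x * g' x \<partial>lborel)" .
qed

text \<open>Borel representatives reduce the claim to \<open>wpd_unique\<close>; it makes the
  arbitrary choice in \<open>weak_partial\<close> harmless.\<close>

lemma has_weak_partial_real_unique:
  fixes f g :: "'a::euclidean_space \<Rightarrow> real"
  assumes w: "has_weak_partial i f g" "has_weak_partial i f g'" and i: "i \<in> Basis"
  shows "AE x in lborel. g x = g' x"
proof -
  have L: "Lp_loc 1 g" "Lp_loc 1 g'" "Lp_loc 1 f" using w by (auto simp: has_weak_partial_def)
  then have m: "g \<in> borel_measurable lebesgue" "g' \<in> borel_measurable lebesgue" "f \<in> borel_measurable lebesgue"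
    by (simp_all add: Lp_loc_def)
  obtain F where F: "F \<in> borel_measurable borel" "AE x in lborel. f x = F x" by (rule Borel_representative[OF m(3)])
  obtain G where G: "G \<in> borel_measurable borel" "AE x in lborel. g x = G x" by (rule Borel_representative[OF m(1)])
  obtain G' where G': "G' \<in> borel_measurable borel" "AE x in lborel. g' x = G' x" by (rule Borel_representative[OF m(2)])
  have b: "AE x in lborel. \<bar>G x\<bar> \<le> norm (g x)" using G(2) by eventually_elim simp
  have b': "AE x in lborel. \<bar>G' x\<bar> \<le> norm (g' x)" using G'(2) by eventually_elim simp
  have "AE x in lborel. G x = G' x"
  proof (rule wpd_unique)
    show "wpd i F G" by (rule has_weak_partial_wpd[OF w(1) i F(1) G(1) F(2) G(2)])
    show "wpd i F G'" by (rule has_weak_partial_wpd[OF w(2) i F(1) G'(1) F(2) G'(2)])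
    show "locint G" by (rule locint_Lp_loc[OF L(1) G(1) b]) simp
    show "locint G'" by (rule locint_Lp_loc[OF L(2) G'(1) b']) simp
  qed
  then show ?thesis using G(2) G'(2) by eventually_elim simp
qed

lemma integrable_test_Lp_loc:
  fixes f :: "'a::euclidean_space \<Rightarrow> 'b::{banach,second_countable_topology}"
  assumes f: "Lp_loc 1 f" and \<phi>: "test_function \<phi>"
  shows "integrable lebesgue (\<lambda>x. \<phi> x *\<^sub>R f x)"
proof -
  obtain C where C: "C \<ge> 0" "\<And>x. \<bar>\<phi> x\<bar> \<le> C" using test_function_bounded[OF \<phi>] by blast
  obtain R where R: "\<And>x. norm x > R \<Longrightarrow> \<phi> x = 0" using \<phi> by (auto simp: test_function_iff)
  have [measurable]: "f \<in> borel_measurable lebesgue" using f by (simp add: Lp_loc_def)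
  have [measurable]: "\<phi> \<in> borel_measurable lebesgue" by (rule borel_imp_lebesgue[OF test_function_borel[OF \<phi>]])
  show ?thesis
  proof (rule Bochner_Integration.integrable_bound)
    show "integrable lebesgue (\<lambda>x. C * (indicator (cball 0 R) x *\<^sub>R (norm (f x) powr 1)))"
      using f compact_cball[of "0::'a" R] unfolding Lp_loc_def set_integrable_def by auto
    show "AE x in lebesgue. norm (\<phi> x *\<^sub>R f x) \<le> norm (C * (indicator (cball 0 R) x *\<^sub>R (norm (f x) powr 1)))"
    proof (rule AE_I2)
      fix x
      show "norm (\<phi> x *\<^sub>R f x) \<le> norm (C * (indicator (cball 0 R) x *\<^sub>R (norm (f x) powr 1)))"
      proof (cases "norm x \<le> R")
        case True
        have "\<bar>\<phi> x\<bar> * norm (f x) \<le> C * norm (f x)" by (rule mult_right_mono[OF C(2)]) simp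
        then show ?thesis using True C(1) by (simp add: abs_mult)
      qed (simp add: R)
    qed
  qed measurable
qed

lemma component_bounded_linear:
  assumes "\<rho> = Re \<or> \<rho> = Im"
  shows "bounded_linear \<rho>" "\<bar>\<rho> z\<bar> \<le> norm z"
  using assms bounded_linear_Re bounded_linear_Im abs_Re_le_cmod abs_Im_le_cmod by auto

lemma component_measurable:
  assumes "\<rho> = Re \<or> \<rho> = Im" "f \<in> borel_measurable M"
  shows "(\<lambda>x. \<rho> (f x)) \<in> borel_measurable M"
  using assms by auto

lemma Lp_loc_component:
  assumes \<rho>: "\<rho> = Re \<or> \<rho> = Im" and f: "Lp_loc 1 f"
  shows "Lp_loc 1 (\<lambda>x. \<rho> (f x))"
  unfolding Lp_loc_def
proof (intro conjI allI impI)
  have [measurable]: "f \<in> borel_measurable lebesgue" using f by (simp add: Lp_loc_def)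
  show m[measurable]: "(\<lambda>x. \<rho> (f x)) \<in> borel_measurable lebesgue" by (rule component_measurable[OF \<rho>]) simp
  fix K :: "'a set" assume K: "compact K"
  then have [measurable]: "K \<in> sets lebesgue" by (simp add: compact_imp_closed)
  have "set_integrable lebesgue K (\<lambda>x. norm (f x) powr 1)" using f K by (simp add: Lp_loc_def)
  then show "set_integrable lebesgue K (\<lambda>x. norm (\<rho> (f x)) powr 1)"
    unfolding set_integrable_def
    by (rule Bochner_Integration.integrable_bound) (auto simp: component_bounded_linear[OF \<rho>] split: split_indicator)
qed

lemma has_weak_partial_component:
  fixes f g :: "'a::euclidean_space \<Rightarrow> complex"
  assumes w: "has_weak_partial i f g" and i: "i \<in> Basis" and \<rho>: "\<rho> = Re \<or> \<rho> = Im"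
  shows "has_weak_partial i (\<lambda>x. \<rho> (f x)) (\<lambda>x. \<rho> (g x))"
  unfolding has_weak_partial_def
proof (intro conjI allI impI)
  have L: "Lp_loc 1 f" "Lp_loc 1 g" using w by (auto simp: has_weak_partial_def)
  show "Lp_loc 1 (\<lambda>x. \<rho> (f x))" "Lp_loc 1 (\<lambda>x. \<rho> (g x))" by (intro Lp_loc_component \<rho> L)+
  fix \<phi> :: "'a \<Rightarrow> real" assume \<phi>: "test_function \<phi>"
  interpret \<rho>: bounded_linear \<rho> by (rule component_bounded_linear[OF \<rho>])
  have "(\<integral>x. partial i \<phi> x *\<^sub>R \<rho> (f x) \<partial>lebesgue) = \<rho> (\<integral>x. partial i \<phi> x *\<^sub>R f x \<partial>lebesgue)"
    using integral_bounded_linear[OF component_bounded_linear(1)[OF \<rho>] integrable_test_Lp_loc[OF L(1) test_function_partial[OF \<phi> i]]]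
    by (simp add: \<rho>.scaleR)
  also have "\<dots> = - \<rho> (\<integral>x. \<phi> x *\<^sub>R g x \<partial>lebesgue)"
    using w \<phi> unfolding has_weak_partial_def by (simp add: \<rho>.neg)
  also have "\<rho> (\<integral>x. \<phi> x *\<^sub>R g x \<partial>lebesgue) = (\<integral>x. \<phi> x *\<^sub>R \<rho> (g x) \<partial>lebesgue)"
    using integral_bounded_linear[OF component_bounded_linear(1)[OF \<rho>] integrable_test_Lp_loc[OF L(2) \<phi>]]
    by (simp add: \<rho>.scaleR)
  finally show "(\<integral>x. partial i \<phi> x *\<^sub>R \<rho> (f x) \<partial>lebesgue) = - (\<integral>x. \<phi> x *\<^sub>R \<rho> (g x) \<partial>lebesgue)" .
qed

lemma has_weak_partial_complex_unique:
  fixes f g :: "'a::euclidean_space \<Rightarrow> complex"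
  assumes w: "has_weak_partial i f g" "has_weak_partial i f g'" and i: "i \<in> Basis"
  shows "AE x in lborel. g x = g' x"
proof -
  have "AE x in lborel. \<rho> (g x) = \<rho> (g' x)" if "\<rho> = Re \<or> \<rho> = Im" for \<rho>
    by (rule has_weak_partial_real_unique[OF has_weak_partial_component[OF w(1) i that] has_weak_partial_component[OF w(2) i that] i])
  from this[of Re] this[of Im] have "AE x in lborel. Re (g x) = Re (g' x)" "AE x in lborel. Im (g x) = Im (g' x)" by simp_all
  then show ?thesis by eventually_elim (simp add: complex_eq_iff)
qed

lemma has_weak_partial_cong_AE:
  fixes f :: "'a::euclidean_space \<Rightarrow> 'b::{banach,second_countable_topology}"
  assumes w: "has_weak_partial i f g" and i: "i \<in> Basis" and L: "Lp_loc 1 f'" and ae: "AE x in lborel. f x = f' x"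
  shows "has_weak_partial i f' g"
  unfolding has_weak_partial_def
proof (intro conjI allI impI L)
  show "Lp_loc 1 g" using w by (simp add: has_weak_partial_def)
  have [measurable]: "f \<in> borel_measurable lebesgue" "f' \<in> borel_measurable lebesgue"
    using w L by (auto simp: has_weak_partial_def Lp_loc_def)
  fix \<phi> :: "'a \<Rightarrow> real" assume \<phi>: "test_function \<phi>"
  have [measurable]: "partial i \<phi> \<in> borel_measurable lebesgue"
    by (intro borel_imp_lebesgue test_function_borel test_function_partial \<phi> i)
  have "(\<integral>x. partial i \<phi> x *\<^sub>R f' x \<partial>lebesgue) = (\<integral>x. partial i \<phi> x *\<^sub>R f x \<partial>lebesgue)"
  proof (rule integral_cong_AE)
    show "AE x in lebesgue. partial i \<phi> x *\<^sub>R f' x = partial i \<phi> x *\<^sub>R f x"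
      unfolding AE_lebesgue_iff using ae by eventually_elim simp
  qed measurable
  then show "(\<integral>x. partial i \<phi> x *\<^sub>R f' x \<partial>lebesgue) = - (\<integral>x. \<phi> x *\<^sub>R g x \<partial>lebesgue)"
    using w \<phi> by (simp add: has_weak_partial_def)
qed

lemma weak_partial_has_weak_partial:
  "has_weak_partial i f g \<Longrightarrow> has_weak_partial i f (weak_partial i f)"
  unfolding weak_partial_def by (rule someI[of "has_weak_partial i f"])

text \<open>\<open>weak_laplacian\<close> makes a choice twice. The first chosen derivative agrees
  a.e. with \<open>g i\<close>, hence has the same weak derivatives, and uniqueness then identifies
  the second choice with \<open>h i i\<close>.\<close>

lemma H2_weak_laplacian:
  fixes u :: "'a::euclidean_space \<Rightarrow> complex"
  assumes g: "\<And>i. i \<in> Basis \<Longrightarrow> has_weak_partial i u (g i)" and h: "\<And>i. i \<in> Basis \<Longrightarrow> has_weak_partial i (g i) (h i i)"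
  shows "AE x in lborel. weak_laplacian u x = (\<Sum>i\<in>Basis. h i i x)" "weak_laplacian u \<in> borel_measurable lebesgue"
proof -
  have 1: "has_weak_partial i (weak_partial i u) (h i i)" if i: "i \<in> Basis" for i
  proof (rule has_weak_partial_cong_AE[OF h[OF i] i])
    have w: "has_weak_partial i u (weak_partial i u)" by (rule weak_partial_has_weak_partial[OF g[OF i]])
    then show "Lp_loc 1 (weak_partial i u)" by (simp add: has_weak_partial_def)
    show "AE x in lborel. g i x = weak_partial i u x" by (rule has_weak_partial_complex_unique[OF g[OF i] w i])
  qed
  have 2: "AE x in lborel. weak_partial i (weak_partial i u) x = h i i x" if i: "i \<in> Basis" for i
    by (rule has_weak_partial_complex_unique[OF weak_partial_has_weak_partial[OF 1[OF i]] 1[OF i] i])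
  have "AE x in lborel. \<forall>i\<in>Basis. weak_partial i (weak_partial i u) x = h i i x"
    by (intro AE_finite_allI 2) auto
  then show "AE x in lborel. weak_laplacian u x = (\<Sum>i\<in>Basis. h i i x)"
    by eventually_elim (simp add: weak_laplacian_def)
  have [measurable]: "weak_partial i (weak_partial i u) \<in> borel_measurable lebesgue" if i: "i \<in> Basis" for i
    using weak_partial_has_weak_partial[OF 1[OF i]] by (simp add: has_weak_partial_def Lp_loc_def)
  show "weak_laplacian u \<in> borel_measurable lebesgue"
    unfolding weak_laplacian_def[abs_def] by measurable
qed

lemma H2_components:
  fixes u :: "'a::euclidean_space \<Rightarrow> complex"
  assumes u: "H2 u"
  obtains g h where "\<And>i. i \<in> Basis \<Longrightarrow> has_weak_partial i u (g i)" "\<And>i. i \<in> Basis \<Longrightarrow> Lp 2 (g i)"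
    "\<And>i j. i \<in> Basis \<Longrightarrow> j \<in> Basis \<Longrightarrow> has_weak_partial j (g i) (h i j)" "\<And>i j. i \<in> Basis \<Longrightarrow> j \<in> Basis \<Longrightarrow> Lp 2 (h i j)"
proof -
  have "\<forall>i\<in>Basis. \<exists>g. has_weak_partial i u g \<and> Lp 2 g \<and> (\<forall>j\<in>Basis. \<exists>h. has_weak_partial j g h \<and> Lp 2 h)"
    using u by (simp add: numeral_2_eq_2)
  then obtain g where g: "\<forall>i\<in>Basis. has_weak_partial i u (g i) \<and> Lp 2 (g i) \<and> (\<forall>j\<in>Basis. \<exists>h. has_weak_partial j (g i) h \<and> Lp 2 h)"
    by metis
  then obtain h where "\<forall>i\<in>Basis. \<forall>j\<in>Basis. has_weak_partial j (g i) (h i j) \<and> Lp 2 (h i j)"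
    by metis
  with g show ?thesis using that[of g h] by blast
qed

lemma H2r_component:
  fixes u :: "'a::euclidean_space \<Rightarrow> complex"
  assumes u: "H2 u" and \<rho>: "\<rho> = Re \<or> \<rho> = Im"
  obtains U G H where "H2r U G H" "AE x in lborel. \<rho> (u x) = U x" "AE x in lborel. \<rho> (weak_laplacian u x) = (\<Sum>i\<in>Basis. H i i x)"
proof -
  interpret \<rho>: bounded_linear \<rho> by (rule component_bounded_linear[OF \<rho>])
  obtain g h where g: "\<And>i. i \<in> Basis \<Longrightarrow> has_weak_partial i u (g i)" "\<And>i. i \<in> Basis \<Longrightarrow> Lp 2 (g i)"
    and h: "\<And>i j. i \<in> Basis \<Longrightarrow> j \<in> Basis \<Longrightarrow> has_weak_partial j (g i) (h i j)" "\<And>i j. i \<in> Basis \<Longrightarrow> j \<in> Basis \<Longrightarrow> Lp 2 (h i j)"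
    using H2_components[OF u] by metis
  have L: "Lp 2 u" using u by (simp add: numeral_2_eq_2)
  have rep: "\<exists>F. F \<in> borel_measurable borel \<and> (AE x in lborel. \<rho> (f x) = F x) \<and> NP 2 F < \<infinity>" if f: "Lp 2 f" for f :: "'a \<Rightarrow> complex"
  proof -
    have "(\<lambda>x. \<rho> (f x)) \<in> borel_measurable lebesgue" using f by (intro component_measurable[OF \<rho>]) (simp add: Lp_def)
    then obtain F where F: "F \<in> borel_measurable borel" "AE x in lborel. \<rho> (f x) = F x" by (rule Borel_representative)
    have "AE x in lborel. \<bar>F x\<bar> \<le> norm (f x)"
      using F(2) by eventually_elim (metis component_bounded_linear(2)[OF \<rho>])
    then have "NP 2 F < \<infinity>" by (intro NP_Lp[OF f F(1)]) auto
    with F show ?thesis by blast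
  qed
  obtain U where U: "U \<in> borel_measurable borel" "AE x in lborel. \<rho> (u x) = U x" "NP 2 U < \<infinity>" using rep[OF L] by blast
  have "\<forall>i\<in>Basis. \<exists>F. F \<in> borel_measurable borel \<and> (AE x in lborel. \<rho> (g i x) = F x) \<and> NP 2 F < \<infinity>"
    using rep g(2) by blast
  then obtain G where G: "\<forall>i\<in>Basis. G i \<in> borel_measurable borel \<and> (AE x in lborel. \<rho> (g i x) = G i x) \<and> NP 2 (G i) < \<infinity>"
    by metis
  have "\<forall>i\<in>Basis. \<forall>j\<in>Basis. \<exists>F. F \<in> borel_measurable borel \<and> (AE x in lborel. \<rho> (h i j x) = F x) \<and> NP 2 F < \<infinity>"
    using rep h(2) by blast
  then obtain H where H: "\<forall>i\<in>Basis. \<forall>j\<in>Basis. H i j \<in> borel_measurable borel \<and> (AE x in lborel. \<rho> (h i j x) = H i j x) \<and> NP 2 (H i j) < \<infinity>"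
    by metis
  have "H2r U G H"
    unfolding H2r_def
  proof (intro conjI ballI)
    fix i :: 'a assume i: "i \<in> Basis"
    show "wpd i U (G i)"
      using has_weak_partial_wpd[OF has_weak_partial_component[OF g(1)[OF i] i \<rho>] i] U G i by blast
    fix j :: 'a assume j: "j \<in> Basis"
    show "wpd j (G i) (H i j)"
      using has_weak_partial_wpd[OF has_weak_partial_component[OF h(1)[OF i j] j \<rho>] j] H G i j by blast
  qed (use U G H in auto)
  moreover have "AE x in lborel. \<rho> (weak_laplacian u x) = (\<Sum>i\<in>Basis. H i i x)"
  proof -
    have "AE x in lborel. \<forall>i\<in>Basis. \<rho> (h i i x) = H i i x" using H by (intro AE_finite_allI) auto
    moreover have "AE x in lborel. weak_laplacian u x = (\<Sum>i\<in>Basis. h i i x)"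
      by (rule H2_weak_laplacian(1)[where g=g and h=h]) (simp_all add: g h)
    ultimately show ?thesis by eventually_elim (simp add: \<rho>.sum)
  qed
  ultimately show ?thesis using that U(2) by blast
qed

lemma Lp_of_real:
  fixes f :: "'a::euclidean_space \<Rightarrow> real"
  assumes [measurable]: "f \<in> borel_measurable borel" and "NP p f < \<infinity>"
  shows "Lp p (\<lambda>x. complex_of_real (f x))"
  unfolding Lp_def
proof
  show "(\<lambda>x. complex_of_real (f x)) \<in> borel_measurable lebesgue" by (rule borel_imp_lebesgue) measurable
  have "integrable lborel (\<lambda>x. \<bar>f x\<bar> powr p)"
    unfolding integrable_iff_bounded using assms(2) by (simp add: NP_def)
  then show "integrable lebesgue (\<lambda>x. norm (complex_of_real (f x)) powr p)"
    by (simp add: integrable_completion)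
qed

lemma Lp_loc_of_real:
  fixes f :: "'a::euclidean_space \<Rightarrow> real"
  assumes f: "locint f"
  shows "Lp_loc 1 (\<lambda>x. complex_of_real (f x))"
  unfolding Lp_loc_def
proof (intro conjI allI impI)
  have [measurable]: "f \<in> borel_measurable borel" using f by (simp add: locint_def)
  show "(\<lambda>x. complex_of_real (f x)) \<in> borel_measurable lebesgue" by (rule borel_imp_lebesgue) measurable
  fix K :: "'a set" assume K: "compact K"
  then have [measurable]: "K \<in> sets borel" by (simp add: compact_imp_closed)
  from K obtain R where R: "\<And>x. x \<in> K \<Longrightarrow> norm x \<le> R" using compact_imp_bounded bounded_iff by metis
  have "integrable lborel (\<lambda>x. indicator (cball 0 R) x * f x)" using f by (simp add: locint_def)
  then have "integrable lborel (\<lambda>x. indicator K x *\<^sub>R (norm (complex_of_real (f x)) powr 1))"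
    by (rule Bochner_Integration.integrable_bound) (auto dest: R split: split_indicator)
  then show "set_integrable lebesgue K (\<lambda>x. norm (complex_of_real (f x)) powr 1)"
    unfolding set_integrable_def by (subst integrable_completion) auto
qed

lemma has_weak_partial_of_real:
  fixes f g :: "'a::euclidean_space \<Rightarrow> real"
  assumes w: "wpd i f g" and f: "locint f" and g: "locint g" and i: "i \<in> Basis"
  shows "has_weak_partial i (\<lambda>x. complex_of_real (f x)) (\<lambda>x. complex_of_real (g x))"
  unfolding has_weak_partial_def
proof (intro conjI allI impI Lp_loc_of_real f g)
  fix \<phi> :: "'a \<Rightarrow> real" assume \<phi>: "test_function \<phi>"
  have [measurable]: "f \<in> borel_measurable borel" "g \<in> borel_measurable borel" "\<phi> \<in> borel_measurable borel" "partial i \<phi> \<in> borel_measurable borel"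
    using f g by (auto simp: locint_def intro!: test_function_borel \<phi> test_function_partial i)
  have "(\<integral>x. \<psi> x *\<^sub>R complex_of_real (k x) \<partial>lebesgue) = complex_of_real (\<integral>x. \<psi> x * k x \<partial>lborel)"
    if [measurable]: "\<psi> \<in> borel_measurable borel" "k \<in> borel_measurable borel" for \<psi> k :: "'a \<Rightarrow> real"
  proof -
    have "(\<lambda>x. complex_of_real (\<psi> x * k x)) \<in> borel_measurable lborel" by measurable
    then have "(\<integral>x. complex_of_real (\<psi> x * k x) \<partial>lebesgue) = (\<integral>x. complex_of_real (\<psi> x * k x) \<partial>lborel)"
      by (rule integral_completion)
    also have "\<dots> = complex_of_real (\<integral>x. \<psi> x * k x \<partial>lborel)" by (rule integral_complex_of_real)
    finally show ?thesis by (simp add: scaleR_conv_of_real)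
  qed
  then show "(\<integral>x. partial i \<phi> x *\<^sub>R complex_of_real (f x) \<partial>lebesgue) = - (\<integral>x. \<phi> x *\<^sub>R complex_of_real (g x) \<partial>lebesgue)"
    using w \<phi> by (simp add: wpd_def)
qed

text \<open>Makes a real compactly supported function an admissible test function of the complex
  equation, with its weak Laplacian identified a.e.\<close>

lemma W2c_H2:
  fixes v :: "'a::euclidean_space \<Rightarrow> real"
  assumes v: "W2c R v gv hv"
  shows "H2 (\<lambda>x. complex_of_real (v x))" "compactly_supported (\<lambda>x. complex_of_real (v x))"
    "AE x in lborel. weak_laplacian (\<lambda>x. complex_of_real (v x)) x = complex_of_real (\<Sum>i\<in>Basis. hv i i x)"
    "weak_laplacian (\<lambda>x. complex_of_real (v x)) \<in> borel_measurable lebesgue"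
proof -
  have m: "v \<in> borel_measurable borel" "NP 2 v < \<infinity>"
    "\<And>i. i \<in> Basis \<Longrightarrow> gv i \<in> borel_measurable borel" "\<And>i. i \<in> Basis \<Longrightarrow> NP 2 (gv i) < \<infinity>" "\<And>i. i \<in> Basis \<Longrightarrow> wpd i v (gv i)"
    "\<And>i j. i \<in> Basis \<Longrightarrow> j \<in> Basis \<Longrightarrow> hv i j \<in> borel_measurable borel" "\<And>i j. i \<in> Basis \<Longrightarrow> j \<in> Basis \<Longrightarrow> NP 2 (hv i j) < \<infinity>"
    "\<And>i j. i \<in> Basis \<Longrightarrow> j \<in> Basis \<Longrightarrow> wpd j (gv i) (hv i j)"
    using v by (auto simp: W2c_iff H2r_def)
  have l: "locint v" "\<And>i. i \<in> Basis \<Longrightarrow> locint (gv i)" "\<And>i j. i \<in> Basis \<Longrightarrow> j \<in> Basis \<Longrightarrow> locint (hv i j)"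
    using m by (auto intro!: locint_NP[where p=2])
  have w1: "has_weak_partial i (\<lambda>x. complex_of_real (v x)) (\<lambda>x. complex_of_real (gv i x))" if "i \<in> Basis" for i
    by (rule has_weak_partial_of_real[OF m(5) l(1,2)]) (rule that)+
  have w2: "has_weak_partial j (\<lambda>x. complex_of_real (gv i x)) (\<lambda>x. complex_of_real (hv i j x))" if "i \<in> Basis" "j \<in> Basis" for i j
    by (rule has_weak_partial_of_real[OF m(8) l(2,3)]) (rule that)+
  show "H2 (\<lambda>x. complex_of_real (v x))"
    unfolding numeral_2_eq_2 sobolev.simps unfolding numeral_2_eq_2[symmetric]
  proof (intro conjI ballI Lp_of_real m(1,2))
    fix i :: 'a assume i: "i \<in> Basis"
    have "Lp 2 (\<lambda>x. complex_of_real (gv i x))" by (intro Lp_of_real m(3,4) i)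
    moreover have "\<exists>g. has_weak_partial j (\<lambda>x. complex_of_real (gv i x)) g \<and> Lp 2 g" if j: "j \<in> Basis" for j
      using w2[OF i j] Lp_of_real[OF m(6)[OF i j] m(7)[OF i j]] by blast
    ultimately show "\<exists>g. has_weak_partial i (\<lambda>x. complex_of_real (v x)) g \<and> Lp 2 g \<and> (\<forall>j\<in>Basis. \<exists>h. has_weak_partial j g h \<and> Lp 2 h)"
      using w1[OF i] by blast
  qed
  show "compactly_supported (\<lambda>x. complex_of_real (v x))"
    unfolding compactly_supported_def using v by (intro exI[of _ "cball 0 R"]) (auto simp: W2c_iff)
  show "AE x in lborel. weak_laplacian (\<lambda>x. complex_of_real (v x)) x = complex_of_real (\<Sum>i\<in>Basis. hv i i x)"
    using H2_weak_laplacian(1)[of "\<lambda>x. complex_of_real (v x)" "\<lambda>i x. complex_of_real (gv i x)" "\<lambda>i j x. complex_of_real (hv i j x)"] w1 w2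
    by simp
  show "weak_laplacian (\<lambda>x. complex_of_real (v x)) \<in> borel_measurable lebesgue"
    using H2_weak_laplacian(2)[of "\<lambda>x. complex_of_real (v x)" "\<lambda>i x. complex_of_real (gv i x)" "\<lambda>i j x. complex_of_real (hv i j x)"] w1 w2
    by simp
qed

text \<open>Both parts have to be integrable: otherwise the complex integral would be 0 by
  convention even if one part had a nonzero integral.\<close>

lemma integral_lebesgue_Complex:
  fixes F :: "'a::euclidean_space \<Rightarrow> complex"
  assumes F: "F \<in> borel_measurable lebesgue" and A: "integrable lborel A" and B: "integrable lborel B"
    and ae: "AE x in lborel. F x = Complex (A x) (B x)"
  shows "(\<integral>x. F x \<partial>lebesgue) = Complex (\<integral>x. A x \<partial>lborel) (\<integral>x. B x \<partial>lborel)"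
proof -
  have [measurable]: "A \<in> borel_measurable lborel" "B \<in> borel_measurable lborel" using A B by auto
  define C where "C x = complex_of_real (A x) + \<i> * complex_of_real (B x)" for x
  have C: "integrable lborel C" unfolding C_def using A B by simp
  have Cm: "C \<in> borel_measurable lborel" using C by auto
  have "(\<integral>x. F x \<partial>lebesgue) = (\<integral>x. C x \<partial>lebesgue)"
  proof (intro integral_cong_AE F measurable_completion Cm)
    show "AE x in lebesgue. F x = C x"
      unfolding AE_lebesgue_iff using ae by eventually_elim (simp add: C_def complex_eq_iff)
  qed
  also have "\<dots> = (\<integral>x. C x \<partial>lborel)" by (rule integral_completion[OF Cm])
  also have "\<dots> = complex_of_real (\<integral>x. A x \<partial>lborel) + \<i> * complex_of_real (\<integral>x. B x \<partial>lborel)"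
    unfolding C_def using A B by simp
  finally show ?thesis by (simp add: complex_eq_iff)
qed

lemma W2c_NP_embedding:
  fixes w :: "'a::euclidean_space \<Rightarrow> real"
  assumes "W2c R w g h" "DIM('a) \<ge> 5"
  shows "NP (2 * (DIM('a) / (real DIM('a) - 4))) w < \<infinity>"
proof -
  obtain K :: "nat \<Rightarrow> 'a \<Rightarrow> real" where K: "mollifiers K" using mollifiers_exist by blast
  interpret W2_compact R w g h K using assms K by unfold_locales auto
  show ?thesis using Sobolev_embedding_2[OF assms(2)] assms(2) by (simp add: of_nat_diff)
qed

lemma NP_mult_fin:
  assumes [measurable]: "v \<in> borel_measurable borel" "w \<in> borel_measurable borel"
    and fin: "NP (2 * p) v < \<infinity>" "NP (2 * p) w < \<infinity>"
  shows "NP p (\<lambda>x. v x * w x) < \<infinity>"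
proof -
  have "\<bar>v x * w x\<bar> powr p \<le> \<bar>v x\<bar> powr (2 * p) + \<bar>w x\<bar> powr (2 * p)" for x
  proof -
    have e: "\<bar>t\<bar> powr (2 * p) = (\<bar>t\<bar> powr p)\<^sup>2" for t :: real
      by (simp add: powr_add[symmetric] power2_eq_square)
    have "\<bar>v x * w x\<bar> powr p = \<bar>v x\<bar> powr p * \<bar>w x\<bar> powr p"
      unfolding abs_mult by (rule powr_mult)
    also have "\<dots> \<le> 2 * (\<bar>v x\<bar> powr p) * (\<bar>w x\<bar> powr p)" by simp
    also have "\<dots> \<le> (\<bar>v x\<bar> powr p)\<^sup>2 + (\<bar>w x\<bar> powr p)\<^sup>2" by (rule sum_squares_bound)
    finally show ?thesis by (simp add: e)
  qed
  then have "NP p (\<lambda>x. v x * w x) \<le> (\<integral>\<^sup>+x. ennreal (\<bar>v x\<bar> powr (2 * p)) + ennreal (\<bar>w x\<bar> powr (2 * p)) \<partial>lborel)"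
    unfolding NP_def by (intro nn_integral_mono) (simp add: ennreal_plus[symmetric] del: ennreal_plus)
  also have "\<dots> = NP (2 * p) v + NP (2 * p) w"
    unfolding NP_def by (rule nn_integral_add) measurable
  also have "\<dots> < \<infinity>" using fin by simp
  finally show ?thesis .
qed

text \<open>The embedding needs compact support, which \<open>u\<close> lacks; a cutoff equal to 1
  on the support of \<open>v\<close> supplies it without changing the product. Then L^(d/4) is
  paired with a product of two functions in L^(2d/(d - 4)).\<close>

lemma integrable_potential:
  fixes u v V :: "'a::euclidean_space \<Rightarrow> real"
  assumes d: "DIM('a) \<ge> 5" and u: "H2r u G H" and v: "W2c R v gv hv"
    and V[measurable]: "V \<in> borel_measurable borel" "\<And>R. NP (DIM('a) / 4) (\<lambda>x. indicator (cball 0 R) x * V x) < \<infinity>"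
  shows "integrable lborel (\<lambda>x. V x * u x * v x)"
proof -
  define p where "p = DIM('a) / (real DIM('a) - 4)"
  have p: "real DIM('a) / 4 > 1" "p > 1" "1 / (real DIM('a) / 4) + 1 / p = 1"
    using d by (auto simp: p_def field_simps)
  obtain \<kappa>' :: "'a \<Rightarrow> real" where \<kappa>': "smooth \<kappa>'" "\<And>x. 0 \<le> \<kappa>' x" "\<And>x. \<kappa>' x \<le> 1"
    "\<And>x. norm x \<le> 1 \<Longrightarrow> \<kappa>' x = 1" "\<And>x. norm x \<ge> 2 \<Longrightarrow> \<kappa>' x = 0"
    using smooth_cutoff_exists by blast
  define S where "S = max R 1"
  have S: "S > 0" "R \<le> S" by (auto simp: S_def)
  define \<kappa> where "\<kappa> x = \<kappa>' ((1 / S) *\<^sub>R x + 0)" for x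
  have "test_function \<kappa>'" using \<kappa>' by (auto simp: test_function_iff intro!: exI[of _ 2])
  then have t: "test_function \<kappa>" unfolding \<kappa>_def using S by (intro test_function_affine) auto
  have \<kappa>1: "\<kappa> x = 1" if "norm x \<le> S" for x
    unfolding \<kappa>_def using that S by (intro \<kappa>'(4)) (simp add: field_simps)
  have \<kappa>0: "\<kappa> x = 0" if "norm x > 2 * S" for x
    unfolding \<kappa>_def using that S by (intro \<kappa>'(5)) (simp add: field_simps)
  have [measurable]: "\<kappa> \<in> borel_measurable borel" by (rule test_function_borel[OF t])
  have [measurable]: "u \<in> borel_measurable borel" "v \<in> borel_measurable borel"
    using u v by (auto simp: W2c_iff H2r_def)
  have [measurable]: "cball (0::'a) S \<in> sets borel" by (rule borel_closed) simp
  have "NP (2 * p) (\<lambda>x. \<kappa> x * u x) < \<infinity>"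
    unfolding p_def by (rule W2c_NP_embedding[OF W2c_mult[OF t \<kappa>0 u] d])
  moreover have "NP (2 * p) v < \<infinity>"
    unfolding p_def by (rule W2c_NP_embedding[OF v d])
  ultimately have uv: "NP p (\<lambda>x. \<kappa> x * u x * v x) < \<infinity>" by (rule NP_mult_fin[rotated 2]) measurable
  have "integrable lborel (\<lambda>x. (indicator (cball 0 S) x * V x) * (\<kappa> x * u x * v x))"
    by (rule integrable_mult_NP[OF _ _ p V(2) uv]) auto
  moreover have "(indicator (cball 0 S) x * V x) * (\<kappa> x * u x * v x) = V x * u x * v x" for x
  proof (cases "norm x \<le> S")
    case False
    then have "v x = 0" using v S by (auto simp: W2c_iff)
    then show ?thesis by simp
  qed (simp add: \<kappa>1)
  ultimately show ?thesis by simp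
qed

text \<open>Write f v as |x|^2 f times v/|x|^2, two square integrable factors by the Rellich
  inequality; the identity fails at most at the origin.\<close>

lemma integrable_rhs:
  fixes f v :: "'a::euclidean_space \<Rightarrow> real"
  assumes d: "DIM('a) \<ge> 5" and v: "W2c R v gv hv"
    and f[measurable]: "f \<in> borel_measurable borel" "NP 2 (\<lambda>x. (x \<bullet> x) * f x) < \<infinity>"
  shows "integrable lborel (\<lambda>x. f x * v x)"
proof -
  obtain K :: "nat \<Rightarrow> 'a \<Rightarrow> real" where K: "mollifiers K" using mollifiers_exist by blast
  interpret W2_compact R v gv hv K using v K by unfold_locales auto
  have vh: "H2r v gv hv" using v by (simp add: W2c_iff)
  then have [measurable]: "v \<in> borel_measurable borel" by (auto simp: H2r_def)
  have "NP 2 Lap < \<infinity>"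
    unfolding Lap_def[abs_def] using vh by (intro NP_sum_fin) (auto simp: H2r_def)
  then have "ennreal ((4 / (DIM('a) * (DIM('a) - 4)))\<^sup>2) * NP 2 Lap < \<infinity>"
    by (simp add: ennreal_mult_less_top)
  from le_less_trans[OF Rellich[OF d] this]
  have fin: "NP 2 (\<lambda>x. v x / (x \<bullet> x)) < \<infinity>" unfolding NP_2_div_square .
  have i: "integrable lborel (\<lambda>x. ((x \<bullet> x) * f x) * (v x / (x \<bullet> x)))"
    by (rule integrable_mult_2[OF _ _ f(2) fin]) auto
  have "AE x in lborel. ((x \<bullet> x) * f x) * (v x / (x \<bullet> x)) = f x * v x"
    using AE_lborel_singleton[of "0::'a"] by eventually_elim simp
  then show ?thesis by (rule integrable_cong_AE_imp[OF i, rotated]) auto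
qed

lemma sobolev_loc_representative:
  fixes V :: "'a::euclidean_space \<Rightarrow> real"
  assumes V: "sobolev_loc 1 p V" and p: "p \<ge> 0"
  obtains W GW where "W \<in> borel_measurable borel" "AE x in lborel. V x = W x" "\<And>R. NP p (\<lambda>x. indicator (cball 0 R) x * W x) < \<infinity>"
    "\<And>i. i \<in> Basis \<Longrightarrow> GW i \<in> borel_measurable borel" "\<And>i. i \<in> Basis \<Longrightarrow> AE x in lborel. weak_partial i V x = GW i x"
    "\<And>i R. i \<in> Basis \<Longrightarrow> NP p (\<lambda>x. indicator (cball 0 R) x * GW i x) < \<infinity>" "\<And>i. i \<in> Basis \<Longrightarrow> wpd i W (GW i)"
proof -
  have rep: "\<exists>F. F \<in> borel_measurable borel \<and> (AE x in lborel. f x = F x) \<and> (\<forall>R. NP p (\<lambda>x. indicator (cball 0 R) x * F x) < \<infinity>)"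
    if f: "Lp_loc p f" for f :: "'a \<Rightarrow> real"
  proof -
    have "f \<in> borel_measurable lebesgue" using f by (simp add: Lp_loc_def)
    then obtain F where F: "F \<in> borel_measurable borel" "AE x in lborel. f x = F x" by (rule Borel_representative)
    have "AE x in lborel. \<bar>F x\<bar> \<le> norm (f x)" using F(2) by eventually_elim simp
    from NP_indicator_Lp_loc[OF f F(1) this p] F show ?thesis by blast
  qed
  have V': "Lp_loc p V" "\<forall>i\<in>Basis. \<exists>g. has_weak_partial i V g \<and> Lp_loc p g" using V by simp_all
  obtain W where W: "W \<in> borel_measurable borel" "AE x in lborel. V x = W x" "\<forall>R. NP p (\<lambda>x. indicator (cball 0 R) x * W x) < \<infinity>"
    using rep[OF V'(1)] by blast
  have "\<exists>F. F \<in> borel_measurable borel \<and> (AE x in lborel. weak_partial i V x = F x) \<and> (\<forall>R. NP p (\<lambda>x. indicator (cball 0 R) x * F x) < \<infinity>) \<and> wpd i W F"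
    if i: "i \<in> Basis" for i
  proof -
    obtain g where g: "has_weak_partial i V g" "Lp_loc p g" using V'(2) i by blast
    obtain F where F: "F \<in> borel_measurable borel" "AE x in lborel. g x = F x" "\<forall>R. NP p (\<lambda>x. indicator (cball 0 R) x * F x) < \<infinity>"
      using rep[OF g(2)] by blast
    have "AE x in lborel. weak_partial i V x = g x"
      by (rule has_weak_partial_real_unique[OF weak_partial_has_weak_partial[OF g(1)] g(1) i])
    then have "AE x in lborel. weak_partial i V x = F x" using F(2) by eventually_elim simp
    moreover have "wpd i W F" by (rule has_weak_partial_wpd[OF g(1) i W(1) F(1) W(2) F(2)])
    ultimately show ?thesis using F by blast
  qed
  then have "\<forall>i\<in>Basis. \<exists>F. F \<in> borel_measurable borel \<and> (AE x in lborel. weak_partial i V x = F x) \<and> (\<forall>R. NP p (\<lambda>x. indicator (cball 0 R) x * F x) < \<infinity>) \<and> wpd i W F"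
    by blast
  from bchoice[OF this] obtain GW where "\<forall>i\<in>Basis. GW i \<in> borel_measurable borel \<and> (AE x in lborel. weak_partial i V x = GW i x) \<and> (\<forall>R. NP p (\<lambda>x. indicator (cball 0 R) x * GW i x) < \<infinity>) \<and> wpd i W (GW i)"
    by blast
  with W show ?thesis using that[of W GW] by blast
qed

lemma Lp_norm_2_Complex:
  fixes F :: "'a::euclidean_space \<Rightarrow> complex"
  assumes F: "F \<in> borel_measurable lebesgue" and ae: "AE x in lborel. Re (F x) = A x" "AE x in lborel. Im (F x) = B x"
    and [measurable]: "A \<in> borel_measurable borel" "B \<in> borel_measurable borel" and fin: "NP 2 A < \<infinity>" "NP 2 B < \<infinity>"
  shows "Lp_norm 2 F = sqrt ((nm A)\<^sup>2 + (nm B)\<^sup>2)"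
proof -
  have "(\<integral>x. norm (F x) powr 2 \<partial>lebesgue) = (\<integral>x. (A x)\<^sup>2 + (B x)\<^sup>2 \<partial>lborel)"
  proof (rule integral_lebesgue_cong)
    show "(\<lambda>x. norm (F x) powr 2) \<in> borel_measurable lebesgue" using F by measurable
    show "AE x in lborel. norm (F x) powr 2 = (A x)\<^sup>2 + (B x)\<^sup>2"
      using ae by eventually_elim (simp add: cmod_power2)
  qed measurable
  also have "\<dots> = (nm A)\<^sup>2 + (nm B)\<^sup>2"
    using fin by (subst Bochner_Integration.integral_add) (auto simp: nm_square intro!: NP_2_integral)
  finally show ?thesis unfolding Lp_norm_def by (simp add: powr_half_sqrt)
qed

section \<open>Complex-valued solutions\<close>

text \<open>Real and imaginary parts satisfy decoupled equations with the same real V and z, and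
  hence the same estimate. Squared norms add over the two parts, so the constant survives.\<close>

lemma biharmonic_estimate:
  fixes V :: "'a::euclidean_space \<Rightarrow> real" and f u :: "'a \<Rightarrow> complex"
  assumes d: "DIM('a) \<ge> 5" and V_sob: "sobolev_loc 1 (DIM('a) / 4) V" and a: "0 \<le> a" "a < 1"
    and small: "\<And>\<psi> :: 'a \<Rightarrow> complex. H2 \<psi> \<Longrightarrow>
        ennreal (1 / 4) * (\<integral>\<^sup>+x. ennreal (max (x \<bullet> weak_gradient V x) 0 * (norm (\<psi> x))\<^sup>2) \<partial>lebesgue)
        \<le> ennreal a * (\<integral>\<^sup>+x. ennreal ((norm (weak_laplacian \<psi> x))\<^sup>2) \<partial>lebesgue)"
    and f: "f \<in> borel_measurable lebesgue" "Lp 2 (\<lambda>x. (norm x)\<^sup>2 *\<^sub>R f x)" and sol: "H2_solution V z f u"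
  shows "Lp_norm 2 (weak_laplacian u)
    \<le> 1 / (1 - a) * (2 * (real DIM('a) - 2) / (real DIM('a) * (real DIM('a) - 4))) * Lp_norm 2 (\<lambda>x. (norm x)\<^sup>2 *\<^sub>R f x)"
proof -
  define C where "C = 1 / (1 - a) * (2 * (real DIM('a) - 2) / (real DIM('a) * (real DIM('a) - 4)))"
  have C0: "C \<ge> 0" using a d by (simp add: C_def)
  have uH: "H2 u" using sol by (simp add: H2_solution_def)
  have um[measurable]: "u \<in> borel_measurable lebesgue" using uH by (simp add: numeral_2_eq_2 Lp_def)
  have Vm[measurable]: "V \<in> borel_measurable lebesgue" using V_sob by (simp add: Lp_loc_def)
  note [measurable] = f(1)
  obtain g h where gh: "\<And>i. i \<in> Basis \<Longrightarrow> has_weak_partial i u (g i)"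
    "\<And>i j. i \<in> Basis \<Longrightarrow> j \<in> Basis \<Longrightarrow> has_weak_partial j (g i) (h i j)"
    by (rule H2_components[OF uH]) blast
  have Dum[measurable]: "weak_laplacian u \<in> borel_measurable lebesgue"
    by (rule H2_weak_laplacian(2)[where g=g and h=h]) (simp_all add: gh)
  obtain W GW where W: "W \<in> borel_measurable borel" "AE x in lborel. V x = W x" "\<And>R. NP (DIM('a) / 4) (\<lambda>x. indicator (cball 0 R) x * W x) < \<infinity>"
    and GW: "\<And>i. i \<in> Basis \<Longrightarrow> GW i \<in> borel_measurable borel" "\<And>i. i \<in> Basis \<Longrightarrow> AE x in lborel. weak_partial i V x = GW i x"
    "\<And>i R. i \<in> Basis \<Longrightarrow> NP (DIM('a) / 4) (\<lambda>x. indicator (cball 0 R) x * GW i x) < \<infinity>" "\<And>i. i \<in> Basis \<Longrightarrow> wpd i W (GW i)"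
    by (rule sobolev_loc_representative[OF V_sob]) (simp, blast)
  have rep_u: "\<exists>U G H. H2r U G H \<and> (AE x in lborel. \<rho> (u x) = U x) \<and> (AE x in lborel. \<rho> (weak_laplacian u x) = (\<Sum>i\<in>Basis. H i i x))"
    if "\<rho> = Re \<or> \<rho> = Im" for \<rho>
    by (rule H2r_component[OF uH that]) blast
  obtain Ur Gr Hr where r: "H2r Ur Gr Hr" "AE x in lborel. Re (u x) = Ur x" "AE x in lborel. Re (weak_laplacian u x) = (\<Sum>i\<in>Basis. Hr i i x)"
    using rep_u[of Re] by blast
  obtain Ui Gi Hi where i: "H2r Ui Gi Hi" "AE x in lborel. Im (u x) = Ui x" "AE x in lborel. Im (weak_laplacian u x) = (\<Sum>i\<in>Basis. Hi i i x)"
    using rep_u[of Im] by blast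
  have rep_f: "\<exists>F. F \<in> borel_measurable borel \<and> (AE x in lborel. \<rho> (f x) = F x) \<and> NP 2 (\<lambda>x. (x \<bullet> x) * F x) < \<infinity>"
    if \<rho>: "\<rho> = Re \<or> \<rho> = Im" for \<rho>
  proof -
    obtain F where F: "F \<in> borel_measurable borel" "AE x in lborel. \<rho> (f x) = F x"
      by (rule Borel_representative[OF component_measurable[OF \<rho> f(1)]]) blast
    have "AE x in lborel. \<bar>(x \<bullet> x) * F x\<bar> \<le> norm ((norm x)\<^sup>2 *\<^sub>R f x)"
      using F(2)
    proof eventually_elim
      case (elim x)
      have "\<bar>F x\<bar> \<le> norm (f x)" unfolding elim[symmetric] by (rule component_bounded_linear(2)[OF \<rho>])
      then show ?case by (simp add: abs_mult power2_norm_eq_inner mult_left_mono)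
    qed
    then have "NP 2 (\<lambda>x. (x \<bullet> x) * F x) < \<infinity>" using F(1) by (intro NP_Lp[OF f(2)]) auto
    with F show ?thesis by blast
  qed
  obtain Fr where Fr: "Fr \<in> borel_measurable borel" "AE x in lborel. Re (f x) = Fr x" "NP 2 (\<lambda>x. (x \<bullet> x) * Fr x) < \<infinity>"
    using rep_f[of Re] by blast
  obtain Fi where Fi: "Fi \<in> borel_measurable borel" "AE x in lborel. Im (f x) = Fi x" "NP 2 (\<lambda>x. (x \<bullet> x) * Fi x) < \<infinity>"
    using rep_f[of Im] by blast
  have lap: "(\<lambda>x. \<Sum>i\<in>Basis. H i i x) \<in> borel_measurable borel" "NP 2 (\<lambda>x. \<Sum>i\<in>Basis. H i i x) < \<infinity>"
    if "H2r U G H" for U :: "'a \<Rightarrow> real" and G H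
  proof -
    show "(\<lambda>x. \<Sum>i\<in>Basis. H i i x) \<in> borel_measurable borel" using that by (intro borel_measurable_sum) (auto simp: H2r_def)
    show "NP 2 (\<lambda>x. \<Sum>i\<in>Basis. H i i x) < \<infinity>" using that by (intro NP_sum_fin) (auto simp: H2r_def)
  qed
  \<comment> \<open>With a real test function, taking real and imaginary parts of the single complex
    identity gives both equations at once.\<close>
  have eqs:
    "(\<integral>x. (\<Sum>i\<in>Basis. Hr i i x) * (\<Sum>i\<in>Basis. hv i i x) \<partial>lborel) + (\<integral>x. W x * Ur x * v x \<partial>lborel)
       - z * (\<integral>x. Ur x * v x \<partial>lborel) = (\<integral>x. Fr x * v x \<partial>lborel) \<and>
     (\<integral>x. (\<Sum>i\<in>Basis. Hi i i x) * (\<Sum>i\<in>Basis. hv i i x) \<partial>lborel) + (\<integral>x. W x * Ui x * v x \<partial>lborel)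
       - z * (\<integral>x. Ui x * v x \<partial>lborel) = (\<integral>x. Fi x * v x \<partial>lborel)"
    if v: "W2c R v gv hv" for R v gv hv
  proof -
    have vH: "H2r v gv hv" using v by (simp add: W2c_iff)
    have vb: "v \<in> borel_measurable borel" "NP 2 v < \<infinity>" using vH by (auto simp: H2r_def)
    have Ub: "Ur \<in> borel_measurable borel" "NP 2 Ur < \<infinity>" "Ui \<in> borel_measurable borel" "NP 2 Ui < \<infinity>"
      using r(1) i(1) by (auto simp: H2r_def)
    define vc where "vc x = complex_of_real (v x)" for x
    note vc = W2c_H2[OF v, folded vc_def]
    have cnj_measurable: "(\<lambda>x. cnj (h x)) \<in> borel_measurable lebesgue" if "h \<in> borel_measurable lebesgue" for h :: "'a \<Rightarrow> complex"
      by (rule measurable_compose[OF that]) (intro borel_measurable_continuous_onI continuous_intros)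
    have "vc \<in> borel_measurable lebesgue" unfolding vc_def by (rule borel_imp_lebesgue) (use vb in measurable)
    note [measurable] = cnj_measurable[OF this]
    have 1: "(\<integral>x. weak_laplacian u x * cnj (weak_laplacian vc x) \<partial>lebesgue)
        = Complex (\<integral>x. (\<Sum>i\<in>Basis. Hr i i x) * (\<Sum>i\<in>Basis. hv i i x) \<partial>lborel) (\<integral>x. (\<Sum>i\<in>Basis. Hi i i x) * (\<Sum>i\<in>Basis. hv i i x) \<partial>lborel)"
    proof (rule integral_lebesgue_Complex)
      show "AE x in lborel. weak_laplacian u x * cnj (weak_laplacian vc x)
          = Complex ((\<Sum>i\<in>Basis. Hr i i x) * (\<Sum>i\<in>Basis. hv i i x)) ((\<Sum>i\<in>Basis. Hi i i x) * (\<Sum>i\<in>Basis. hv i i x))"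
        using r(3) i(3) vc(3) by eventually_elim (simp add: complex_eq_iff)
    qed (rule borel_measurable_times[OF Dum cnj_measurable[OF vc(4)]], intro integrable_mult_2 lap[OF r(1)] lap[OF i(1)] lap[OF vH], intro integrable_mult_2 lap[OF r(1)] lap[OF i(1)] lap[OF vH])
    have 2: "(\<integral>x. complex_of_real (V x) * u x * cnj (vc x) \<partial>lebesgue)
        = Complex (\<integral>x. W x * Ur x * v x \<partial>lborel) (\<integral>x. W x * Ui x * v x \<partial>lborel)"
    proof (rule integral_lebesgue_Complex)
      show "AE x in lborel. complex_of_real (V x) * u x * cnj (vc x) = Complex (W x * Ur x * v x) (W x * Ui x * v x)"
        using r(2) i(2) W(2) by eventually_elim (simp add: complex_eq_iff vc_def)
    qed (measurable, rule integrable_potential[OF d r(1) v W(1,3)], rule integrable_potential[OF d i(1) v W(1,3)])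
    have 3: "(\<integral>x. u x * cnj (vc x) \<partial>lebesgue) = Complex (\<integral>x. Ur x * v x \<partial>lborel) (\<integral>x. Ui x * v x \<partial>lborel)"
    proof (rule integral_lebesgue_Complex)
      show "AE x in lborel. u x * cnj (vc x) = Complex (Ur x * v x) (Ui x * v x)"
        using r(2) i(2) by eventually_elim (simp add: complex_eq_iff vc_def)
    qed (measurable, rule integrable_mult_2[OF Ub(1) vb(1) Ub(2) vb(2)], rule integrable_mult_2[OF Ub(3) vb(1) Ub(4) vb(2)])
    have 4: "(\<integral>x. f x * cnj (vc x) \<partial>lebesgue) = Complex (\<integral>x. Fr x * v x \<partial>lborel) (\<integral>x. Fi x * v x \<partial>lborel)"
    proof (rule integral_lebesgue_Complex)
      show "AE x in lborel. f x * cnj (vc x) = Complex (Fr x * v x) (Fi x * v x)"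
        using Fr(2) Fi(2) by eventually_elim (simp add: complex_eq_iff vc_def)
    qed (measurable, rule integrable_rhs[OF d v Fr(1,3)], rule integrable_rhs[OF d v Fi(1,3)])
    have "(\<integral>x. weak_laplacian u x * cnj (weak_laplacian vc x) \<partial>lebesgue)
        + (\<integral>x. complex_of_real (V x) * u x * cnj (vc x) \<partial>lebesgue)
        - complex_of_real z * (\<integral>x. u x * cnj (vc x) \<partial>lebesgue)
        = (\<integral>x. f x * cnj (vc x) \<partial>lebesgue)"
      using sol vc(1,2) unfolding H2_solution_def by blast
    then show ?thesis unfolding 1 2 3 4 by (simp add: complex_eq_iff)
  qed
  have small': "(\<integral>\<^sup>+x. ennreal (max (\<Sum>i\<in>Basis. (x \<bullet> i) * GW i x) 0 * (\<psi> x)\<^sup>2) \<partial>lborel)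
      \<le> ennreal (4 * a) * NP 2 (\<lambda>x. \<Sum>i\<in>Basis. h\<psi> i i x)" if \<psi>: "W2c R \<psi> g\<psi> h\<psi>" for R \<psi> g\<psi> h\<psi>
  proof -
    have \<psi>H: "H2r \<psi> g\<psi> h\<psi>" using \<psi> by (simp add: W2c_iff)
    have [measurable]: "\<psi> \<in> borel_measurable borel" "(\<lambda>x. \<Sum>i\<in>Basis. h\<psi> i i x) \<in> borel_measurable borel"
      using \<psi>H lap(1)[OF \<psi>H] by (auto simp: H2r_def)
    note [measurable] = GW(1)
    define \<psi>c where "\<psi>c x = complex_of_real (\<psi> x)" for x
    note \<psi>c = W2c_H2[OF \<psi>, folded \<psi>c_def]
    have "AE x in lborel. \<forall>i\<in>Basis. weak_partial i V x = GW i x" using GW(2) by (intro AE_finite_allI) auto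
    then have ae: "AE x in lborel. max (x \<bullet> weak_gradient V x) 0 * (norm (\<psi>c x))\<^sup>2 = max (\<Sum>i\<in>Basis. (x \<bullet> i) * GW i x) 0 * (\<psi> x)\<^sup>2"
      by eventually_elim (simp add: weak_gradient_def inner_sum_right \<psi>c_def mult.commute)
    have X: "(\<integral>\<^sup>+x. ennreal (max (x \<bullet> weak_gradient V x) 0 * (norm (\<psi>c x))\<^sup>2) \<partial>lebesgue)
        = (\<integral>\<^sup>+x. ennreal (max (\<Sum>i\<in>Basis. (x \<bullet> i) * GW i x) 0 * (\<psi> x)\<^sup>2) \<partial>lborel)"
      by (rule nn_integral_lebesgue_cong[OF _ ae]) measurable
    have ae2: "AE x in lborel. (norm (weak_laplacian \<psi>c x))\<^sup>2 = (\<Sum>i\<in>Basis. h\<psi> i i x)\<^sup>2"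
      using \<psi>c(3) by eventually_elim (simp only: norm_of_real power2_abs)
    have Y: "(\<integral>\<^sup>+x. ennreal ((norm (weak_laplacian \<psi>c x))\<^sup>2) \<partial>lebesgue) = NP 2 (\<lambda>x. \<Sum>i\<in>Basis. h\<psi> i i x)"
      unfolding NP_2 by (rule nn_integral_lebesgue_cong[OF _ ae2]) measurable
    \<comment> \<open>The factor 1/4 of the hypothesis is moved to the other side by multiplication,
      since \<open>ennreal\<close> has no cancellation at infinity.\<close>
    have m: "ennreal 4 * ennreal (1 / 4) = 1" by (subst ennreal_mult[symmetric]) auto
    have "(\<integral>\<^sup>+x. ennreal (max (\<Sum>i\<in>Basis. (x \<bullet> i) * GW i x) 0 * (\<psi> x)\<^sup>2) \<partial>lborel)
        = ennreal 4 * (ennreal (1 / 4) * (\<integral>\<^sup>+x. ennreal (max (\<Sum>i\<in>Basis. (x \<bullet> i) * GW i x) 0 * (\<psi> x)\<^sup>2) \<partial>lborel))"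
      unfolding mult.assoc[symmetric] m by (rule mult_1_left[symmetric])
    also have "\<dots> \<le> ennreal 4 * (ennreal a * NP 2 (\<lambda>x. \<Sum>i\<in>Basis. h\<psi> i i x))"
      using small[OF \<psi>c(1)] unfolding X Y by (intro mult_left_mono) auto
    also have "\<dots> = ennreal (4 * a) * NP 2 (\<lambda>x. \<Sum>i\<in>Basis. h\<psi> i i x)"
      using a(1) by (simp only: mult.assoc[symmetric] ennreal_mult[of 4 a, symmetric])
    finally show ?thesis .
  qed
  have br: "biharmonic Ur Gr Hr W GW Fr a z"
    by (intro biharmonic.intro d r(1) W(1,3) GW(1,3,4) a Fr(1,3) conjunct1[OF eqs] small')
  have bi: "biharmonic Ui Gi Hi W GW Fi a z"
    by (intro biharmonic.intro d i(1) W(1,3) GW(1,3,4) a Fi(1,3) conjunct2[OF eqs] small')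
  define A B A' B' where "A = nm (\<lambda>x. \<Sum>i\<in>Basis. Hr i i x)" and "B = nm (\<lambda>x. \<Sum>i\<in>Basis. Hi i i x)"
    and "A' = nm (\<lambda>x. (x \<bullet> x) * Fr x)" and "B' = nm (\<lambda>x. (x \<bullet> x) * Fi x)"
  have AB: "A \<le> C * A'" "B \<le> C * B'"
    unfolding A_def B_def A'_def B'_def C_def by (rule biharmonic.final_bound[OF br] biharmonic.final_bound[OF bi])+
  have nn: "A \<ge> 0" "B \<ge> 0" by (simp_all add: A_def B_def nm_nonneg)
  have "Lp_norm 2 (weak_laplacian u) = sqrt (A\<^sup>2 + B\<^sup>2)"
    unfolding A_def B_def by (rule Lp_norm_2_Complex[OF Dum r(3) i(3) lap(1)[OF r(1)] lap(1)[OF i(1)] lap(2)[OF r(1)] lap(2)[OF i(1)]])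
  also have "\<dots> \<le> sqrt ((C * A')\<^sup>2 + (C * B')\<^sup>2)"
    using AB nn by (intro real_sqrt_le_mono add_mono power_mono)
  also have "\<dots> = C * sqrt (A'\<^sup>2 + B'\<^sup>2)"
  proof -
    have "(C * A')\<^sup>2 + (C * B')\<^sup>2 = C\<^sup>2 * (A'\<^sup>2 + B'\<^sup>2)" by (simp add: power_mult_distrib distrib_left)
    then show ?thesis using C0 by (simp add: real_sqrt_mult)
  qed
  also have "sqrt (A'\<^sup>2 + B'\<^sup>2) = Lp_norm 2 (\<lambda>x. (norm x)\<^sup>2 *\<^sub>R f x)"
    unfolding A'_def B'_def
  proof (rule Lp_norm_2_Complex[symmetric])
    show "(\<lambda>x. (norm x)\<^sup>2 *\<^sub>R f x) \<in> borel_measurable lebesgue" using f(2) by (simp add: Lp_def)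
    show "AE x in lborel. Re ((norm x)\<^sup>2 *\<^sub>R f x) = (x \<bullet> x) * Fr x" using Fr(2) by eventually_elim (simp add: power2_norm_eq_inner)
    show "AE x in lborel. Im ((norm x)\<^sup>2 *\<^sub>R f x) = (x \<bullet> x) * Fi x" using Fi(2) by eventually_elim (simp add: power2_norm_eq_inner)
  qed (use Fr Fi in auto)
  finally show ?thesis unfolding C_def .
qed

theorem theorem1p7:
  fixes V :: "real ^ 'd \<Rightarrow> real" and a :: real
  defines "d \<equiv> real CARD('d)"
  assumes dim: "CARD('d) \<ge> 5"
    and V_loc: "Lp_loc 1 V"
    and rad_loc: "Lp_loc 1 (\<lambda>x. max (x \<bullet> weak_gradient V x) 0)"
    and V_sob: "sobolev_loc 1 (d / 4) V"
    and a: "0 \<le> a" "a < 1"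
    and small: "\<And>\<psi> :: real ^ 'd \<Rightarrow> complex. H2 \<psi> \<Longrightarrow>
        ennreal (1 / 4) * (\<integral>\<^sup>+x. ennreal (max (x \<bullet> weak_gradient V x) 0 * (norm (\<psi> x))\<^sup>2) \<partial>lebesgue)
        \<le> ennreal a * (\<integral>\<^sup>+x. ennreal ((norm (weak_laplacian \<psi> x))\<^sup>2) \<partial>lebesgue)"
  shows "\<forall>(z::real) (f :: real ^ 'd \<Rightarrow> complex) u.
      f \<in> borel_measurable lebesgue \<longrightarrow>
      Lp 2 (\<lambda>x. (norm x)\<^sup>2 *\<^sub>R f x) \<longrightarrow>
      H2_solution V z f u \<longrightarrow>
      Lp_norm 2 (weak_laplacian u)
        \<le> 1 / (1 - a) * (2 * (d - 2) / (d * (d - 4))) * Lp_norm 2 (\<lambda>x. (norm x)\<^sup>2 *\<^sub>R f x)"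
proof (intro allI impI)
  fix z and f u :: "real ^ 'd \<Rightarrow> complex"
  assume f: "f \<in> borel_measurable lebesgue" "Lp 2 (\<lambda>x. (norm x)\<^sup>2 *\<^sub>R f x)" and sol: "H2_solution V z f u"
  have D: "DIM(real ^ 'd) = CARD('d)" by simp
  show "Lp_norm 2 (weak_laplacian u)
      \<le> 1 / (1 - a) * (2 * (d - 2) / (d * (d - 4))) * Lp_norm 2 (\<lambda>x. (norm x)\<^sup>2 *\<^sub>R f x)"
    using biharmonic_estimate[OF _ _ a small f sol] dim V_sob unfolding d_def D by blast
qed

end
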